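(* Let $R$ (red points) and $B$ (blue points) be independent Poisson point processes of intensity $1$ on $\mathbb{R}$, and let $a\in(0,\infty)$, $a\neq 1$, be fixed. Almost surely: (i) For $\gamma\in\{-\infty,1^-,1^+,\infty\}\cup(1,\infty)$, the set of balanced $\gamma$-minimal matchings and the set of unbalanced $(\gamma,a)$-minimal matchings between $R$ and $B$ are identical. (ii) For $\gamma\in(-\infty,1)$, the unique balanced $\gamma$-minimal matching and the unique unbalanced $(\gamma,a)$-minimal matching have finite difference.
   Context: A matching $M$ between $R$ (red) and $B$ (blue) is a set of edges $\langle x,y\rangle$, $x\in R$, $y\in B$, with each point in at most one edge; $M(x)$ is the partner of $x$, and $|x-M(x)|=\infty$ if $x$ is unmatched. With cost function $f$, the edge $\langle x,y\rangle$ costs $f(y-x)$, and the cost of a finite matching is the sum over its edges; unmatched points count as infinite cost. For finite $R,B$ an $f$-minimal matching minimizes total cost among the matchings with as few unmatched points as possible. For countable $R,B$, call a finite set $S\subset R\cup B$ admissible for $M$ if it is a union of edges of $M$ and unmatched points; $M$ is $f$-minimal if for every admissible $S$ the restriction $M|_S$ is an $f$-minimal matching between $R\cap S$ and $B\cap S$. For $a\in(0,\infty)$ and $\gamma\in\mathbb{R}$ define, for $x\neq0$: if $\gamma>0$, $f_{\gamma,a}(x)=a|x|^\gamma$ for $x<0$ and $x^\gamma$ for $x>0$; if $\gamma=0$, $f_{0,a}(x)=\log(a|x|)$ for $x<0$ and $\log x$ for $x>0$; if $\gamma<0$, $f_{\gamma,a}(x)=-a|x|^{\gamma}$ for $x<0$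 and $-x^{\gamma}$ for $x>0$. A $(\gamma,a)$-minimal matching is an $f_{\gamma,a}$-minimal matching. A balanced $\gamma$-minimal matching is a $(\gamma,1)$-minimal matching. Limiting values of $\gamma$ (with $a$ fixed): $M$ is $(1^+,a)$-minimal (resp. $(1^-,a)$-minimal) if for every admissible $S$, $M|_S$ is $f_{\gamma,a}$-minimal between $R\cap S$ and $B\cap S$ for all $\gamma>1$ (resp. $\gamma<1$) sufficiently close to $1$. $M$ is $(-\infty,a)$-minimal if it is stable: $\min(|x-M(x)|,|y-M(y)|)\le|x-y|$ for all $x,y$ of opposite colour. $M$ is $(\infty,a)$-minimal if it is altruistic: for every admissible $S$, among matchings of $R\cap S$ and $B\cap S$ with as few unmatched points as possible, $M|_S$ minimizes in lexicographic order the sequence of edge lengths arranged in descending order. Two matchings $M,M'$ between $R$ and $B$ have finite difference if the multigraph on $R\cup B$ formed by the union of their edges has no infinite connected component. *)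

theory Defs
  imports "HOL-Probability.Probability" "HOL-Library.Multiset"
begin

section \<open>Poisson processes on the real line\<close>

definition locally_finite :: "real set \<Rightarrow> bool" where
  "locally_finite C \<longleftrightarrow> (\<forall>A. bounded A \<longrightarrow> finite (C \<inter> A))"

text \<open>Simple point configurations, with the \<sigma>-algebra generated by the counts of points in
  bounded Borel sets.  These counts are finite by local finiteness, so \<open>card\<close> (which is \<open>0\<close> on
  infinite sets) is the true number of points.\<close>

definition config_space :: "real set measure" where
  "config_space = sigma {C. locally_finite C}
     {{C. locally_finite C \<and> card (C \<inter> A) = k} | A k. A \<in> sets borel \<and> bounded A}"

text \<open>The library constant \<open>poisson_pmf\<close> is only specified for positive rates.\<close>

definition poisson_law :: "real \<Rightarrow> nat pmf" where
  "poisson_law r = (if r > 0 then poisson_pmf r else return_pmf 0)"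

definition poisson_process :: "'w measure \<Rightarrow> real \<Rightarrow> ('w \<Rightarrow> real set) \<Rightarrow> bool" where
  "poisson_process P lam X \<longleftrightarrow>
     X \<in> measurable P config_space \<and>
     (\<forall>A. A \<in> sets borel \<and> bounded A \<longrightarrow>
        distr P (count_space UNIV) (\<lambda>\<omega>. card (X \<omega> \<inter> A))
          = measure_pmf (poisson_law (lam * measure lborel A))) \<and>
     (\<forall>(I :: nat set) A. finite I \<and> disjoint_family_on A I \<and>
          (\<forall>i\<in>I. A i \<in> sets borel \<and> bounded (A i)) \<longrightarrow>
        prob_space.indep_vars P (\<lambda>_. count_space UNIV) (\<lambda>i \<omega>. card (X \<omega> \<inter> A i)) I)"

section \<open>Matchings\<close>

text \<open>An edge \<open>\<langle>x, y\<rangle>\<close> is the pair \<open>(x, y)\<close>, with the red point first.  The point sets are not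
  required to be disjoint (two independent Poisson processes almost surely are), so the two
  colours are treated separately.\<close>

definition matching :: "real set \<Rightarrow> real set \<Rightarrow> (real \<times> real) set \<Rightarrow> bool" where
  "matching R B M \<longleftrightarrow> M \<subseteq> R \<times> B \<and>
     (\<forall>x y y'. (x, y) \<in> M \<and> (x, y') \<in> M \<longrightarrow> y = y') \<and>
     (\<forall>x x' y. (x, y) \<in> M \<and> (x', y) \<in> M \<longrightarrow> x = x')"

definition unmatched_red :: "real set \<Rightarrow> (real \<times> real) set \<Rightarrow> real set" where
  "unmatched_red R M = {x \<in> R. \<forall>y. (x, y) \<notin> M}"

definition unmatched_blue :: "real set \<Rightarrow> (real \<times> real) set \<Rightarrow> real set" where
  "unmatched_blue B M = {y \<in> B. \<forall>x. (x, y) \<notin> M}"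

definition num_unmatched :: "real set \<Rightarrow> real set \<Rightarrow> (real \<times> real) set \<Rightarrow> nat" where
  "num_unmatched R B M = card (unmatched_red R M) + card (unmatched_blue B M)"

text \<open>Matchings with as few unmatched points as possible; only used for finite \<open>R\<close> and \<open>B\<close>.\<close>

definition fewest_unmatched :: "real set \<Rightarrow> real set \<Rightarrow> (real \<times> real) set \<Rightarrow> bool" where
  "fewest_unmatched R B M \<longleftrightarrow> matching R B M \<and>
     (\<forall>M'. matching R B M' \<longrightarrow> num_unmatched R B M \<le> num_unmatched R B M')"

definition cost :: "(real \<Rightarrow> real) \<Rightarrow> (real \<times> real) set \<Rightarrow> real" where
  "cost f M = (\<Sum>(x, y)\<in>M. f (y - x))"

definition finite_minimal ::
    "(real \<Rightarrow> real) \<Rightarrow> real set \<Rightarrow> real set \<Rightarrow> (real \<times> real) set \<Rightarrow> bool" where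
  "finite_minimal f R B M \<longleftrightarrow> fewest_unmatched R B M \<and>
     (\<forall>M'. fewest_unmatched R B M' \<longrightarrow> cost f M \<le> cost f M')"

definition admissible ::
    "real set \<Rightarrow> real set \<Rightarrow> (real \<times> real) set \<Rightarrow> real set \<Rightarrow> bool" where
  "admissible R B M S \<longleftrightarrow> finite S \<and>
     (\<exists>E U. E \<subseteq> M \<and> U \<subseteq> unmatched_red R M \<union> unmatched_blue B M \<and>
        S = (\<Union>(x, y)\<in>E. {x, y}) \<union> U)"

definition restrict_matching :: "(real \<times> real) set \<Rightarrow> real set \<Rightarrow> (real \<times> real) set" where
  "restrict_matching M S = M \<inter> (S \<times> S)"

definition f_minimal ::
    "(real \<Rightarrow> real) \<Rightarrow> real set \<Rightarrow> real set \<Rightarrow> (real \<times> real) set \<Rightarrow> bool" where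
  "f_minimal f R B M \<longleftrightarrow> matching R B M \<and>
     (\<forall>S. admissible R B M S \<longrightarrow>
        finite_minimal f (R \<inter> S) (B \<inter> S) (restrict_matching M S))"

text \<open>The value at \<open>x = 0\<close> is irrelevant: it would require a red and a blue point to coincide.\<close>

definition cost_fun :: "real \<Rightarrow> real \<Rightarrow> real \<Rightarrow> real" where
  "cost_fun g a x =
     (if g > 0 then (if x < 0 then a * \<bar>x\<bar> powr g else x powr g)
      else if g = 0 then (if x < 0 then ln (a * \<bar>x\<bar>) else ln x)
      else (if x < 0 then - (a * \<bar>x\<bar> powr g) else - (x powr g)))"

definition red_partner_dist :: "(real \<times> real) set \<Rightarrow> real \<Rightarrow> ereal" where
  "red_partner_dist M x =
     (if \<exists>y. (x, y) \<in> M then ereal \<bar>x - (THE y. (x, y) \<in> M)\<bar> else \<infinity>)"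

definition blue_partner_dist :: "(real \<times> real) set \<Rightarrow> real \<Rightarrow> ereal" where
  "blue_partner_dist M y =
     (if \<exists>x. (x, y) \<in> M then ereal \<bar>y - (THE x. (x, y) \<in> M)\<bar> else \<infinity>)"

definition stable :: "real set \<Rightarrow> real set \<Rightarrow> (real \<times> real) set \<Rightarrow> bool" where
  "stable R B M \<longleftrightarrow> matching R B M \<and>
     (\<forall>x\<in>R. \<forall>y\<in>B. min (red_partner_dist M x) (blue_partner_dist M y) \<le> ereal \<bar>x - y\<bar>)"

definition descending_lengths :: "(real \<times> real) set \<Rightarrow> real list" where
  "descending_lengths M =
     rev (sorted_list_of_multiset (image_mset (\<lambda>(x, y). \<bar>y - x\<bar>) (mset_set M)))"

definition lex_le :: "real list \<Rightarrow> real list \<Rightarrow> bool" where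
  "lex_le l l' \<longleftrightarrow> l = l' \<or> (l, l') \<in> lexord {(u, v). u < v}"

definition altruistic :: "real set \<Rightarrow> real set \<Rightarrow> (real \<times> real) set \<Rightarrow> bool" where
  "altruistic R B M \<longleftrightarrow> matching R B M \<and>
     (\<forall>S. admissible R B M S \<longrightarrow>
        fewest_unmatched (R \<inter> S) (B \<inter> S) (restrict_matching M S) \<and>
        (\<forall>M'. fewest_unmatched (R \<inter> S) (B \<inter> S) M' \<longrightarrow>
           lex_le (descending_lengths (restrict_matching M S)) (descending_lengths M')))"

text \<open>The parameter values: \<open>-\<infinity>\<close>, \<open>1\<^sup>-\<close>, \<open>1\<^sup>+\<close>, \<open>\<infinity>\<close> and the reals.\<close>

datatype exponent = MinusInf | OneMinus | OnePlus | PlusInf | Exponent real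

text \<open>In the cases \<open>1\<^sup>-\<close> and \<open>1\<^sup>+\<close>, how close to \<open>1\<close> is sufficient may depend on \<open>S\<close>.\<close>

fun minimal_matching ::
    "exponent \<Rightarrow> real \<Rightarrow> real set \<Rightarrow> real set \<Rightarrow> (real \<times> real) set \<Rightarrow> bool" where
  "minimal_matching (Exponent g) a R B M = f_minimal (cost_fun g a) R B M"
| "minimal_matching OnePlus a R B M = (matching R B M \<and>
     (\<forall>S. admissible R B M S \<longrightarrow>
        (\<forall>\<^sub>F g in at_right 1.
           finite_minimal (cost_fun g a) (R \<inter> S) (B \<inter> S) (restrict_matching M S))))"
| "minimal_matching OneMinus a R B M = (matching R B M \<and>
     (\<forall>S. admissible R B M S \<longrightarrow>
        (\<forall>\<^sub>F g in at_left 1.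
           finite_minimal (cost_fun g a) (R \<inter> S) (B \<inter> S) (restrict_matching M S))))"
| "minimal_matching MinusInf a R B M = stable R B M"
| "minimal_matching PlusInf a R B M = altruistic R B M"

abbreviation balanced_minimal_matching ::
    "exponent \<Rightarrow> real set \<Rightarrow> real set \<Rightarrow> (real \<times> real) set \<Rightarrow> bool" where
  "balanced_minimal_matching \<gamma> R B M \<equiv> minimal_matching \<gamma> 1 R B M"

definition component :: "(real \<times> real) set \<Rightarrow> real \<Rightarrow> real set" where
  "component E v = {w. (v, w) \<in> (E \<union> E\<inverse>)\<^sup>*}"

definition finite_difference ::
    "real set \<Rightarrow> real set \<Rightarrow> (real \<times> real) set \<Rightarrow> (real \<times> real) set \<Rightarrow> bool" where
  "finite_difference R B M M' \<longleftrightarrow> (\<forall>v\<in>R \<union> B. finite (component (M \<union> M') v))"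

end

theory Submission
  imports Defs "HOL-Real_Asymp.Real_Asymp"
begin

text \<open>
  For exponents above \<open>1\<close> the edges of a minimal matching are ordered monotonically, and no point is left
  unmatched, since otherwise a long chain of partners could be shifted with profit.  Conversely, monotone
  matchings without unmatched points are minimal for every \<open>a\<close>.  Just below \<open>1\<close> the minimal matchings
  are those without unmatched points in which no two edges cross and nested edges point in the same
  direction, again a condition without \<open>a\<close>.  For exponents below \<open>1\<close> edges are nested up to a bounded
  factor \<open>K\<close>; where the counting walk stays below a given level on a whole annulus \<open>t \<le> \<bar>z\<bar> \<le> K * t\<close>,
  the points of that level are matched within \<open>[-t, t]\<close>, so that the matching is determined by
  finite windows.  It is unique because almost surely no two finite matchings of the same points have equal
  costs.  The scales that are needed occur almost surely: on disjoint blocks the walk descends with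
  probabilities bounded below by the central limit theorem and Levy's maximal inequality, and
  the second Borel-Cantelli lemma applies.
\<close>

text \<open>The definitions of stable and altruistic matchings do not mention \<open>a\<close>, so
  work is required only for real exponents and the two limits at 1. At a fixed exponent below 1 the
  direction of an edge can decide between configurations, and matchings for different
  \<open>a\<close> are compared only up to finite pieces: they all match the points of one level in
  \<open>[-t, t]\<close> internally. Only the factor \<open>K\<close> depends on \<open>a\<close>,
  so valleys of arbitrary ratio are required, low on both sides of 0. Read outwards, the walk counts
  red minus blue on the right and blue minus red on the left; the two agree after
  \<open>x \<mapsto> -x\<close> with the colours exchanged. Apart from crude density bounds and the
  absence of ties, randomness enters through runs of \<open>N\<close> descents at scale
  \<open>n\<close> on both sides, with a rise constant \<open>L\<close> fixed before
  \<open>N\<close>: after \<open>L + 6\<close> pieces the accumulated drop beats all fluctuations,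
  and further pieces extend the low region by any ratio. The same descents supply the chain for
  exponents above 1. Ties are null because the leftmost point involved has two partners at different
  distances, so that a tie pins it down once the other points are given.\<close>

definition locally_opt ::
    "(real \<Rightarrow> real) \<Rightarrow> real set \<Rightarrow> real set \<Rightarrow> (real \<times> real) set \<Rightarrow> real set \<Rightarrow> bool" where
  "locally_opt f R B E U \<longleftrightarrow>
     (\<forall>E'. matching (R \<inter> (fst ` E \<union> U)) (B \<inter> (snd ` E \<union> U)) E' \<longrightarrow>
        card E' \<le> card E \<and> (card E' = card E \<longrightarrow> cost f E \<le> cost f E'))"

text \<open>One notion for all exponents: \<open>F\<close> is \<open>principal {g}\<close> for a
  real exponent \<open>g\<close>, \<open>at_right 1\<close> for \<open>1^+\<close> and
  \<open>at_left 1\<close> for \<open>1^-\<close>. Quantifying over \<open>E\<close> and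
  \<open>U\<close> before the filter lets the required closeness to 1 depend on the finite
  set.\<close>

definition locally_minimal ::
    "real filter \<Rightarrow> real \<Rightarrow> real set \<Rightarrow> real set \<Rightarrow> (real \<times> real) set \<Rightarrow> bool" where
  "locally_minimal F a R B M \<longleftrightarrow> matching R B M \<and>
     (\<forall>E U. E \<subseteq> M \<and> U \<subseteq> unmatched_red R M \<union> unmatched_blue B M \<and> finite E \<and> finite U \<longrightarrow>
        (\<forall>\<^sub>F g in F. locally_opt (cost_fun g a) R B E U))"

definition no_ties :: "(real \<Rightarrow> real) \<Rightarrow> real set \<Rightarrow> real set \<Rightarrow> bool" where
  "no_ties f R B \<longleftrightarrow> (\<forall>N N'. matching R B N \<and> matching R B N' \<and> finite N \<and> finite N' \<and>
     fst ` N = fst ` N' \<and> snd ` N = snd ` N' \<and> cost f N = cost f N' \<longrightarrow> N = N')"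

section \<open>Matchings and local optimality\<close>

lemma matchingI:
  assumes "\<And>x y. (x, y) \<in> M \<Longrightarrow> x \<in> R \<and> y \<in> B"
    "\<And>x y y'. (x, y) \<in> M \<Longrightarrow> (x, y') \<in> M \<Longrightarrow> y = y'"
    "\<And>x x' y. (x, y) \<in> M \<Longrightarrow> (x', y) \<in> M \<Longrightarrow> x = x'"
  shows "matching R B M"
  unfolding matching_def
proof (intro conjI)
  show "M \<subseteq> R \<times> B" using assms(1) by (intro subrelI) blast
qed (use assms(2,3) in blast)+

lemma matching_sub: "matching R B M \<Longrightarrow> E \<subseteq> M \<Longrightarrow> matching R B E"
  unfolding matching_def by blast

lemma matching_red_unique: "matching R B M \<Longrightarrow> (x, y) \<in> M \<Longrightarrow> (x, y') \<in> M \<Longrightarrow> y = y'"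
  unfolding matching_def by blast

lemma matching_blue_unique: "matching R B M \<Longrightarrow> (x, y) \<in> M \<Longrightarrow> (x', y) \<in> M \<Longrightarrow> x = x'"
  unfolding matching_def by blast

lemma matching_mem: "matching R B M \<Longrightarrow> (x, y) \<in> M \<Longrightarrow> x \<in> R \<and> y \<in> B"
  unfolding matching_def by blast

lemma matching_subset: "matching R B M \<Longrightarrow> M \<subseteq> R \<times> B"
  unfolding matching_def by blast

lemma matching_verts:
  assumes "matching R B M"
  shows "fst ` M \<subseteq> R" "snd ` M \<subseteq> B"
  using matching_subset[OF assms] by auto

lemma matching_mono:
  assumes "matching X Y E" "X \<subseteq> X'" "Y \<subseteq> Y'"
  shows "matching X' Y' E"
proof -
  have "E \<subseteq> X' \<times> Y'"
    using matching_subset[OF assms(1)] Sigma_mono[OF assms(2), of "\<lambda>_. Y" "\<lambda>_. Y'"] assms(3) by (meson order_trans)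
  then show ?thesis using assms(1) unfolding matching_def by blast
qed

lemma matching_own:
  assumes "matching R B E"
  shows "matching (fst ` E) (snd ` E) E"
proof -
  have "E \<subseteq> fst ` E \<times> snd ` E" by force
  then show ?thesis using assms unfolding matching_def by blast
qed

lemma matching_inj_fst: "matching R B M \<Longrightarrow> inj_on fst M"
  by (auto simp: inj_on_def intro: matching_red_unique)

lemma matching_inj_snd: "matching R B M \<Longrightarrow> inj_on snd M"
  by (auto simp: inj_on_def intro: matching_blue_unique)

lemma matching_finite: "matching R B M \<Longrightarrow> finite R \<Longrightarrow> finite B \<Longrightarrow> finite M"
  by (rule finite_subset[OF matching_subset]) auto

lemma num_unmatched_card:
  assumes "finite R" "finite B" "matching R B M"
  shows "num_unmatched R B M + 2 * card M = card R + card B"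
proof -
  have 1: "unmatched_red R M = R - fst ` M" "unmatched_blue B M = B - snd ` M"
    unfolding unmatched_red_def unmatched_blue_def by force+
  have 2: "fst ` M \<subseteq> R" "snd ` M \<subseteq> B" using matching_verts[OF assms(3)] by auto
  have 3: "card (fst ` M) = card M" "card (snd ` M) = card M"
    using assms(3) by (auto intro!: card_image matching_inj_fst matching_inj_snd)
  have 4: "card (R - fst ` M) = card R - card M" "card (B - snd ` M) = card B - card M"
    using 2 3 assms by (simp_all add: card_Diff_subset finite_subset)
  have 5: "card M \<le> card R" "card M \<le> card B"
    using 2 3 assms by (metis card_mono)+
  show ?thesis unfolding num_unmatched_def 1 4 using 5 by simp
qed

text \<open>Each edge covers one point of each colour, so the fewest unmatched points means the most
  edges (\<open>num_unmatched_card\<close>).\<close>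

lemma finite_minimal_iff:
  assumes "finite R" "finite B"
  shows "finite_minimal f R B M \<longleftrightarrow> matching R B M \<and>
    (\<forall>M'. matching R B M' \<longrightarrow> card M' \<le> card M \<and> (card M' = card M \<longrightarrow> cost f M \<le> cost f M'))"
proof -
  have *: "num_unmatched R B M \<le> num_unmatched R B M' \<longleftrightarrow> card M' \<le> card M"
    if "matching R B M" "matching R B M'" for M M'
    using num_unmatched_card[OF assms that(1)] num_unmatched_card[OF assms that(2)] by linarith
  show ?thesis (is "?L \<longleftrightarrow> ?R")
  proof
    assume L: ?L
    then have M: "matching R B M" unfolding finite_minimal_def fewest_unmatched_def by blast
    have le: "card M' \<le> card M" if "matching R B M'" for M'
      using L * M that unfolding finite_minimal_def fewest_unmatched_def by blast
    moreover have "cost f M \<le> cost f M'" if "matching R B M'" "card M' = card M" for M'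
    proof -
      have "fewest_unmatched R B M'" unfolding fewest_unmatched_def using that le * by auto
      then show ?thesis using L unfolding finite_minimal_def by blast
    qed
    ultimately show ?R using M by blast
  next
    assume R: ?R
    have "card M' = card M" if "fewest_unmatched R B M'" for M'
      using that R * unfolding fewest_unmatched_def by (meson le_antisym)
    then show ?L using R * unfolding finite_minimal_def fewest_unmatched_def by blast
  qed
qed

text \<open>An admissible set is given by its edges and its unmatched points. As the colours are
  disjoint, a point of \<open>S\<close> has only one role, so restricting the matching to
  \<open>S\<close> returns exactly \<open>E\<close>.\<close>

lemma locally_opt_finite_minimal:
  assumes disj: "R \<inter> B = {}" and M: "matching R B M" and E: "E \<subseteq> M" "finite E"
    and U: "U \<subseteq> unmatched_red R M \<union> unmatched_blue B M" "finite U"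
    and S: "S = (\<Union>(x, y)\<in>E. {x, y}) \<union> U"
  shows "finite_minimal f (R \<inter> S) (B \<inter> S) (restrict_matching M S) \<longleftrightarrow> locally_opt f R B E U"
proof -
  have RB: "fst ` E \<subseteq> R" "snd ` E \<subseteq> B" using E matching_verts[OF M] by auto
  have S': "S = fst ` E \<union> snd ` E \<union> U" unfolding S by force
  have R: "R \<inter> S = R \<inter> (fst ` E \<union> U)" and B: "B \<inter> S = B \<inter> (snd ` E \<union> U)"
    using RB disj unfolding S' by auto
  have res: "restrict_matching M S = E"
  proof
    show "E \<subseteq> restrict_matching M S" unfolding restrict_matching_def S' using E by force
    show "restrict_matching M S \<subseteq> E"
    proof
      fix e assume "e \<in> restrict_matching M S"
      then obtain x y where e: "e = (x, y)" "(x, y) \<in> M" "x \<in> S" unfolding restrict_matching_def by auto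
      have xR: "x \<in> R" using M e matching_mem by blast
      then have "x \<in> fst ` E \<union> U" using e(3) R by blast
      moreover have "x \<notin> U" using U e(2) disj xR unfolding unmatched_red_def unmatched_blue_def by auto
      ultimately obtain y' where "(x, y') \<in> E" by force
      then have "y' = y" using matching_red_unique[OF M] e(2) E by blast
      then show "e \<in> E" using \<open>(x, y') \<in> E\<close> e by simp
    qed
  qed
  have "finite S" unfolding S' using E U by simp
  then have fin: "finite (R \<inter> S)" "finite (B \<inter> S)" by auto
  have "matching (R \<inter> S) (B \<inter> S) E"
  proof -
    have "matching (fst ` E) (snd ` E) E" using matching_sub[OF M E(1)] by (rule matching_own)
    then show ?thesis by (rule matching_mono) (use RB in \<open>auto simp: S'\<close>)
  qed
  then show ?thesis
    unfolding finite_minimal_iff[OF fin] res locally_opt_def R[symmetric] B[symmetric] by simp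
qed

lemma locally_minimal_admissible:
  assumes disj: "R \<inter> B = {}"
  shows "locally_minimal F a R B M \<longleftrightarrow> matching R B M \<and>
    (\<forall>S. admissible R B M S \<longrightarrow>
      (\<forall>\<^sub>F g in F. finite_minimal (cost_fun g a) (R \<inter> S) (B \<inter> S) (restrict_matching M S)))"
    (is "_ \<longleftrightarrow> _ \<and> ?A")
proof (cases "matching R B M")
  case M: True
  have "?A" if L: "locally_minimal F a R B M"
  proof (intro allI impI)
    fix S assume "admissible R B M S"
    then obtain E U where S: "finite S" "E \<subseteq> M" "U \<subseteq> unmatched_red R M \<union> unmatched_blue B M"
      "S = (\<Union>(x, y)\<in>E. {x, y}) \<union> U" unfolding admissible_def by auto
    have "E \<subseteq> S \<times> S" using S(4) by force
    then have fE: "finite E" using S(1) finite_subset by blast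
    have fU: "finite U" using S by auto
    show "\<forall>\<^sub>F g in F. finite_minimal (cost_fun g a) (R \<inter> S) (B \<inter> S) (restrict_matching M S)"
      unfolding locally_opt_finite_minimal[OF disj M S(2) fE S(3) fU S(4)]
      using L S(2,3) fE fU unfolding locally_minimal_def by blast
  qed
  moreover have "locally_minimal F a R B M" if A: ?A
    unfolding locally_minimal_def
  proof (intro conjI allI impI M)
    fix E U assume H: "E \<subseteq> M \<and> U \<subseteq> unmatched_red R M \<union> unmatched_blue B M \<and> finite E \<and> finite U"
    define S where "S = (\<Union>(x, y)\<in>E. {x, y}) \<union> U"
    have "admissible R B M S" 
      unfolding admissible_def using H by (intro conjI exI[of _ E] exI[of _ U]) (auto simp: S_def)
    with A have "\<forall>\<^sub>F g in F. finite_minimal (cost_fun g a) (R \<inter> S) (B \<inter> S) (restrict_matching M S)"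
      by blast
    then show "\<forall>\<^sub>F g in F. locally_opt (cost_fun g a) R B E U"
      using H locally_opt_finite_minimal[OF disj M, of E U S] S_def by simp
  qed
  ultimately show ?thesis using M by blast
qed (auto simp: locally_minimal_def)

lemma minimal_matching_Exponent_iff:
  "R \<inter> B = {} \<Longrightarrow> minimal_matching (Exponent g) a R B M \<longleftrightarrow> locally_minimal (principal {g}) a R B M"
  by (simp add: locally_minimal_admissible f_minimal_def eventually_principal)

lemma minimal_matching_OnePlus_iff:
  "R \<inter> B = {} \<Longrightarrow> minimal_matching OnePlus a R B M \<longleftrightarrow> locally_minimal (at_right 1) a R B M"
  by (simp add: locally_minimal_admissible)

lemma minimal_matching_OneMinus_iff:
  "R \<inter> B = {} \<Longrightarrow> minimal_matching OneMinus a R B M \<longleftrightarrow> locally_minimal (at_left 1) a R B M"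
  by (simp add: locally_minimal_admissible)

text \<open>Every exclusion argument tests one finite rearrangement, so a single exponent suffices
  at which local optimality and the eventual property \<open>G\<close> hold together. It may vary
  with the rearrangement.\<close>

lemma locally_minimalD:
  assumes "locally_minimal F a R B M" "F \<noteq> bot" "\<forall>\<^sub>F g in F. g \<in> G"
    "E \<subseteq> M" "finite E" "U \<subseteq> unmatched_red R M \<union> unmatched_blue B M" "finite U"
  obtains g where "g \<in> G" "locally_opt (cost_fun g a) R B E U"
proof -
  have "\<forall>\<^sub>F g in F. locally_opt (cost_fun g a) R B E U"
    using assms(1,4-7) unfolding locally_minimal_def by blast
  from eventually_happens'[OF assms(2) eventually_conj[OF assms(3) this]] show thesis
    using that by blast
qed

lemma locally_opt_swap:
  assumes "locally_opt f R B {(x, y), (x', y')} U" "x \<in> R" "x' \<in> R" "y \<in> B" "y' \<in> B" "x \<noteq> x'" "y \<noteq> y'"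
  shows "f (y - x) + f (y' - x') \<le> f (y' - x) + f (y - x')"
proof -
  have "matching (R \<inter> (fst ` {(x, y), (x', y')} \<union> U)) (B \<inter> (snd ` {(x, y), (x', y')} \<union> U)) {(x, y'), (x', y)}"
    using assms unfolding matching_def by auto
  moreover have "card {(x, y'), (x', y)} = card {(x, y), (x', y')}" using assms by simp
  ultimately have "cost f {(x, y), (x', y')} \<le> cost f {(x, y'), (x', y)}"
    using assms(1) unfolding locally_opt_def by blast
  then show ?thesis using assms(6,7) unfolding cost_def by simp
qed

lemma locally_opt_replace_red:
  assumes "locally_opt f R B {(x, y)} {u}" "x \<in> R" "u \<in> R" "y \<in> B"
  shows "f (y - x) \<le> f (y - u)"
proof -
  have "matching (R \<inter> (fst ` {(x, y)} \<union> {u})) (B \<inter> (snd ` {(x, y)} \<union> {u})) {(u, y)}"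
    using assms unfolding matching_def by auto
  then have "cost f {(x, y)} \<le> cost f {(u, y)}"
    using assms(1) unfolding locally_opt_def by force
  then show ?thesis unfolding cost_def by simp
qed

lemma locally_opt_replace_blue:
  assumes "locally_opt f R B {(x, y)} {u}" "x \<in> R" "u \<in> B" "y \<in> B"
  shows "f (y - x) \<le> f (u - x)"
proof -
  have "matching (R \<inter> (fst ` {(x, y)} \<union> {u})) (B \<inter> (snd ` {(x, y)} \<union> {u})) {(x, u)}"
    using assms unfolding matching_def by auto
  then have "cost f {(x, y)} \<le> cost f {(x, u)}"
    using assms(1) unfolding locally_opt_def by force
  then show ?thesis unfolding cost_def by simp
qed

lemma locally_opt_not_both:
  assumes "locally_opt f R B {} {x, y}" "x \<in> R" "y \<in> B"
  shows False
proof -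
  have "matching (R \<inter> (fst ` {} \<union> {x, y})) (B \<inter> (snd ` {} \<union> {x, y})) {(x, y)}"
    using assms unfolding matching_def by auto
  then show ?thesis using assms(1) unfolding locally_opt_def by fastforce
qed

text \<open>A better rearrangement of a part, completed by the untouched edges \<open>N - E\<close>,
  would be a better rearrangement of the whole.\<close>

lemma locally_opt_subset:
  assumes opt: "locally_opt f R B N V" and disj: "R \<inter> B = {}" and N: "matching R B N" "finite N"
    and V: "V \<subseteq> unmatched_red R N \<union> unmatched_blue B N" and E: "E \<subseteq> N" and U: "U \<subseteq> V"
  shows "locally_opt f R B E U"
  unfolding locally_opt_def
proof (intro allI impI)
  fix E' assume E': "matching (R \<inter> (fst ` E \<union> U)) (B \<inter> (snd ` E \<union> U)) E'"
  have NE: "fst ` (N - E) \<inter> fst ` E = {}" "snd ` (N - E) \<inter> snd ` E = {}"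
    using matching_inj_fst[OF N(1)] matching_inj_snd[OF N(1)] E by (fastforce simp: inj_on_def)+
  have Un: "x \<notin> U" if "(x, y) \<in> N" for x y
    using that V U disj matching_mem[OF N(1) that] unfolding unmatched_red_def unmatched_blue_def by auto
  have Un': "y \<notin> U" if "(x, y) \<in> N" for x y
    using that V U disj matching_mem[OF N(1) that] unfolding unmatched_red_def unmatched_blue_def by auto
  have f': "fst ` (N - E) \<inter> fst ` E' = {}"
  proof -
    have "fst ` E' \<subseteq> fst ` E \<union> U" using matching_verts(1)[OF E'] by blast
    moreover have "fst ` (N - E) \<inter> U = {}" using Un by auto
    ultimately show ?thesis using NE by blast
  qed
  have s': "snd ` (N - E) \<inter> snd ` E' = {}"
  proof -
    have "snd ` E' \<subseteq> snd ` E \<union> U" using matching_verts(2)[OF E'] by blast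
    moreover have "snd ` (N - E) \<inter> U = {}" using Un' by auto
    ultimately show ?thesis using NE by blast
  qed
  let ?N = "(N - E) \<union> E'"
  have finE: "finite E" using N E finite_subset by blast
  have sub: "R \<inter> (fst ` E \<union> U) \<subseteq> R \<inter> (fst ` N \<union> V)" "B \<inter> (snd ` E \<union> U) \<subseteq> B \<inter> (snd ` N \<union> V)"
    using E U by auto
  \<comment> \<open>\<open>card\<close> is 0 on infinite sets, so the counts below are right only
    for a finite competitor. An infinite one would contain \<open>card N + 1\<close> edges, more
    than optimality of \<open>N\<close> allows.\<close>
  have finE': "finite E'"
  proof (rule ccontr)
    assume "infinite E'"
    then obtain T where T: "T \<subseteq> E'" "card T = card N + 1"
      by (metis infinite_arbitrarily_large)
    have "matching (R \<inter> (fst ` N \<union> V)) (B \<inter> (snd ` N \<union> V)) T"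
      using matching_mono[OF matching_sub[OF E' T(1)] sub] .
    then show False using opt T(2) unfolding locally_opt_def by fastforce
  qed
  have mat: "matching (R \<inter> (fst ` N \<union> V)) (B \<inter> (snd ` N \<union> V)) ?N"
  proof -
    have "x \<in> R \<inter> (fst ` N \<union> V) \<and> y \<in> B \<inter> (snd ` N \<union> V)" if "(x, y) \<in> ?N" for x y
    proof (cases "(x, y) \<in> N")
      case True
      then show ?thesis using matching_mem[OF N(1) True] by force
    next
      case False
      then have "(x, y) \<in> E'" using that by blast
      then show ?thesis using matching_mem[OF E'] sub by blast
    qed
    then have 1: "?N \<subseteq> (R \<inter> (fst ` N \<union> V)) \<times> (B \<inter> (snd ` N \<union> V))" by (intro subrelI) simp
    have 2: "y = y'" if "(x, y) \<in> ?N" "(x, y') \<in> ?N" for x y y'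
    proof -
      have "(x, z) \<notin> E'" if "(x, w) \<in> N - E" for z w using f' that by force
      then show ?thesis using that matching_red_unique[OF N(1)] matching_red_unique[OF E'] by blast
    qed
    have 3: "x = x'" if "(x, y) \<in> ?N" "(x', y) \<in> ?N" for x x' y
    proof -
      have "(z, y) \<notin> E'" if "(w, y) \<in> N - E" for z w using s' that by force
      then show ?thesis using that matching_blue_unique[OF N(1)] matching_blue_unique[OF E'] by blast
    qed
    show ?thesis unfolding matching_def using 1 2 3 by blast
  qed
  have dj: "(N - E) \<inter> E' = {}" using f' by auto
  have c: "card ?N = card (N - E) + card E'" "card N = card (N - E) + card E"
    using dj N finE' finE E by (simp_all add: card_Un_disjoint card_Diff_subset card_mono)
  have d: "cost f ?N = cost f (N - E) + cost f E'" "cost f N = cost f (N - E) + cost f E"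
    unfolding cost_def using dj N finE' finE E
    by (simp_all add: sum.union_disjoint sum.subset_diff[of E N])
  have "card ?N \<le> card N \<and> (card ?N = card N \<longrightarrow> cost f N \<le> cost f ?N)"
    using opt mat unfolding locally_opt_def by blast
  then show "card E' \<le> card E \<and> (card E' = card E \<longrightarrow> cost f E \<le> cost f E')"
    using c d by auto
qed

lemma locally_opt_empty:
  assumes "E \<subseteq> R \<times> B"
  shows "locally_opt f R B E {} \<longleftrightarrow>
    (\<forall>E'. matching (fst ` E) (snd ` E) E' \<longrightarrow>
        card E' \<le> card E \<and> (card E' = card E \<longrightarrow> cost f E \<le> cost f E'))"
proof -
  have "R \<inter> fst ` E = fst ` E" "B \<inter> snd ` E = snd ` E" using assms by auto
  then show ?thesis unfolding locally_opt_def by simp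
qed

lemma perfect_matching_verts:
  assumes "matching X Y N" "finite X" "finite Y" "card N = card X" "card N = card Y"
  shows "fst ` N = X" "snd ` N = Y"
proof -
  have "card (fst ` N) = card N" "card (snd ` N) = card N"
    using assms(1) by (auto intro!: card_image matching_inj_fst matching_inj_snd)
  moreover have "fst ` N \<subseteq> X" "snd ` N \<subseteq> Y" using matching_verts[OF assms(1)] by auto
  ultimately show "fst ` N = X" "snd ` N = Y" using assms by (metis card_subset_eq)+
qed

text \<open>Only finitely many matchings have the vertices of \<open>E\<close>, so one of them is
  optimal. If consequences of optimality already single out \<open>E\<close>, this one is
  \<open>E\<close>. In this way necessary conditions become sufficient.\<close>

lemma locally_opt_unique:
  assumes E: "matching R B E" "finite E"
    and uni: "\<And>N. matching R B N \<Longrightarrow> finite N \<Longrightarrow> fst ` N = fst ` E \<Longrightarrow> snd ` N = snd ` E \<Longrightarrow>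
      locally_opt f R B N {} \<Longrightarrow> N = E"
  shows "locally_opt f R B E {}"
proof -
  have ER: "E \<subseteq> R \<times> B" using E unfolding matching_def by blast
  let ?X = "fst ` E" let ?Y = "snd ` E"
  let ?A = "{N. matching ?X ?Y N \<and> card N = card E}"
  have fX: "finite ?X" "finite ?Y" using E by auto
  have cX: "card ?X = card E" "card ?Y = card E"
    using E(1) by (auto intro!: card_image matching_inj_fst matching_inj_snd)
  have EA: "E \<in> ?A" using matching_own[OF E(1)] by blast
  have "?A \<subseteq> Pow (?X \<times> ?Y)" unfolding matching_def by blast
  then have fA: "finite ?A" using fX by (meson finite_Pow_iff finite_SigmaI finite_subset)
  then obtain N where N: "N \<in> ?A" "\<And>N'. N' \<in> ?A \<Longrightarrow> cost f N \<le> cost f N'"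
    using EA by (metis (no_types, lifting) arg_min_least empty_iff arg_min_if_finite(1))
  have v: "fst ` N = ?X" "snd ` N = ?Y"
    using perfect_matching_verts[of ?X ?Y N] N(1) fX cX by auto
  have fN: "finite N" using N(1) fX matching_finite by blast
  have Nm: "matching R B N" using matching_mono[OF _ matching_verts[OF E(1)]] N(1) by blast
  have NR: "N \<subseteq> R \<times> B" using matching_subset[OF Nm] .
  have le: "card E' \<le> card N" if "matching ?X ?Y E'" for E'
  proof -
    have "card (fst ` E') = card E'" using that by (auto intro!: card_image matching_inj_fst)
    moreover have "fst ` E' \<subseteq> ?X" using matching_verts[OF that] by auto
    ultimately show ?thesis using N(1) cX fX by (metis (mono_tags, lifting) card_mono mem_Collect_eq)
  qed
  have "locally_opt f R B N {}"
    unfolding locally_opt_empty[OF NR] v using le N by auto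
  with uni[OF Nm fN v] show ?thesis by simp
qed

subsection \<open>Reflection\<close>

text \<open>Reflection at 0 with the colours exchanged. The displacement \<open>y - x\<close> of an
  edge is unchanged, so even an asymmetric cost is preserved, and statements about red points on the
  right transfer to blue points on the left.\<close>

definition reflected :: "(real \<times> real) set \<Rightarrow> (real \<times> real) set" where
  "reflected M = {(x, y). (- y, - x) \<in> M}"

lemma mem_mirror: "(x, y) \<in> reflected M \<longleftrightarrow> (- y, - x) \<in> M"
  unfolding reflected_def by simp

lemma mirror_mirror: "reflected (reflected M) = M"
  unfolding reflected_def by simp

lemma mirror_image: "reflected M = (\<lambda>(x, y). (- y, - x)) ` M"
proof -
  have "(x, y) \<in> (\<lambda>(x, y). (- y, - x)) ` M" if "(- y, - x) \<in> M" for x y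
    using that by (intro image_eqI[where x = "(- y, - x)"]) auto
  then show ?thesis unfolding reflected_def by auto
qed

lemma mem_uminus_image: "x \<in> uminus ` A \<longleftrightarrow> - x \<in> (A :: real set)"
  by (metis image_iff minus_minus)

lemma mirror_matching:
  assumes "matching R B M"
  shows "matching (uminus ` B) (uminus ` R) (reflected M)"
proof -
  have "reflected M \<subseteq> uminus ` B \<times> uminus ` R"
    using assms unfolding matching_def reflected_def by (auto simp: mem_uminus_image)
  moreover have "y = y'" if "(x, y) \<in> reflected M" "(x, y') \<in> reflected M" for x y y'
    using that assms matching_blue_unique[of R B M "- y" "- x" "- y'"] by (simp add: mem_mirror)
  moreover have "x = x'" if "(x, y) \<in> reflected M" "(x', y) \<in> reflected M" for x x' y
    using that assms matching_red_unique[of R B M "- y" "- x" "- x'"] by (simp add: mem_mirror)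
  ultimately show ?thesis unfolding matching_def by blast
qed

lemma mirror_verts: "fst ` reflected M = uminus ` snd ` M" "snd ` reflected M = uminus ` fst ` M"
  unfolding mirror_image by (simp_all add: image_image case_prod_beta)

lemma mirror_inj: "inj_on (\<lambda>(x, y). (- y, - x)) (M :: (real \<times> real) set)"
  by (auto simp: inj_on_def)

lemma card_mirror: "card (reflected M) = card M"
  unfolding mirror_image by (intro card_image mirror_inj)

lemma cost_mirror: "cost f (reflected M) = cost f M"
  unfolding mirror_image cost_def by (subst sum.reindex[OF mirror_inj]) (auto intro!: sum.cong)

lemma finite_mirror: "finite (reflected M) \<longleftrightarrow> finite M"
  unfolding mirror_image by (intro finite_image_iff mirror_inj)

lemma uminus_image_uminus: "uminus ` uminus ` (A :: real set) = A"
  by (simp add: image_image)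

lemma locally_opt_mirror:
  assumes "locally_opt f R B E U"
  shows "locally_opt f (uminus ` B) (uminus ` R) (reflected E) (uminus ` U)"
  unfolding locally_opt_def
proof (intro allI impI)
  fix E' assume "matching (uminus ` B \<inter> (fst ` reflected E \<union> uminus ` U)) (uminus ` R \<inter> (snd ` reflected E \<union> uminus ` U)) E'"
  from mirror_matching[OF this]
  have "matching (R \<inter> (fst ` E \<union> U)) (B \<inter> (snd ` E \<union> U)) (reflected E')"
    unfolding mirror_verts by (simp add: image_Int image_Un uminus_image_uminus)
  then have "card (reflected E') \<le> card E \<and> (card (reflected E') = card E \<longrightarrow> cost f E \<le> cost f (reflected E'))"
    using assms unfolding locally_opt_def by blast
  then show "card E' \<le> card (reflected E) \<and> (card E' = card (reflected E) \<longrightarrow> cost f (reflected E) \<le> cost f E')"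
    by (simp add: card_mirror cost_mirror)
qed

lemma all_uminus_iff: "(\<forall>z. P (- z)) \<longleftrightarrow> (\<forall>z :: real. P z)"
proof
  assume H: "\<forall>z. P (- z)"
  show "\<forall>z. P z"
  proof
    fix z show "P z" using spec[OF H, of "- z"] by simp
  qed
qed simp

lemma unmatched_mirror:
  "unmatched_red (uminus ` B) (reflected M) = uminus ` unmatched_blue B M"
  "unmatched_blue (uminus ` R) (reflected M) = uminus ` unmatched_red R M"
proof -
  have *: "(\<forall>z. P (- z)) \<longleftrightarrow> (\<forall>z. P z)" for P :: "real \<Rightarrow> bool"
    using all_uminus_iff[of P] .
  show "unmatched_red (uminus ` B) (reflected M) = uminus ` unmatched_blue B M"
  proof (rule set_eqI)
    fix x
    show "x \<in> unmatched_red (uminus ` B) (reflected M) \<longleftrightarrow> x \<in> uminus ` unmatched_blue B M"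
      unfolding mem_uminus_image unmatched_red_def unmatched_blue_def
      using *[of "\<lambda>z. (z, - x) \<notin> M"] by (simp add: mem_mirror mem_uminus_image)
  qed
  show "unmatched_blue (uminus ` R) (reflected M) = uminus ` unmatched_red R M"
  proof (rule set_eqI)
    fix x
    show "x \<in> unmatched_blue (uminus ` R) (reflected M) \<longleftrightarrow> x \<in> uminus ` unmatched_red R M"
      unfolding mem_uminus_image unmatched_red_def unmatched_blue_def
      using *[of "\<lambda>z. (- x, z) \<notin> M"] by (simp add: mem_mirror mem_uminus_image)
  qed
qed

lemma locally_minimal_mirror:
  assumes "locally_minimal F a R B M"
  shows "locally_minimal F a (uminus ` B) (uminus ` R) (reflected M)"
  unfolding locally_minimal_def
proof (intro conjI allI impI)
  show "matching (uminus ` B) (uminus ` R) (reflected M)"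
    using assms mirror_matching unfolding locally_minimal_def by blast
  fix E U
  assume H: "E \<subseteq> reflected M \<and> U \<subseteq> unmatched_red (uminus ` B) (reflected M) \<union> unmatched_blue (uminus ` R) (reflected M)
    \<and> finite E \<and> finite U"
  have "reflected E \<subseteq> M" using H by (auto simp: mem_mirror reflected_def)
  moreover have "uminus ` U \<subseteq> unmatched_red R M \<union> unmatched_blue B M"
  proof
    fix u assume "u \<in> uminus ` U"
    then have "- u \<in> U" by (simp add: mem_uminus_image)
    then show "u \<in> unmatched_red R M \<union> unmatched_blue B M"
      using H unfolding unmatched_mirror by (auto simp: mem_uminus_image)
  qed
  ultimately have "\<forall>\<^sub>F g in F. locally_opt (cost_fun g a) R B (reflected E) (uminus ` U)"
    using assms H finite_mirror unfolding locally_minimal_def by blast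
  then show "\<forall>\<^sub>F g in F. locally_opt (cost_fun g a) (uminus ` B) (uminus ` R) E U"
    by eventually_elim (use locally_opt_mirror[of _ R B "reflected E" "uminus ` U"] in \<open>simp add: mirror_mirror uminus_image_uminus\<close>)
qed

section \<open>Levels of the counting walk\<close>

definition cnt :: "real set \<Rightarrow> real \<Rightarrow> real \<Rightarrow> int" where
  "cnt A u v = int (card (A \<inter> {u<..v}))"

text \<open>Red minus blue points, read from 0. Since intervals are open on the left and closed on
  the right, the value at a point already includes the step made there.\<close>

definition walk :: "real set \<Rightarrow> real set \<Rightarrow> real \<Rightarrow> int" where
  "walk R B z = (if 0 \<le> z then cnt R 0 z - cnt B 0 z else - (cnt R z 0 - cnt B z 0))"

lemma locally_finite_subset:
  assumes "locally_finite A" "A' \<subseteq> A"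
  shows "locally_finite A'"
  unfolding locally_finite_def
proof (intro allI impI)
  fix D :: "real set" assume "bounded D"
  then have "finite (A \<inter> D)" using assms(1) unfolding locally_finite_def by blast
  then show "finite (A' \<inter> D)" by (rule finite_subset[rotated]) (use assms(2) in blast)
qed

lemma locally_finite_Ioc: "locally_finite A \<Longrightarrow> finite (A \<inter> {u<..v})"
  unfolding locally_finite_def by (meson bounded_subset bounded_closed_interval greaterThanAtMost_subseteq_atLeastAtMost_iff order_refl)

lemma locally_finite_Ioo: "locally_finite A \<Longrightarrow> finite (A \<inter> {u<..<v})"
  by (rule finite_subset[OF _ locally_finite_Ioc[of A u v]]) auto

lemma cnt_nonneg: "0 \<le> cnt A u v"
  unfolding cnt_def by simp

lemma cnt_refl: "cnt A u u = 0"
  unfolding cnt_def by simp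

lemma cnt_add:
  assumes "locally_finite A" "u \<le> v" "v \<le> w"
  shows "cnt A u w = cnt A u v + cnt A v w"
proof -
  have "A \<inter> {u<..w} = (A \<inter> {u<..v}) \<union> (A \<inter> {v<..w})" using assms by auto
  moreover have "(A \<inter> {u<..v}) \<inter> (A \<inter> {v<..w}) = {}" by auto
  ultimately show ?thesis
    unfolding cnt_def using locally_finite_Ioc[OF assms(1)] by (simp add: card_Un_disjoint)
qed

lemma cnt_mono:
  assumes "locally_finite A" "u' \<le> u" "v \<le> v'"
  shows "cnt A u v \<le> cnt A u' v'"
  unfolding cnt_def using assms
  by (intro of_nat_mono card_mono locally_finite_Ioc) auto

lemma walk_diff:
  assumes "locally_finite R" "locally_finite B" "u \<le> v"
  shows "walk R B v - walk R B u = cnt R u v - cnt B u v"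
proof -
  consider "0 \<le> u" | "u < 0" "0 \<le> v" | "v < 0" by linarith
  then show ?thesis
  proof cases
    case 1
    then show ?thesis using assms cnt_add[of R 0 u v] cnt_add[of B 0 u v] unfolding walk_def by simp
  next
    case 2
    then show ?thesis using assms cnt_add[of R u 0 v] cnt_add[of B u 0 v] unfolding walk_def by simp
  next
    case 3
    then show ?thesis using assms cnt_add[of R u v 0] cnt_add[of B u v 0] unfolding walk_def by simp
  qed
qed

text \<open>A bracket structure: what lies under an edge is matched under that edge. This is all
  that the level argument uses about exponents below 1.\<close>

definition closed_edges :: "real set \<Rightarrow> real set \<Rightarrow> (real \<times> real) set \<Rightarrow> bool" where
  "closed_edges R B M \<longleftrightarrow> (\<forall>x y p. (x, y) \<in> M \<and> min x y < p \<and> p < max x y \<longrightarrow>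
     (p \<in> R \<longrightarrow> (\<exists>q. (p, q) \<in> M \<and> min x y < q \<and> q < max x y)) \<and>
     (p \<in> B \<longrightarrow> (\<exists>q. (q, p) \<in> M \<and> min x y < q \<and> q < max x y)))"

lemma matching_card_le_red:
  assumes M: "matching R B M" and "finite Y" and "\<And>x. x \<in> X \<Longrightarrow> \<exists>y\<in>Y. (x, y) \<in> M"
  shows "card X \<le> card Y"
proof -
  obtain f where f: "\<And>x. x \<in> X \<Longrightarrow> f x \<in> Y \<and> (x, f x) \<in> M" using assms(3) by metis
  have "inj_on f X" by (rule inj_onI) (metis f matching_blue_unique[OF M])
  then show ?thesis using f assms(2) by (intro card_inj_on_le[of f]) auto
qed

lemma matching_card_le_blue:
  assumes M: "matching R B M" and "finite X" and "\<And>y. y \<in> Y \<Longrightarrow> \<exists>x\<in>X. (x, y) \<in> M"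
  shows "card Y \<le> card X"
proof -
  obtain f where f: "\<And>y. y \<in> Y \<Longrightarrow> f y \<in> X \<and> (f y, y) \<in> M" using assms(3) by metis
  have "inj_on f Y" by (rule inj_onI) (metis f matching_red_unique[OF M])
  then show ?thesis using f assms(2) by (intro card_inj_on_le[of f]) auto
qed

text \<open>The points strictly under an edge are matched among themselves, so red and blue balance
  there, and only the right end of the edge contributes to the increment of the walk.\<close>

lemma edge_walk:
  assumes lf: "locally_finite R" "locally_finite B" and disj: "R \<inter> B = {}"
    and M: "matching R B M" and cl: "closed_edges R B M" and e: "(x, y) \<in> M"
  shows "walk R B y = walk R B x - 1"
proof -
  let ?l = "min x y" and ?u = "max x y"
  have xy: "x \<in> R" "y \<in> B" "x \<notin> B" "y \<notin> R" using matching_mem[OF M e] disj by auto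
  then have ne: "x \<noteq> y" by auto
  have fin: "finite (R \<inter> {?l<..<?u})" "finite (B \<inter> {?l<..<?u})"
    using lf locally_finite_Ioo by blast+
  have "card (R \<inter> {?l<..<?u}) \<le> card (B \<inter> {?l<..<?u})"
    using cl e matching_mem[OF M] unfolding closed_edges_def
    by (intro matching_card_le_red[OF M fin(2)]) (metis greaterThanLessThan_iff IntI Int_iff)
  moreover have "card (B \<inter> {?l<..<?u}) \<le> card (R \<inter> {?l<..<?u})"
    using cl e matching_mem[OF M] unfolding closed_edges_def
    by (intro matching_card_le_blue[OF M fin(1)]) (metis greaterThanLessThan_iff IntI Int_iff)
  ultimately have eq: "card (R \<inter> {?l<..<?u}) = card (B \<inter> {?l<..<?u})" by simp
  show ?thesis
  proof (cases "x < y")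
    case True
    have "R \<inter> {x<..y} = R \<inter> {?l<..<?u}" using True xy by (auto simp: less_le)
    moreover have "B \<inter> {x<..y} = insert y (B \<inter> {?l<..<?u})" using True xy by auto
    ultimately have "cnt R x y - cnt B x y = -1"
      unfolding cnt_def using eq fin True by simp
    then show ?thesis using walk_diff[OF lf, of x y] True by simp
  next
    case False
    then have lt: "y < x" using ne by simp
    have "B \<inter> {y<..x} = B \<inter> {?l<..<?u}" using lt xy by (auto simp: less_le)
    moreover have "R \<inter> {y<..x} = insert x (R \<inter> {?l<..<?u})" using lt xy by auto
    ultimately have "cnt R y x - cnt B y x = 1"
      unfolding cnt_def using eq fin lt by simp
    then show ?thesis using walk_diff[OF lf, of y x] lt by simp
  qed
qed

text \<open>Red points at which the walk steps up from \<open>l\<close> to \<open>l + 1\<close>;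
  \<open>blue_level R B l\<close> collects the steps down from \<open>l + 1\<close> to
  \<open>l\<close>. By \<open>edge_walk\<close>, an edge of a bracket structure joins points of one
  level.\<close>

definition red_level :: "real set \<Rightarrow> real set \<Rightarrow> int \<Rightarrow> real set" where
  "red_level R B l = {p \<in> R. walk R B p = l + 1}"

definition blue_level :: "real set \<Rightarrow> real set \<Rightarrow> int \<Rightarrow> real set" where
  "blue_level R B l = {p \<in> B. walk R B p = l}"

text \<open>Upward and downward passages between \<open>l\<close> and \<open>l + 1\<close>
  alternate, so their numbers differ only by what the positions of the walk at the two ends dictate.
  The induction removes the last point of the interval.\<close>

lemma level_balance:
  assumes lf: "locally_finite R" "locally_finite B" and disj: "R \<inter> B = {}" and "u \<le> v"
  shows "cnt (red_level R B l) u v - cnt (blue_level R B l) u v =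
     of_bool (l < walk R B v) - of_bool (l < walk R B u)"
  using \<open>u \<le> v\<close>
proof (induction "card ((R \<union> B) \<inter> {u<..v})" arbitrary: v rule: less_induct)
  case less
  let ?P = "(R \<union> B) \<inter> {u<..v}"
  have fin: "finite ?P" using lf locally_finite_Ioc by (simp add: Int_Un_distrib2)
  have lfl: "locally_finite (red_level R B l)" "locally_finite (blue_level R B l)"
    by (rule locally_finite_subset[OF lf(1)] locally_finite_subset[OF lf(2)],
      force simp: red_level_def blue_level_def)+
  show ?case
  proof (cases "?P = {}")
    case True
    then have "cnt R u v = 0" "cnt B u v = 0" "cnt (red_level R B l) u v = 0" "cnt (blue_level R B l) u v = 0"
      unfolding cnt_def red_level_def blue_level_def by (auto simp: card_eq_0_iff)
    moreover from this have "walk R B v = walk R B u" using walk_diff[OF lf less.prems] by simp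
    ultimately show ?thesis by simp
  next
    case False
    define p where "p = Max ?P"
    have pP: "p \<in> ?P" unfolding p_def using fin False by (rule Max_in)
    have pmax: "q \<le> p" if "q \<in> ?P" for q unfolding p_def using fin that by simp
    \<comment> \<open>The maximum \<open>w\<close> of \<open>Q\<close> is the last point before
      \<open>p\<close>, or \<open>u\<close> if there is none, so \<open>(w, v]\<close> contains only
      \<open>p\<close>.\<close>
    define Q where "Q = insert u ((R \<union> B) \<inter> {u<..<p})"
    have finQ: "finite Q" unfolding Q_def using fin pP by (auto intro: finite_subset[OF _ fin])
    define w where "w = Max Q"
    have wQ: "w \<in> Q" unfolding w_def using finQ by (rule Max_in) (simp add: Q_def)
    have wmax: "q \<le> w" if "q \<in> Q" for q unfolding w_def using finQ that by simp
    have uw: "u \<le> w" by (rule wmax) (simp add: Q_def)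
    have wp: "w < p" using wQ pP unfolding Q_def by auto
    have pv: "p \<le> v" using pP by simp
    have only: "q = p" if "q \<in> R \<union> B" "w < q" "q \<le> v" for q
    proof (rule ccontr)
      assume "q \<noteq> p"
      moreover have "q \<le> p" using pmax that uw by auto
      ultimately have "q \<in> Q" unfolding Q_def using that uw by auto
      then show False using wmax that by force
    qed
    have "(R \<union> B) \<inter> {u<..w} \<subseteq> ?P" "p \<in> ?P - (R \<union> B) \<inter> {u<..w}" using pP wp pv by auto
    then have "(R \<union> B) \<inter> {u<..w} \<subset> ?P" by blast
    then have "card ((R \<union> B) \<inter> {u<..w}) < card ?P" using fin by (simp add: psubset_card_mono)
    from less.hyps[OF this uw]
    have IH: "cnt (red_level R B l) u w - cnt (blue_level R B l) u w =
       of_bool (l < walk R B w) - of_bool (l < walk R B u)" .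
    have one: "A \<inter> {w<..v} = (if p \<in> A then {p} else {})" if "A \<subseteq> R \<union> B" for A
    proof -
      have "q = p" if "q \<in> A" "w < q" "q \<le> v" for q using only that \<open>A \<subseteq> R \<union> B\<close> by blast
      then have "A \<inter> {w<..v} \<subseteq> {p}" by force
      moreover have "p \<in> {w<..v}" using wp pv by simp
      ultimately show ?thesis by auto
    qed
    have c: "cnt A w v = of_bool (p \<in> A)" if "A \<subseteq> R \<union> B" for A
      unfolding cnt_def one[OF that] by simp
    have sub: "red_level R B l \<subseteq> R \<union> B" "blue_level R B l \<subseteq> R \<union> B"
      unfolding red_level_def blue_level_def by auto
    have wv: "w \<le> v" using wp pv by simp
    have s: "cnt A u v = cnt A u w + of_bool (p \<in> A)" if "A \<subseteq> R \<union> B" "locally_finite A" for A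
      using cnt_add[OF that(2) uw wv] c[OF that(1)] by simp
    have "A \<inter> {p<..v} = {}" if "A \<subseteq> R \<union> B" for A
    proof -
      have "q = p" if "q \<in> A" "p < q" "q \<le> v" for q
        using only[of q] that \<open>A \<subseteq> R \<union> B\<close> wp by auto
      then show ?thesis by fastforce
    qed
    then have "cnt R p v = 0" "cnt B p v = 0" unfolding cnt_def by auto
    then have Wp: "walk R B p = walk R B v" using walk_diff[OF lf pv] by simp
    have Wv: "walk R B v - walk R B w = of_bool (p \<in> R) - of_bool (p \<in> B)"
      using walk_diff[OF lf wv] c[of R] c[of B] by simp
    have "p \<in> R \<or> p \<in> B" "\<not> (p \<in> R \<and> p \<in> B)" using pP disj by auto
    then show ?thesis
      using s[OF sub(1) lfl(1)] s[OF sub(2) lfl(2)] IH Wp Wv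
      unfolding red_level_def blue_level_def by auto
  qed
qed

definition red_near :: "real set \<Rightarrow> real set \<Rightarrow> int \<Rightarrow> real \<Rightarrow> real set" where
  "red_near R B l t = {p \<in> red_level R B l. \<bar>p\<bar> \<le> t}"

definition blue_near :: "real set \<Rightarrow> real set \<Rightarrow> int \<Rightarrow> real \<Rightarrow> real set" where
  "blue_near R B l t = {p \<in> blue_level R B l. \<bar>p\<bar> \<le> t}"

definition low :: "real set \<Rightarrow> real set \<Rightarrow> real \<Rightarrow> int \<Rightarrow> real \<Rightarrow> bool" where
  "low R B K l t \<longleftrightarrow> 0 < t \<and> (\<forall>s. t \<le> \<bar>s\<bar> \<and> \<bar>s\<bar> \<le> K * t \<longrightarrow> walk R B s < l)"

text \<open>A point of level \<open>l\<close> matched within the window is matched within \<open>[-t, t]\<close>, because the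
  walk avoids level \<open>l\<close> in between.\<close>

locale valley =
  fixes R B :: "real set" and M :: "(real \<times> real) set" and l :: int and t K :: real
  assumes lf: "locally_finite R" "locally_finite B" and disj: "R \<inter> B = {}"
    and M: "matching R B M" and cl: "closed_edges R B M"
    and lowt: "low R B K l t" and K: "1 \<le> K"
begin

abbreviation "X \<equiv> red_near R B l t"
abbreviation "Y \<equiv> blue_near R B l t"

lemmas X_def = red_near_def[of R B l t]
lemmas Y_def = blue_near_def[of R B l t]

lemma low: "t \<le> \<bar>s\<bar> \<Longrightarrow> \<bar>s\<bar> \<le> K * t \<Longrightarrow> walk R B s < l"
  using lowt unfolding low_def by blast

lemma t: "0 < t"
  using lowt unfolding low_def by blast

lemma tK: "t \<le> K * t" using t K by simp

lemma fin: "finite X" "finite Y"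
proof -
  have "X \<subseteq> R \<inter> {- t - 1<..t}" "Y \<subseteq> B \<inter> {- t - 1<..t}"
    unfolding X_def Y_def red_level_def blue_level_def by auto
  then show "finite X" "finite Y" using lf locally_finite_Ioc finite_subset by blast+
qed

text \<open>The walk is below \<open>l\<close> at \<open>-t\<close> and at \<open>t\<close>, so
  upward and downward passages in between balance. The left end is lost in the half-open interval,
  but a level point at \<open>-t\<close> would put the walk there at \<open>l\<close> or
  higher.\<close>

lemma card_eq: "card X = card Y"
proof -
  have "walk R B t < l" "walk R B (- t) < l" using low[of t] low[of "- t"] t tK by simp_all
  moreover have "X = red_level R B l \<inter> {- t<..t}"
  proof -
    have "- t < p" if "p \<in> red_level R B l" "\<bar>p\<bar> \<le> t" for p
      using that \<open>walk R B (- t) < l\<close> unfolding red_level_def by (cases "p = - t") auto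
    then show ?thesis unfolding X_def by auto
  qed
  moreover have "Y = blue_level R B l \<inter> {- t<..t}"
  proof -
    have "- t < p" if "p \<in> blue_level R B l" "\<bar>p\<bar> \<le> t" for p
      using that \<open>walk R B (- t) < l\<close> unfolding blue_level_def by (cases "p = - t") auto
    then show ?thesis unfolding Y_def by auto
  qed
  ultimately show ?thesis
    using level_balance[OF lf disj, of "- t" t l] t unfolding cnt_def by simp
qed

lemma partner_Y: "x \<in> X \<Longrightarrow> (x, y) \<in> M \<Longrightarrow> \<bar>y\<bar> \<le> K * t \<Longrightarrow> y \<in> Y"
  using edge_walk[OF lf disj M cl, of x y] low[of y] matching_mem[OF M, of x y]
  unfolding X_def Y_def red_level_def blue_level_def by force

lemma partner_X: "y \<in> Y \<Longrightarrow> (x, y) \<in> M \<Longrightarrow> \<bar>x\<bar> \<le> K * t \<Longrightarrow> x \<in> X"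
  using edge_walk[OF lf disj M cl, of x y] low[of x] matching_mem[OF M, of x y]
  unfolding X_def Y_def red_level_def blue_level_def by force

text \<open>\<open>X\<close> and \<open>Y\<close> have equally many points, and so have the parts of
  them that are matched with each other; hence leftovers occur in both colours or in neither. A
  leftover of one colour thus supplies one of the other colour for an exchange.\<close>

lemma bad_iff:
  "(\<exists>x\<in>X. \<not> (\<exists>y. (x, y) \<in> M \<and> \<bar>y\<bar> \<le> K * t)) \<longleftrightarrow> (\<exists>y\<in>Y. \<not> (\<exists>x. (x, y) \<in> M \<and> \<bar>x\<bar> \<le> K * t))"
proof -
  let ?X = "{x\<in>X. \<exists>y\<in>Y. (x, y) \<in> M}" and ?Y = "{y\<in>Y. \<exists>x\<in>X. (x, y) \<in> M}"
  have "card ?X = card ?Y"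
    using fin by (intro antisym matching_card_le_red[OF M] matching_card_le_blue[OF M]) auto
  then have eq: "?X = X \<longleftrightarrow> ?Y = Y"
    using card_eq fin by (metis (no_types, lifting) card_subset_eq mem_Collect_eq subsetI)
  have Xt: "\<bar>x\<bar> \<le> K * t" if "x \<in> X" for x using that tK unfolding X_def by auto
  have Yt: "\<bar>y\<bar> \<le> K * t" if "y \<in> Y" for y using that tK unfolding Y_def by auto
  have "(\<exists>y. (x, y) \<in> M \<and> \<bar>y\<bar> \<le> K * t) \<longleftrightarrow> (\<exists>y\<in>Y. (x, y) \<in> M)" if "x \<in> X" for x
    using partner_Y[OF that] Yt by blast
  moreover have "(\<exists>x. (x, y) \<in> M \<and> \<bar>x\<bar> \<le> K * t) \<longleftrightarrow> (\<exists>x\<in>X. (x, y) \<in> M)" if "y \<in> Y" for y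
    using partner_X[OF that] Xt by blast
  ultimately show ?thesis using eq by blast
qed

end

section \<open>Cost functions\<close>

text \<open>At exponent \<open>g\<close> the slope is a multiple of \<open>z powr (g - 1)\<close>
  whether \<open>g\<close> is positive, zero or negative, so the three branches of
  \<open>cost_fun\<close> can be treated together. The factor \<open>a\<close>, or the summand
  \<open>ln a\<close> at exponent 0, affects at most the constant \<open>k\<close>.\<close>

definition power_slope :: "real \<Rightarrow> real \<Rightarrow> (real \<Rightarrow> real) \<Rightarrow> bool" where
  "power_slope k p f \<longleftrightarrow> 0 < k \<and> (\<forall>z>0. (f has_real_derivative k * z powr p) (at z))"

definition base_cost :: "real \<Rightarrow> real \<Rightarrow> real" where
  "base_cost g z = (if g > 0 then z powr g else if g = 0 then ln z else - (z powr g))"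

lemma cost_fun_pos: "0 < z \<Longrightarrow> cost_fun g a z = base_cost g z"
  unfolding cost_fun_def base_cost_def by simp

lemma cost_fun_neg:
  "0 < z \<Longrightarrow> 0 < a \<Longrightarrow> cost_fun g a (- z) = (if g = 0 then ln a + base_cost g z else a * base_cost g z)"
  unfolding cost_fun_def base_cost_def by (simp add: ln_mult)

lemma power_slope_base: "power_slope (if g = 0 then 1 else \<bar>g\<bar>) (g - 1) (base_cost g)"
  unfolding power_slope_def
proof (intro conjI allI impI)
  show "0 < (if g = 0 then 1 else \<bar>g\<bar>)" by simp
  fix z :: real assume z: "0 < z"
  consider "g > 0" | "g = 0" | "g < 0" by linarith
  then show "(base_cost g has_real_derivative (if g = 0 then 1 else \<bar>g\<bar>) * z powr (g - 1)) (at z)"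
  proof cases
    case 1
    then have "base_cost g = (\<lambda>z. z powr g)" unfolding base_cost_def by auto
    then show ?thesis using 1 z by (auto intro!: derivative_eq_intros)
  next
    case 2
    then have "base_cost g = ln" unfolding base_cost_def by auto
    then show ?thesis using 2 z by (auto intro!: derivative_eq_intros simp: powr_minus divide_inverse)
  next
    case 3
    then have "base_cost g = (\<lambda>z. - (z powr g))" unfolding base_cost_def by auto
    then show ?thesis using 3 z by (auto intro!: derivative_eq_intros)
  qed
qed

lemma power_slope_transform:
  assumes "power_slope k p f" "\<And>z. 0 < z \<Longrightarrow> h z = c + d * f z" "0 < d"
  shows "power_slope (d * k) p h"
  unfolding power_slope_def
proof (intro conjI allI impI)
  show "0 < d * k" using assms unfolding power_slope_def by simp
  fix z :: real assume z: "0 < z"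
  have "((\<lambda>z. c + d * f z) has_real_derivative d * k * z powr p) (at z)"
    using assms z unfolding power_slope_def by (auto intro!: derivative_eq_intros)
  then show "(h has_real_derivative d * k * z powr p) (at z)"
    by (rule has_field_derivative_transform_within_open[of _ _ _ "{0<..}"]) (use z assms in auto)
qed

lemma power_slope_cost_pos: "\<exists>k. power_slope k (g - 1) (cost_fun g a)"
  using power_slope_transform[OF power_slope_base[of g], of "cost_fun g a" 0 1] cost_fun_pos by auto

lemma power_slope_cost_neg:
  assumes "0 < a"
  shows "\<exists>k. power_slope k (g - 1) (\<lambda>z. cost_fun g a (- z))"
proof (cases "g = 0")
  case True
  then show ?thesis
    using power_slope_transform[OF power_slope_base[of g], of "\<lambda>z. cost_fun g a (- z)" "ln a" 1]
      cost_fun_neg[OF _ assms, of _ g] by auto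
next
  case False
  then show ?thesis
    using power_slope_transform[OF power_slope_base[of g], of "\<lambda>z. cost_fun g a (- z)" 0 a]
      cost_fun_neg[OF _ assms, of _ g] assms by auto
qed

lemma power_slope_mono:
  assumes "power_slope k p f" "0 < u" "u < v"
  shows "f u < f v"
proof (rule DERIV_pos_imp_increasing[OF assms(3)])
  fix x assume "u \<le> x" "x \<le> v"
  then have "0 < x" using assms by simp
  then have "(f has_real_derivative k * x powr p) (at x)" "0 < k * x powr p"
    using assms unfolding power_slope_def by auto
  then show "\<exists>y. (f has_real_derivative y) (at x) \<and> 0 < y" by blast
qed

text \<open>The lengths of a nested and of a crossing pair of edges on four successive points with
  gaps \<open>p\<close>, \<open>q\<close>, \<open>r\<close>. Both pairs cost the same at
  \<open>r = 0\<close>, and the advantage of nesting grows with \<open>r\<close> because the slope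
  decreases with distance.\<close>

lemma power_slope_concave:
  assumes "power_slope k s f" "s < 0" "0 < p" "0 < q" "0 < r"
  shows "f (p + q + r) + f q < f (p + q) + f (q + r)"
proof -
  have "f (q + 0) - f (p + q + 0) < f (q + r) - f (p + q + r)"
  proof (rule DERIV_pos_imp_increasing[of 0 r "\<lambda>t. f (q + t) - f (p + q + t)"])
    fix t assume t: "0 \<le> t" "t \<le> r"
    have d: "(f has_real_derivative k * z powr s) (at z)" if "0 < z" for z
      using assms that unfolding power_slope_def by blast
    have "((\<lambda>t. f (q + t) - f (p + q + t)) has_real_derivative k * (q + t) powr s - k * (p + q + t) powr s) (at t)"
    proof -
      have "((\<lambda>t. f (q + t)) has_real_derivative k * (q + t) powr s * 1) (at t)"
        using t assms by (intro DERIV_chain2[of f, OF d]) (auto intro!: derivative_eq_intros)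
      moreover have "((\<lambda>t. f (p + q + t)) has_real_derivative k * (p + q + t) powr s * 1) (at t)"
        using t assms by (intro DERIV_chain2[of f, OF d]) (auto intro!: derivative_eq_intros)
      ultimately show ?thesis using DERIV_diff by fastforce
    qed
    moreover have "(p + q + t) powr s < (q + t) powr s"
      using t assms by (intro powr_less_mono2_neg) auto
    then have "k * (q + t) powr s - k * (p + q + t) powr s > 0"
      using assms unfolding power_slope_def by simp
    ultimately show "\<exists>y. ((\<lambda>t. f (q + t) - f (p + q + t)) has_real_derivative y) (at t) \<and> 0 < y" by blast
  qed (use assms in simp)
  then show ?thesis by simp
qed

definition concave_cost :: "(real \<Rightarrow> real) \<Rightarrow> bool" where
  "concave_cost f \<longleftrightarrow>
     (\<forall>u v. 0 < u \<and> u < v \<longrightarrow> f u < f v \<and> f (- u) < f (- v)) \<and>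
     (\<forall>p q r. 0 < p \<and> 0 < q \<and> 0 < r \<longrightarrow> f (p + q + r) + f q < f (p + q) + f (q + r) \<and>
        f (- (p + q + r)) + f (- q) < f (- (p + q)) + f (- (q + r)))"

lemma concave_cost_cost_fun:
  assumes "g < 1" "0 < a"
  shows "concave_cost (cost_fun g a)"
proof -
  obtain k k' where k: "power_slope k (g - 1) (cost_fun g a)" "power_slope k' (g - 1) (\<lambda>z. cost_fun g a (- z))"
    using power_slope_cost_pos power_slope_cost_neg assms by meson
  show ?thesis
    unfolding concave_cost_def
    using power_slope_mono[OF k(1)] power_slope_mono[OF k(2)]
      power_slope_concave[OF k(1)] power_slope_concave[OF k(2)] assms by simp
qed

lemma concave_cost_reflect: "concave_cost f \<Longrightarrow> concave_cost (\<lambda>z. f (- z))"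
  unfolding concave_cost_def minus_minus by blast

lemma concave_costD:
  assumes "concave_cost f"
  shows "0 < u \<Longrightarrow> u < v \<Longrightarrow> f u < f v" "0 < u \<Longrightarrow> u < v \<Longrightarrow> f (- u) < f (- v)"
    "0 < p \<Longrightarrow> 0 < q \<Longrightarrow> 0 < r \<Longrightarrow> f (p + q + r) + f q < f (p + q) + f (q + r)"
    "0 < p \<Longrightarrow> 0 < q \<Longrightarrow> 0 < r \<Longrightarrow> f (- (p + q + r)) + f (- q) < f (- (p + q)) + f (- (q + r))"
  using assms unfolding concave_cost_def by blast+

section \<open>Comparing long edges with short ones of either direction\<close>

definition dominates :: "real \<Rightarrow> (real \<Rightarrow> real) \<Rightarrow> bool" where
  "dominates K f \<longleftrightarrow> (\<forall>w z. w \<noteq> 0 \<and> K * \<bar>w\<bar> \<le> \<bar>z\<bar> \<longrightarrow> f w < f z)"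

text \<open>The last clause concerns two equally directed edges of length \<open>b\<close> that
  reach from two points at distance \<open>|w|\<close> to opposite sides: joining the far ends and
  closing the gap must pay. For positive \<open>g\<close> the slack comes from
  \<open>2 powr g < 2\<close> and vanishes as \<open>g\<close> tends to 1, so \<open>K\<close>
  depends on the exponent.\<close>

definition quasi_cost :: "real \<Rightarrow> (real \<Rightarrow> real) \<Rightarrow> bool" where
  "quasi_cost K f \<longleftrightarrow> 2 \<le> K \<and> concave_cost f \<and> dominates K f \<and>
     (\<forall>b w. w \<noteq> 0 \<and> K * \<bar>w\<bar> \<le> b \<longrightarrow>
        f (2 * b + \<bar>w\<bar>) + f w < 2 * f b \<and> f (- (2 * b + \<bar>w\<bar>)) + f w < 2 * f (- b))"

lemma cost_fun_bounds:
  assumes "0 < a" "z \<noteq> 0"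
  shows "g > 0 \<Longrightarrow> min 1 a * \<bar>z\<bar> powr g \<le> cost_fun g a z \<and> cost_fun g a z \<le> max 1 a * \<bar>z\<bar> powr g"
    "g < 0 \<Longrightarrow> - (max 1 a * \<bar>z\<bar> powr g) \<le> cost_fun g a z \<and> cost_fun g a z \<le> - (min 1 a * \<bar>z\<bar> powr g)"
    "ln (min 1 a * \<bar>z\<bar>) \<le> cost_fun 0 a z \<and> cost_fun 0 a z \<le> ln (max 1 a * \<bar>z\<bar>)"
proof -
  have p: "0 < \<bar>z\<bar> powr g" "0 < \<bar>z\<bar>" using assms by simp_all
  have mm: "min 1 a * r \<le> r" "r \<le> max 1 a * r" "min 1 a * r \<le> a * r" "a * r \<le> max 1 a * r" if "0 < r" for r
    using that by (simp_all add: mult_le_cancel_right1)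
  show "g > 0 \<Longrightarrow> min 1 a * \<bar>z\<bar> powr g \<le> cost_fun g a z \<and> cost_fun g a z \<le> max 1 a * \<bar>z\<bar> powr g"
    using mm[OF p(1)] unfolding cost_fun_def by auto
  show "g < 0 \<Longrightarrow> - (max 1 a * \<bar>z\<bar> powr g) \<le> cost_fun g a z \<and> cost_fun g a z \<le> - (min 1 a * \<bar>z\<bar> powr g)"
    using mm[OF p(1)] unfolding cost_fun_def by auto
  have mp: "0 < min 1 a * \<bar>z\<bar>" using assms by simp
  have "ln (min 1 a * \<bar>z\<bar>) \<le> ln \<bar>z\<bar>" "ln \<bar>z\<bar> \<le> ln (max 1 a * \<bar>z\<bar>)"
    "ln (min 1 a * \<bar>z\<bar>) \<le> ln (a * \<bar>z\<bar>)" "ln (a * \<bar>z\<bar>) \<le> ln (max 1 a * \<bar>z\<bar>)"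
    using mm[OF p(2)] mp p(2) assms by (auto intro!: ln_mono)
  then show "ln (min 1 a * \<bar>z\<bar>) \<le> cost_fun 0 a z \<and> cost_fun 0 a z \<le> ln (max 1 a * \<bar>z\<bar>)"
    unfolding cost_fun_def by auto
qed

lemma dominates_pos:
  assumes "0 < a" "0 < g" "0 < K" "max 1 a < min 1 a * K powr g"
  shows "dominates K (cost_fun g a)"
  unfolding dominates_def
proof (intro allI impI, elim conjE)
  fix w z :: real assume w: "w \<noteq> 0" "K * \<bar>w\<bar> \<le> \<bar>z\<bar>"
  have "0 < K * \<bar>w\<bar>" using w assms by simp
  then have z: "z \<noteq> 0" using w by auto
  have "cost_fun g a w \<le> max 1 a * \<bar>w\<bar> powr g" using cost_fun_bounds(1) assms w by blast
  also have "\<dots> < min 1 a * K powr g * \<bar>w\<bar> powr g" using assms(4) w by simp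
  also have "\<dots> = min 1 a * (K * \<bar>w\<bar>) powr g" using assms by (simp add: powr_mult)
  also have "\<dots> \<le> min 1 a * \<bar>z\<bar> powr g"
    using w assms by (intro mult_left_mono powr_mono2) auto
  also have "\<dots> \<le> cost_fun g a z" using cost_fun_bounds(1) assms z by blast
  finally show "cost_fun g a w < cost_fun g a z" .
qed

text \<open>After division by \<open>b powr g\<close>, the bound \<open>|w| \<le> b / K\<close>
  reduces the claim to \<open>c * (2 + 1 / K) powr g + max 1 a * K powr (- g) < 2 * c\<close> with
  \<open>c\<close> equal to 1 or \<open>a\<close>. The left side tends to
  \<open>c * 2 powr g\<close> as \<open>K\<close> grows.\<close>

lemma quasi_cost_pos:
  assumes "0 < a" "0 < g" "g < 1"
  shows "\<forall>\<^sub>F K in at_top. quasi_cost K (cost_fun g a)"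
proof -
  let ?m = "min 1 a" and ?A = "max 1 a"
  have mA: "0 < ?m" "0 < ?A" using assms by auto
  have lim: "((\<lambda>K. c * (2 + 1 / K) powr g + ?A * K powr (- g)) \<longlongrightarrow> c * 2 powr g) at_top" for c :: real
    using assms by real_asymp
  have "2 powr g < 2 powr 1" using assms by (intro powr_less_mono) auto
  then have lt: "c * 2 powr g < 2 * c" if "0 < c" for c :: real using that by simp
  have ev1: "\<forall>\<^sub>F K in at_top. 1 * (2 + 1 / K) powr g + ?A * K powr (- g) < 2 * 1"
    using order_tendstoD(2)[OF lim lt[of 1]] by simp
  have ev2: "\<forall>\<^sub>F K in at_top. a * (2 + 1 / K) powr g + ?A * K powr (- g) < 2 * a"
    using order_tendstoD(2)[OF lim lt[OF assms(1)]] .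
  have "filterlim (\<lambda>K. ?m * K powr g) at_top at_top" using mA assms by real_asymp
  then have ev3: "\<forall>\<^sub>F K in at_top. ?A < ?m * K powr g" unfolding filterlim_at_top_dense by blast
  show ?thesis
    using ev1 ev2 ev3 eventually_ge_at_top[of 2]
  proof eventually_elim
    case (elim K)
    have K: "0 < K" using elim by simp
    have main: "c * (2 * b + \<bar>w\<bar>) powr g + ?A * \<bar>w\<bar> powr g < 2 * (c * b powr g)"
      if w: "w \<noteq> 0" "K * \<bar>w\<bar> \<le> b" and c: "0 < c" "c * (2 + 1 / K) powr g + ?A * K powr (- g) < 2 * c"
      for b w c
    proof -
      have b: "0 < b" using w K by (smt (verit, best) mult_pos_pos zero_less_abs_iff)
      have w': "\<bar>w\<bar> \<le> b / K" using w K by (simp add: field_simps)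
      have "(2 * b + \<bar>w\<bar>) powr g \<le> ((2 + 1 / K) * b) powr g"
        using w' b K assms by (intro powr_mono2) (auto simp: algebra_simps)
      then have 1: "(2 * b + \<bar>w\<bar>) powr g \<le> (2 + 1 / K) powr g * b powr g"
        using b K by (simp add: powr_mult)
      have "\<bar>w\<bar> powr g \<le> (b / K) powr g" using w' assms by (intro powr_mono2) auto
      then have 2: "\<bar>w\<bar> powr g \<le> K powr (- g) * b powr g"
        using b K by (simp add: powr_divide powr_minus field_simps)
      have "c * (2 * b + \<bar>w\<bar>) powr g + ?A * \<bar>w\<bar> powr g \<le>
          c * ((2 + 1 / K) powr g * b powr g) + ?A * (K powr (- g) * b powr g)"
        using 1 2 c mA by (intro add_mono mult_left_mono) auto
      also have "\<dots> = (c * (2 + 1 / K) powr g + ?A * K powr (- g)) * b powr g" by (simp add: algebra_simps)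
      also have "\<dots> < 2 * c * b powr g" using c b by (intro mult_strict_right_mono) auto
      finally show ?thesis by simp
    qed
    have "cost_fun g a (2 * b + \<bar>w\<bar>) + cost_fun g a w < 2 * cost_fun g a b \<and>
      cost_fun g a (- (2 * b + \<bar>w\<bar>)) + cost_fun g a w < 2 * cost_fun g a (- b)"
      if w: "w \<noteq> 0" "K * \<bar>w\<bar> \<le> b" for b w
    proof -
      have b: "0 < b" using w K by (smt (verit, best) mult_pos_pos zero_less_abs_iff)
      have "cost_fun g a w \<le> ?A * \<bar>w\<bar> powr g" using cost_fun_bounds(1) assms w by blast
      moreover have "cost_fun g a (2 * b + \<bar>w\<bar>) = (2 * b + \<bar>w\<bar>) powr g" "cost_fun g a b = b powr g"
        "cost_fun g a (- (2 * b + \<bar>w\<bar>)) = a * (2 * b + \<bar>w\<bar>) powr g" "cost_fun g a (- b) = a * b powr g"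
        using cost_fun_pos[of b g a] cost_fun_pos[of "2 * b + \<bar>w\<bar>" g a]
          cost_fun_neg[of b a g] cost_fun_neg[of "2 * b + \<bar>w\<bar>" a g] b assms
        by (simp_all add: base_cost_def del: minus_add_distrib)
      ultimately show ?thesis
        using main[OF w, of 1] main[OF w, of a] elim(1,2) assms by (simp del: minus_add_distrib)
    qed
    then show ?case
      unfolding quasi_cost_def
      using elim dominates_pos[OF assms(1,2) K elim(3)] concave_cost_cost_fun[OF assms(3,1)] by blast
  qed
qed

lemma quasi_cost_zero:
  assumes "0 < a"
  shows "\<exists>K. quasi_cost K (cost_fun 0 a)"
proof -
  let ?m = "min 1 a" and ?A = "max 1 a"
  have mA: "0 < ?m" "0 < ?A" "?m \<le> 1" "1 \<le> ?A" using assms by auto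
  \<comment> \<open>Logarithms turn the claim into one between products, and this \<open>K\<close>
    makes \<open>3 * b * (max 1 a * |w|)\<close> smaller than
    \<open>b * (min 1 a * b)\<close>.\<close>
  define K where "K = 4 * ?A / ?m"
  have K: "2 \<le> K" "?m * K = 4 * ?A" using mA unfolding K_def by (auto simp: field_simps)
  have dom: "dominates K (cost_fun 0 a)"
    unfolding dominates_def
  proof (intro allI impI, elim conjE)
    fix w z :: real assume w: "w \<noteq> 0" "K * \<bar>w\<bar> \<le> \<bar>z\<bar>"
    have "0 < K * \<bar>w\<bar>" using w K by simp
    then have z: "z \<noteq> 0" using w by auto
    have "?A * \<bar>w\<bar> < ?m * K * \<bar>w\<bar>" unfolding K(2) using w mA by simp
    also have "\<dots> \<le> ?m * \<bar>z\<bar>" using w mA by (simp add: mult.assoc)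
    finally have "ln (?A * \<bar>w\<bar>) < ln (?m * \<bar>z\<bar>)" using w z mA by simp
    then show "cost_fun 0 a w < cost_fun 0 a z"
      using cost_fun_bounds(3)[OF assms w(1)] cost_fun_bounds(3)[OF assms z] by linarith
  qed
  have "cost_fun 0 a (2 * b + \<bar>w\<bar>) + cost_fun 0 a w < 2 * cost_fun 0 a b \<and>
      cost_fun 0 a (- (2 * b + \<bar>w\<bar>)) + cost_fun 0 a w < 2 * cost_fun 0 a (- b)"
    if w: "w \<noteq> 0" "K * \<bar>w\<bar> \<le> b" for b w
  proof -
    have w0: "0 < \<bar>w\<bar>" using w by simp
    have "2 * \<bar>w\<bar> \<le> K * \<bar>w\<bar>" using K by (intro mult_right_mono) auto
    then have b: "0 < b" "\<bar>w\<bar> \<le> b" using w w0 by linarith+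
    have le: "cost_fun 0 a w \<le> ln (?A * \<bar>w\<bar>)" using cost_fun_bounds(3)[OF assms w(1)] by simp
    have "c * ((2 * b + \<bar>w\<bar>) * (?A * \<bar>w\<bar>)) < (c * b) * (c * b)" if c: "?m \<le> c" for c
    proof -
      have "0 < c" using c mA by linarith
      have "(2 * b + \<bar>w\<bar>) * (?A * \<bar>w\<bar>) \<le> (3 * b) * (?A * \<bar>w\<bar>)"
        using b mA by (intro mult_right_mono) auto
      also have "\<dots> < b * (4 * ?A * \<bar>w\<bar>)" using b mA w0 by simp
      also have "\<dots> = b * (?m * (K * \<bar>w\<bar>))" using K(2) by (simp add: mult.assoc[symmetric])
      also have "\<dots> \<le> b * (c * b)"
        using b w c mA K by (intro mult_left_mono mult_mono) auto
      finally show ?thesis using \<open>0 < c\<close> by simp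
    qed
    note main = this
    have ln1: "ln (2 * b + \<bar>w\<bar>) + ln (?A * \<bar>w\<bar>) < 2 * ln b"
    proof -
      have "ln ((2 * b + \<bar>w\<bar>) * (?A * \<bar>w\<bar>)) < ln (b * b)"
        using main[of 1] b mA w0 by (subst ln_less_cancel_iff) auto
      then show ?thesis using b mA w0 by (subst (asm) (1 2) ln_mult_pos) auto
    qed
    have ln2: "ln (a * (2 * b + \<bar>w\<bar>)) + ln (?A * \<bar>w\<bar>) < 2 * ln (a * b)"
    proof -
      have "ln ((a * (2 * b + \<bar>w\<bar>)) * (?A * \<bar>w\<bar>)) < ln ((a * b) * (a * b))"
        using main[of a] b mA w0 assms by (subst ln_less_cancel_iff) (auto simp: mult.assoc)
      then show ?thesis using b mA w0 assms by (subst (asm) (1 2) ln_mult_pos) auto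
    qed
    have "cost_fun 0 a (2 * b + \<bar>w\<bar>) = ln (2 * b + \<bar>w\<bar>)" "cost_fun 0 a b = ln b"
      "cost_fun 0 a (- (2 * b + \<bar>w\<bar>)) = ln (a * (2 * b + \<bar>w\<bar>))" "cost_fun 0 a (- b) = ln (a * b)"
      using cost_fun_pos[of b 0 a] cost_fun_pos[of "2 * b + \<bar>w\<bar>" 0 a]
          cost_fun_neg[of b a 0] cost_fun_neg[of "2 * b + \<bar>w\<bar>" a 0] b assms
      by (simp_all add: base_cost_def ln_mult_pos del: minus_add_distrib)
    then show ?thesis using ln1 ln2 le by (simp del: minus_add_distrib)
  qed
  then have "quasi_cost K (cost_fun 0 a)"
    unfolding quasi_cost_def using K(1) dom concave_cost_cost_fun[of 0 a] assms by simp
  then show ?thesis ..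
qed

text \<open>Costs are negative and unbounded near 0: the short edge alone outweighs two edges that
  are \<open>K\<close> times as long, and the new long edge costs at most 0.\<close>

lemma quasi_cost_neg:
  assumes "0 < a" "g < 0"
  shows "\<exists>K. quasi_cost K (cost_fun g a)"
proof -
  let ?m = "min 1 a" and ?A = "max 1 a"
  have mA: "0 < ?m" "0 < ?A" "?m \<le> 1" "1 \<le> ?A" using assms by auto
  have "((\<lambda>K. 2 * ?A * K powr g) \<longlongrightarrow> 0) at_top" using assms by real_asymp
  then have "\<forall>\<^sub>F K in at_top. 2 * ?A * K powr g < ?m" using order_tendstoD(2) mA(1) by blast
  then have "\<forall>\<^sub>F K in at_top. 2 * ?A * K powr g < ?m \<and> 2 \<le> K"
    using eventually_ge_at_top[of "2::real"] by (rule eventually_conj)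
  then obtain K where K: "2 * ?A * K powr g < ?m" "2 \<le> K"
    using eventually_happens'[OF trivial_limit_at_top_linorder] by blast
  have far: "2 * (?A * \<bar>z\<bar> powr g) < ?m * \<bar>w\<bar> powr g" if w: "w \<noteq> 0" "K * \<bar>w\<bar> \<le> \<bar>z\<bar>" for w z
  proof -
    have p: "0 < K * \<bar>w\<bar>" using w K by simp
    have "\<bar>z\<bar> powr g \<le> (K * \<bar>w\<bar>) powr g" using w p assms by (intro powr_mono2') auto
    also have "\<dots> = K powr g * \<bar>w\<bar> powr g" using K by (simp add: powr_mult)
    finally have "?A * \<bar>z\<bar> powr g \<le> ?A * (K powr g * \<bar>w\<bar> powr g)"
      using mA by (intro mult_left_mono) auto
    then have "2 * (?A * \<bar>z\<bar> powr g) \<le> (2 * ?A * K powr g) * \<bar>w\<bar> powr g"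
      by (simp add: mult.assoc)
    also have "\<dots> < ?m * \<bar>w\<bar> powr g" using K w by (intro mult_strict_right_mono) auto
    finally show ?thesis .
  qed
  have dom: "dominates K (cost_fun g a)"
    unfolding dominates_def
  proof (intro allI impI, elim conjE)
    fix w z :: real assume w: "w \<noteq> 0" "K * \<bar>w\<bar> \<le> \<bar>z\<bar>"
    have "0 < K * \<bar>w\<bar>" using w K by simp
    then have z: "z \<noteq> 0" using w by auto
    have "0 \<le> ?A * \<bar>z\<bar> powr g" using mA by simp
    then have "?A * \<bar>z\<bar> powr g < ?m * \<bar>w\<bar> powr g" using far[OF w] by linarith
    then show "cost_fun g a w < cost_fun g a z"
      using cost_fun_bounds(2)[OF assms(1) w(1) assms(2)] cost_fun_bounds(2)[OF assms(1) z assms(2)] by linarith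
  qed
  have "cost_fun g a (2 * b + \<bar>w\<bar>) + cost_fun g a w < 2 * cost_fun g a b \<and>
      cost_fun g a (- (2 * b + \<bar>w\<bar>)) + cost_fun g a w < 2 * cost_fun g a (- b)"
    if w: "w \<noteq> 0" "K * \<bar>w\<bar> \<le> b" for b w
  proof -
    have "0 < K * \<bar>w\<bar>" using w K by simp
    then have b: "0 < b" using w by linarith
    have f: "2 * (?A * b powr g) < ?m * \<bar>w\<bar> powr g" using far[of w b] w b by simp
    have neg: "cost_fun g a z \<le> 0" if "z \<noteq> 0" for z
    proof -
      have "cost_fun g a z \<le> - (?m * \<bar>z\<bar> powr g)" using cost_fun_bounds(2)[OF assms(1) that assms(2)] by simp
      moreover have "0 \<le> ?m * \<bar>z\<bar> powr g" using mA by simp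
      ultimately show ?thesis by linarith
    qed
    have "cost_fun g a (2 * b + \<bar>w\<bar>) \<le> 0" "cost_fun g a (- (2 * b + \<bar>w\<bar>)) \<le> 0"
      using b by (intro neg; linarith)+
    moreover have "cost_fun g a w \<le> - (?m * \<bar>w\<bar> powr g)" using cost_fun_bounds(2)[OF assms(1) w(1) assms(2)] by simp
    moreover have "- (?A * b powr g) \<le> cost_fun g a b" "- (?A * b powr g) \<le> cost_fun g a (- b)"
      using cost_fun_bounds(2)[OF assms(1) _ assms(2), of b] cost_fun_bounds(2)[OF assms(1) _ assms(2), of "- b"] b by simp_all
    ultimately show ?thesis using f by linarith
  qed
  then have "quasi_cost K (cost_fun g a)"
    unfolding quasi_cost_def using K(2) dom concave_cost_cost_fun[of g a] assms by simp
  then show ?thesis ..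
qed

lemma quasi_cost_exists:
  assumes "0 < a" "g < 1"
  shows "\<exists>K. quasi_cost K (cost_fun g a)"
proof -
  consider "0 < g" | "g = 0" | "g < 0" by linarith
  then show ?thesis
  proof cases
    case 1
    then show ?thesis
      using eventually_happens'[OF trivial_limit_at_top_linorder quasi_cost_pos] assms by blast
  qed (use assms quasi_cost_zero quasi_cost_neg in auto)
qed

text \<open>\<open>K\<close> is chosen for exponent 1/2 and then serves all exponents in
  \<open>(1/2, 1)\<close>, since \<open>K powr g\<close> increases with \<open>g\<close>.\<close>

lemma dominates_near_one:
  assumes "0 < a"
  shows "\<exists>K\<ge>2. \<forall>\<^sub>F g in at_left 1. dominates K (cost_fun g a)"
proof -
  let ?m = "min 1 a" and ?A = "max 1 a"
  have mA: "0 < ?m" "0 < ?A" using assms by auto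
  have "filterlim (\<lambda>K. ?m * K powr (1/2)) at_top at_top" using mA by real_asymp
  then have "\<forall>\<^sub>F K in at_top. ?A < ?m * K powr (1/2)" unfolding filterlim_at_top_dense by blast
  then have "\<forall>\<^sub>F K in at_top. ?A < ?m * K powr (1/2) \<and> 2 \<le> K"
    using eventually_ge_at_top[of "2::real"] by (rule eventually_conj)
  then obtain K where K: "?A < ?m * K powr (1/2)" "2 \<le> K"
    using eventually_happens'[OF trivial_limit_at_top_linorder] by blast
  have "\<forall>\<^sub>F g :: real in at_left 1. 1/2 < g" 
    using eventually_at_left_real[of "1/2" "1::real"] by (auto elim: eventually_mono)
  then have "\<forall>\<^sub>F g in at_left 1. dominates K (cost_fun g a)"
  proof eventually_elim
    case (elim g)
    have "K powr (1/2) \<le> K powr g" using K elim by (intro powr_mono) auto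
    then have "?m * K powr (1/2) \<le> ?m * K powr g" using mA by simp
    then have "?A < ?m * K powr g" using K(1) by linarith
    then show ?case using dominates_pos[of a g K] K elim assms by simp
  qed
  then show ?thesis using K by blast
qed

lemma quasi_cost_reflect: "quasi_cost K f \<Longrightarrow> quasi_cost K (\<lambda>z. f (- z))"
proof -
  assume H: "quasi_cost K f"
  have "dominates K (\<lambda>z. f (- z))" using H unfolding quasi_cost_def dominates_def
    by (metis abs_minus_cancel neg_equal_0_iff_equal)
  moreover have "f (- (2 * b + \<bar>w\<bar>)) + f (- w) < 2 * f (- b) \<and> f (- (- (2 * b + \<bar>w\<bar>))) + f (- w) < 2 * f (- (- b))"
    if "w \<noteq> 0" "K * \<bar>w\<bar> \<le> b" for b w
  proof -
    have "- w \<noteq> 0 \<and> K * \<bar>- w\<bar> \<le> b" using that by simp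
    then have "f (2 * b + \<bar>- w\<bar>) + f (- w) < 2 * f b \<and> f (- (2 * b + \<bar>- w\<bar>)) + f (- w) < 2 * f (- b)"
      using H unfolding quasi_cost_def by blast
    then show ?thesis unfolding abs_minus_cancel minus_minus by blast
  qed
  ultimately show ?thesis using H concave_cost_reflect[of f] unfolding quasi_cost_def by blast
qed

text \<open>Equal lengths are covered by \<open>quasi_cost\<close>. For unequal ones, concavity
  makes lengthening by the difference of \<open>A\<close> and \<open>B\<close> no more expensive on
  the long edge than on the shorter of the two.\<close>

lemma quasi_cost_long:
  assumes Q: "quasi_cost K f" and w: "w \<noteq> 0" "K * \<bar>w\<bar> \<le> A" "K * \<bar>w\<bar> \<le> B"
  shows "f (A + B + \<bar>w\<bar>) + f w < f A + f B"
  using w(2,3)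
proof (induction A B rule: linorder_wlog)
  case (sym a b)
  then show ?case by (simp add: algebra_simps)
next
  case (le b a)
  have "2 * \<bar>w\<bar> \<le> K * \<bar>w\<bar>" using Q unfolding quasi_cost_def by (intro mult_right_mono) auto
  then have b: "0 < b" using le w by (smt (verit) zero_less_abs_iff)
  have "f (b + (b + \<bar>w\<bar>) + (a - b)) + f b \<le> f (b + (b + \<bar>w\<bar>)) + f (b + (a - b))"
  proof (cases "a = b")
    case False
    then show ?thesis
      using concave_costD(3)[of f "b + \<bar>w\<bar>" b "a - b"] Q b le unfolding quasi_cost_def
      by (simp add: algebra_simps less_imp_le)
  qed simp
  moreover have "f (2 * b + \<bar>w\<bar>) + f w < 2 * f b"
    using Q w le unfolding quasi_cost_def by blast
  moreover have "b + (b + \<bar>w\<bar>) = 2 * b + \<bar>w\<bar>" "2 * b + \<bar>w\<bar> + (a - b) = b + a + \<bar>w\<bar>" by simp_all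
  ultimately show ?case by (simp add: algebra_simps)
qed

lemma quasi_cost_swap_aux:
  assumes Q: "quasi_cost K f" and ne: "x \<noteq> y" "xs \<noteq> ys" and far: "K * \<bar>x - y\<bar> \<le> \<bar>ys - x\<bar>" "K * \<bar>x - y\<bar> \<le> \<bar>xs - y\<bar>"
    and ys: "x < ys"
  shows "f (y - x) + f (ys - xs) < f (ys - x) + f (y - xs)"
proof -
  have c: "concave_cost f" and d: "dominates K f" and K: "2 \<le> K" using Q unfolding quasi_cost_def by auto
  define D where "D = \<bar>x - y\<bar>"
  have D: "x - y \<le> D" "y - x \<le> D" "0 < D" "\<bar>y - x\<bar> = D" using ne unfolding D_def by auto
  have "2 * D \<le> K * D" using K D by (intro mult_right_mono) auto
  then have far2: "2 * D \<le> ys - x" "2 * D \<le> \<bar>xs - y\<bar>" using far ys unfolding D_def by linarith+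
  have dm: "f (y - x) < f (ys - x)" "f (y - x) < f (y - xs)"
    using d far ne unfolding dominates_def by (auto simp: abs_minus_commute)
  have y: "y < ys" using far2 D by linarith
  show ?thesis
  proof (cases "y < xs")
    \<comment> \<open>The far ends lie on the same side, so the old edges have opposite directions
      and the new long edge is shorter than the old edge of its own direction. Domination compares
      the short edge with the other old edge.\<close>
    case True
    then have "2 * D \<le> xs - y" using far2(2) by linarith
    then have x: "x < xs" using D by linarith
    show ?thesis
    proof (cases "xs < ys")
      case True
      then have "f (ys - xs) < f (ys - x)" using x by (intro concave_costD(1)[OF c]) simp_all
      then show ?thesis using dm by linarith
    next
      case False
      then have "f (- (xs - ys)) < f (- (xs - y))"
        using ne y by (intro concave_costD(2)[OF c]) simp_all
      then show ?thesis using dm by simp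
    qed
  next
    \<comment> \<open>The far ends lie on opposite sides, so the new long edge spans at most the two
      old edges and the gap; this is where \<open>quasi_cost_long\<close> is used.\<close>
    case False
    then have xs: "2 * D \<le> y - xs" using far2(2) by linarith
    then have xs_y: "xs < y" using D(3) by linarith
    have "f (ys - xs) \<le> f (ys - x + (y - xs) + \<bar>y - x\<bar>)"
    proof (cases "ys - xs = ys - x + (y - xs) + \<bar>y - x\<bar>")
      case False
      have "ys - xs \<le> ys - x + (y - xs) + D" "0 < ys - xs" using xs y D by linarith+
      then have "f (ys - xs) < f (ys - x + (y - xs) + \<bar>y - x\<bar>)"
        using False unfolding D(4) by (intro concave_costD(1)[OF c]) simp_all
      then show ?thesis by simp
    qed simp
    moreover have "f (ys - x + (y - xs) + \<bar>y - x\<bar>) + f (y - x) < f (ys - x) + f (y - xs)"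
    proof (rule quasi_cost_long[OF Q])
      show "y - x \<noteq> 0" using ne by simp
      show "K * \<bar>y - x\<bar> \<le> ys - x" using far(1) ys unfolding D(4) D_def by simp
      show "K * \<bar>y - x\<bar> \<le> y - xs" using far(2) xs_y unfolding D(4) D_def by simp
    qed
    ultimately show ?thesis by linarith
  qed
qed

text \<open>Two edges that are both much longer than the distance of a red end \<open>x\<close> of the one to a blue
  end \<open>y\<close> of the other can be uncrossed with a gain.\<close>

lemma quasi_cost_swap:
  assumes Q: "quasi_cost K f" and ne: "x \<noteq> y" "xs \<noteq> ys" and far: "K * \<bar>x - y\<bar> \<le> \<bar>ys - x\<bar>" "K * \<bar>x - y\<bar> \<le> \<bar>xs - y\<bar>"
  shows "f (y - x) + f (ys - xs) < f (ys - x) + f (y - xs)"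
proof (cases "x < ys")
  case True
  then show ?thesis using quasi_cost_swap_aux[OF assms] by simp
next
  case False
  have "2 * \<bar>x - y\<bar> \<le> K * \<bar>x - y\<bar>" using Q unfolding quasi_cost_def by (intro mult_right_mono) auto
  moreover have "0 < 2 * \<bar>x - y\<bar>" using ne by simp
  ultimately have "0 < \<bar>ys - x\<bar>" using far(1) by linarith
  then have "x \<noteq> ys" by auto
  then have "- x < - ys" using False by simp
  then show ?thesis
    using quasi_cost_swap_aux[OF quasi_cost_reflect[OF Q], of "- x" "- y" "- xs" "- ys"] ne far
    by (simp add: abs_minus_commute)
qed

section \<open>Concave costs\<close>

context
  fixes F :: "real filter" and a :: real and R B :: "real set" and M :: "(real \<times> real) set" and G :: "real set"
  assumes lm: "locally_minimal F a R B M" and F: "F \<noteq> bot" and G: "\<forall>\<^sub>F g in F. g \<in> G"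
begin

lemma lm_matching: "matching R B M"
  using lm unfolding locally_minimal_def by blast

lemma lm_swap:
  assumes "(x, y) \<in> M" "(x', y') \<in> M" "x \<noteq> x'" "y \<noteq> y'"
  obtains g where "g \<in> G"
    "cost_fun g a (y - x) + cost_fun g a (y' - x') \<le> cost_fun g a (y' - x) + cost_fun g a (y - x')"
proof -
  have "{(x, y), (x', y')} \<subseteq> M" using assms by simp
  from locally_minimalD[OF lm F G this, of "{}"]
  obtain g where g: "g \<in> G" "locally_opt (cost_fun g a) R B {(x, y), (x', y')} {}" by auto
  show thesis
    using that[OF g(1)] locally_opt_swap[OF g(2)] assms matching_mem[OF lm_matching assms(1)]
      matching_mem[OF lm_matching assms(2)] by blast
qed

lemma lm_replace_red:
  assumes "(x, y) \<in> M" "u \<in> unmatched_red R M"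
  obtains g where "g \<in> G" "cost_fun g a (y - x) \<le> cost_fun g a (y - u)"
proof -
  have "{(x, y)} \<subseteq> M" "{u} \<subseteq> unmatched_red R M \<union> unmatched_blue B M" "u \<in> R"
    using assms unfolding unmatched_red_def by auto
  then obtain g where g: "g \<in> G" "locally_opt (cost_fun g a) R B {(x, y)} {u}"
    using locally_minimalD[OF lm F G, of "{(x, y)}" "{u}"] by auto
  show thesis
    using that[OF g(1)] locally_opt_replace_red[OF g(2)] \<open>u \<in> R\<close> matching_mem[OF lm_matching assms(1)] by blast
qed

lemma lm_replace_blue:
  assumes "(x, y) \<in> M" "u \<in> unmatched_blue B M"
  obtains g where "g \<in> G" "cost_fun g a (y - x) \<le> cost_fun g a (u - x)"
proof -
  have "{(x, y)} \<subseteq> M" "{u} \<subseteq> unmatched_red R M \<union> unmatched_blue B M" "u \<in> B"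
    using assms unfolding unmatched_blue_def by auto
  then obtain g where g: "g \<in> G" "locally_opt (cost_fun g a) R B {(x, y)} {u}"
    using locally_minimalD[OF lm F G, of "{(x, y)}" "{u}"] by auto
  show thesis
    using that[OF g(1)] locally_opt_replace_blue[OF g(2)] \<open>u \<in> B\<close> matching_mem[OF lm_matching assms(1)] by blast
qed

lemma lm_not_both:
  assumes "x \<in> unmatched_red R M" "y \<in> unmatched_blue B M"
  shows False
proof -
  have "{x, y} \<subseteq> unmatched_red R M \<union> unmatched_blue B M" "x \<in> R" "y \<in> B"
    using assms unfolding unmatched_red_def unmatched_blue_def by auto
  then obtain g where "locally_opt (cost_fun g a) R B {} {x, y}"
    using locally_minimalD[OF lm F G, of "{}" "{x, y}"] by auto
  then show False using locally_opt_not_both \<open>x \<in> R\<close> \<open>y \<in> B\<close> by blast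
qed

end

context
  fixes F :: "real filter" and a :: real and R B :: "real set" and M :: "(real \<times> real) set"
  assumes lm: "locally_minimal F a R B M" and F: "F \<noteq> bot" and lt1: "\<forall>\<^sub>F g in F. g \<in> {..<1}"
    and a: "0 < a" and disj: "R \<inter> B = {}"
begin

lemma concave_cost_lt1: "g \<in> {..<1} \<Longrightarrow> concave_cost (cost_fun g a)"
  using concave_cost_cost_fun a by simp

text \<open>The four \<open>not_crossing\<close> lemmas cover the ways in which two edges can cross.
  With equal directions, exchanging the blue ends turns the crossing pair into a nested one, which
  concavity prefers.\<close>

lemma not_crossing_right:
  assumes "(x, y) \<in> M" "(x', y') \<in> M" "x < x'" "x' < y" "y < y'"
  shows False
proof -
  have "x \<noteq> x'" "y \<noteq> y'" using assms by auto
  then obtain g where g: "g \<in> {..<1}"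
    "cost_fun g a (y - x) + cost_fun g a (y' - x') \<le> cost_fun g a (y' - x) + cost_fun g a (y - x')"
    using lm_swap[OF lm F lt1 assms(1,2)] by blast
  show False
    using concave_costD(3)[OF concave_cost_lt1[OF g(1)], of "x' - x" "y - x'" "y' - y"] g(2) assms by simp
qed

lemma not_crossing_left:
  assumes "(x, y) \<in> M" "(x', y') \<in> M" "y < y'" "y' < x" "x < x'"
  shows False
proof -
  have "x \<noteq> x'" "y \<noteq> y'" using assms by auto
  then obtain g where g: "g \<in> {..<1}"
    "cost_fun g a (y - x) + cost_fun g a (y' - x') \<le> cost_fun g a (y' - x) + cost_fun g a (y - x')"
    using lm_swap[OF lm F lt1 assms(1,2)] by blast
  show False
    using concave_costD(4)[OF concave_cost_lt1[OF g(1)], of "y' - y" "x - y'" "x' - x"] g(2) assms by simp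
qed

text \<open>With opposite directions the exchange leaves one edge in each direction and shortens
  both, so monotonicity decides.\<close>

lemma not_crossing_outward:
  assumes "(x, y) \<in> M" "(x', y') \<in> M" "x < y'" "y' < y" "y < x'"
  shows False
proof -
  have "x \<noteq> x'" "y \<noteq> y'" using assms by auto
  then obtain g where g: "g \<in> {..<1}"
    "cost_fun g a (y - x) + cost_fun g a (y' - x') \<le> cost_fun g a (y' - x) + cost_fun g a (y - x')"
    using lm_swap[OF lm F lt1 assms(1,2)] by blast
  show False
    using concave_costD(1)[OF concave_cost_lt1[OF g(1)], of "y' - x" "y - x"]
      concave_costD(2)[OF concave_cost_lt1[OF g(1)], of "x' - y" "x' - y'"] g(2) assms by simp
qed

lemma not_crossing_inward:
  assumes "(x, y) \<in> M" "(x', y') \<in> M" "y' < x" "x < x'" "x' < y"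
  shows False
proof -
  have "x \<noteq> x'" "y \<noteq> y'" using assms by auto
  then obtain g where g: "g \<in> {..<1}"
    "cost_fun g a (y - x) + cost_fun g a (y' - x') \<le> cost_fun g a (y' - x) + cost_fun g a (y - x')"
    using lm_swap[OF lm F lt1 assms(1,2)] by blast
  show False
    using concave_costD(1)[OF concave_cost_lt1[OF g(1)], of "y - x'" "y - x"]
      concave_costD(2)[OF concave_cost_lt1[OF g(1)], of "x - y'" "x' - y'"] g(2) assms by simp
qed

text \<open>An unmatched red point under an edge could take over its blue end, which gives a shorter
  edge of the same direction.\<close>

lemma inner_red_matched:
  assumes "(x, y) \<in> M" "p \<in> R" "min x y < p" "p < max x y"
  obtains q where "(p, q) \<in> M"
proof (rule ccontr)
  assume "\<not> thesis"
  then have "p \<in> unmatched_red R M" using assms(2) that unfolding unmatched_red_def by blast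
  then obtain g where g: "g \<in> {..<1}" "cost_fun g a (y - x) \<le> cost_fun g a (y - p)"
    using lm_replace_red[OF lm F lt1 assms(1)] by blast
  show False
  proof (cases "x < y")
    case True
    then show False
      using concave_costD(1)[OF concave_cost_lt1[OF g(1)], of "y - p" "y - x"] g(2) assms by simp
  next
    case False
    then show False
      using concave_costD(2)[OF concave_cost_lt1[OF g(1)], of "p - y" "x - y"] g(2) assms by simp
  qed
qed

lemma inner_blue_matched:
  assumes "(x, y) \<in> M" "p \<in> B" "min x y < p" "p < max x y"
  obtains q where "(q, p) \<in> M"
proof (rule ccontr)
  assume "\<not> thesis"
  then have "p \<in> unmatched_blue B M" using assms(2) that unfolding unmatched_blue_def by blast
  then obtain g where g: "g \<in> {..<1}" "cost_fun g a (y - x) \<le> cost_fun g a (p - x)"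
    using lm_replace_blue[OF lm F lt1 assms(1)] by blast
  show False
  proof (cases "x < y")
    case True
    then show False
      using concave_costD(1)[OF concave_cost_lt1[OF g(1)], of "p - x" "y - x"] g(2) assms by simp
  next
    case False
    then show False
      using concave_costD(2)[OF concave_cost_lt1[OF g(1)], of "x - p" "x - y"] g(2) assms by simp
  qed
qed

lemma concave_closed_edges: "closed_edges R B M"
  unfolding closed_edges_def
proof (intro allI impI conjI; elim conjE)
  note Mt = lm_matching[OF lm F lt1]
  fix x y p
  assume e: "(x, y) \<in> M" and p: "min x y < p" "p < max x y"
  have xy: "x \<in> R" "y \<in> B" using matching_mem[OF Mt e] by auto
  {
    assume pR: "p \<in> R"
    obtain q where q: "(p, q) \<in> M" using inner_red_matched[OF e pR p] .
    have qB: "q \<in> B" using matching_mem[OF Mt q] by blast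
    have "p \<noteq> x" using p by auto
    then have "q \<noteq> y" using matching_blue_unique[OF Mt q] e by blast
    moreover have "q \<noteq> x" using qB xy disj by blast
    ultimately consider "min x y < q" "q < max x y" | "x < y" "q < x" | "x < y" "y < q" | "y < x" "q < y" | "y < x" "x < q"
      using p by linarith
    then show "\<exists>q. (p, q) \<in> M \<and> min x y < q \<and> q < max x y"
    proof cases
      case 2
      then show ?thesis using not_crossing_inward[OF e q] p by simp
    next
      case 3
      then show ?thesis using not_crossing_right[OF e q] p by simp
    next
      case 4
      then show ?thesis using not_crossing_left[OF q e] p by simp
    next
      case 5
      then show ?thesis using not_crossing_inward[OF q e] p by simp
    qed (use q in blast)
  }
  {
    assume pB: "p \<in> B"
    obtain q where q: "(q, p) \<in> M" using inner_blue_matched[OF e pB p] .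
    have qR: "q \<in> R" using matching_mem[OF Mt q] by blast
    have "p \<noteq> y" using p by auto
    then have "q \<noteq> x" using matching_red_unique[OF Mt q] e by blast
    moreover have "q \<noteq> y" using qR xy disj by blast
    ultimately consider "min x y < q" "q < max x y" | "x < y" "q < x" | "x < y" "y < q" | "y < x" "q < y" | "y < x" "x < q"
      using p by linarith
    then show "\<exists>q. (q, p) \<in> M \<and> min x y < q \<and> q < max x y"
    proof cases
      case 2
      then show ?thesis using not_crossing_right[OF q e] p by simp
    next
      case 3
      then show ?thesis using not_crossing_outward[OF e q] p by simp
    next
      case 4
      then show ?thesis using not_crossing_outward[OF q e] p by simp
    next
      case 5
      then show ?thesis using not_crossing_left[OF e q] p by simp
    qed (use q in blast)
  }
qed

end

section \<open>Valleys are matched internally\<close>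

lemma low_antimono: "low R B K l t \<Longrightarrow> K' \<le> K \<Longrightarrow> low R B K' l t"
  unfolding low_def by (meson mult_right_mono order_trans less_imp_le)

lemma red_near_bound: "x \<in> red_near R B l t \<Longrightarrow> x \<in> R \<and> \<bar>x\<bar> \<le> t"
  unfolding red_near_def red_level_def by simp

lemma blue_near_bound: "x \<in> blue_near R B l t \<Longrightarrow> x \<in> B \<and> \<bar>x\<bar> \<le> t"
  unfolding blue_near_def blue_level_def by simp

lemma dominatesD: "dominates K f \<Longrightarrow> w \<noteq> 0 \<Longrightarrow> K * \<bar>w\<bar> \<le> \<bar>z\<bar> \<Longrightarrow> f w < f z"
  unfolding dominates_def by blast

text \<open>By \<open>bad_iff\<close> a failure yields a red \<open>x\<close> and a blue
  \<open>y\<close> in \<open>[-t, t]\<close>, both without a partner up to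
  \<open>(2 * K + 1) * t\<close>. They are at distance at most \<open>2 * t\<close>, while any
  partners are further than \<open>2 * K * t\<close> away. So matching \<open>x\<close> with
  \<open>y\<close> pays, whether both, one or neither of them is matched.\<close>

lemma quasi_closed:
  assumes lm: "locally_minimal (principal {g}) a R B M" and lf: "locally_finite R" "locally_finite B"
    and disj: "R \<inter> B = {}" and a: "0 < a" and g: "g < 1" and Q: "quasi_cost K (cost_fun g a)"
    and lo: "low R B (2 * K + 1) l t"
  shows "(\<forall>x\<in>red_near R B l t. \<exists>y\<in>blue_near R B l t. (x, y) \<in> M) \<and>
         (\<forall>y\<in>blue_near R B l t. \<exists>x\<in>red_near R B l t. (x, y) \<in> M)"
proof -
  let ?f = "cost_fun g a"
  have F: "principal {g} \<noteq> bot" by (simp add: principal_eq_bot_iff)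
  have ev: "\<forall>\<^sub>F g' in principal {g}. g' \<in> {g}" by (simp add: eventually_principal)
  have lt1: "\<forall>\<^sub>F g in principal {g}. g \<in> {..<1}" using g by (simp add: eventually_principal)
  note Mt = lm_matching[OF lm F ev]
  have cl: "closed_edges R B M" using concave_closed_edges[OF lm F lt1 a disj] .
  have K: "2 \<le> K" and dom: "dominates K ?f" using Q unfolding quasi_cost_def by auto
  have t: "0 < t" using lo unfolding low_def by blast
  interpret valley R B M l t "2 * K + 1"
    by unfold_locales (use lf disj Mt cl lo K in auto)
  have no: False
    if x: "x \<in> X" "\<not> (\<exists>y. (x, y) \<in> M \<and> \<bar>y\<bar> \<le> (2 * K + 1) * t)"
    and y: "y \<in> Y" "\<not> (\<exists>x. (x, y) \<in> M \<and> \<bar>x\<bar> \<le> (2 * K + 1) * t)" for x y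
  proof -
    have b: "x \<in> R" "\<bar>x\<bar> \<le> t" "y \<in> B" "\<bar>y\<bar> \<le> t" using x y red_near_bound blue_near_bound by blast+
    have ne: "x \<noteq> y" using b disj by blast
    have "\<bar>x - y\<bar> \<le> 2 * t" using b by linarith
    then have "K * \<bar>x - y\<bar> \<le> K * (2 * t)" using K by (intro mult_left_mono) auto
    then have Kd: "K * \<bar>x - y\<bar> \<le> 2 * K * t" by simp
    have far: "K * \<bar>x - y\<bar> \<le> \<bar>q - p\<bar>" if "\<bar>p\<bar> \<le> t" "\<not> \<bar>q\<bar> \<le> (2 * K + 1) * t" for p q
      using Kd that by (simp add: algebra_simps)
    have unX: "x \<in> unmatched_red R M" if "\<nexists>ys. (x, ys) \<in> M" using that b unfolding unmatched_red_def by blast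
    have unY: "y \<in> unmatched_blue B M" if "\<nexists>xs. (xs, y) \<in> M" using that b unfolding unmatched_blue_def by blast
    show False
    proof (cases "\<exists>ys. (x, ys) \<in> M")
      case True
      then obtain ys where ys: "(x, ys) \<in> M" by blast
      then have fy: "K * \<bar>x - y\<bar> \<le> \<bar>ys - x\<bar>" using far[of x ys] x b by blast
      show False
      proof (cases "\<exists>xs. (xs, y) \<in> M")
        case True
        then obtain xs where xs: "(xs, y) \<in> M" by blast
        then have fx: "K * \<bar>x - y\<bar> \<le> \<bar>xs - y\<bar>" using far[of y xs] y b by blast
        have tt: "\<bar>y\<bar> \<le> (2 * K + 1) * t" using b tK by linarith
        then have "y \<noteq> ys" using x ys by blast
        moreover from this have "x \<noteq> xs" using matching_red_unique[OF Mt] xs ys by blast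
        ultimately have "?f (ys - x) + ?f (y - xs) \<le> ?f (y - x) + ?f (ys - xs)"
          using lm_swap[OF lm F ev ys xs] by blast
        moreover have "xs \<noteq> ys" using matching_mem[OF Mt xs] matching_mem[OF Mt ys] disj by blast
        ultimately show False using quasi_cost_swap[OF Q ne, of xs ys] fx fy by linarith
      next
        case False
        then have "?f (ys - x) \<le> ?f (y - x)" using lm_replace_blue[OF lm F ev ys unY] by blast
        moreover have "?f (y - x) < ?f (ys - x)"
          using dom fy ne unfolding dominates_def by (simp add: abs_minus_commute)
        ultimately show False by linarith
      qed
    next
      case False
      show False
      proof (cases "\<exists>xs. (xs, y) \<in> M")
        case True
        then obtain xs where xs: "(xs, y) \<in> M" by blast
        then have fx: "K * \<bar>x - y\<bar> \<le> \<bar>xs - y\<bar>" using far[of y xs] y b by blast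
        have "?f (y - xs) \<le> ?f (y - x)" using lm_replace_red[OF lm F ev xs unX[OF False]] by blast
        moreover have "?f (y - x) < ?f (y - xs)"
          using dom fx ne unfolding dominates_def by (simp add: abs_minus_commute)
        ultimately show False by linarith
      next
        case F2: False
        show False using lm_not_both[OF lm F ev unX[OF False] unY[OF F2]] .
      qed
    qed
  qed
  have "\<forall>x\<in>X. \<exists>y. (x, y) \<in> M \<and> \<bar>y\<bar> \<le> (2 * K + 1) * t" using no bad_iff by blast
  moreover have "\<forall>y\<in>Y. \<exists>x. (x, y) \<in> M \<and> \<bar>x\<bar> \<le> (2 * K + 1) * t" using no bad_iff by blast
  ultimately show ?thesis using partner_X partner_Y by blast
qed

definition has_valleys :: "real set \<Rightarrow> real set \<Rightarrow> bool" where
  "has_valleys R B \<longleftrightarrow> (\<forall>K l T. \<exists>t\<ge>T. low R B K l t)"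

lemma has_valleys_red:
  assumes "has_valleys R B" "p \<in> R"
  obtains l t where "low R B K l t" "p \<in> red_near R B l t"
proof -
  obtain t where "t \<ge> \<bar>p\<bar>" "low R B K (walk R B p - 1) t" using assms unfolding has_valleys_def by blast
  then show thesis using that[of "walk R B p - 1" t] assms unfolding red_near_def red_level_def by simp
qed

lemma has_valleys_blue:
  assumes "has_valleys R B" "p \<in> B"
  obtains l t where "low R B K l t" "p \<in> blue_near R B l t"
proof -
  obtain t where "t \<ge> \<bar>p\<bar>" "low R B K (walk R B p) t" using assms unfolding has_valleys_def by blast
  then show thesis using that[of "walk R B p" t] assms unfolding blue_near_def blue_level_def by simp
qed

text \<open>Near exponent \<open>1\<close> only the domination constant is uniform, which suffices to match all points.\<close>

lemma concave_perfect:
  assumes lm: "locally_minimal F a R B M" and lf: "locally_finite R" "locally_finite B"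
    and F: "F \<noteq> bot" and disj: "R \<inter> B = {}" and a: "0 < a" and K: "1 \<le> K"
    and ev: "\<forall>\<^sub>F g in F. g \<in> {g. g < 1 \<and> dominates K (cost_fun g a)}" and V: "has_valleys R B"
  shows "unmatched_red R M = {}" "unmatched_blue B M = {}"
proof -
  have lt1: "\<forall>\<^sub>F g in F. g \<in> {..<1}" using ev by eventually_elim simp
  note Mt = lm_matching[OF lm F ev]
  have cl: "closed_edges R B M" using concave_closed_edges[OF lm F lt1 a disj] .
  have val: "valley R B M l t (2 * K + 1)" if "low R B (2 * K + 1) l t" for l t
    by unfold_locales (use lf disj Mt cl that K in auto)
  show R0: "unmatched_red R M = {}"
  proof (rule ccontr)
    assume "unmatched_red R M \<noteq> {}"
    then obtain x where x: "x \<in> unmatched_red R M" by blast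
    then have xR: "x \<in> R" "\<nexists>y. (x, y) \<in> M" unfolding unmatched_red_def by auto
    obtain l t where lo: "low R B (2 * K + 1) l t" and xX: "x \<in> red_near R B l t"
      using has_valleys_red[OF V xR(1)] .
    interpret valley R B M l t "2 * K + 1" by (rule val[OF lo])
    obtain y where y: "y \<in> Y" "\<not> (\<exists>x. (x, y) \<in> M \<and> \<bar>x\<bar> \<le> (2 * K + 1) * t)"
      using bad_iff xX xR(2) by blast
    have yB: "y \<in> B" "\<bar>y\<bar> \<le> t" using y blue_near_bound by blast+
    \<comment> \<open>\<open>x\<close> and \<open>y\<close> cannot both be unmatched. The partner of
      \<open>y\<close> is far away, so replacing it by \<open>x\<close> pays by domination
      alone.\<close>
    have "\<exists>xs. (xs, y) \<in> M"
      using lm_not_both[OF lm F ev x, of y] yB unfolding unmatched_blue_def by blast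
    then obtain xs where xs: "(xs, y) \<in> M" by blast
    obtain g where g: "dominates K (cost_fun g a)" "cost_fun g a (y - xs) \<le> cost_fun g a (y - x)"
      using lm_replace_red[OF lm F ev xs x] by blast
    have "x \<noteq> y" "\<bar>x\<bar> \<le> t" using xR yB disj red_near_bound[OF xX] by auto
    have "\<not> \<bar>xs\<bar> \<le> (2 * K + 1) * t" using y xs by blast
    have "K * \<bar>y - x\<bar> \<le> \<bar>y - xs\<bar>"
    proof -
      have "\<bar>y - x\<bar> \<le> 2 * t" using yB \<open>\<bar>x\<bar> \<le> t\<close> by linarith
      then have "K * \<bar>y - x\<bar> \<le> K * (2 * t)" using K by (intro mult_left_mono) auto
      then show ?thesis using yB \<open>\<not> \<bar>xs\<bar> \<le> (2 * K + 1) * t\<close> by (simp add: algebra_simps)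
    qed
    then show False using dominatesD[OF g(1), of "y - x" "y - xs"] g(2) \<open>x \<noteq> y\<close> by simp
  qed
  show "unmatched_blue B M = {}"
  proof (rule ccontr)
    assume "unmatched_blue B M \<noteq> {}"
    then obtain y where y: "y \<in> unmatched_blue B M" by blast
    then have yB: "y \<in> B" "\<nexists>x. (x, y) \<in> M" unfolding unmatched_blue_def by auto
    obtain l t where lo: "low R B (2 * K + 1) l t" and yY: "y \<in> blue_near R B l t"
      using has_valleys_blue[OF V yB(1)] .
    interpret valley R B M l t "2 * K + 1" by (rule val[OF lo])
    obtain x where x: "x \<in> X" "\<not> (\<exists>y. (x, y) \<in> M \<and> \<bar>y\<bar> \<le> (2 * K + 1) * t)"
      using bad_iff yY yB(2) by blast
    have xR: "x \<in> R" "\<bar>x\<bar> \<le> t" using x red_near_bound by blast+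
    have "\<exists>ys. (x, ys) \<in> M" using R0 xR unfolding unmatched_red_def by blast
    then obtain ys where ys: "(x, ys) \<in> M" by blast
    obtain g where g: "dominates K (cost_fun g a)" "cost_fun g a (ys - x) \<le> cost_fun g a (y - x)"
      using lm_replace_blue[OF lm F ev ys y] by blast
    have "x \<noteq> y" "\<bar>y\<bar> \<le> t" using xR yB disj blue_near_bound[OF yY] by auto
    have "\<not> \<bar>ys\<bar> \<le> (2 * K + 1) * t" using x ys by blast
    have "K * \<bar>y - x\<bar> \<le> \<bar>ys - x\<bar>"
    proof -
      have "\<bar>y - x\<bar> \<le> 2 * t" using xR \<open>\<bar>y\<bar> \<le> t\<close> by linarith
      then have "K * \<bar>y - x\<bar> \<le> K * (2 * t)" using K by (intro mult_left_mono) auto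
      then show ?thesis using xR \<open>\<not> \<bar>ys\<bar> \<le> (2 * K + 1) * t\<close> by (simp add: algebra_simps)
    qed
    then show False using dominatesD[OF g(1), of "y - x" "ys - x"] g(2) \<open>x \<noteq> y\<close> by simp
  qed
qed

section \<open>Existence and uniqueness for concave costs\<close>

lemma finite_locally_minimal_exists:
  assumes fin: "finite R" "finite B" and disj: "R \<inter> B = {}"
  shows "\<exists>M. locally_minimal (principal {g}) a R B M"
proof -
  let ?A = "{M. matching R B M}"
  let ?f = "cost_fun g a"
  have "?A \<subseteq> Pow (R \<times> B)" using matching_subset by (intro subsetI) simp
  then have fA: "finite ?A" using fin by (meson finite_Pow_iff finite_SigmaI finite_subset)
  have "matching R B {}" unfolding matching_def by simp
  then have neA: "?A \<noteq> {}" by blast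
  define k where "k = Max (card ` ?A)"
  have k: "card M \<le> k" if "matching R B M" for M unfolding k_def using fA that by simp
  have "k \<in> card ` ?A" unfolding k_def using fA neA by (intro Max_in) auto
  then have neA': "{M \<in> ?A. card M = k} \<noteq> {}" by auto
  define M where "M = arg_min_on (cost ?f) {M \<in> ?A. card M = k}"
  have M: "matching R B M" "card M = k"
    using arg_min_if_finite(1)[of "{M \<in> ?A. card M = k}" "cost ?f"] fA neA' unfolding M_def by auto
  have M': "cost ?f M \<le> cost ?f M'" if "matching R B M'" "card M' = k" for M'
    unfolding M_def using fA that neA' by (intro arg_min_least) auto
  define V where "V = unmatched_red R M \<union> unmatched_blue B M"
  have v: "R \<inter> (fst ` M \<union> V) = R" "B \<inter> (snd ` M \<union> V) = B"
    unfolding V_def unmatched_red_def unmatched_blue_def by force+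
  have opt: "locally_opt ?f R B M V" unfolding locally_opt_def v using k M M' by auto
  have finM: "finite M" using matching_finite[OF M(1) fin] .
  have "locally_opt ?f R B E U" if "E \<subseteq> M" "U \<subseteq> V" for E U
    using locally_opt_subset[OF opt disj M(1) finM _ that] unfolding V_def by blast
  then have "locally_minimal (principal {g}) a R B M"
    unfolding locally_minimal_def V_def[symmetric] using M(1) by (simp add: eventually_principal)
  then show ?thesis ..
qed

lemma locally_minimal_principalD:
  assumes "locally_minimal (principal {g}) a R B M" "E \<subseteq> M" "finite E"
  shows "locally_opt (cost_fun g a) R B E {}"
  using assms(1)[unfolded locally_minimal_def, THEN conjunct2, rule_format, of E "{}"] assms(2,3)
  by (simp add: eventually_principal)

text \<open>\<open>N\<close> and \<open>N'\<close> may be minimal for different parts of the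
  configuration, such as two windows. If both match \<open>X\<close> with \<open>Y\<close>, each of
  the two pieces competes with the other, so their costs agree and the absence of ties
  applies.\<close>

lemma closed_part_unique:
  assumes nt: "no_ties (cost_fun g a) R B"
    and N: "locally_minimal (principal {g}) a R1 B1 N" and N': "locally_minimal (principal {g}) a R2 B2 N'"
    and sub: "R1 \<subseteq> R" "B1 \<subseteq> B" "R2 \<subseteq> R" "B2 \<subseteq> B" and fin: "finite X" "finite Y"
    and c: "(\<forall>x\<in>X. \<exists>y\<in>Y. (x, y) \<in> N) \<and> (\<forall>y\<in>Y. \<exists>x\<in>X. (x, y) \<in> N)"
    and c': "(\<forall>x\<in>X. \<exists>y\<in>Y. (x, y) \<in> N') \<and> (\<forall>y\<in>Y. \<exists>x\<in>X. (x, y) \<in> N')"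
  shows "N \<inter> X \<times> Y = N' \<inter> X \<times> Y"
proof -
  let ?f = "cost_fun g a" and ?E = "N \<inter> X \<times> Y" and ?E' = "N' \<inter> X \<times> Y"
  have m: "matching R1 B1 N" "matching R2 B2 N'" using N N' unfolding locally_minimal_def by auto
  have mE: "matching R1 B1 ?E" "matching R2 B2 ?E'"
    using matching_sub[OF m(1) Int_lower1] matching_sub[OF m(2) Int_lower1] .
  have v0: "fst ` (K \<inter> X \<times> Y) = X \<and> snd ` (K \<inter> X \<times> Y) = Y"
    if K: "(\<forall>x\<in>X. \<exists>y\<in>Y. (x, y) \<in> K) \<and> (\<forall>y\<in>Y. \<exists>x\<in>X. (x, y) \<in> K)" for K
  proof -
    have "X \<subseteq> fst ` (K \<inter> X \<times> Y)"
    proof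
      fix x assume "x \<in> X"
      then obtain y where "y \<in> Y" "(x, y) \<in> K" using K by blast
      then show "x \<in> fst ` (K \<inter> X \<times> Y)" using \<open>x \<in> X\<close> by (intro image_eqI[of _ _ "(x, y)"]) auto
    qed
    moreover have "Y \<subseteq> snd ` (K \<inter> X \<times> Y)"
    proof
      fix y assume "y \<in> Y"
      then obtain x where "x \<in> X" "(x, y) \<in> K" using K by blast
      then show "y \<in> snd ` (K \<inter> X \<times> Y)" using \<open>y \<in> Y\<close> by (intro image_eqI[of _ _ "(x, y)"]) auto
    qed
    ultimately show ?thesis by auto
  qed
  have v: "fst ` ?E = X" "snd ` ?E = Y" "fst ` ?E' = X" "snd ` ?E' = Y" using v0[OF c] v0[OF c'] by auto
  have fE: "finite ?E" "finite ?E'" using fin by auto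
  have cd: "card ?E = card X" "card ?E' = card X"
    using card_image[OF matching_inj_fst[OF mE(1)]] card_image[OF matching_inj_fst[OF mE(2)]] v by auto
  have o: "locally_opt ?f R1 B1 ?E {}" "locally_opt ?f R2 B2 ?E' {}"
    using locally_minimal_principalD[OF N Int_lower1 fE(1)] locally_minimal_principalD[OF N' Int_lower1 fE(2)] .
  have "cost ?f ?E \<le> cost ?f ?E'"
    using o(1) matching_own[OF mE(2)] cd unfolding locally_opt_empty[OF matching_subset[OF mE(1)]] v by simp
  moreover have "cost ?f ?E' \<le> cost ?f ?E"
    using o(2) matching_own[OF mE(1)] cd unfolding locally_opt_empty[OF matching_subset[OF mE(2)]] v by simp
  moreover have "matching R B ?E" "matching R B ?E'"
    using matching_mono[OF mE(1) sub(1,2)] matching_mono[OF mE(2) sub(3,4)] .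
  ultimately show ?thesis
    using nt[unfolded no_ties_def, rule_format, of ?E ?E'] fE unfolding v by simp
qed

text \<open>The walk is read from 0, so cutting the configuration to a window does not change it
  inside the window.\<close>

lemma window_walk:
  assumes "\<bar>s\<bar> \<le> T"
  shows "walk (R \<inter> {- T..T}) (B \<inter> {- T..T}) s = walk R B s"
proof -
  have "A \<inter> {- T..T} \<inter> {0<..s} = A \<inter> {0<..s}" "A \<inter> {- T..T} \<inter> {s<..0} = A \<inter> {s<..0}" for A
    using assms by auto
  then show ?thesis unfolding walk_def cnt_def by simp
qed

lemma window_near:
  assumes "t \<le> T"
  shows "red_near (R \<inter> {- T..T}) (B \<inter> {- T..T}) l t = red_near R B l t"
    "blue_near (R \<inter> {- T..T}) (B \<inter> {- T..T}) l t = blue_near R B l t"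
proof -
  have "p \<in> red_near (R \<inter> {- T..T}) (B \<inter> {- T..T}) l t \<longleftrightarrow> p \<in> red_near R B l t"
    "p \<in> blue_near (R \<inter> {- T..T}) (B \<inter> {- T..T}) l t \<longleftrightarrow> p \<in> blue_near R B l t" for p
    using assms window_walk[of p T R B] unfolding red_near_def blue_near_def red_level_def blue_level_def
    by (auto simp: abs_le_iff)
  then show "red_near (R \<inter> {- T..T}) (B \<inter> {- T..T}) l t = red_near R B l t"
    "blue_near (R \<inter> {- T..T}) (B \<inter> {- T..T}) l t = blue_near R B l t" by blast+
qed

lemma window_low: "K * t \<le> T \<Longrightarrow> low R B K l t \<Longrightarrow> low (R \<inter> {- T..T}) (B \<inter> {- T..T}) K l t"
  unfolding low_def using window_walk[of _ T R B] by fastforce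

lemma near_finite:
  assumes "locally_finite R" "locally_finite B"
  shows "finite (red_near R B l t)" "finite (blue_near R B l t)"
proof -
  have "red_near R B l t \<subseteq> R \<inter> {- t - 1<..t}" "blue_near R B l t \<subseteq> B \<inter> {- t - 1<..t}"
    unfolding red_near_def blue_near_def red_level_def blue_level_def by auto
  then show "finite (red_near R B l t)" "finite (blue_near R B l t)"
    using finite_subset[OF _ locally_finite_Ioc[OF assms(1)]] finite_subset[OF _ locally_finite_Ioc[OF assms(2)]] by blast+
qed

text \<open>The window matchings match every valley that fits into the window internally, so on it
  they agree for all large \<open>n\<close>, and the eventual edges form a limit. Each point lies in
  a valley of its own level, hence the limit leaves no point over, and every minimal matching agrees
  with it on all valleys.\<close>

theorem concave_unique:
  assumes lf: "locally_finite R" "locally_finite B" and disj: "R \<inter> B = {}" and a: "0 < a" and g: "g < 1"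
    and V: "has_valleys R B" and nt: "no_ties (cost_fun g a) R B"
  shows "\<exists>!M. locally_minimal (principal {g}) a R B M"
proof -
  obtain K0 where Q: "quasi_cost K0 (cost_fun g a)" using quasi_cost_exists a g by blast
  have K02: "2 \<le> K0" using Q unfolding quasi_cost_def by blast
  define K where "K = 2 * K0 + 1"
  let ?W = "\<lambda>A n. A \<inter> {- real n..real n}"
  have finW: "finite (?W R n)" "finite (?W B n)" for n
    using lf[THEN locally_finite_def[THEN iffD1], rule_format, OF bounded_closed_interval] .
  have lfW: "locally_finite (?W R n)" "locally_finite (?W B n)" for n
    using locally_finite_subset[OF lf(1) Int_lower1] locally_finite_subset[OF lf(2) Int_lower1] .
  have disjW: "?W R n \<inter> ?W B n = {}" for n using disj by blast
  define Mn where "Mn n = (SOME M. locally_minimal (principal {g}) a (?W R n) (?W B n) M)" for n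
  have Mn: "locally_minimal (principal {g}) a (?W R n) (?W B n) (Mn n)" for n
    unfolding Mn_def using someI_ex[OF finite_locally_minimal_exists[OF finW disjW]] .
  have mMn: "matching (?W R n) (?W B n) (Mn n)" for n using Mn unfolding locally_minimal_def by blast
  let ?X = "\<lambda>l t. red_near R B l t" and ?Y = "\<lambda>l t. blue_near R B l t"
  let ?cl = "\<lambda>N l t. (\<forall>x\<in>?X l t. \<exists>y\<in>?Y l t. (x, y) \<in> N) \<and> (\<forall>y\<in>?Y l t. \<exists>x\<in>?X l t. (x, y) \<in> N)"
  have cln: "?cl (Mn n) l t" if lo: "low R B K l t" and n: "K * t \<le> real n" for l t n
  proof -
    have t: "0 < t" using lo unfolding low_def by blast
    then have "1 * t \<le> K * t" using K02 unfolding K_def by (intro mult_right_mono) auto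
    then have tn: "t \<le> real n" using n by simp
    show ?thesis
      using quasi_closed[OF Mn lfW disjW a g Q, of n l t] window_low[OF n lo]
      unfolding window_near[OF tn] K_def by blast
  qed
  have stab: "N \<inter> ?X l t \<times> ?Y l t = Mn n \<inter> ?X l t \<times> ?Y l t"
    if "locally_minimal (principal {g}) a R1 B1 N" "R1 \<subseteq> R" "B1 \<subseteq> B" "?cl N l t" "low R B K l t" "K * t \<le> real n"
    for N R1 B1 l t n
    by (rule closed_part_unique[OF nt that(1) Mn that(2,3) _ _ near_finite[OF lf] that(4) cln[OF that(5,6)]]) auto
  define M where "M = {e. \<forall>\<^sub>F n in sequentially. e \<in> Mn n}"
  have memM: "e \<in> M" if "e \<in> Mn n" "e \<in> ?X l t \<times> ?Y l t" "low R B K l t" "K * t \<le> real n" for e n l t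
  proof -
    have "e \<in> Mn m" if "m \<ge> n" for m
    proof -
      have m: "K * t \<le> real m" using that \<open>K * t \<le> real n\<close> by linarith
      have "Mn n \<inter> ?X l t \<times> ?Y l t = Mn m \<inter> ?X l t \<times> ?Y l t"
        by (rule stab[OF Mn _ _ cln]) (use that m \<open>low R B K l t\<close> \<open>K * t \<le> real n\<close> in auto)
      then show ?thesis using \<open>e \<in> Mn n\<close> \<open>e \<in> ?X l t \<times> ?Y l t\<close> by blast
    qed
    then show ?thesis unfolding M_def eventually_sequentially by blast
  qed
  \<comment> \<open>A finite part of the limit lies in a single window matching and inherits local
    optimality from it; the set \<open>U\<close> will be empty because no point is left
    over.\<close>
  have common: "\<exists>n. E \<subseteq> Mn n" if "E \<subseteq> M" "finite E" for E
  proof -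
    have "\<forall>\<^sub>F n in sequentially. \<forall>e\<in>E. e \<in> Mn n"
      using that unfolding M_def by (intro eventually_ball_finite) auto
    then show ?thesis using eventually_happens'[OF sequentially_bot] by blast
  qed
  have Mt: "matching R B M"
  proof -
    have "x \<in> R \<and> y \<in> B" if "(x, y) \<in> M" for x y
      using common[of "{(x, y)}"] that matching_mem[OF mMn] by blast
    moreover have "y = y'" if "(x, y) \<in> M" "(x, y') \<in> M" for x y y'
      using common[of "{(x, y), (x, y')}"] that matching_red_unique[OF mMn] by blast
    moreover have "x = x'" if "(x, y) \<in> M" "(x', y) \<in> M" for x x' y
      using common[of "{(x, y), (x', y)}"] that matching_blue_unique[OF mMn] by blast
    ultimately show ?thesis by (rule matchingI)
  qed
  have perf: "\<exists>y. (x, y) \<in> M" if "x \<in> R" for x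
  proof -
    obtain l t where lo: "low R B K l t" and x: "x \<in> ?X l t" using has_valleys_red[OF V \<open>x \<in> R\<close>] .
    obtain n where n: "K * t \<le> real n" using real_arch_simple by blast
    obtain y where "y \<in> ?Y l t" "(x, y) \<in> Mn n" using cln[OF lo n] x by blast
    then show ?thesis using memM[OF _ _ lo n] x by blast
  qed
  have perf': "\<exists>x. (x, y) \<in> M" if "y \<in> B" for y
  proof -
    obtain l t where lo: "low R B K l t" and y: "y \<in> ?Y l t" using has_valleys_blue[OF V \<open>y \<in> B\<close>] .
    obtain n where n: "K * t \<le> real n" using real_arch_simple by blast
    obtain x where "x \<in> ?X l t" "(x, y) \<in> Mn n" using cln[OF lo n] y by blast
    then show ?thesis using memM[OF _ _ lo n] y by blast
  qed
  have un: "unmatched_red R M \<union> unmatched_blue B M = {}"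
    using perf perf' unfolding unmatched_red_def unmatched_blue_def by blast
  have "locally_opt (cost_fun g a) R B E {}" if E: "E \<subseteq> M" "finite E" for E
  proof -
    obtain n where n: "E \<subseteq> Mn n" using common[OF E] by blast
    have "locally_opt (cost_fun g a) (?W R n) (?W B n) E {}"
      using locally_minimal_principalD[OF Mn n E(2)] .
    moreover have "E \<subseteq> ?W R n \<times> ?W B n" using matching_subset[OF mMn] n by (rule order_trans[rotated])
    moreover have "E \<subseteq> R \<times> B" using E(1) matching_subset[OF Mt] by (rule order_trans)
    ultimately show ?thesis by (simp add: locally_opt_empty)
  qed
  then have lmM: "locally_minimal (principal {g}) a R B M"
    unfolding locally_minimal_def un using Mt by (simp add: eventually_principal)
  have sub: "N \<subseteq> N'" if N: "locally_minimal (principal {g}) a R B N" and N': "locally_minimal (principal {g}) a R B N'" for N N'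
  proof (rule subrelI)
    fix x y assume xy: "(x, y) \<in> N"
    have mN: "matching R B N" using N unfolding locally_minimal_def by blast
    have "x \<in> R" using matching_mem[OF mN xy] by blast
    then obtain l t where lo: "low R B K l t" and x: "x \<in> ?X l t" using has_valleys_red[OF V] by blast
    obtain n where n: "K * t \<le> real n" using real_arch_simple by blast
    have c: "?cl N l t" "?cl N' l t"
      using quasi_closed[OF N lf disj a g Q] quasi_closed[OF N' lf disj a g Q] lo unfolding K_def by blast+
    have eq: "N \<inter> ?X l t \<times> ?Y l t = N' \<inter> ?X l t \<times> ?Y l t"
      using stab[OF N order_refl order_refl c(1) lo n] stab[OF N' order_refl order_refl c(2) lo n] by blast
    obtain y' where "y' \<in> ?Y l t" "(x, y') \<in> N" using c(1) x by blast
    then have "y \<in> ?Y l t" using matching_red_unique[OF mN xy] by blast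
    then show "(x, y) \<in> N'" using eq xy x by blast
  qed
  show ?thesis
  proof (rule ex1I[of "locally_minimal (principal {g}) a R B" M])
    show "locally_minimal (principal {g}) a R B M" by (rule lmM)
    show "N = M" if "locally_minimal (principal {g}) a R B N" for N
      using sub[OF that lmM] sub[OF lmM that] by (rule equalityI)
  qed
qed

lemma component_subset:
  assumes "\<And>x y. (x, y) \<in> E \<Longrightarrow> x \<in> C \<longleftrightarrow> y \<in> C" "v \<in> C"
  shows "component E v \<subseteq> C"
proof
  fix w assume "w \<in> component E v"
  then have "(v, w) \<in> (E \<union> E\<inverse>)\<^sup>*" unfolding component_def by simp
  then show "w \<in> C" by (induction rule: rtrancl_induct) (use assms in blast)+
qed

text \<open>One ratio \<open>K\<close> serves both costs, so both matchings match the same finite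
  set internally, and a component of their union cannot leave it.\<close>

theorem concave_finite_difference:
  assumes lf: "locally_finite R" "locally_finite B" and disj: "R \<inter> B = {}" and g: "g < 1" and V: "has_valleys R B"
    and a: "0 < a" "0 < a'"
    and M: "locally_minimal (principal {g}) a R B M" and M': "locally_minimal (principal {g}) a' R B M'"
  shows "finite_difference R B M M'"
  unfolding finite_difference_def
proof
  fix v assume v: "v \<in> R \<union> B"
  obtain K1 K2 where Q: "quasi_cost K1 (cost_fun g a)" "quasi_cost K2 (cost_fun g a')"
    using quasi_cost_exists a g by meson
  define K where "K = 2 * max K1 K2 + 1"
  have K: "2 * K1 + 1 \<le> K" "2 * K2 + 1 \<le> K" unfolding K_def by auto
  obtain l t where lo: "low R B K l t" and vC: "v \<in> red_near R B l t \<union> blue_near R B l t"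
    using has_valleys_red[OF V, of v K] has_valleys_blue[OF V, of v K] v by blast
  let ?X = "red_near R B l t" and ?Y = "blue_near R B l t"
  have inv: "x \<in> ?X \<union> ?Y \<longleftrightarrow> y \<in> ?X \<union> ?Y"
    if N: "matching R B N" and c: "(\<forall>x\<in>?X. \<exists>y\<in>?Y. (x, y) \<in> N) \<and> (\<forall>y\<in>?Y. \<exists>x\<in>?X. (x, y) \<in> N)" and e: "(x, y) \<in> N" for N x y
  proof -
    have xy: "x \<in> R" "y \<in> B" using matching_mem[OF N e] by auto
    then have "x \<notin> ?Y" "y \<notin> ?X" using red_near_bound blue_near_bound disj by blast+
    moreover have "y \<in> ?Y" if "x \<in> ?X" using c that matching_red_unique[OF N e] by blast
    moreover have "x \<in> ?X" if "y \<in> ?Y" using c that matching_blue_unique[OF N e] by blast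
    ultimately show ?thesis by blast
  qed
  have mt: "matching R B M" "matching R B M'" using M M' unfolding locally_minimal_def by auto
  note c = quasi_closed[OF M lf disj a(1) g Q(1) low_antimono[OF lo K(1)]]
  note c' = quasi_closed[OF M' lf disj a(2) g Q(2) low_antimono[OF lo K(2)]]
  have "component (M \<union> M') v \<subseteq> ?X \<union> ?Y"
    by (rule component_subset[OF _ vC]) (use inv[OF mt(1) c] inv[OF mt(2) c'] in blast)
  then show "finite (component (M \<union> M') v)"
    using near_finite[OF lf] finite_subset by blast
qed

section \<open>Convex costs\<close>

definition convex_slope :: "real \<Rightarrow> real \<Rightarrow> real \<Rightarrow> real" where
  "convex_slope g a z = (if z < 0 then - (a * g * \<bar>z\<bar> powr (g - 1)) else g * z powr (g - 1))"

text \<open>Above exponent 1 the slopes of both branches vanish at 0, so the cost is differentiable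
  across the change of direction, and mean value arguments may pass through 0.\<close>

lemma convex_cost_deriv:
  assumes "1 < g" "0 < a"
  shows "(cost_fun g a has_real_derivative convex_slope g a z) (at z)"
proof -
  consider "0 < z" | "z < 0" | "z = 0" by linarith
  then show ?thesis
  proof cases
    case 1
    have "((\<lambda>z. z powr g) has_real_derivative convex_slope g a z) (at z)"
      using 1 unfolding convex_slope_def by (auto intro!: derivative_eq_intros)
    then show ?thesis
      by (rule has_field_derivative_transform_within_open[of _ _ _ "{0<..}"])
        (use 1 assms in \<open>auto simp: cost_fun_def\<close>)
  next
    case 2
    have "((\<lambda>z. a * (- z) powr g) has_real_derivative convex_slope g a z) (at z)"
      using 2 unfolding convex_slope_def by (auto intro!: derivative_eq_intros)
    then show ?thesis
      by (rule has_field_derivative_transform_within_open[of _ _ _ "{..<0}"])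
        (use 2 assms in \<open>auto simp: cost_fun_def\<close>)
  next
    case 3
    have lim: "((\<lambda>h. max 1 a * \<bar>h\<bar> powr (g - 1)) \<longlongrightarrow> 0) (at 0)"
    proof (rule tendsto_mult_right_zero)
      have "((\<lambda>h::real. \<bar>h\<bar>) \<longlongrightarrow> 0) (at 0)" by (rule tendsto_rabs_zero) (rule tendsto_ident_at)
      then show "((\<lambda>h::real. \<bar>h\<bar> powr (g - 1)) \<longlongrightarrow> 0) (at 0)"
        by (rule tendsto_zero_powrI[OF _ tendsto_const]) (use assms in auto)
    qed
    have bd: "norm ((cost_fun g a (0 + h) - cost_fun g a 0) / h) \<le> max 1 a * \<bar>h\<bar> powr (g - 1)" if "h \<noteq> 0" for h
    proof -
      have "0 \<le> cost_fun g a h" "cost_fun g a h \<le> max 1 a * \<bar>h\<bar> powr g"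
        using cost_fun_bounds(1)[OF assms(2) that, of g] assms by (auto intro: order_trans[rotated])
      then have "\<bar>cost_fun g a h\<bar> / \<bar>h\<bar> \<le> max 1 a * \<bar>h\<bar> powr g / \<bar>h\<bar>"
        by (intro divide_right_mono) auto
      also have "\<bar>h\<bar> powr g / \<bar>h\<bar> = \<bar>h\<bar> powr (g - 1)" using that by (simp add: powr_diff)
      then have "max 1 a * \<bar>h\<bar> powr g / \<bar>h\<bar> = max 1 a * \<bar>h\<bar> powr (g - 1)" by (metis times_divide_eq_right)
      finally show ?thesis using assms unfolding cost_fun_def[of g a 0] by simp
    qed
    have ev: "\<forall>\<^sub>F h in at 0. norm ((cost_fun g a (0 + h) - cost_fun g a 0) / h) \<le> max 1 a * \<bar>h\<bar> powr (g - 1)"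
      unfolding eventually_at_filter by (intro always_eventually allI impI bd)
    have "((\<lambda>h. (cost_fun g a (0 + h) - cost_fun g a 0) / h) \<longlongrightarrow> 0) (at 0)"
      by (rule Lim_null_comparison[OF ev lim])
    then show ?thesis using 3 unfolding DERIV_def convex_slope_def by simp
  qed
qed

lemma convex_slope_strict_mono:
  assumes "1 < g" "0 < a" "u < v"
  shows "convex_slope g a u < convex_slope g a v"
proof -
  consider "0 \<le> u" | "u < 0" "0 \<le> v" | "v < 0" by linarith
  then show ?thesis
  proof cases
    case 1
    then have "u powr (g - 1) < v powr (g - 1)" using assms by (intro powr_less_mono2) auto
    then show ?thesis using assms 1 unfolding convex_slope_def by auto
  next
    case 2
    have "0 < a * g * \<bar>u\<bar> powr (g - 1)" using assms 2 by simp
    moreover have "0 \<le> g * v powr (g - 1)" using assms by simp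
    ultimately have "- (a * g * \<bar>u\<bar> powr (g - 1)) < g * v powr (g - 1)" by linarith
    then show ?thesis using 2 unfolding convex_slope_def by simp
  next
    case 3
    then have "(- v) powr (g - 1) < (- u) powr (g - 1)" using assms by (intro powr_less_mono2) auto
    then have "a * g * (- v) powr (g - 1) < a * g * (- u) powr (g - 1)" using assms by (intro mult_strict_left_mono) auto
    then show ?thesis using assms 3 unfolding convex_slope_def by simp
  qed
qed

text \<open>The slope is strictly increasing, so
  \<open>cost_fun g a (y' - s) - cost_fun g a (y - s)\<close> strictly decreases in
  \<open>s\<close>.\<close>

lemma convex_exchange:
  assumes "1 < g" "0 < a" "x < x'" "y < y'"
  shows "cost_fun g a (y - x) + cost_fun g a (y' - x') < cost_fun g a (y' - x) + cost_fun g a (y - x')"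
proof -
  let ?f = "cost_fun g a"
  have "?f (y' - x) - ?f (y - x) > ?f (y' - x') - ?f (y - x')"
  proof (rule DERIV_neg_imp_decreasing[OF assms(3), of "\<lambda>s. ?f (y' - s) - ?f (y - s)"])
    fix s
    have d: "((\<lambda>s. ?f (q - s)) has_real_derivative convex_slope g a (q - s) * (- 1)) (at s)" for q
      by (rule DERIV_chain2[of ?f, OF convex_cost_deriv]) (use assms in \<open>auto intro!: derivative_eq_intros\<close>)
    have "((\<lambda>s. ?f (y' - s) - ?f (y - s)) has_real_derivative
        convex_slope g a (y' - s) * (- 1) - convex_slope g a (y - s) * (- 1)) (at s)"
      using DERIV_diff[OF d[of y'] d[of y]] .
    moreover have "convex_slope g a (y' - s) * (- 1) - convex_slope g a (y - s) * (- 1) < 0"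
      using convex_slope_strict_mono[OF assms(1,2), of "y - s" "y' - s"] assms(4) by simp
    ultimately show "\<exists>d. ((\<lambda>s. ?f (y' - s) - ?f (y - s)) has_real_derivative d) (at s) \<and> d < 0" by blast
  qed
  then show ?thesis by linarith
qed

lemma convex_cost_increment:
  assumes "1 < g" "0 < a" "0 \<le> d" "z \<le> H"
  shows "cost_fun g a z - cost_fun g a (z - d) \<le> convex_slope g a H * d"
proof (cases "d = 0")
  case False
  then have "z - d < z" using assms by simp
  then obtain w where w: "z - d < w" "w < z"
    "cost_fun g a z - cost_fun g a (z - d) = (z - (z - d)) * convex_slope g a w"
    using MVT2[OF \<open>z - d < z\<close> convex_cost_deriv[OF assms(1,2)]] by blast
  have "convex_slope g a w \<le> convex_slope g a H"
    using convex_slope_strict_mono[OF assms(1,2), of w H] w assms by simp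
  then have "d * convex_slope g a w \<le> d * convex_slope g a H" using assms by (intro mult_left_mono)
  then show ?thesis using w by (simp add: mult.commute)
qed simp

context
  fixes F :: "real filter" and a :: real and R B :: "real set" and M :: "(real \<times> real) set"
  assumes lm: "locally_minimal F a R B M" and F: "F \<noteq> bot" and gt1: "\<forall>\<^sub>F g in F. g \<in> {1<..}"
    and a: "0 < a" and disj: "R \<inter> B = {}"
begin

lemma convex_monotone:
  assumes "(x, y) \<in> M" "(x', y') \<in> M" "x < x'"
  shows "y < y'"
proof (rule ccontr)
  assume "\<not> y < y'"
  moreover have "y \<noteq> y'" using matching_blue_unique[OF lm_matching[OF lm F gt1] assms(1)] assms by force
  ultimately have lt: "y' < y" by simp
  obtain g where g: "g \<in> {1<..}"
    "cost_fun g a (y - x) + cost_fun g a (y' - x') \<le> cost_fun g a (y' - x) + cost_fun g a (y - x')"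
    using lm_swap[OF lm F gt1 assms(1,2)] assms(3) \<open>y \<noteq> y'\<close> by blast
  then show False using convex_exchange[of g a x x' y' y] lt a assms by simp
qed

lemma unmatched_red_not_inside:
  assumes "(x, y) \<in> M" "u \<in> unmatched_red R M"
  shows "\<not> (x < u \<and> u < y)" "\<not> (y < u \<and> u < x)"
proof -
  obtain g where g: "g \<in> {1<..}" "cost_fun g a (y - x) \<le> cost_fun g a (y - u)"
    using lm_replace_red[OF lm F gt1 assms] by blast
  obtain k k' where k: "power_slope k (g - 1) (cost_fun g a)" "power_slope k' (g - 1) (\<lambda>z. cost_fun g a (- z))"
    using power_slope_cost_pos power_slope_cost_neg a by meson
  show "\<not> (x < u \<and> u < y)" using power_slope_mono[OF k(1), of "y - u" "y - x"] g(2) by auto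
  show "\<not> (y < u \<and> u < x)" using power_slope_mono[OF k(2), of "u - y" "x - y"] g(2) by auto
qed

end

text \<open>Deterministic input for shifting a chain that starts at \<open>x\<close>. The two count
  conditions keep a blue point of the chain at most \<open>H\<close> to the right of the red point
  with the same index, and at least \<open>H\<close> to its left once that red point is beyond
  \<open>t1 + H\<close>. The red point in \<open>(t1 + H, t1 + 2 * H]\<close> prevents the chain
  from jumping across the change of regime. The ratio \<open>K\<close> will be
  \<open>1 / a\<close>.\<close>

definition good_right :: "real set \<Rightarrow> real set \<Rightarrow> bool" where
  "good_right R B \<longleftrightarrow> (\<forall>x K. \<exists>H t1 t2. 0 < H \<and> x \<le> t1 \<and> t1 + 2 * H \<le> t2 \<and>
      K * (t1 + 2 * H - x) < t2 - (t1 + 2 * H) \<and>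
      (\<forall>u. x \<le> u \<and> u \<le> t2 \<longrightarrow> cnt R x u < cnt B x (u + H)) \<and>
      (\<forall>u. t1 \<le> u \<and> u \<le> t2 \<longrightarrow> cnt R x (u + H) + 1 < cnt B x u) \<and>
      R \<inter> {t1 + H<..t1 + 2 * H} \<noteq> {})"

lemma cnt_ge:
  assumes "locally_finite A" "inj_on h {..<n}" "\<And>i. i < n \<Longrightarrow> h i \<in> A \<and> u < h i \<and> h i \<le> v"
  shows "int n \<le> cnt A u v"
proof -
  have "card (h ` {..<n}) \<le> card (A \<inter> {u<..v})"
    by (rule card_mono[OF locally_finite_Ioc[OF assms(1)]]) (use assms(3) in auto)
  then show ?thesis unfolding cnt_def using card_image[OF assms(2)] by simp
qed

text \<open>Shifting the matching along a chain that starts at the unmatched point \<open>x\<close> is profitable: it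
  loses on a short stretch where blue points are at most \<open>H\<close> to the right of their new partners, and
  gains on a much longer stretch where they are at least \<open>H\<close> to the left.\<close>

lemma chain_contradiction:
  assumes lm: "locally_minimal F a R B M" and F: "F \<noteq> bot" and gt1: "\<forall>\<^sub>F g in F. g \<in> {1<..}"
    and a: "0 < a" and disj: "R \<inter> B = {}" and lf: "locally_finite R" "locally_finite B"
    and gr: "good_right R B" and x: "x \<in> unmatched_red R M"
  shows False
proof -
  note Mt = lm_matching[OF lm F gt1]
  have xR: "x \<in> R" "\<And>y. (x, y) \<notin> M" using x unfolding unmatched_red_def by auto
  have "\<exists>r. (r, b) \<in> M" if "b \<in> B" for b
    using lm_not_both[OF lm F gt1 x, of b] that unfolding unmatched_blue_def by blast
  then obtain pr where pr: "\<And>b. b \<in> B \<Longrightarrow> (pr b, b) \<in> M" by metis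
  have prR: "pr b \<in> R" "pr b \<noteq> b" if "b \<in> B" for b using matching_mem[OF Mt pr[OF that]] disj by auto
  have prx: "x < pr b" if "b \<in> B" "x < b" for b
    using unmatched_red_not_inside(1)[OF lm F gt1 a disj pr[OF that(1)] x] xR(2) pr[OF that(1)] that(2)
    by (metis linorder_neqE_linordered_idom)
  have prx': "x < b" if "b \<in> B" "x < pr b" for b
  proof (rule ccontr)
    assume "\<not> x < b"
    moreover have "b \<noteq> x" using that xR disj by blast
    ultimately show False using unmatched_red_not_inside(2)[OF lm F gt1 a disj pr[OF that(1)] x] that by simp
  qed
  have prmono: "pr b < pr b'" if "b \<in> B" "b' \<in> B" "b < b'" for b b'
  proof (rule ccontr)
    assume "\<not> pr b < pr b'"
    moreover have "pr b \<noteq> pr b'" using matching_red_unique[OF Mt] pr[OF that(1)] pr[OF that(2)] that(3) by force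
    ultimately have "pr b' < pr b" by simp
    then show False using convex_monotone[OF lm F gt1 a disj pr[OF that(2)] pr[OF that(1)]] that(3) by simp
  qed
  obtain H t1 t2 where H: "0 < H" "x \<le> t1" "t1 + 2 * H \<le> t2"
    and K: "1 / a * (t1 + 2 * H - x) < t2 - (t1 + 2 * H)"
    and g1: "\<And>u. x \<le> u \<Longrightarrow> u \<le> t2 \<Longrightarrow> cnt R x u < cnt B x (u + H)"
    and g2: "\<And>u. t1 \<le> u \<Longrightarrow> u \<le> t2 \<Longrightarrow> cnt R x (u + H) + 1 < cnt B x u"
    and gap: "R \<inter> {t1 + H<..t1 + 2 * H} \<noteq> {}"
    using gr[unfolded good_right_def, rule_format, of x "1 / a"] by blast
  define \<theta> where "\<theta> = t1 + 2 * H"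
  define bs where "bs = B \<inter> {x<..t2}"
  have fbs: "finite bs" unfolding bs_def using lf locally_finite_Ioc by blast
  define m where "m = card bs"
  define b where "b i = sorted_list_of_set bs ! i" for i
  have len: "length (sorted_list_of_set bs) = m" unfolding m_def by simp
  have bmem: "b i \<in> B \<and> x < b i \<and> b i \<le> t2" if "i < m" for i
  proof -
    have "b i \<in> set (sorted_list_of_set bs)" unfolding b_def using that len by (intro nth_mem) simp
    then show ?thesis using fbs unfolding bs_def by simp
  qed
  have blt: "b i < b j" if "i < j" "j < m" for i j
    unfolding b_def using that len
    by (intro sorted_wrt_nth_less[OF strict_sorted_list_of_set]) auto
  have bsur: "\<exists>i<m. \<beta> = b i" if "\<beta> \<in> B" "x < \<beta>" "\<beta> \<le> t2" for \<beta>
  proof -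
    have "\<beta> \<in> set (sorted_list_of_set bs)" using that fbs unfolding bs_def by simp
    then show ?thesis unfolding b_def using len by (metis in_set_conv_nth)
  qed
  have bltD: "i < j" if "b i < b j" "i < m" "j < m" for i j
    using that blt by (metis linorder_neqE_nat less_asym')
  \<comment> \<open>Old edges join \<open>r (Suc i)\<close> to \<open>b i\<close>, new ones join
    \<open>r i\<close> to \<open>b i\<close>: each blue point moves to the preceding red point of
    the chain, so that \<open>x\<close> comes in and \<open>r m\<close> drops out.\<close>
  define r where "r i = (case i of 0 \<Rightarrow> x | Suc k \<Rightarrow> pr (b k))" for i
  have r0: "r 0 = x" and rS: "r (Suc i) = pr (b i)" for i unfolding r_def by simp_all
  have rR: "r i \<in> R" "x \<le> r i" if "i \<le> m" for i
  proof -
    have "r i \<in> R \<and> x \<le> r i"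
    proof (cases i)
      case 0
      then show ?thesis using xR(1) r0 by simp
    next
      case (Suc k)
      then have "k < m" using that by simp
      then show ?thesis using prR(1)[of "b k"] prx[of "b k"] bmem[of k] unfolding Suc rS by simp
    qed
    then show "r i \<in> R" "x \<le> r i" by simp_all
  qed
  have rlt: "r i < r j" if ij: "i < j" "j \<le> m" for i j
  proof -
    obtain l where l: "j = Suc l" "l < m" using ij by (cases j) auto
    show ?thesis
    proof (cases i)
      case 0
      then show ?thesis using prx[of "b l"] bmem[of l] l by (simp add: r0 rS)
    next
      case (Suc k)
      then have "k < l" using ij l by simp
      then show ?thesis using prmono[of "b k" "b l"] bmem[of k] bmem[of l] blt[of k l] l unfolding Suc l(1) rS by simp
    qed
  qed
  have rltD: "i < j" if "r i < r j" "i \<le> m" "j \<le> m" for i j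
    using that rlt by (metis linorder_neqE_nat less_asym')
  \<comment> \<open>The chain may skip unmatched red points, so their count is only bounded from
    below. All blue points of \<open>(x, t2]\<close> belong to the chain, which in
    \<open>cntB\<close> bounds their count from above. Both errors have the harmless sign.\<close>
  have cntR: "int i \<le> cnt R x v" if "i \<le> m" "r i \<le> v" for i v
  proof (rule cnt_ge[of R "\<lambda>k. r (Suc k)", OF lf(1)])
    show "inj_on (\<lambda>k. r (Suc k)) {..<i}"
    proof (rule inj_onI)
      fix k l assume kl: "k \<in> {..<i}" "l \<in> {..<i}" "r (Suc k) = r (Suc l)"
      show "k = l"
        using rlt[of "Suc k" "Suc l"] rlt[of "Suc l" "Suc k"] kl that(1) by (cases k l rule: linorder_cases) auto
    qed
    fix k assume "k < i"
    then have "Suc k \<le> i" by simp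
    then have "r (Suc k) \<le> r i" using rlt[of "Suc k" i] that by (cases "Suc k = i") (auto simp: less_imp_le)
    moreover have "x < r (Suc k)" using rlt[of 0 "Suc k"] \<open>Suc k \<le> i\<close> that r0 by simp
    ultimately show "r (Suc k) \<in> R \<and> x < r (Suc k) \<and> r (Suc k) \<le> v"
      using rR(1)[of "Suc k"] \<open>Suc k \<le> i\<close> that by simp
  qed
  have cntB: "cnt B x v \<le> int i" if "\<And>\<beta>. \<beta> \<in> B \<Longrightarrow> x < \<beta> \<Longrightarrow> \<beta> \<le> v \<Longrightarrow> \<exists>j<i. \<beta> = b j" for v i
  proof -
    have "B \<inter> {x<..v} \<subseteq> b ` {..<i}"
    proof
      fix \<beta> assume "\<beta> \<in> B \<inter> {x<..v}"
      then have "\<exists>j<i. \<beta> = b j" using that[of \<beta>] by simp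
      then show "\<beta> \<in> b ` {..<i}" by auto
    qed
    then have "card (B \<inter> {x<..v}) \<le> card (b ` {..<i})" by (intro card_mono) auto
    also have "\<dots> \<le> i" using card_image_le[of "{..<i}" b] by simp
    finally show ?thesis unfolding cnt_def by simp
  qed
  have near: "b i - r i \<le> H" if i: "i < m" for i
  proof (rule ccontr)
    assume "\<not> b i - r i \<le> H"
    then have lt: "r i + H < b i" by simp
    have "cnt R x (r i) < cnt B x (r i + H)"
      by (rule g1) (use rR[of i] i lt H bmem[OF i] in auto)
    moreover have "cnt B x (r i + H) \<le> int i"
    proof (rule cntB)
      fix \<beta> assume \<beta>: "\<beta> \<in> B" "x < \<beta>" "\<beta> \<le> r i + H"
      then obtain j where j: "j < m" "\<beta> = b j" using bsur lt bmem[OF i] by force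
      then have "b j < b i" using \<beta> lt by simp
      then show "\<exists>j<i. \<beta> = b j" using bltD j i by blast
    qed
    moreover have "int i \<le> cnt R x (r i)" using cntR[of i "r i"] i by simp
    ultimately show False by simp
  qed
  have far: "b i - r i \<le> - H" if i: "i < m" "t1 + H < r i" for i
  proof (cases "b i \<le> t1")
    case False
    show ?thesis
    proof (rule ccontr)
      assume "\<not> b i - r i \<le> - H"
      then have "r i \<le> b i + H" by simp
      then have "int i \<le> cnt R x (b i + H)" using cntR[of i] i by simp
      moreover have "cnt R x (b i + H) + 1 < cnt B x (b i)" using g2 False bmem[OF i(1)] by simp
      moreover have "cnt B x (b i) \<le> int (Suc i)"
      proof (rule cntB)
        fix \<beta> assume \<beta>: "\<beta> \<in> B" "x < \<beta>" "\<beta> \<le> b i"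
        then obtain j where j: "j < m" "\<beta> = b j" using bsur bmem[OF i(1)] by force
        show "\<exists>j<Suc i. \<beta> = b j"
        proof (cases "j = i")
          case False
          then have "b j < b i" using \<beta> j blt[of i j] by (metis not_less linorder_neqE_nat blt i(1))
          then show ?thesis using bltD j i by (metis less_SucI)
        qed (use j in blast)
      qed
      ultimately show False by simp
    qed
  qed (use that in simp)
  have rm: "t2 < r m"
  proof (rule ccontr)
    assume "\<not> t2 < r m"
    then have "int m \<le> cnt R x (t2 + H)" using cntR[of m] H by simp
    moreover have "cnt R x (t2 + H) + 1 < cnt B x t2" using g2 H by simp
    moreover have "cnt B x t2 \<le> int m" by (rule cntB) (use bsur in blast)
    ultimately show False by simp
  qed
  \<comment> \<open>If the red point \<open>\<rho>\<close> of the gap were unmatched, no edge could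
    pass over it, and the blue points of \<open>(x, \<rho>]\<close> would all be matched to red
    points there, against the second count condition. So \<open>\<rho>\<close> is matched, and by
    monotonicity the step of the chain cannot pass it.\<close>
  have jump: "r (Suc i) \<le> \<theta>" if i: "i < m" "r i \<le> t1 + H" for i
  proof -
    obtain \<rho> where \<rho>: "\<rho> \<in> R" "t1 + H < \<rho>" "\<rho> \<le> \<theta>" using gap unfolding \<theta>_def by auto
    have "\<exists>\<beta>. (\<rho>, \<beta>) \<in> M"
    proof (rule ccontr)
      assume "\<nexists>\<beta>. (\<rho>, \<beta>) \<in> M"
      then have u: "\<rho> \<in> unmatched_red R M" using \<rho> unfolding unmatched_red_def by blast
      have "card (B \<inter> {x<..\<rho>}) \<le> card (R \<inter> {x<..\<rho>})"
      proof (rule matching_card_le_blue[OF Mt locally_finite_Ioc[OF lf(1)]])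
        fix y assume y: "y \<in> B \<inter> {x<..\<rho>}"
        then have "y < \<rho>" using \<rho> disj by (cases "y = \<rho>") auto
        moreover have "pr y \<noteq> \<rho>" using pr[of y] y u unfolding unmatched_red_def by auto
        ultimately have "pr y < \<rho>"
          using unmatched_red_not_inside(2)[OF lm F gt1 a disj pr u, of y] y by (metis IntD1 linorder_neqE_linordered_idom)
        then show "\<exists>z\<in>R \<inter> {x<..\<rho>}. (z, y) \<in> M" using y prR prx pr by (intro bexI[of _ "pr y"]) auto
      qed
      then have "cnt B x \<rho> \<le> cnt R x \<rho>" unfolding cnt_def by simp
      also have "\<dots> \<le> cnt R x (\<rho> + H)" using H by (intro cnt_mono[OF lf(1)]) auto
      finally show False using g2[of \<rho>] \<rho> H unfolding \<theta>_def by simp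
    qed
    then obtain \<beta> where \<beta>: "(\<rho>, \<beta>) \<in> M" by blast
    have \<beta>B: "\<beta> \<in> B" using matching_mem[OF Mt \<beta>] by blast
    have p\<beta>: "pr \<beta> = \<rho>" using matching_blue_unique[OF Mt \<beta> pr[OF \<beta>B]] by simp
    have x\<beta>: "x < \<beta>" using prx'[OF \<beta>B] p\<beta> \<rho> H by simp
    show ?thesis
    proof (cases "\<beta> \<le> t2")
      case True
      then obtain k where k: "k < m" "\<beta> = b k" using bsur \<beta>B x\<beta> by blast
      then have rk: "r (Suc k) = \<rho>" using rS p\<beta> by simp
      then have "i < Suc k" using rltD[of i "Suc k"] i \<rho> k by simp
      then have "r (Suc i) \<le> r (Suc k)" using rlt[of "Suc i" "Suc k"] k by (cases "i = k") auto
      then show ?thesis using rk \<rho> by simp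
    next
      case False
      then have "pr (b i) < pr \<beta>" using prmono[of "b i" \<beta>] bmem[OF i(1)] \<beta>B by simp
      then show ?thesis using p\<beta> rS \<rho> by simp
    qed
  qed
  \<comment> \<open>A potential whose increment, times the slope \<open>c\<close> of the cost at
    \<open>H\<close>, bounds the loss of each shift. It rises with slope 1 up to
    \<open>\<theta>\<close>, where a shift may cost, and falls with slope \<open>-a\<close> beyond,
    because the slope of the cost at \<open>-H\<close> is \<open>-(a * c)\<close>. The exponent
    enters only through the common factor \<open>c\<close>, so its sign decides for every exponent
    above 1.\<close>
  define \<psi> where "\<psi> v = (if v \<le> \<theta> then v else \<theta> - a * (v - \<theta>))" for v
  define E where "E = (\<lambda>i. (r (Suc i), b i)) ` {..<m}"
  define E' where "E' = (\<lambda>i. (r i, b i)) ` {..<m}"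
  have binj: "inj_on b {..<m}" by (rule inj_onI) (metis blt lessThan_iff less_irrefl linorder_neqE_nat)
  have rinj: "inj_on r {..<m}" by (rule inj_onI) (metis rlt lessThan_iff less_imp_le less_irrefl linorder_neqE_nat)
  have inj: "inj_on (\<lambda>i. (r (Suc i), b i)) {..<m}" "inj_on (\<lambda>i. (r i, b i)) {..<m}"
    using binj by (auto simp: inj_on_def)
  have EM: "E \<subseteq> M" unfolding E_def using rS pr bmem by auto
  have cards: "card E = m" "card E' = m" unfolding E_def E'_def using inj by (simp_all add: card_image)
  have c1: "cost f E = (\<Sum>i<m. f (b i - r (Suc i)))" "cost f E' = (\<Sum>i<m. f (b i - r i))" for f
    unfolding cost_def E_def E'_def by (simp_all add: sum.reindex[OF inj(1)] sum.reindex[OF inj(2)])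
  have mE': "matching (R \<inter> (fst ` E \<union> {x})) (B \<inter> (snd ` E \<union> {})) E'"
  proof -
    have "r i \<in> R \<inter> (fst ` E \<union> {x}) \<and> b i \<in> B \<inter> snd ` E" if "i < m" for i
    proof -
      have "r i \<in> fst ` E \<union> {x}"
        using that unfolding E_def by (cases i) (auto simp: r0 image_image)
      moreover have "b i \<in> snd ` E" using that unfolding E_def by (auto simp: image_image)
      ultimately show ?thesis using rR(1)[of i] bmem that by simp
    qed
    then have "E' \<subseteq> (R \<inter> (fst ` E \<union> {x})) \<times> (B \<inter> (snd ` E \<union> {}))" unfolding E'_def by auto
    moreover have "y = y'" if "(z, y) \<in> E'" "(z, y') \<in> E'" for z y y'
      using that rinj unfolding E'_def inj_on_def by auto
    moreover have "z = z'" if "(z, y) \<in> E'" "(z', y) \<in> E'" for z z' y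
      using that binj unfolding E'_def inj_on_def by auto
    ultimately show ?thesis by (intro matchingI) blast+
  qed
  have mE'2: "matching (R \<inter> (fst ` E \<union> {x})) (B \<inter> (snd ` E \<union> {x})) E'"
    by (rule matching_mono[OF mE']) auto
  obtain g where g: "g \<in> {1<..}" and opt: "locally_opt (cost_fun g a) R B E {x}"
    by (rule locally_minimalD[OF lm F gt1 EM, of "{x}"]) (use x in \<open>auto simp: E_def\<close>)
  let ?f = "cost_fun g a"
  have le: "cost ?f E \<le> cost ?f E'" using opt mE'2 cards unfolding locally_opt_def by simp
  define c where "c = g * H powr (g - 1)"
  have c0: "0 < c" unfolding c_def using g H by simp
  have slope: "convex_slope g a H = c" "convex_slope g a (- H) = - (a * c)"
    unfolding convex_slope_def c_def using H by simp_all
  have step: "?f (b i - r i) - ?f (b i - r (Suc i)) \<le> c * (\<psi> (r (Suc i)) - \<psi> (r i))" if i: "i < m" for i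
  proof -
    define d where "d = r (Suc i) - r i"
    have d: "0 \<le> d" using rlt[of i "Suc i"] i unfolding d_def by simp
    have e: "b i - r (Suc i) = b i - r i - d" unfolding d_def by simp
    show ?thesis
    proof (cases "r i \<le> t1 + H")
      case True
      have "?f (b i - r i) - ?f (b i - r i - d) \<le> c * d"
        using convex_cost_increment[OF _ a d near[OF i], of g] g slope by simp
      moreover have "\<psi> (r (Suc i)) - \<psi> (r i) = d"
        using jump[OF i True] True H unfolding \<psi>_def d_def \<theta>_def by simp
      ultimately show ?thesis unfolding e by simp
    next
      case False
      then have f: "b i - r i \<le> - H" using far[OF i] by simp
      have "?f (b i - r i) - ?f (b i - r i - d) \<le> - (a * c) * d"
        using convex_cost_increment[OF _ a d f, of g] g slope by simp
      also have "\<dots> = c * (- (a * d))" by simp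
      also have "\<dots> \<le> c * (\<psi> (r (Suc i)) - \<psi> (r i))"
      proof (rule mult_left_mono)
        have ad: "0 \<le> a * d" using a d by simp
        show "- (a * d) \<le> \<psi> (r (Suc i)) - \<psi> (r i)"
        proof (cases "r i \<le> \<theta>")
          case True
          then have "a * (r (Suc i) - \<theta>) \<le> a * d" using a unfolding d_def by (intro mult_left_mono) auto
          then show ?thesis using True ad d unfolding \<psi>_def d_def by auto
        next
          case False
          then have "\<not> r (Suc i) \<le> \<theta>" using d unfolding d_def by simp
          then show ?thesis using False unfolding \<psi>_def d_def by (simp add: algebra_simps)
        qed
      qed (use c0 in simp)
      finally show ?thesis unfolding e .
    qed
  qed
  have "cost ?f E' - cost ?f E = (\<Sum>i<m. ?f (b i - r i) - ?f (b i - r (Suc i)))"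
    unfolding c1 by (simp add: sum_subtractf)
  also have "\<dots> \<le> (\<Sum>i<m. c * (\<psi> (r (Suc i)) - \<psi> (r i)))" by (intro sum_mono step) simp
  also have "\<dots> = c * (\<psi> (r m) - \<psi> (r 0))"
    unfolding sum_distrib_left[symmetric] using sum_lessThan_telescope[of "\<lambda>i. \<psi> (r i)" m] by simp
  \<comment> \<open>With the ratio \<open>1 / a\<close> the falling part of the potential outweighs
    the rise by \<open>\<theta> - x\<close>.\<close>
  also have "\<dots> < 0"
  proof -
    have "\<theta> - x < a * (t2 - \<theta>)" using K a unfolding \<theta>_def by (simp add: field_simps)
    also have "\<dots> \<le> a * (r m - \<theta>)" using rm a by (intro mult_left_mono) auto
    finally have "\<theta> - a * (r m - \<theta>) < x" by simp
    moreover have "\<psi> (r 0) = x" "\<psi> (r m) = \<theta> - a * (r m - \<theta>)"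
      using H rm unfolding \<psi>_def \<theta>_def r0 by auto
    ultimately show ?thesis using c0 by (simp add: mult_less_0_iff)
  qed
  finally show False using le by simp
qed

lemma convex_perfect:
  assumes lm: "locally_minimal F a R B M" and F: "F \<noteq> bot" and gt1: "\<forall>\<^sub>F g in F. g \<in> {1<..}"
    and a: "0 < a" and disj: "R \<inter> B = {}" and lf: "locally_finite R" "locally_finite B"
    "locally_finite (uminus ` R)" "locally_finite (uminus ` B)"
    and gr: "good_right R B" "good_right (uminus ` B) (uminus ` R)"
  shows "unmatched_red R M = {}" "unmatched_blue B M = {}"
proof -
  show "unmatched_red R M = {}" using chain_contradiction[OF lm F gt1 a disj lf(1,2) gr(1)] by blast
  have "uminus ` B \<inter> uminus ` R = {}" using disj by auto
  then have "unmatched_red (uminus ` B) (reflected M) = {}"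
    using chain_contradiction[OF locally_minimal_mirror[OF lm] F gt1 a _ lf(4,3) gr(2)] by blast
  then show "unmatched_blue B M = {}" unfolding unmatched_mirror by simp
qed

section \<open>Monotone matchings without unmatched points are minimal\<close>

definition monotone_edges :: "(real \<times> real) set \<Rightarrow> bool" where
  "monotone_edges M \<longleftrightarrow> (\<forall>x y x' y'. (x, y) \<in> M \<and> (x', y') \<in> M \<and> x < x' \<longrightarrow> y < y')"

text \<open>A monotone matching pairs points of equal rank, and is therefore determined by its
  vertices.\<close>

lemma monotone_edges_rank:
  assumes N: "matching R B N" "finite N" "monotone_edges N" and e: "(x, y) \<in> N"
  shows "card {x' \<in> fst ` N. x' < x} = card {y' \<in> snd ` N. y' < y}"
proof -
  have 1: "y' < y \<longleftrightarrow> x' < x" if "(x', y') \<in> N" for x' y'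
  proof -
    have "x' = x \<longleftrightarrow> y' = y" using matching_red_unique[OF N(1)] matching_blue_unique[OF N(1)] that e by blast
    moreover have "x' < x \<Longrightarrow> y' < y" "x < x' \<Longrightarrow> y < y'" using N(3) that e unfolding monotone_edges_def by blast+
    ultimately show ?thesis by (metis linorder_neqE_linordered_idom less_asym)
  qed
  have "card {x' \<in> fst ` N. x' < x} \<le> card {y' \<in> snd ` N. y' < y}"
    by (rule matching_card_le_red[OF N(1)]) (use N(2) 1 in force)+
  moreover have "card {y' \<in> snd ` N. y' < y} \<le> card {x' \<in> fst ` N. x' < x}"
    by (rule matching_card_le_blue[OF N(1)]) (use N(2) 1 in force)+
  ultimately show ?thesis by simp
qed

lemma monotone_edges_unique_sub:
  assumes N: "matching R B N" "finite N" "monotone_edges N" and N': "matching R B N'" "finite N'" "monotone_edges N'"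
    and v: "fst ` N = fst ` N'" "snd ` N = snd ` N'"
  shows "N \<subseteq> N'"
proof (rule subrelI)
  fix x y assume e: "(x, y) \<in> N"
  then have "x \<in> fst ` N'" unfolding v(1)[symmetric] by force
  then obtain y' where e': "(x, y') \<in> N'" by auto
  let ?r = "\<lambda>y. {z \<in> snd ` N. z < y}"
  have eq: "card (?r y) = card (?r y')"
    using monotone_edges_rank[OF N e] monotone_edges_rank[OF N' e'] v by simp
  have mem: "y \<in> snd ` N" "y' \<in> snd ` N" using e e' v by force+
  have lt: "card (?r p) < card (?r q)" if "p < q" "p \<in> snd ` N" for p q
  proof (rule psubset_card_mono)
    show "finite (?r q)" using N(2) by simp
    show "?r p \<subset> ?r q" using that by force
  qed
  have "y = y'" using lt[of y y'] lt[of y' y] eq mem by (cases y y' rule: linorder_cases) simp_all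
  then show "(x, y) \<in> N'" using e' by simp
qed

lemma locally_opt_pair:
  assumes "locally_opt f R B N {}" "R \<inter> B = {}" "matching R B N" "finite N" "(x, y) \<in> N" "(x', y') \<in> N" "x \<noteq> x'" "y \<noteq> y'"
  shows "f (y - x) + f (y' - x') \<le> f (y' - x) + f (y - x')"
proof -
  have "locally_opt f R B {(x, y), (x', y')} {}"
    by (rule locally_opt_subset[OF assms(1,2,3,4)]) (use assms in auto)
  then show ?thesis
    using locally_opt_swap matching_mem[OF assms(3,5)] matching_mem[OF assms(3,6)] assms(7,8) by blast
qed

text \<open>An optimal matching of the vertices of \<open>E\<close> is monotone by
  \<open>convex_exchange\<close>, hence equal to \<open>E\<close>. The cost enters only through this
  strict exchange inequality, which holds for every positive \<open>a\<close>.\<close>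

lemma monotone_locally_minimal:
  assumes M: "matching R B M" "monotone_edges M" "unmatched_red R M = {}" "unmatched_blue B M = {}"
    and disj: "R \<inter> B = {}" and a: "0 < a" and gt1: "\<forall>\<^sub>F g in F. g \<in> {1<..}"
  shows "locally_minimal F a R B M"
proof -
  have "locally_opt (cost_fun g a) R B E {}" if E: "E \<subseteq> M" "finite E" and g: "1 < g" for E g
  proof (rule locally_opt_unique[OF matching_sub[OF M(1) E(1)] E(2)])
    fix N assume N: "matching R B N" "finite N" "fst ` N = fst ` E" "snd ` N = snd ` E"
      and opt: "locally_opt (cost_fun g a) R B N {}"
    have mE: "monotone_edges E" using M(2) E(1) unfolding monotone_edges_def by blast
    have mN: "monotone_edges N"
      unfolding monotone_edges_def
    proof (intro allI impI, elim conjE)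
      fix x y x' y' assume e: "(x, y) \<in> N" "(x', y') \<in> N" "x < x'"
      have ne: "y \<noteq> y'" using matching_blue_unique[OF N(1) e(1)] e by force
      have "cost_fun g a (y - x) + cost_fun g a (y' - x') \<le> cost_fun g a (y' - x) + cost_fun g a (y - x')"
        using locally_opt_pair[OF opt disj N(1,2) e(1,2)] e(3) ne by simp
      then show "y < y'" using convex_exchange[OF g a e(3), of y' y] ne by linarith
    qed
    show "N = E"
      using monotone_edges_unique_sub[OF N(1,2) mN matching_sub[OF M(1) E(1)] E(2) mE N(3,4)]
        monotone_edges_unique_sub[OF matching_sub[OF M(1) E(1)] E(2) mE N(1,2) mN] N(3,4) by auto
  qed
  moreover have "\<forall>\<^sub>F g in F. 1 < g" using gt1 by eventually_elim simp
  ultimately show ?thesis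
    unfolding locally_minimal_def M(3,4) using M(1) by (auto elim: eventually_mono)
qed

theorem convex_minimal_iff:
  assumes F: "F \<noteq> bot" and gt1: "\<forall>\<^sub>F g in F. g \<in> {1<..}"
    and a: "0 < a" "0 < a'" and disj: "R \<inter> B = {}" and lf: "locally_finite R" "locally_finite B"
    "locally_finite (uminus ` R)" "locally_finite (uminus ` B)"
    and gr: "good_right R B" "good_right (uminus ` B) (uminus ` R)"
    and lm: "locally_minimal F a R B M"
  shows "locally_minimal F a' R B M"
proof (rule monotone_locally_minimal[OF _ _ convex_perfect[OF lm F gt1 a(1) disj lf gr] disj a(2) gt1])
  show "matching R B M" using lm_matching[OF lm F gt1] .
  show "monotone_edges M"
    unfolding monotone_edges_def using convex_monotone[OF lm F gt1 a(1) disj] by blast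
qed

section \<open>The limit from below at exponent one\<close>

text \<open>The first two clauses exclude crossings of equally directed edges, which strict
  concavity forbids at every exponent below 1. The third excludes any overlap, crossing or nested,
  of a rightward with a leftward edge; already at exponent 1 the exchanged pair is strictly
  cheaper.\<close>

definition stacked :: "(real \<times> real) set \<Rightarrow> bool" where
  "stacked M \<longleftrightarrow> (\<forall>x y x' y'. (x, y) \<in> M \<and> (x', y') \<in> M \<longrightarrow>
     \<not> (x < x' \<and> x' < y \<and> y < y') \<and> \<not> (y < y' \<and> y' < x \<and> x < x') \<and> \<not> max x y' < min y x')"

lemma stackedD:
  assumes "stacked M" "(x, y) \<in> M" "(x', y') \<in> M"
  shows "\<not> (x < x' \<and> x' < y \<and> y < y')" "\<not> (y < y' \<and> y' < x \<and> x < x')" "\<not> max x y' < min y x'"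
  using assms unfolding stacked_def by blast+

lemma stacked_converse: "stacked M \<Longrightarrow> stacked (M\<inverse>)"
  unfolding stacked_def converse_iff by (metis max.commute min.commute)

lemma matching_converse: "matching R B M \<Longrightarrow> matching B R (M\<inverse>)"
  unfolding matching_def by blast

lemma edge_of_vertex:
  "p \<in> fst ` N \<Longrightarrow> \<exists>q. (p, q) \<in> N \<and> q \<in> snd ` N" "q \<in> snd ` N \<Longrightarrow> \<exists>p. (p, q) \<in> N \<and> p \<in> fst ` N"
  by force+

text \<open>Suppose that \<open>y2\<close> lies left of \<open>x\<close>. Then \<open>N'\<close>
  matches the red points left of \<open>x\<close> to blue points there other than \<open>y2\<close>,
  while \<open>N\<close> matches the blue points left of \<open>x\<close> to red points there: the
  counts clash. Suppose that \<open>y2\<close> lies beyond \<open>y\<close>. Then \<open>N\<close>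
  matches the red points of \<open>(x, y)\<close> to blue points there, while \<open>N'\<close>
  matches the blue points of \<open>(x, y]\<close> to red points of \<open>(x, y)\<close>, one too
  many.\<close>

lemma stacked_right_edge:
  assumes N: "matching R B N" "finite N" "stacked N" and N': "matching R B N'" "finite N'" "stacked N'"
    and v: "fst ` N = fst ` N'" "snd ` N = snd ` N'" and disj: "R \<inter> B = {}"
    and e: "(x, y) \<in> N" "x < y" and e': "(x, y2) \<in> N'"
  shows "x < y2 \<and> \<not> y < y2"
proof -
  let ?X = "fst ` N" and ?Y = "snd ` N"
  have fin: "finite ?X" "finite ?Y" using N by auto
  have ne: "p \<noteq> q" if "p \<in> ?X" "q \<in> ?Y" for p q
    using that matching_verts[OF N(1)] disj by blast
  have parN: "\<exists>q. (p, q) \<in> N \<and> q \<in> ?Y" "\<exists>q. (p, q) \<in> N' \<and> q \<in> ?Y" if "p \<in> ?X" for p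
    using edge_of_vertex(1)[OF that] edge_of_vertex(1)[OF that[unfolded v(1)]] unfolding v(2) by simp_all
  have parNb: "\<exists>p. (p, q) \<in> N \<and> p \<in> ?X" "\<exists>p. (p, q) \<in> N' \<and> p \<in> ?X" if "q \<in> ?Y" for q
    using edge_of_vertex(2)[OF that] edge_of_vertex(2)[OF that[unfolded v(2)]] unfolding v(1) by simp_all
  have mem: "x \<in> ?X" "y \<in> ?Y" "y2 \<in> ?Y" using e e' v by force+
  have right: "x < y2"
  proof (rule ccontr)
    assume "\<not> x < y2"
    then have y2x: "y2 < x" using ne[OF mem(1,3)] by simp
    have "card {p \<in> ?X. p < x} \<le> card ({q \<in> ?Y. q < x} - {y2})"
    proof (rule matching_card_le_red[OF N'(1)])
      fix p assume p: "p \<in> {p \<in> ?X. p < x}"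
      then obtain q where q: "(p, q) \<in> N'" "q \<in> ?Y" using parN(2) by blast
      have "q \<noteq> y2" using matching_blue_unique[OF N'(1) q(1)] e' p by force
      moreover have "\<not> max p y2 < min q x" using stackedD(3)[OF N'(3) q(1) e'] .
      then have "q < x" using p y2x ne[OF mem(1) q(2)] by (auto simp: max_def min_def split: if_splits)
      ultimately show "\<exists>q\<in>{q \<in> ?Y. q < x} - {y2}. (p, q) \<in> N'" using q by blast
    qed (use fin in simp)
    also have "\<dots> < card {q \<in> ?Y. q < x}"
      by (rule card_Diff1_less) (use fin mem y2x in auto)
    also have "\<dots> \<le> card {p \<in> ?X. p < x}"
    proof (rule matching_card_le_blue[OF N(1)])
      fix q assume q: "q \<in> {q \<in> ?Y. q < x}"
      then obtain p where p: "(p, q) \<in> N" "p \<in> ?X" using parNb(1) by blast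
      have "p \<noteq> x" using matching_red_unique[OF N(1) p(1)] e q by force
      moreover have "\<not> max x q < min y p" using stackedD(3)[OF N(3) e(1) p(1)] .
      then have "\<not> x < p" using q e(2) by (auto simp: max_def min_def split: if_splits)
      ultimately show "\<exists>p\<in>{p \<in> ?X. p < x}. (p, q) \<in> N" using p by force
    qed (use fin in simp)
    finally show False by simp
  qed
  moreover have "\<not> y < y2"
  proof
    assume yy: "y < y2"
    have "card {p \<in> ?X. x < p \<and> p < y} \<le> card {q \<in> ?Y. x < q \<and> q < y}"
    proof (rule matching_card_le_red[OF N(1)])
      fix p assume p: "p \<in> {p \<in> ?X. x < p \<and> p < y}"
      then obtain q where q: "(p, q) \<in> N" "q \<in> ?Y" using parN(1) by blast
      have "\<not> (x < p \<and> p < y \<and> y < q)" using stackedD(1)[OF N(3) e(1) q(1)] .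
      moreover have "\<not> max x q < min y p" using stackedD(3)[OF N(3) e(1) q(1)] .
      moreover have "q \<noteq> y" using matching_blue_unique[OF N(1) q(1)] e p by force
      ultimately have "x < q" "q < y"
        using p ne[OF mem(1) q(2)] by (auto simp: max_def min_def split: if_splits)
      then show "\<exists>q\<in>{q \<in> ?Y. x < q \<and> q < y}. (p, q) \<in> N" using q by blast
    qed (use fin in simp)
    also have "\<dots> < card (insert y {q \<in> ?Y. x < q \<and> q < y})" using fin by simp
    also have "\<dots> \<le> card {p \<in> ?X. x < p \<and> p < y}"
    proof (rule matching_card_le_blue[OF N'(1)])
      fix q assume q: "q \<in> insert y {q \<in> ?Y. x < q \<and> q < y}"
      then have qY: "q \<in> ?Y" "x < q" "q \<le> y" using mem e by auto
      then obtain p where p: "(p, q) \<in> N'" "p \<in> ?X" using parNb(2) by blast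
      have "\<not> (p < x \<and> x < q \<and> q < y2)" using stackedD(1)[OF N'(3) p(1) e'] .
      moreover have "\<not> max x q < min y2 p" using stackedD(3)[OF N'(3) e' p(1)] .
      moreover have "p \<noteq> x" using matching_red_unique[OF N'(1) p(1)] e' qY yy by force
      moreover have "p \<noteq> q" using ne[OF p(2) qY(1)] .
      ultimately have "x < p" "p < y"
        using qY yy by (auto simp: max_def min_def split: if_splits)
      then show "\<exists>p\<in>{p \<in> ?X. x < p \<and> p < y}. (p, q) \<in> N'" using p by blast
    qed (use fin in simp)
    finally show False by simp
  qed
  ultimately show ?thesis by blast
qed

lemma stacked_right_edge_eq:
  assumes N: "matching R B N" "finite N" "stacked N" and N': "matching R B N'" "finite N'" "stacked N'"
    and v: "fst ` N = fst ` N'" "snd ` N = snd ` N'" and disj: "R \<inter> B = {}"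
    and e: "(x, y) \<in> N" "x < y"
  shows "(x, y) \<in> N'"
proof -
  have "x \<in> fst ` N'" using e v by force
  then obtain y2 where e': "(x, y2) \<in> N'" by auto
  have "x < y2" "\<not> y < y2" using stacked_right_edge[OF N N' v disj e e'] by auto
  moreover from this have "\<not> y2 < y" using stacked_right_edge[OF N' N v[symmetric] disj e' _ e(1)] by blast
  ultimately show ?thesis using e' by (metis linorder_neqE_linordered_idom)
qed

lemma stacked_unique_sub:
  assumes N: "matching R B N" "finite N" "stacked N" and N': "matching R B N'" "finite N'" "stacked N'"
    and v: "fst ` N = fst ` N'" "snd ` N = snd ` N'" and disj: "R \<inter> B = {}"
  shows "N \<subseteq> N'"
proof (rule subrelI)
  fix x y assume e: "(x, y) \<in> N"
  have "x \<noteq> y" using matching_mem[OF N(1) e] disj by blast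
  then consider "x < y" | "y < x" by linarith
  then show "(x, y) \<in> N'"
  proof cases
    case 1
    then show ?thesis using stacked_right_edge_eq[OF assms e] by blast
  next
    case 2
    have "fst ` (K\<inverse>) = snd ` K" "snd ` (K\<inverse>) = fst ` K" for K :: "(real \<times> real) set" by force+
    then have "(y, x) \<in> N'\<inverse>"
      using stacked_right_edge_eq[of B R "N\<inverse>" "N'\<inverse>" y x] e 2 N N' v disj
      by (simp add: matching_converse stacked_converse Int_commute)
    then show ?thesis by simp
  qed
qed

lemma cost_fun_tendsto_one:
  "((\<lambda>g. cost_fun g a z) \<longlongrightarrow> (if z < 0 then a * \<bar>z\<bar> else z)) (at_left 1)"
proof (cases "z = 0")
  case True
  then have "\<forall>\<^sub>F g in at_left 1. cost_fun g a z = 0"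
    using eventually_at_left_real[of 0 "1::real"] by (auto simp: cost_fun_def elim!: eventually_mono)
  then show ?thesis using True tendsto_eventually by force
next
  case False
  have id: "((\<lambda>g :: real. g) \<longlongrightarrow> 1) (at_left 1)" by (rule tendsto_ident_at)
  have "((\<lambda>g. (if z < 0 then a * \<bar>z\<bar> powr g else z powr g)) \<longlongrightarrow> (if z < 0 then a * \<bar>z\<bar> powr 1 else z powr 1)) (at_left 1)"
  proof -
    have "((\<lambda>g. \<bar>z\<bar> powr g) \<longlongrightarrow> \<bar>z\<bar> powr 1) (at_left 1)"
      by (rule tendsto_powr[OF tendsto_const id]) (use False in auto)
    then have "((\<lambda>g. a * \<bar>z\<bar> powr g) \<longlongrightarrow> a * \<bar>z\<bar> powr 1) (at_left 1)"
      by (rule tendsto_mult_left)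
    moreover have "((\<lambda>g. z powr g) \<longlongrightarrow> z powr 1) (at_left 1)"
      by (rule tendsto_powr[OF tendsto_const id]) (use False in auto)
    ultimately show ?thesis by (cases "z < 0") (simp_all only: if_True if_False)
  qed
  moreover have "\<forall>\<^sub>F g in at_left 1. (if z < 0 then a * \<bar>z\<bar> powr g else z powr g) = cost_fun g a z"
    using eventually_at_left_real[of 0 "1::real"] by (auto simp: cost_fun_def elim!: eventually_mono)
  ultimately have "((\<lambda>g. cost_fun g a z) \<longlongrightarrow> (if z < 0 then a * \<bar>z\<bar> powr 1 else z powr 1)) (at_left 1)"
    by (rule Lim_transform_eventually)
  then show ?thesis using False by (auto split: if_splits)
qed

text \<open>For the limiting cost, \<open>z\<close> to the right and \<open>a * |z|\<close> to the
  left, the exchange gains strictly; by continuity in the exponent it still gains near 1.\<close>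

lemma opposite_swap_near_one:
  assumes "0 < a" "max x y' < min y x'"
  shows "\<forall>\<^sub>F g in at_left 1. cost_fun g a (y' - x) + cost_fun g a (y - x') < cost_fun g a (y - x) + cost_fun g a (y' - x')"
proof -
  let ?l = "\<lambda>z :: real. if z < 0 then a * \<bar>z\<bar> else z"
  have o: "x < y" "x < x'" "y' < y" "y' < x'" using assms by auto
  have "?l (y' - x) + ?l (y - x') < ?l (y - x) + ?l (y' - x')"
  proof -
    have A: "a * (x' - y) < a * (x' - y')" "a * (x - y') < a * (x' - y')" using o assms by simp_all
    have A2: "0 < a * (x' - y')" using o assms by simp
    \<comment> \<open>If both exchanged edges point left, their total length is that of the old
      leftward edge minus that of the old rightward one.\<close>
    have A3: "a * (x - y') + a * (x' - y) < a * (x' - y') + (y - x)"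
    proof -
      have "a * (x - y') + a * (x' - y) = a * (x' - y') - a * (y - x)" by (simp add: algebra_simps)
      moreover have "0 < a * (y - x)" using o assms by simp
      ultimately show ?thesis using o by linarith
    qed
    show ?thesis using o A A2 A3 by (auto simp: abs_if)
  qed
  then obtain m where m: "?l (y' - x) + ?l (y - x') < m" "m < ?l (y - x) + ?l (y' - x')" using dense by blast
  have "((\<lambda>g. cost_fun g a (y' - x) + cost_fun g a (y - x')) \<longlongrightarrow> ?l (y' - x) + ?l (y - x')) (at_left 1)"
    by (intro tendsto_add cost_fun_tendsto_one)
  from order_tendstoD(2)[OF this m(1)]
  have lo: "\<forall>\<^sub>F g in at_left 1. cost_fun g a (y' - x) + cost_fun g a (y - x') < m" .
  have "((\<lambda>g. cost_fun g a (y - x) + cost_fun g a (y' - x')) \<longlongrightarrow> ?l (y - x) + ?l (y' - x')) (at_left 1)"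
    by (intro tendsto_add cost_fun_tendsto_one)
  from order_tendstoD(1)[OF this m(2)]
  have "\<forall>\<^sub>F g in at_left 1. m < cost_fun g a (y - x) + cost_fun g a (y' - x')" .
  with lo show ?thesis by eventually_elim (rule less_trans)
qed

lemma at_left_one_lt: "\<forall>\<^sub>F g :: real in at_left 1. g \<in> {..<1}"
  using eventually_at_left_real[of 0 "1::real"] by (auto elim: eventually_mono)

lemma near_one_stacked:
  assumes lm: "locally_minimal (at_left 1) a R B M" and a: "0 < a" and disj: "R \<inter> B = {}"
  shows "stacked M"
  unfolding stacked_def
proof (intro allI impI, elim conjE)
  fix x y x' y' assume e: "(x, y) \<in> M" "(x', y') \<in> M"
  have F: "at_left (1::real) \<noteq> bot" by simp
  have "\<not> max x y' < min y x'"
  proof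
    assume H: "max x y' < min y x'"
    have ne: "x \<noteq> x'" "y \<noteq> y'" using H by auto
    have "\<forall>\<^sub>F g in at_left 1. g \<in> {g. cost_fun g a (y' - x) + cost_fun g a (y - x') < cost_fun g a (y - x) + cost_fun g a (y' - x')}"
      using opposite_swap_near_one[OF a H] by simp
    from lm_swap[OF lm F this e ne] show False by force
  qed
  then show "\<not> (x < x' \<and> x' < y \<and> y < y') \<and> \<not> (y < y' \<and> y' < x \<and> x < x') \<and> \<not> max x y' < min y x'"
    using not_crossing_right[OF lm F at_left_one_lt a disj e] not_crossing_left[OF lm F at_left_one_lt a disj e] by blast
qed

text \<open>A finite \<open>E\<close> admits only finitely many exchanges of overlapping opposite
  edges on its vertices, so one neighbourhood of 1 makes all of them profitable. Optimal matchings
  for these exponents are stacked, and uniqueness leaves only \<open>E\<close>.\<close>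

lemma stacked_locally_minimal:
  assumes M: "matching R B M" "stacked M" "unmatched_red R M = {}" "unmatched_blue B M = {}"
    and disj: "R \<inter> B = {}" and a: "0 < a"
  shows "locally_minimal (at_left 1) a R B M"
proof -
  have "\<forall>\<^sub>F g in at_left 1. locally_opt (cost_fun g a) R B E {}" if E: "E \<subseteq> M" "finite E" for E
  proof -
    let ?X = "fst ` E" and ?Y = "snd ` E"
    have "\<forall>\<^sub>F g in at_left 1. \<forall>x\<in>?X. \<forall>y'\<in>?Y. \<forall>y\<in>?Y. \<forall>x'\<in>?X. max x y' < min y x' \<longrightarrow>
        cost_fun g a (y' - x) + cost_fun g a (y - x') < cost_fun g a (y - x) + cost_fun g a (y' - x')"
      using E(2) opposite_swap_near_one[OF a] by (intro eventually_ball_finite ballI) (auto intro!: eventually_all_ge_at_top simp: eventually_mono)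
    then show ?thesis using at_left_one_lt
    proof eventually_elim
      case (elim g)
      show ?case
      proof (rule locally_opt_unique[OF matching_sub[OF M(1) E(1)] E(2)])
        fix N assume N: "matching R B N" "finite N" "fst ` N = ?X" "snd ` N = ?Y"
          and opt: "locally_opt (cost_fun g a) R B N {}"
        have c: "concave_cost (cost_fun g a)" using concave_cost_cost_fun a elim(2) by simp
        have sN: "stacked N"
          unfolding stacked_def
        proof (intro allI impI conjI notI; elim conjE)
          fix x y x' y' assume e: "(x, y) \<in> N" "(x', y') \<in> N"
          have v: "x \<in> ?X" "x' \<in> ?X" "y \<in> ?Y" "y' \<in> ?Y" using e N(3,4) by force+
          note P = locally_opt_pair[OF opt disj N(1,2) e]
          show False if "x < x'" "x' < y" "y < y'"
            using P concave_costD(3)[OF c, of "x' - x" "y - x'" "y' - y"] that by simp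
          show False if "y < y'" "y' < x" "x < x'"
            using P concave_costD(4)[OF c, of "y' - y" "x - y'" "x' - x"] that by simp
          show False if H: "max x y' < min y x'"
          proof -
            have "x \<noteq> x'" "y \<noteq> y'" using H by auto
            then show False using P elim(1)[rule_format, OF v(1,4,3,2) H] by simp
          qed
        qed
        have sE: "stacked E" using M(2) E(1) unfolding stacked_def by blast
        show "N = E"
          using stacked_unique_sub[OF N(1,2) sN matching_sub[OF M(1) E(1)] E(2) sE N(3,4) disj]
            stacked_unique_sub[OF matching_sub[OF M(1) E(1)] E(2) sE N(1,2) sN N(3,4)[symmetric] disj] by auto
      qed
    qed
  qed
  then show ?thesis unfolding locally_minimal_def M(3,4) using M(1) by auto
qed

theorem near_one_minimal_iff:
  assumes a: "0 < a" "0 < a'" and disj: "R \<inter> B = {}" and lf: "locally_finite R" "locally_finite B"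
    and V: "has_valleys R B" and lm: "locally_minimal (at_left 1) a R B M"
  shows "locally_minimal (at_left 1) a' R B M"
proof -
  have F: "at_left (1::real) \<noteq> bot" by simp
  obtain K where K: "2 \<le> K" "\<forall>\<^sub>F g in at_left 1. dominates K (cost_fun g a)"
    using dominates_near_one[OF a(1)] by blast
  have ev: "\<forall>\<^sub>F g in at_left 1. g \<in> {g. g < 1 \<and> dominates K (cost_fun g a)}"
    using K(2) at_left_one_lt by eventually_elim simp
  have "1 \<le> K" using K(1) by simp
  note p = concave_perfect[OF lm lf F disj a(1) this ev V]
  show ?thesis
    by (rule stacked_locally_minimal[OF lm_matching[OF lm F ev] near_one_stacked[OF lm a(1) disj] p disj a(2)])
qed

section \<open>From descents to valleys\<close>

text \<open>Density 1 within a factor 2, in the consecutive windows of length \<open>n\<close> that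
  fill \<open>(0, n ^ 4]\<close>. This range contains every block used at scale
  \<open>n\<close>.\<close>

definition dense_at :: "nat \<Rightarrow> real set \<Rightarrow> bool" where
  "dense_at n A \<longleftrightarrow> (\<forall>i<n ^ 3. int n \<le> 2 * cnt A (real (i * n)) (real ((i + 1) * n)) \<and>
     cnt A (real (i * n)) (real ((i + 1) * n)) \<le> 2 * int n)"

definition excess :: "real set \<Rightarrow> real set \<Rightarrow> real \<Rightarrow> int" where
  "excess A C u = cnt A 0 u - cnt C 0 u"

text \<open>Pieces have length \<open>n\<^sup>2\<close> because the walk then varies by order
  \<open>n\<close> on each, with probabilities bounded below uniformly in \<open>n\<close>. Starting
  at \<open>n\<close> rather than at 0 allows blocks of different scales to be disjoint.\<close>

definition descent :: "nat \<Rightarrow> nat \<Rightarrow> nat \<Rightarrow> real set \<Rightarrow> real set \<Rightarrow> bool" where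
  "descent N L n A C \<longleftrightarrow> (\<forall>q<N. let p = n + q * n\<^sup>2 in
     excess A C (real (p + n\<^sup>2)) - excess A C (real p) \<le> - int n \<and>
     (\<forall>k\<le>n\<^sup>2. excess A C (real (p + k)) - excess A C (real p) \<le> int (L * n)))"

context
  fixes A C :: "real set" and N L n :: nat
  assumes lf: "locally_finite A" "locally_finite C"
    and dn: "dense_at n A" "dense_at n C" and n: "N + 2 \<le> n" and de: "descent N L n A C"
begin

lemma n_pos: "2 \<le> n" using n by simp

text \<open>Keeps a block, with a few spare windows, inside the range of \<open>dense_at\<close>;
  \<open>N + 2 \<le> n\<close> enters here.\<close>

lemma range_bound: "n + N * n\<^sup>2 + 4 * n \<le> n ^ 3 * n"
proof -
  have "n ^ 3 * n = n\<^sup>2 * n\<^sup>2" by (simp add: power_numeral_reduce)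
  moreover have "4 \<le> n\<^sup>2" using power_mono[OF n_pos, of 2] by simp
  moreover have "(N + 2) * n\<^sup>2 \<le> n * n\<^sup>2" using n by (rule mult_right_mono) simp
  moreover have "2 * (n * n\<^sup>2) \<le> n * (n * n\<^sup>2)" using n_pos by (intro mult_right_mono) auto
  moreover have "n * (n * n\<^sup>2) = n\<^sup>2 * n\<^sup>2" by (simp add: power2_eq_square)
  moreover have "n * 2 \<le> n * n" using n_pos by (intro mult_left_mono) auto
  then have "2 * n \<le> n\<^sup>2" by (simp add: power2_eq_square)
  moreover have "2 * n\<^sup>2 \<le> n * n\<^sup>2" using n_pos by (intro mult_right_mono) auto
  moreover have "(N + 2) * n\<^sup>2 = N * n\<^sup>2 + 2 * n\<^sup>2" by (simp add: algebra_simps)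
  ultimately show ?thesis by linarith
qed

lemma unit_cell:
  assumes "k \<le> n + N * n\<^sup>2"
  shows "cnt A (real k) (real k + 1) \<le> 2 * int n"
proof -
  let ?i = "k div n"
  have "?i < n ^ 3"
  proof -
    have "k < n ^ 3 * n" using range_bound assms n_pos by linarith
    then show ?thesis using n_pos by (simp add: div_less_iff_less_mult)
  qed
  then have "cnt A (real (?i * n)) (real ((?i + 1) * n)) \<le> 2 * int n" using dn(1) unfolding dense_at_def by blast
  moreover have "?i * n \<le> k" "k + 1 \<le> (?i + 1) * n"
    using n_pos by (simp_all add: dividend_less_div_times Suc_leI)
  then have "cnt A (real k) (real k + 1) \<le> cnt A (real (?i * n)) (real ((?i + 1) * n))"
    by (intro cnt_mono[OF lf(1)]) (simp_all add: of_nat_mono del: of_nat_mult of_nat_add flip: of_nat_Suc)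
  ultimately show ?thesis by simp
qed

lemma start_bound:
  assumes "0 \<le> u" "u \<le> real n"
  shows "excess A C u \<le> 2 * int n"
proof -
  have "0 < n ^ 3" using n_pos by simp
  then have "cnt A (real (0 * n)) (real ((0 + 1) * n)) \<le> 2 * int n" using dn(1) unfolding dense_at_def by blast
  moreover have "cnt A 0 u \<le> cnt A 0 (real n)" using assms by (intro cnt_mono[OF lf(1)]) auto
  ultimately show ?thesis unfolding excess_def using cnt_nonneg[of C 0 u] by simp
qed

lemma excess_pieces:
  assumes "q \<le> N"
  shows "excess A C (real (n + q * n\<^sup>2)) \<le> 2 * int n - int (q * n)"
  using assms
proof (induction q)
  case 0
  then show ?case using start_bound[of "real n"] by simp
next
  case (Suc q)
  then have "q < N" "excess A C (real (n + q * n\<^sup>2)) \<le> 2 * int n - int (q * n)" by simp_all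
  moreover from this(1) have "excess A C (real (n + q * n\<^sup>2 + n\<^sup>2)) - excess A C (real (n + q * n\<^sup>2)) \<le> - int n"
    using de unfolding descent_def Let_def by blast
  moreover have "n + Suc q * n\<^sup>2 = n + q * n\<^sup>2 + n\<^sup>2" "int (Suc q * n) = int (q * n) + int n" by simp_all
  ultimately show ?case by presburger
qed

text \<open>The initial stretch \<open>(0, n]\<close> contributes at most \<open>2 * n\<close>, the
  current piece at most \<open>L * n\<close>, and each of at least \<open>q\<close> completed pieces
  takes away \<open>n\<close>.\<close>

lemma excess_nat:
  assumes "q \<le> N" "n + q * n\<^sup>2 \<le> k" "k \<le> n + N * n\<^sup>2"
  shows "excess A C (real k) \<le> int ((L + 2) * n) - int (q * n)"
proof (cases "k = n + N * n\<^sup>2")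
  case True
  have "int (q * n) \<le> int (N * n)" by (intro of_nat_mono mult_le_mono1 assms(1))
  moreover have "excess A C (real k) \<le> 2 * int n - int (N * n)" using excess_pieces[of N] True by simp
  moreover have "int ((L + 2) * n) = int (L * n) + 2 * int n" by (simp add: algebra_simps)
  ultimately show ?thesis using of_nat_0_le_iff[of "L * n", where ?'a = int] by linarith
next
  case False
  define q' where "q' = (k - n) div n\<^sup>2"
  have n2: "0 < n\<^sup>2" using n_pos by simp
  have "k - n < N * n\<^sup>2" using False assms by linarith
  then have q'N: "q' < N" unfolding q'_def using n2 by (simp add: div_less_iff_less_mult)
  have "q * n\<^sup>2 \<le> k - n" using assms by linarith
  then have qq': "q \<le> q'" unfolding q'_def using n2 by (simp add: less_eq_div_iff_mult_less_eq)
  define r where "r = (k - n) mod n\<^sup>2"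
  have k: "k = n + q' * n\<^sup>2 + r" 
    unfolding q'_def r_def using div_mult_mod_eq[of "k - n" "n\<^sup>2"] assms(2) by linarith
  have "r \<le> n\<^sup>2" unfolding r_def using n2 by (simp add: less_imp_le)
  then have "excess A C (real k) - excess A C (real (n + q' * n\<^sup>2)) \<le> int (L * n)"
    unfolding k using de q'N unfolding descent_def Let_def by blast
  moreover have "excess A C (real (n + q' * n\<^sup>2)) \<le> 2 * int n - int (q' * n)" using excess_pieces q'N by simp
  moreover have "int (q * n) \<le> int (q' * n)" by (intro of_nat_mono mult_le_mono1 qq')
  ultimately show ?thesis by (simp add: algebra_simps)
qed

text \<open>Between integers the excess rises by at most the number of points in a window,
  \<open>2 * n\<close>; hence \<open>L + 4\<close> in place of \<open>L + 2\<close>.\<close>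

lemma excess_real:
  assumes "q \<le> N" "real (n + q * n\<^sup>2) \<le> u" "u \<le> real (n + N * n\<^sup>2)"
  shows "excess A C u \<le> int ((L + 4) * n) - int (q * n)"
proof -
  define k where "k = nat \<lfloor>u\<rfloor>"
  have u0: "0 \<le> u" using assms by (meson of_nat_0_le_iff order_trans)
  have k: "real k \<le> u" "u < real k + 1" unfolding k_def using u0 by (simp_all add: of_nat_nat)
  have "n + q * n\<^sup>2 \<le> k"
    using assms(2) k by (metis Suc_leI le_less_trans not_less of_nat_Suc of_nat_less_iff add.commute not_less_eq_eq)
  moreover have kN: "k \<le> n + N * n\<^sup>2" using assms(3) k by (meson of_nat_le_iff order_trans)
  ultimately have "excess A C (real k) \<le> int ((L + 2) * n) - int (q * n)" using excess_nat assms(1) by blast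
  moreover have "excess A C u = excess A C (real k) + cnt A (real k) u - cnt C (real k) u"
    unfolding excess_def using cnt_add[OF lf(1), of 0 "real k" u] cnt_add[OF lf(2), of 0 "real k" u] k by simp
  moreover have "cnt A (real k) u \<le> cnt A (real k) (real k + 1)" using k by (intro cnt_mono[OF lf(1)]) auto
  ultimately show ?thesis using unit_cell[OF kN] cnt_nonneg[of C "real k" u] by (simp add: algebra_simps)
qed

lemma excess_upper:
  assumes "0 \<le> u" "u \<le> real (n + N * n\<^sup>2)"
  shows "excess A C u \<le> int ((L + 4) * n)"
proof (cases "u \<le> real n")
  case True
  have "int ((L + 4) * n) = int (L * n) + 4 * int n" by (simp add: algebra_simps)
  then show ?thesis using start_bound[OF assms(1) True] of_nat_0_le_iff[of "L * n", where ?'a = int] by linarith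
next
  case False
  then show ?thesis using excess_real[of 0 u] assms by simp
qed

end

lemma dense_windows:
  assumes "locally_finite A" "dense_at n A" "i + m \<le> n ^ 3"
  shows "int (m * n) \<le> 2 * cnt A (real (i * n)) (real ((i + m) * n)) \<and>
    cnt A (real (i * n)) (real ((i + m) * n)) \<le> 2 * int (m * n)"
  using assms(3)
proof (induction m)
  case 0
  then show ?case by (simp add: cnt_refl)
next
  case (Suc m)
  have "i + m < n ^ 3" using Suc.prems by simp
  then have "int n \<le> 2 * cnt A (real ((i + m) * n)) (real ((i + m + 1) * n)) \<and>
     cnt A (real ((i + m) * n)) (real ((i + m + 1) * n)) \<le> 2 * int n"
    using assms(2) unfolding dense_at_def by blast
  moreover have "cnt A (real (i * n)) (real ((i + Suc m) * n)) =
      cnt A (real (i * n)) (real ((i + m) * n)) + cnt A (real ((i + m) * n)) (real ((i + m + 1) * n))"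
    using cnt_add[OF assms(1), of "real (i * n)" "real ((i + m) * n)" "real ((i + m + 1) * n)"]
    by (simp add: mult_right_mono)
  ultimately show ?case using Suc by simp
qed

text \<open>Rounding \<open>u\<close> up to the start of a window costs less than one window, hence
  the length \<open>(m + 1) * n\<close>.\<close>

lemma dense_lower:
  assumes "locally_finite A" "dense_at n A" "0 < n" "0 \<le> u" "u + real ((m + 1) * n) \<le> real (n ^ 3 * n)"
  shows "int (m * n) \<le> 2 * cnt A u (u + real ((m + 1) * n))"
proof -
  define i where "i = nat \<lceil>u / real n\<rceil>"
  have i: "u / real n \<le> real i" "real i < u / real n + 1"
    unfolding i_def using assms by (simp_all add: of_nat_nat ceiling_correct; linarith)+
  have i': "u \<le> real i * real n" "real i * real n < u + real n"
    using i assms by (simp_all add: field_simps)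
  have "real ((i + m) * n) \<le> u + real ((m + 1) * n)" using i' by (simp add: algebra_simps)
  then have "real ((i + m) * n) \<le> real (n ^ 3 * n)" using assms(5) by linarith
  then have "i + m \<le> n ^ 3" using assms(3) unfolding of_nat_le_iff by simp
  then have "int (m * n) \<le> 2 * cnt A (real (i * n)) (real ((i + m) * n))"
    using dense_windows[OF assms(1,2)] by blast
  also have "\<dots> \<le> 2 * cnt A u (u + real ((m + 1) * n))"
    using i' \<open>real ((i + m) * n) \<le> u + real ((m + 1) * n)\<close> by (intro mult_left_mono cnt_mono[OF assms(1)]) auto
  finally show ?thesis .
qed

lemma dense_upper:
  assumes "locally_finite A" "dense_at n A" "0 < n" "0 \<le> u" "u + real ((m + 1) * n) \<le> real (n ^ 3 * n)"
  shows "cnt A u (u + real (m * n)) \<le> 2 * int ((m + 1) * n)"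
proof -
  define i where "i = nat \<lfloor>u / real n\<rfloor>"
  have "0 \<le> u / real n" using assms by simp
  then have i: "real i \<le> u / real n" "u / real n < real i + 1"
    unfolding i_def by (simp_all add: of_nat_nat)
  have i': "real i * real n \<le> u" "u < real i * real n + real n"
    using i assms by (simp_all add: field_simps)
  have "real ((i + (m + 1)) * n) \<le> u + real ((m + 1) * n)" using i' by (simp add: algebra_simps)
  then have "real ((i + (m + 1)) * n) \<le> real (n ^ 3 * n)" using assms(5) by linarith
  then have "0 < n \<longrightarrow> i + (m + 1) \<le> n ^ 3" unfolding of_nat_le_iff mult_le_cancel2 .
  then have "i + (m + 1) \<le> n ^ 3" using assms(3) by blast
  then have "cnt A (real (i * n)) (real ((i + (m + 1)) * n)) \<le> 2 * int ((m + 1) * n)"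
    using dense_windows[OF assms(1,2)] by blast
  moreover have "cnt A u (u + real (m * n)) \<le> cnt A (real (i * n)) (real ((i + (m + 1)) * n))"
    using i' by (intro cnt_mono[OF assms(1)]) (auto simp: algebra_simps)
  ultimately show ?thesis by simp
qed

text \<open>\<open>L\<close> is fixed before \<open>N\<close> because the number of pieces required
  for a valley or a chain is computed from \<open>L\<close>. On the left of 0 the outward walk is
  the excess of reflected blue over reflected red points.\<close>

definition good_scales :: "real set \<Rightarrow> real set \<Rightarrow> bool" where
  "good_scales R B \<longleftrightarrow>
     (\<exists>L. \<forall>N. \<exists>\<^sub>F n in sequentially.
        descent N L n R B \<and> descent N L n (uminus ` B) (uminus ` R)) \<and>
     (\<forall>\<^sub>F n in sequentially. dense_at n R \<and> dense_at n B \<and> dense_at n (uminus ` R) \<and> dense_at n (uminus ` B))"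

lemma good_scales_obtain:
  assumes "good_scales R B"
  shows "\<exists>L. \<forall>N T. \<exists>n\<ge>T. descent N L n R B \<and> descent N L n (uminus ` B) (uminus ` R) \<and>
      dense_at n R \<and> dense_at n B \<and> dense_at n (uminus ` R) \<and> dense_at n (uminus ` B) \<and> N + 2 \<le> n"
proof -
  obtain L where L: "\<And>N. \<exists>\<^sub>F n in sequentially. descent N L n R B \<and> descent N L n (uminus ` B) (uminus ` R)"
    and D: "\<forall>\<^sub>F n in sequentially. dense_at n R \<and> dense_at n B \<and> dense_at n (uminus ` R) \<and> dense_at n (uminus ` B)"
    using assms unfolding good_scales_def by blast
  have "\<exists>n\<ge>T. descent N L n R B \<and> descent N L n (uminus ` B) (uminus ` R) \<and>
      dense_at n R \<and> dense_at n B \<and> dense_at n (uminus ` R) \<and> dense_at n (uminus ` B) \<and> N + 2 \<le> n" for N T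
  proof -
    have "\<forall>\<^sub>F n in sequentially. (dense_at n R \<and> dense_at n B \<and> dense_at n (uminus ` R) \<and> dense_at n (uminus ` B)) \<and>
        T \<le> n \<and> N + 2 \<le> n"
      using D eventually_ge_at_top[of T] eventually_ge_at_top[of "N + 2"] by eventually_elim simp
    from frequently_eventually_frequently[OF L[of N] this] show ?thesis
      using frequently_ex by fastforce
  qed
  then show ?thesis by blast
qed

lemma locally_finite_uminus:
  assumes "locally_finite A"
  shows "locally_finite (uminus ` A)"
  unfolding locally_finite_def
proof (intro allI impI)
  fix D :: "real set" assume "bounded D"
  then have "bounded (uminus ` D)" by (simp add: bounded_uminus)
  then have "finite (A \<inter> uminus ` D)" using assms unfolding locally_finite_def by blast
  then have "finite (uminus ` (A \<inter> uminus ` D))" by simp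
  moreover have "uminus ` A \<inter> D \<subseteq> uminus ` (A \<inter> uminus ` D)" by force
  ultimately show "finite (uminus ` A \<inter> D)" by (rule finite_subset[rotated])
qed

text \<open>Reflection exchanges the open and the closed end of an interval, so a point at 0 or at
  \<open>-u\<close> may be counted on one side only.\<close>

lemma cnt_uminus:
  assumes "locally_finite A" "0 \<le> u"
  shows "cnt A (- u) 0 \<le> cnt (uminus ` A) 0 u + 1" "cnt (uminus ` A) 0 u \<le> cnt A (- u) 0 + 1"
proof -
  let ?D = "uminus ` A \<inter> {0<..u}" and ?E = "A \<inter> {- u<..0}"
  have f: "finite ?D" "finite ?E"
    using locally_finite_Ioc[OF locally_finite_uminus[OF assms(1)]] locally_finite_Ioc[OF assms(1)] by simp_all
  have c: "card (uminus ` ?D) = card ?D" by (simp add: card_image)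
  have ins: "card (insert w D) \<le> Suc (card D)" if "finite D" for w :: real and D
    using that by (simp add: card_insert_if)
  have "?E \<subseteq> insert 0 (uminus ` ?D)"
  proof
    fix z assume z: "z \<in> ?E"
    show "z \<in> insert 0 (uminus ` ?D)"
    proof (cases "z = 0")
      case False
      then have "- z \<in> ?D" using z by auto
      then have "- (- z) \<in> uminus ` ?D" by (rule imageI)
      then show ?thesis by simp
    qed simp
  qed
  then have "card ?E \<le> card (insert 0 (uminus ` ?D))" using f by (intro card_mono) auto
  also have "\<dots> \<le> Suc (card ?D)" using ins[of "uminus ` ?D" 0] f unfolding c by simp
  finally show "cnt A (- u) 0 \<le> cnt (uminus ` A) 0 u + 1" unfolding cnt_def by simp
  have "uminus ` ?D \<subseteq> insert (- u) ?E"
  proof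
    fix z assume "z \<in> uminus ` ?D"
    then obtain y where y: "z = - y" "y \<in> ?D" by (rule imageE)
    then obtain w where "w \<in> A" "y = - w" by blast
    then show "z \<in> insert (- u) ?E" using y by auto
  qed
  then have "card (uminus ` ?D) \<le> card (insert (- u) ?E)" using f by (intro card_mono) auto
  also have "\<dots> \<le> Suc (card ?E)" by (rule ins[OF f(2)])
  finally show "cnt (uminus ` A) 0 u \<le> cnt A (- u) 0 + 1" unfolding c cnt_def by simp
qed

theorem good_scales_valleys:
  assumes lf: "locally_finite R" "locally_finite B" and gs: "good_scales R B"
  shows "has_valleys R B"
  unfolding has_valleys_def
proof (intro allI)
  fix K :: real and l :: int and T :: real
  obtain L where "\<forall>N T. \<exists>n\<ge>T. descent N L n R B \<and> descent N L n (uminus ` B) (uminus ` R) \<and>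
      dense_at n R \<and> dense_at n B \<and> dense_at n (uminus ` R) \<and> dense_at n (uminus ` B) \<and> N + 2 \<le> n"
    using good_scales_obtain[OF gs] by blast
  note L = this[rule_format]
  \<comment> \<open>After \<open>L + 6\<close> pieces the bound \<open>(L + 4) * n - J * n\<close>
    equals \<open>- 2 * n\<close>, which for large \<open>n\<close> lies below \<open>l\<close> even
    after the two endpoint errors of the reflection.\<close>
  define J where "J = L + 6"
  obtain K' :: nat where K': "K \<le> real K'" using real_arch_simple by blast
  \<comment> \<open>Enough pieces to reach \<open>K * t\<close>, because
    \<open>t = n + J * n\<^sup>2 \<le> (J + 1) * n\<^sup>2\<close>.\<close>
  define N where "N = max J (K' * (J + 1))"
  obtain n where n: "nat \<lceil>T\<rceil> + nat \<bar>l\<bar> + 3 \<le> n" and d: "descent N L n R B" "descent N L n (uminus ` B) (uminus ` R)"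
    "dense_at n R" "dense_at n B" "dense_at n (uminus ` R)" "dense_at n (uminus ` B)" "N + 2 \<le> n"
    using L[of "nat \<lceil>T\<rceil> + nat \<bar>l\<bar> + 3" N] by blast
  define t where "t = real (n + J * n\<^sup>2)"
  have JN: "J \<le> N" unfolding N_def by simp
  have Kt: "K * t \<le> real (n + N * n\<^sup>2)"
  proof -
    have "K * t \<le> real K' * t" using K' unfolding t_def by (intro mult_right_mono) auto
    moreover have "real K' * t = real (K' * (n + J * n\<^sup>2))" unfolding t_def by simp
    moreover have "K' * (n + J * n\<^sup>2) \<le> N * n\<^sup>2"
    proof -
      have "K' * (n + J * n\<^sup>2) \<le> K' * ((J + 1) * n\<^sup>2)"
        using n by (intro mult_left_mono) (auto simp: power2_eq_square)
      also have "\<dots> = K' * (J + 1) * n\<^sup>2" by (simp only: mult.assoc)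
      also have "\<dots> \<le> N * n\<^sup>2" by (rule mult_le_mono1) (simp add: N_def)
      finally show ?thesis .
    qed
    then have "real (K' * (n + J * n\<^sup>2)) \<le> real (n + N * n\<^sup>2)" unfolding of_nat_le_iff by linarith
    ultimately show ?thesis by linarith
  qed
  have lf': "locally_finite (uminus ` R)" "locally_finite (uminus ` B)" using lf locally_finite_uminus by blast+
  have ln: "2 - 2 * int n < l" using n by linarith
  have nt: "real n \<le> t" unfolding t_def by (simp only: of_nat_le_iff le_add1)
  moreover have "T \<le> real n" using n by linarith
  ultimately have "T \<le> t" by linarith
  moreover have "walk R B s < l" if s: "t \<le> \<bar>s\<bar>" "\<bar>s\<bar> \<le> K * t" for s
  proof -
    have b: "real (n + J * n\<^sup>2) \<le> \<bar>s\<bar>" "\<bar>s\<bar> \<le> real (n + N * n\<^sup>2)" using s Kt unfolding t_def by auto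
    have e: "int ((L + 4) * n) - int (J * n) = - 2 * int n" unfolding J_def by (simp add: algebra_simps)
    show ?thesis
    proof (cases "0 \<le> s")
      case True
      then have "excess R B s \<le> - 2 * int n"
        using excess_real[OF lf d(3,4,7,1) JN b] e by simp
      then show ?thesis using True ln unfolding walk_def excess_def by simp
    next
      case False
      have "excess (uminus ` B) (uminus ` R) \<bar>s\<bar> \<le> - 2 * int n"
        using excess_real[OF lf'(2,1) d(6,5,7,2) JN b] e by simp
      moreover have "cnt B s 0 \<le> cnt (uminus ` B) 0 \<bar>s\<bar> + 1" "cnt (uminus ` R) 0 \<bar>s\<bar> \<le> cnt R s 0 + 1"
        using cnt_uminus(1)[OF lf(2), of "\<bar>s\<bar>"] cnt_uminus(2)[OF lf(1), of "\<bar>s\<bar>"] False by simp_all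
      ultimately show ?thesis using False ln unfolding walk_def excess_def by simp
    qed
  qed
  moreover have "0 < t" using n nt by linarith
  ultimately show "\<exists>t\<ge>T. low R B K l t" unfolding low_def by blast
qed

text \<open>\<open>H\<close> spans a fixed number of windows, so many that density puts more blue
  points into it than the largest excess \<open>(L + 4) * n\<close>. The point \<open>t1\<close>
  lies so late that the excess has dropped below anything that red points can regain within
  \<open>H\<close>. Both lengths are fixed multiples of \<open>n\<close> and
  \<open>n\<^sup>2\<close>, so a larger \<open>N\<close> achieves the ratio
  \<open>K\<close>.\<close>

lemma good_right_scale:
  assumes lf: "locally_finite R" "locally_finite B"
    and L: "\<And>N T. \<exists>n\<ge>T. descent N L n R B \<and> dense_at n R \<and> dense_at n B \<and> N + 2 \<le> n"
  shows "good_right R B"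
  unfolding good_right_def
proof (intro allI)
  fix x K :: real
  \<comment> \<open>Half density on \<open>m\<close> windows yields \<open>(L + 5) * n\<close>
    points, which is \<open>n\<close> more than the largest excess.\<close>
  define m where "m = 2 * (L + 5)"
  \<comment> \<open>The excess at \<open>t1\<close> is then at most
    \<open>- 2 * (m + 3) * n - 2 * n\<close>, where \<open>2 * (m + 3) * n\<close> bounds the red
    points in an interval of length \<open>H\<close>.\<close>
  define J where "J = L + 4 + 2 * (m + 3) + 2"
  obtain K' :: nat where K': "K \<le> real K'" using real_arch_simple by blast
  define N where "N = J + 3 * m + 20 + K' * (J + 2 * m + 6)"
  \<comment> \<open>Bounds the error from counting from 0 instead of \<open>x\<close>; the scale is
    chosen with \<open>2 * c + 2 \<le> n\<close>.\<close>
  define c where "c = cnt R (- \<bar>x\<bar>) \<bar>x\<bar> + cnt B (- \<bar>x\<bar>) \<bar>x\<bar>"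
  have c0: "0 \<le> c" unfolding c_def using cnt_nonneg by simp
  obtain n where n: "nat \<lceil>\<bar>x\<bar>\<rceil> + 2 * nat c + 2 \<le> n" and d: "descent N L n R B" "dense_at n R" "dense_at n B" "N + 2 \<le> n"
    using L[of "nat \<lceil>\<bar>x\<bar>\<rceil> + 2 * nat c + 2" N] by blast
  have n0: "0 < n" and xn: "\<bar>x\<bar> \<le> real n" and cn: "2 * c + 2 \<le> int n" using n c0 by linarith+
  have nn: "n \<le> n\<^sup>2" by (simp add: power2_eq_square)
  define H where "H = real ((m + 2) * n)"
  define t1 where "t1 = real (n + J * n\<^sup>2)"
  define t2 where "t2 = real (n + (N - m - 8) * n\<^sup>2)"
  have JN: "J \<le> N" unfolding N_def by simp
  have bnd: "u + real ((m + 4) * n) \<le> real (n + N * n\<^sup>2)" if "u \<le> t2" for u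
  proof -
    have "(m + 8) * n\<^sup>2 + (N - m - 8) * n\<^sup>2 = N * n\<^sup>2"
      unfolding add_mult_distrib[symmetric] unfolding N_def by simp
    moreover have "(m + 4) * n \<le> (m + 8) * n\<^sup>2" using nn by (intro mult_mono) auto
    ultimately have "n + (N - m - 8) * n\<^sup>2 + (m + 4) * n \<le> n + N * n\<^sup>2" by linarith
    then have "t2 + real ((m + 4) * n) \<le> real (n + N * n\<^sup>2)" unfolding t2_def by (metis of_nat_add of_nat_mono)
    then show ?thesis using that by linarith
  qed
  have rb: "real (n + N * n\<^sup>2) \<le> real (n ^ 3 * n)"
    using range_bound[OF lf d(2,3,4,1)] by (intro of_nat_mono) simp
  have bnd2: "u + real ((m + 4) * n) \<le> real (n ^ 3 * n)" if "u \<le> t2" for u using bnd[OF that] rb by linarith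
  have up: "cnt R x u \<le> c + cnt R 0 (max u 0)" if "x \<le> u" for u
  proof -
    have "cnt R x u \<le> cnt R (- \<bar>x\<bar>) (max u \<bar>x\<bar>)" by (rule cnt_mono[OF lf(1)]) auto
    also have "\<dots> = cnt R (- \<bar>x\<bar>) \<bar>x\<bar> + cnt R \<bar>x\<bar> (max u \<bar>x\<bar>)" by (rule cnt_add[OF lf(1)]) auto
    also have "cnt R \<bar>x\<bar> (max u \<bar>x\<bar>) \<le> cnt R 0 (max u 0)"
    proof (cases "\<bar>x\<bar> \<le> u")
      case True
      then show ?thesis by (intro cnt_mono[OF lf(1)]) auto
    next
      case False
      then have "cnt R \<bar>x\<bar> (max u \<bar>x\<bar>) = 0" by (simp add: max_def cnt_refl)
      then show ?thesis using cnt_nonneg by simp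
    qed
    finally show ?thesis unfolding c_def using cnt_nonneg[of B "- \<bar>x\<bar>" "\<bar>x\<bar>"] by simp
  qed
  have dn: "cnt B 0 v \<le> c + cnt B x v" if "0 \<le> v" "x \<le> v" for v
  proof (cases "0 \<le> x")
    case True
    then have "cnt B 0 v = cnt B 0 x + cnt B x v" using that by (intro cnt_add[OF lf(2)]) auto
    moreover have "cnt B 0 x \<le> cnt B (- \<bar>x\<bar>) \<bar>x\<bar>" using True by (intro cnt_mono[OF lf(2)]) auto
    ultimately show ?thesis unfolding c_def using cnt_nonneg[of R "- \<bar>x\<bar>" "\<bar>x\<bar>"] by simp
  next
    case False
    then have "cnt B 0 v \<le> cnt B x v" by (intro cnt_mono[OF lf(2)]) auto
    then show ?thesis using c0 by simp
  qed
  have g1: "cnt R x u < cnt B x (u + H)" if u: "x \<le> u" "u \<le> t2" for u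
  proof -
    let ?u = "max u 0"
    have u0: "0 \<le> ?u" "?u \<le> t2" using u unfolding t2_def by auto
    have "?u + real ((m + 1) * n) \<le> u + H"
    proof -
      have "?u \<le> u + \<bar>x\<bar>" using u by (auto simp: max_def)
      moreover have "H = real ((m + 1) * n) + real n" unfolding H_def by (simp add: algebra_simps)
      ultimately show ?thesis using xn by linarith
    qed
    then have "cnt B 0 (?u + real ((m + 1) * n)) \<le> cnt B 0 (u + H)" by (intro cnt_mono[OF lf(2)]) auto
    also have "\<dots> \<le> c + cnt B x (u + H)"
    proof (rule dn)
      show "0 \<le> u + H" using \<open>?u + real ((m + 1) * n) \<le> u + H\<close> u0(1) by (meson add_increasing2 of_nat_0_le_iff order_trans)
      show "x \<le> u + H" using u unfolding H_def by (simp add: add_increasing2)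
    qed
    finally have 1: "cnt B 0 (?u + real ((m + 1) * n)) \<le> c + cnt B x (u + H)" .
    have 2: "cnt B 0 (?u + real ((m + 1) * n)) = cnt B 0 ?u + cnt B ?u (?u + real ((m + 1) * n))"
      by (rule cnt_add[OF lf(2)]) auto
    have "?u + real ((m + 1) * n) \<le> real (n ^ 3 * n)"
    proof -
      have "real ((m + 1) * n) \<le> real ((m + 4) * n)" by (intro of_nat_mono mult_right_mono) auto
      then show ?thesis using bnd2[OF u0(2)] by linarith
    qed
    then have 3: "int (m * n) \<le> 2 * cnt B ?u (?u + real ((m + 1) * n))"
      by (rule dense_lower[OF lf(2) d(3) n0 u0(1)])
    have "?u \<le> real (n + N * n\<^sup>2)" using bnd[OF u0(2)] by (meson add_increasing2 of_nat_0_le_iff order_refl order_trans le_add_same_cancel1)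
    then have 4: "excess R B ?u \<le> int ((L + 4) * n)" using excess_upper[OF lf d(2,3,4,1) u0(1)] by blast
    have 5: "int (m * n) = 2 * (int ((L + 4) * n) + int n)" unfolding m_def by (simp add: algebra_simps)
    have arith: "r < b" if "r \<le> c + r0" "b' \<le> c + b" "b' = b0 + bu" "p \<le> 2 * bu" "r0 - b0 \<le> s"
      "p = 2 * (s + k)" "2 * c + 2 \<le> k" for r r0 b b' b0 bu p s k :: int
    proof -
      have "s + k \<le> bu" using that(4,6) by simp
      moreover have "r \<le> c + (b0 + s)" using that(1,5) by simp
      moreover have "b0 + bu - c \<le> b" using that(2,3) by simp
      ultimately show ?thesis using that(7) by simp
    qed
    show ?thesis by (rule arith[OF up[OF u(1)] 1 2 3 4[unfolded excess_def] 5 cn])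
  qed
  have g2: "cnt R x (u + H) + 1 < cnt B x u" if u: "t1 \<le> u" "u \<le> t2" for u
  proof -
    have "real n \<le> real (n + J * n\<^sup>2)" by (simp only: of_nat_le_iff le_add1)
    then have un: "real n \<le> u" using u(1) unfolding t1_def by (rule order_trans)
    then have u0: "0 \<le> u" "x \<le> u" using xn by linarith+
    have "excess R B u \<le> int ((L + 4) * n) - int (J * n)"
    proof (rule excess_real[OF lf d(2,3,4,1) JN])
      show "real (n + J * n\<^sup>2) \<le> u" using u(1) unfolding t1_def .
      show "u \<le> real (n + N * n\<^sup>2)" using bnd[OF u(2)] by (meson add_increasing2 of_nat_0_le_iff order_refl order_trans le_add_same_cancel1)
    qed
    then have 1: "excess R B u \<le> - (2 * int ((m + 3) * n)) - 2 * int n"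
      unfolding J_def by (simp add: algebra_simps)
    have "u + real ((m + 2 + 1) * n) \<le> real (n ^ 3 * n)"
    proof -
      have "real ((m + 2 + 1) * n) \<le> real ((m + 4) * n)" by (intro of_nat_mono mult_right_mono) auto
      then show ?thesis using bnd2[OF u(2)] by linarith
    qed
    then have "cnt R u (u + real ((m + 2) * n)) \<le> 2 * int ((m + 2 + 1) * n)"
      by (rule dense_upper[OF lf(1) d(2) n0 u0(1)])
    then have 2: "cnt R u (u + H) \<le> 2 * int ((m + 3) * n)" unfolding H_def by (simp add: algebra_simps)
    have H0: "0 \<le> H" unfolding H_def by simp
    have 3: "cnt R x (u + H) = cnt R x u + cnt R u (u + H)" using u0 H0 by (intro cnt_add[OF lf(1)]) auto
    have 4: "cnt R x u \<le> c + cnt R 0 u" using up[OF u0(2)] u0 by (simp add: max_def)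
    have 5: "cnt B 0 u \<le> c + cnt B x u" using dn u0 by blast
    show ?thesis using 1 2 3 4 5 cn unfolding excess_def by linarith
  qed
  have gap: "R \<inter> {t1 + H<..t1 + 2 * H} \<noteq> {}"
  proof -
    have tt: "t1 + H \<le> t2"
    proof -
      have "(N - m - 8) = J + (m + 2) + (m + 10 + K' * (J + 2 * m + 6))" unfolding N_def by simp
      then have "(N - m - 8) * n\<^sup>2 = J * n\<^sup>2 + (m + 2) * n\<^sup>2 + (m + 10 + K' * (J + 2 * m + 6)) * n\<^sup>2"
        by (simp add: add_mult_distrib)
      moreover have "(m + 2) * n \<le> (m + 2) * n\<^sup>2" using nn by (rule mult_left_mono) simp
      ultimately have "n + J * n\<^sup>2 + (m + 2) * n \<le> n + (N - m - 8) * n\<^sup>2" by linarith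
      then show ?thesis unfolding t1_def t2_def H_def by (metis of_nat_add of_nat_mono)
    qed
    have "t1 + H + real ((m + 1) * n) \<le> real (n ^ 3 * n)"
    proof -
      have "real ((m + 1) * n) \<le> real ((m + 4) * n)" by (intro of_nat_mono mult_right_mono) auto
      then show ?thesis using bnd2[OF tt] by linarith
    qed
    then have "int (m * n) \<le> 2 * cnt R (t1 + H) (t1 + H + real ((m + 1) * n))"
      by (intro dense_lower[OF lf(1) d(2) n0]) (auto simp: t1_def H_def)
    also have "\<dots> \<le> 2 * cnt R (t1 + H) (t1 + 2 * H)"
      by (intro mult_left_mono cnt_mono[OF lf(1)]) (auto simp: H_def algebra_simps)
    finally have "int (m * n) \<le> 2 * cnt R (t1 + H) (t1 + 2 * H)" .
    moreover have "0 < m * n" using n0 unfolding m_def by simp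
    ultimately have "0 < cnt R (t1 + H) (t1 + 2 * H)" by linarith
    then show ?thesis unfolding cnt_def by (auto simp: card_gt_0_iff)
  qed
  have tm: "t1 + 2 * H - x \<le> real ((J + 2 * m + 6) * n\<^sup>2)"
  proof -
    have "t1 + 2 * H + real n = real (n + J * n\<^sup>2 + 2 * ((m + 2) * n) + n)" unfolding t1_def H_def by simp
    also have "n + J * n\<^sup>2 + 2 * ((m + 2) * n) + n = J * n\<^sup>2 + (2 * m + 6) * n" by (simp add: algebra_simps)
    also have "\<dots> \<le> J * n\<^sup>2 + (2 * m + 6) * n\<^sup>2" using nn by (intro add_left_mono mult_left_mono) auto
    also have "\<dots> = (J + 2 * m + 6) * n\<^sup>2" by (simp add: algebra_simps)
    finally show ?thesis using xn by linarith
  qed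
  have big: "real ((K' * (J + 2 * m + 6) + 1) * n\<^sup>2) + (t1 + 2 * H) \<le> t2"
  proof -
    have "N - m - 8 = (K' * (J + 2 * m + 6) + 1) + J + (2 * m + 4) + 7" unfolding N_def by simp
    then have "(N - m - 8) * n\<^sup>2 = (K' * (J + 2 * m + 6) + 1) * n\<^sup>2 + J * n\<^sup>2 + (2 * m + 4) * n\<^sup>2 + 7 * n\<^sup>2"
      by (simp only: add_mult_distrib)
    moreover have "2 * ((m + 2) * n) \<le> (2 * m + 4) * n\<^sup>2"
    proof -
      have "2 * ((m + 2) * n) = (2 * m + 4) * n" by (simp add: algebra_simps)
      also have "\<dots> \<le> (2 * m + 4) * n\<^sup>2" using nn by (rule mult_left_mono) simp
      finally show ?thesis .
    qed
    ultimately have "(K' * (J + 2 * m + 6) + 1) * n\<^sup>2 + (n + J * n\<^sup>2 + 2 * ((m + 2) * n)) \<le> n + (N - m - 8) * n\<^sup>2"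
      by linarith
    then have "real ((K' * (J + 2 * m + 6) + 1) * n\<^sup>2 + (n + J * n\<^sup>2 + 2 * ((m + 2) * n))) \<le> t2"
      unfolding t2_def by (rule of_nat_mono)
    then show ?thesis unfolding t1_def H_def by simp
  qed
  have Kb: "K * (t1 + 2 * H - x) < t2 - (t1 + 2 * H)"
  proof -
    have "0 \<le> t1 + 2 * H - x"
    proof -
      have "real n \<le> t1" "0 \<le> H" unfolding t1_def H_def by simp_all
      then show ?thesis using xn by linarith
    qed
    then have "K * (t1 + 2 * H - x) \<le> real K' * (t1 + 2 * H - x)" using K' by (intro mult_right_mono) auto
    also have "\<dots> \<le> real K' * real ((J + 2 * m + 6) * n\<^sup>2)" using tm by (intro mult_left_mono) auto
    also have "\<dots> = real (K' * (J + 2 * m + 6) * n\<^sup>2)" by simp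
    also have "\<dots> < real ((K' * (J + 2 * m + 6) + 1) * n\<^sup>2)"
    proof -
      have "K' * (J + 2 * m + 6) * n\<^sup>2 < (K' * (J + 2 * m + 6) + 1) * n\<^sup>2" using n0 by simp
      then show ?thesis by (simp only: of_nat_less_iff)
    qed
    finally show ?thesis using big by linarith
  qed
  have "0 < (m + 2) * n" using n0 by simp
  then have "0 < H" unfolding H_def by (simp only: of_nat_0_less_iff)
  moreover have "x \<le> t1"
  proof -
    have "real n \<le> t1" unfolding t1_def by simp
    then show ?thesis using xn by linarith
  qed
  moreover have "t1 + 2 * H \<le> t2"
    using big by (meson add_increasing of_nat_0_le_iff order_trans order_refl le_add_same_cancel2)
  ultimately show "\<exists>H t1 t2. 0 < H \<and> x \<le> t1 \<and> t1 + 2 * H \<le> t2 \<and>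
      K * (t1 + 2 * H - x) < t2 - (t1 + 2 * H) \<and>
      (\<forall>u. x \<le> u \<and> u \<le> t2 \<longrightarrow> cnt R x u < cnt B x (u + H)) \<and>
      (\<forall>u. t1 \<le> u \<and> u \<le> t2 \<longrightarrow> cnt R x (u + H) + 1 < cnt B x u) \<and>
      R \<inter> {t1 + H<..t1 + 2 * H} \<noteq> {}"
    using g1 g2 gap Kb by blast
qed

theorem good_scales_good_right:
  assumes lf: "locally_finite R" "locally_finite B" and gs: "good_scales R B"
  shows "good_right R B" "good_right (uminus ` B) (uminus ` R)"
proof -
  obtain L where "\<forall>N T. \<exists>n\<ge>T. descent N L n R B \<and> descent N L n (uminus ` B) (uminus ` R) \<and>
      dense_at n R \<and> dense_at n B \<and> dense_at n (uminus ` R) \<and> dense_at n (uminus ` B) \<and> N + 2 \<le> n"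
    using good_scales_obtain[OF gs] by blast
  note L = this[rule_format]
  show "good_right R B" by (rule good_right_scale[OF lf, of L]) (use L in meson)
  show "good_right (uminus ` B) (uminus ` R)"
    by (rule good_right_scale[OF locally_finite_uminus[OF lf(2)] locally_finite_uminus[OF lf(1)], of L]) (use L in meson)
qed

section \<open>Poisson laws\<close>

lemma poisson_moment:
  assumes "0 < r" "0 \<le> z"
  shows "(\<integral>\<^sup>+k. ennreal (z ^ k) \<partial>measure_pmf (poisson_pmf r)) = ennreal (exp (r * (z - 1)))"
proof -
  have "(\<lambda>k. (r * z) ^ k /\<^sub>R fact k * exp (- r)) sums (exp (r * z) * exp (- r))"
    by (intro sums_mult2 exp_converges)
  moreover have "exp (r * z) * exp (- r) = exp (r * (z - 1))" by (simp add: exp_add[symmetric] algebra_simps)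
  moreover have "(r * z) ^ k /\<^sub>R fact k * exp (- r) = pmf (poisson_pmf r) k * z ^ k" for k
    using assms by (simp add: power_mult_distrib field_simps)
  ultimately have s: "(\<lambda>k. pmf (poisson_pmf r) k * z ^ k) sums exp (r * (z - 1))" by simp
  have "(\<integral>\<^sup>+k. ennreal (z ^ k) \<partial>measure_pmf (poisson_pmf r)) = (\<Sum>k. ennreal (pmf (poisson_pmf r) k) * ennreal (z ^ k))"
    unfolding nn_integral_measure_pmf nn_integral_count_space_nat ..
  also have "\<dots> = (\<Sum>k. ennreal (pmf (poisson_pmf r) k * z ^ k))"
  proof -
    have "ennreal (pmf (poisson_pmf r) k) * ennreal (z ^ k) = ennreal (pmf (poisson_pmf r) k * z ^ k)" for k
      by (rule ennreal_mult[symmetric]) (use assms in simp_all)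
    then show ?thesis by (simp only:)
  qed
  also have "\<dots> = ennreal (exp (r * (z - 1)))"
    by (rule suminf_ennreal_eq[OF _ s]) (use assms in simp)
  finally show ?thesis .
qed

lemma poisson_chernoff:
  assumes "0 < r" "0 \<le> z" "0 < c" "\<And>k. k \<in> A \<Longrightarrow> c \<le> z ^ k"
  shows "measure_pmf.prob (poisson_pmf r) A \<le> exp (r * (z - 1)) / c"
proof -
  let ?M = "measure_pmf (poisson_pmf r)"
  have "ennreal c * emeasure ?M A = (\<integral>\<^sup>+k. ennreal c * indicator A k \<partial>?M)"
    by (simp add: nn_integral_cmult_indicator)
  also have "\<dots> \<le> (\<integral>\<^sup>+k. ennreal (z ^ k) \<partial>?M)"
    by (intro nn_integral_mono) (use assms(4) in \<open>auto simp: indicator_def ennreal_leI\<close>)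
  also have "\<dots> = ennreal (exp (r * (z - 1)))" using poisson_moment assms by blast
  finally have "ennreal (c * measure_pmf.prob (poisson_pmf r) A) \<le> ennreal (exp (r * (z - 1)))"
    using assms(3) by (simp add: measure_pmf.emeasure_eq_measure ennreal_mult)
  then have "c * measure_pmf.prob (poisson_pmf r) A \<le> exp (r * (z - 1))" by (simp add: ennreal_le_iff)
  then show ?thesis using assms(3) by (simp add: field_simps)
qed

text \<open>Chernoff bounds with \<open>z = 2\<close> and \<open>z = 1 / 4\<close> give the ratios
  \<open>exp 1 / 4\<close> and \<open>2 * exp (- 3 / 4)\<close>, both below
  \<open>99 / 100\<close>.\<close>

lemma poisson_tails:
  assumes "0 < n"
  shows "measure_pmf.prob (poisson_pmf (real n)) {k. 2 * n < k} \<le> (99 / 100) ^ n"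
    "measure_pmf.prob (poisson_pmf (real n)) {k. 2 * k < n} \<le> (99 / 100) ^ n"
proof -
  have "measure_pmf.prob (poisson_pmf (real n)) {k. 2 * n < k} \<le> exp (real n * (2 - 1)) / 4 ^ n"
  proof (rule poisson_chernoff)
    fix k assume "k \<in> {k. 2 * n < k}"
    then have "(2::real) ^ (2 * n) \<le> 2 ^ k" by (intro power_increasing) auto
    then show "(4::real) ^ n \<le> 2 ^ k" by (simp add: power_mult)
  qed (use assms in auto)
  also have "\<dots> = (exp 1 / 4) ^ n" by (simp add: power_divide exp_of_nat_mult[symmetric])
  also have "\<dots> \<le> (99 / 100) ^ n" using exp_le by (intro power_mono) auto
  finally show "measure_pmf.prob (poisson_pmf (real n)) {k. 2 * n < k} \<le> (99 / 100) ^ n" .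
  have "measure_pmf.prob (poisson_pmf (real n)) {k. 2 * k < n} \<le> exp (real n * (1 / 4 - 1)) / (1 / 2) ^ n"
  proof (rule poisson_chernoff)
    fix k assume "k \<in> {k. 2 * k < n}"
    then have "(1 / 2 :: real) ^ n \<le> (1 / 2) ^ (2 * k)" by (intro power_decreasing) auto
    then show "(1 / 2 :: real) ^ n \<le> (1 / 4) ^ k" by (simp add: power_mult power2_eq_square)
  qed (use assms in auto)
  also have "\<dots> = (exp (- 3 / 4) * 2) ^ n"
    by (simp add: power_mult_distrib power_divide exp_of_nat_mult[symmetric])
  also have "\<dots> \<le> (99 / 100) ^ n"
  proof (rule power_mono)
    have "1 + 3 / 4 + (3 / 4)\<^sup>2 / 2 \<le> exp (3 / 4 :: real)" by (rule exp_lower_Taylor_quadratic) simp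
    then have "2 * (100 / 99) \<le> exp (3 / 4 :: real)" by (simp add: power2_eq_square)
    then show "exp (- 3 / 4) * 2 \<le> (99 / 100 :: real)" by (simp add: exp_minus field_simps)
  qed simp
  finally show "measure_pmf.prob (poisson_pmf (real n)) {k. 2 * k < n} \<le> (99 / 100) ^ n" .
qed

text \<open>Reduces the second moment, required by the central limit theorem, to the generating
  function at 2.\<close>

lemma square_le_power2: "(real k)\<^sup>2 \<le> 4 * 2 ^ k"
proof (induction k rule: less_induct)
  case (less k)
  show ?case
  proof (cases "k < 4")
    case True
    then have "k \<in> {0, 1, 2, 3}" by auto
    then show ?thesis by auto
  next
    case False
    then obtain j where k: "k = Suc j" "3 \<le> j" by (cases k) auto
    have "3 * real j \<le> real j * real j" using k by (intro mult_right_mono) auto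
    moreover have "1 \<le> real j" using k by simp
    ultimately have "1 + 2 * real j \<le> real j * real j" by linarith
    then have "(real k)\<^sup>2 \<le> 2 * (real j)\<^sup>2" using k by (simp add: power2_eq_square algebra_simps)
    then show ?thesis using less[of j] k by simp
  qed
qed

lemma poisson_square_integrable:
  assumes "0 < r"
  shows "integrable (measure_pmf (poisson_pmf r)) (\<lambda>k. (real k)\<^sup>2)"
proof (rule integrableI_bounded)
  have "(\<integral>\<^sup>+k. ennreal (norm ((real k)\<^sup>2)) \<partial>measure_pmf (poisson_pmf r)) \<le> (\<integral>\<^sup>+k. 4 * ennreal (2 ^ k) \<partial>measure_pmf (poisson_pmf r))"
  proof (rule nn_integral_mono)
    fix k
    have "ennreal (norm ((real k)\<^sup>2)) \<le> ennreal (4 * 2 ^ k)" using square_le_power2 by (intro ennreal_leI) simp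
    then show "ennreal (norm ((real k)\<^sup>2)) \<le> 4 * ennreal (2 ^ k)" by (simp add: ennreal_mult)
  qed
  also have "\<dots> = 4 * ennreal (exp (r * (2 - 1)))" using poisson_moment[OF assms, of 2] by (simp add: nn_integral_cmult)
  also have "\<dots> < \<infinity>" by (simp add: ennreal_mult_less_top)
  finally show "(\<integral>\<^sup>+k. ennreal (norm ((real k)\<^sup>2)) \<partial>measure_pmf (poisson_pmf r)) < \<infinity>" .
qed simp

text \<open>A symmetric Skellam law: the law of the increment of the walk over a length
  \<open>m\<close>. By symmetry it serves both sides of 0.\<close>

definition diff_law :: "real \<Rightarrow> real measure" where
  "diff_law m = distr (measure_pmf (poisson_law m) \<Otimes>\<^sub>M measure_pmf (poisson_law m)) borel (\<lambda>(a, b). real a - real b)"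

lemma diff_measurable:
  "(\<lambda>(a, b). real a - real b) \<in> borel_measurable (measure_pmf p \<Otimes>\<^sub>M measure_pmf q)"
  by measurable

lemma diff_law_uminus: "distr (diff_law m) borel uminus = diff_law m"
proof -
  let ?p = "measure_pmf (poisson_law m)"
  interpret pair_sigma_finite ?p ?p
    by (simp add: pair_sigma_finite_def measure_pmf.sigma_finite_measure_axioms)
  have "distr (diff_law m) borel uminus = distr (?p \<Otimes>\<^sub>M ?p) borel (\<lambda>(a, b). real b - real a)"
    unfolding diff_law_def by (subst distr_distr) (auto simp: comp_def case_prod_beta intro!: distr_cong)
  also have "\<dots> = distr (distr (?p \<Otimes>\<^sub>M ?p) (?p \<Otimes>\<^sub>M ?p) (\<lambda>(x, y). (y, x))) borel (\<lambda>(a, b). real b - real a)"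
    by (subst distr_pair_swap) (rule refl)
  also have "\<dots> = diff_law m"
    unfolding diff_law_def by (subst distr_distr) (auto simp: comp_def case_prod_beta intro!: distr_cong)
  finally show ?thesis .
qed

lemma prob_space_diff_law: "prob_space (diff_law m)"
proof -
  interpret pair_prob_space "measure_pmf (poisson_law m)" "measure_pmf (poisson_law m)"
    by (simp add: pair_prob_space_def pair_sigma_finite_def measure_pmf.sigma_finite_measure_axioms measure_pmf.prob_space_axioms)
  show ?thesis unfolding diff_law_def by (rule P.prob_space_distr[OF diff_measurable])
qed

lemma sets_diff_law [simp]: "sets (diff_law m) = sets borel" "space (diff_law m) = UNIV"
  unfolding diff_law_def by simp_all

lemma diff_law_nonneg: "1 / 2 \<le> measure (diff_law m) {0..}"
proof -
  interpret D: prob_space "diff_law m" by (rule prob_space_diff_law)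
  have "measure (diff_law m) {..0} = measure (distr (diff_law m) borel uminus) {..0}" unfolding diff_law_uminus ..
  also have "\<dots> = measure (diff_law m) (uminus -` {..0} \<inter> space (diff_law m))"
    by (rule measure_distr) (auto intro!: measurable_ident_sets simp: sets_diff_law)
  also have "uminus -` {..0} \<inter> space (diff_law m) = {0..}" by auto
  finally have eq: "measure (diff_law m) {..0} = measure (diff_law m) {0..}" .
  have "1 = measure (diff_law m) ({..0} \<union> {0..})" 
  proof -
    have "{..0} \<union> {0..} = space (diff_law m)" by auto
    then show ?thesis using D.prob_space by simp
  qed
  also have "\<dots> \<le> measure (diff_law m) {..0} + measure (diff_law m) {0..}" by (rule measure_Un_le) auto
  finally show ?thesis using eq by simp
qed

section \<open>Levy's maximal inequality\<close>

text \<open>Let \<open>j\<close> be the first time at which the partial sum exceeds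
  \<open>c\<close>. The rest of the sum is independent of this event and nonnegative with
  probability at least 1/2, and then the full sum exceeds \<open>c\<close> as well.\<close>

lemma (in prob_space) levy_maximal:
  fixes X :: "nat \<Rightarrow> 'a \<Rightarrow> real"
  assumes ind: "indep_vars (\<lambda>_. borel) X UNIV"
    and half: "\<And>j. j \<le> M' \<Longrightarrow> 1 / 2 \<le> prob {w \<in> space M. 0 \<le> (\<Sum>i\<in>{j..<M'}. X i w)}"
  shows "prob {w \<in> space M. \<exists>k\<le>M'. c < (\<Sum>i<k. X i w)} \<le> 2 * prob {w \<in> space M. c < (\<Sum>i<M'. X i w)}"
proof -
  have [measurable]: "X i \<in> borel_measurable M" for i using ind unfolding indep_vars_def2 by simp
  define T where "T j = {w \<in> space M. c < (\<Sum>i<j. X i w) \<and> (\<forall>k<j. (\<Sum>i<k. X i w) \<le> c)}" for j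
  define S where "S j = {w \<in> space M. 0 \<le> (\<Sum>i\<in>{j..<M'}. X i w)}" for j
  have mT: "T j \<in> events" and mS: "S j \<in> events" for j unfolding T_def S_def by measurable
  have indTS: "prob (T j \<inter> S j) = prob (T j) * prob (S j)" for j
  proof -
    have iv: "indep_var (PiM {..<j} (\<lambda>_. borel)) (\<lambda>w. restrict (\<lambda>i. X i w) {..<j})
        (PiM {j..<M'} (\<lambda>_. borel)) (\<lambda>w. restrict (\<lambda>i. X i w) {j..<M'})"
      by (rule indep_var_restrict[OF ind]) auto
    let ?A = "{v \<in> space (PiM {..<j} (\<lambda>_. borel)). c < (\<Sum>i<j. v i) \<and> (\<forall>k<j. (\<Sum>i<k. v i) \<le> c)}"
    let ?B = "{v \<in> space (PiM {j..<M'} (\<lambda>_. borel)). 0 \<le> (\<Sum>i\<in>{j..<M'}. v i :: real)}"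
    have c1: "(\<lambda>v. v i) \<in> borel_measurable (PiM {..<j} (\<lambda>_. borel :: real measure))" if "i < j" for i
      using that by (intro measurable_component_singleton) simp
    have c2: "(\<lambda>v. v i) \<in> borel_measurable (PiM {j..<M'} (\<lambda>_. borel :: real measure))" if "i \<in> {j..<M'}" for i
      using that by (intro measurable_component_singleton) simp
    have A: "?A \<in> sets (PiM {..<j} (\<lambda>_. borel))"
    proof -
      have s: "(\<lambda>v. \<Sum>i<k. v i) \<in> borel_measurable (PiM {..<j} (\<lambda>_. borel :: real measure))" if "k \<le> j" for k
        using that by (intro borel_measurable_sum c1) auto
      have "{v \<in> space (PiM {..<j} (\<lambda>_. borel)). c < (\<Sum>i<j. v i)} \<in> sets (PiM {..<j} (\<lambda>_. borel))"
        using s[OF order_refl] by measurable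
      moreover have "{v \<in> space (PiM {..<j} (\<lambda>_. borel)). \<forall>k\<in>{..<j}. (\<Sum>i<k. v i) \<le> c} \<in> sets (PiM {..<j} (\<lambda>_. borel))"
      proof (rule sets.sets_Collect_finite_All)
        fix k assume "k \<in> {..<j}"
        then have "(\<lambda>v. \<Sum>i<k. v i) \<in> borel_measurable (PiM {..<j} (\<lambda>_. borel :: real measure))" by (intro s) simp
        then show "{v \<in> space (PiM {..<j} (\<lambda>_. borel)). (\<Sum>i<k. v i) \<le> c} \<in> sets (PiM {..<j} (\<lambda>_. borel))"
          by measurable
      qed simp
      ultimately have "{v \<in> space (PiM {..<j} (\<lambda>_. borel)). c < (\<Sum>i<j. v i)} \<inter>
          {v \<in> space (PiM {..<j} (\<lambda>_. borel)). \<forall>k\<in>{..<j}. (\<Sum>i<k. v i) \<le> c} \<in> sets (PiM {..<j} (\<lambda>_. borel))"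
        by (rule sets.Int)
      then show ?thesis by (rule back_subst[of "\<lambda>E. E \<in> _"]) auto
    qed
    have B: "?B \<in> sets (PiM {j..<M'} (\<lambda>_. borel))"
    proof -
      have "(\<lambda>v. \<Sum>i\<in>{j..<M'}. v i) \<in> borel_measurable (PiM {j..<M'} (\<lambda>_. borel :: real measure))"
        by (intro borel_measurable_sum c2)
      then show ?thesis by measurable
    qed
    have eT: "(\<lambda>w. restrict (\<lambda>i. X i w) {..<j}) -` ?A \<inter> space M = T j"
      unfolding T_def by (auto simp: space_PiM)
    have eS: "(\<lambda>w. restrict (\<lambda>i. X i w) {j..<M'}) -` ?B \<inter> space M = S j"
      unfolding S_def by (auto simp: space_PiM)
    have "(\<lambda>x. (restrict (\<lambda>i. X i x) {..<j}, restrict (\<lambda>i. X i x) {j..<M'})) -` (?A \<times> ?B) \<inter> space M = T j \<inter> S j"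
      unfolding eT[symmetric] eS[symmetric] by auto
    then show ?thesis using indep_varD[OF iv A B] unfolding eT eS by simp
  qed
  have dT: "disjoint_family_on T {..M'}"
    unfolding disjoint_family_on_def
  proof (intro ballI impI)
    fix j k :: nat assume "j \<noteq> k"
    then consider "j < k" | "k < j" by linarith
    then show "T j \<inter> T k = {}" by cases (force simp: T_def)+
  qed
  have dTS: "disjoint_family_on (\<lambda>j. T j \<inter> S j) {..M'}"
    using dT unfolding disjoint_family_on_def by blast
  have un: "{w \<in> space M. \<exists>k\<le>M'. c < (\<Sum>i<k. X i w)} = (\<Union>j\<in>{..M'}. T j)"
  proof
    show "(\<Union>j\<in>{..M'}. T j) \<subseteq> {w \<in> space M. \<exists>k\<le>M'. c < (\<Sum>i<k. X i w)}" unfolding T_def by auto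
    show "{w \<in> space M. \<exists>k\<le>M'. c < (\<Sum>i<k. X i w)} \<subseteq> (\<Union>j\<in>{..M'}. T j)"
    proof
      fix w assume "w \<in> {w \<in> space M. \<exists>k\<le>M'. c < (\<Sum>i<k. X i w)}"
      then obtain k where w: "w \<in> space M" and k: "k \<le> M'" "c < (\<Sum>i<k. X i w)" by auto
      define j where "j = (LEAST k. c < (\<Sum>i<k. X i w))"
      have "c < (\<Sum>i<j. X i w)" "j \<le> k"
        unfolding j_def using LeastI[of "\<lambda>k. c < (\<Sum>i<k. X i w)", OF k(2)]
          Least_le[of "\<lambda>k. c < (\<Sum>i<k. X i w)", OF k(2)] by auto
      moreover have "(\<Sum>i<l. X i w) \<le> c" if "l < j" for l
        using not_less_Least[of l "\<lambda>k. c < (\<Sum>i<k. X i w)"] that unfolding j_def by simp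
      ultimately show "w \<in> (\<Union>j\<in>{..M'}. T j)" using w k(1) unfolding T_def by auto
    qed
  qed
  have "prob (\<Union>j\<in>{..M'}. T j) = (\<Sum>j\<le>M'. prob (T j))"
    by (rule finite_measure_finite_Union) (use mT dT in auto)
  also have "\<dots> \<le> (\<Sum>j\<le>M'. 2 * prob (T j \<inter> S j))"
  proof (rule sum_mono)
    fix j assume "j \<in> {..M'}"
    then have "1 / 2 \<le> prob (S j)" unfolding S_def using half by simp
    then have "prob (T j) * (1 / 2) \<le> prob (T j) * prob (S j)" by (intro mult_left_mono) auto
    then show "prob (T j) \<le> 2 * prob (T j \<inter> S j)" unfolding indTS by simp
  qed
  also have "\<dots> = 2 * (\<Sum>j\<le>M'. prob (T j \<inter> S j))" by (simp add: sum_distrib_left)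
  also have "(\<Sum>j\<le>M'. prob (T j \<inter> S j)) = prob (\<Union>j\<in>{..M'}. T j \<inter> S j)"
    by (rule finite_measure_finite_Union[symmetric]) (use mT mS dTS in auto)
  also have "\<dots> \<le> prob {w \<in> space M. c < (\<Sum>i<M'. X i w)}"
  proof (rule finite_measure_mono)
    show "(\<Union>j\<in>{..M'}. T j \<inter> S j) \<subseteq> {w \<in> space M. c < (\<Sum>i<M'. X i w)}"
    proof
      fix w assume "w \<in> (\<Union>j\<in>{..M'}. T j \<inter> S j)"
      then obtain j where j: "j \<le> M'" "w \<in> T j" "w \<in> S j" by auto
      have "{..<M'} = {..<j} \<union> {j..<M'}" using j by auto
      then have "(\<Sum>i<M'. X i w) = (\<Sum>i<j. X i w) + (\<Sum>i\<in>{j..<M'}. X i w)"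
        by (metis finite_atLeastLessThan finite_lessThan ivl_disj_int_one(2) sum.union_disjoint)
      then show "w \<in> {w \<in> space M. c < (\<Sum>i<M'. X i w)}" using j unfolding T_def S_def by auto
    qed
  qed measurable
  finally show ?thesis unfolding un by simp
qed

section \<open>Counts of a pair of independent Poisson processes\<close>

lemma config_space_basic:
  assumes "A \<in> sets borel" "bounded A"
  shows "{C. locally_finite C \<and> card (C \<inter> A) = k} \<in> sets config_space"
  unfolding config_space_def using assms by (intro in_measure_of) auto

lemma space_config_space: "space config_space = {C. locally_finite C}"
  unfolding config_space_def by (intro space_measure_of) auto

lemma config_space_count:
  assumes "A \<in> sets borel" "bounded A"
  shows "{C \<in> space config_space. card (C \<inter> A) \<in> T} \<in> sets config_space"
proof -
  have "{C \<in> space config_space. card (C \<inter> A) \<in> T} = (\<Union>k\<in>T. {C. locally_finite C \<and> card (C \<inter> A) = k})"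
    unfolding space_config_space by auto
  also have "\<dots> \<in> sets config_space" using config_space_basic[OF assms] by (intro sets.countable_UN') auto
  finally show ?thesis .
qed

locale poisson_pair = prob_space P for P :: "'w measure" +
  fixes R B :: "'w \<Rightarrow> real set"
  assumes PR: "poisson_process P 1 R" and PB: "poisson_process P 1 B"
    and indep_RB: "indep_var config_space R config_space B"
begin

definition pts :: "bool \<Rightarrow> 'w \<Rightarrow> real set" where "pts c = (if c then R else B)"

definition num :: "bool \<Rightarrow> real set \<Rightarrow> 'w \<Rightarrow> nat" where "num c A \<omega> = card (pts c \<omega> \<inter> A)"

lemma process: "poisson_process P 1 (pts c)"
  unfolding pts_def using PR PB by simp

lemma pts_measurable: "pts c \<in> measurable P config_space"
  using process unfolding poisson_process_def by blast

lemma pts_locally_finite: "\<omega> \<in> space P \<Longrightarrow> locally_finite (pts c \<omega>)"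
  using measurable_space[OF pts_measurable] unfolding space_config_space by blast

lemma indep_one:
  assumes "finite I" "disjoint_family_on A I" "\<And>i. i \<in> I \<Longrightarrow> A i \<in> sets borel \<and> bounded (A i)"
  shows "indep_vars (\<lambda>_. count_space UNIV) (\<lambda>i. num c (A i)) (I :: nat set)"
  using process[of c] assms unfolding poisson_process_def num_def[abs_def] by simp

lemma num_measurable:
  assumes "A \<in> sets borel" "bounded A"
  shows "num c A \<in> measurable P (count_space UNIV)"
proof -
  have "indep_vars (\<lambda>_. count_space UNIV) (\<lambda>i. num c A) {0 :: nat}"
    using assms by (intro indep_one[of "{0}" "\<lambda>_. A"]) (auto simp: disjoint_family_on_def)
  then show ?thesis unfolding indep_vars_def2 by simp
qed

lemma num_distr:
  assumes "A \<in> sets borel" "bounded A"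
  shows "distr P (count_space UNIV) (num c A) = measure_pmf (poisson_law (measure lborel A))"
  using process[of c] assms unfolding poisson_process_def num_def[abs_def] by simp

lemma num_event:
  assumes "A \<in> sets borel" "bounded A"
  shows "{\<omega> \<in> space P. num c A \<omega> \<in> T} \<in> events"
    "prob {\<omega> \<in> space P. num c A \<omega> \<in> T} = measure_pmf.prob (poisson_law (measure lborel A)) T"
proof -
  have eq: "{\<omega> \<in> space P. num c A \<omega> \<in> T} = num c A -` T \<inter> space P" by auto
  show "{\<omega> \<in> space P. num c A \<omega> \<in> T} \<in> events"
    unfolding eq using num_measurable[OF assms] by (rule measurable_sets) simp
  show "prob {\<omega> \<in> space P. num c A \<omega> \<in> T} = measure_pmf.prob (poisson_law (measure lborel A)) T"
    unfolding eq num_distr[OF assms, of c, symmetric] using num_measurable[OF assms] by (simp add: measure_distr)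
qed

text \<open>The definition of a Poisson process gives independence within one colour, and
  \<open>indep_RB\<close> gives it between the colours. To combine them, an arbitrary finite set of
  pairs is filled up with trivial events to a rectangle of both colours and finitely many
  indices.\<close>

lemma indep_nums:
  assumes dis: "disjoint_family (A :: nat \<Rightarrow> real set)" and A: "\<And>i. A i \<in> sets borel \<and> bounded (A i)"
  shows "indep_vars (\<lambda>_. count_space UNIV) (\<lambda>ci. num (fst ci) (A (snd ci))) UNIV"
  unfolding indep_vars_def2
proof (intro conjI ballI indep_setsI)
  show m: "num (fst ci) (A (snd ci)) \<in> measurable P (count_space UNIV)" for ci
    using num_measurable A by blast
  then show "{num (fst ci) (A (snd ci)) -` S \<inter> space P |S. S \<in> sets (count_space UNIV)} \<subseteq> events" for ci
    by (auto intro: measurable_sets)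
next
  fix E :: "bool \<times> nat \<Rightarrow> 'w set" and J :: "(bool \<times> nat) set"
  assume J: "J \<noteq> {}" "finite J"
    and E: "\<forall>j\<in>J. E j \<in> {num (fst j) (A (snd j)) -` S \<inter> space P |S. S \<in> sets (count_space UNIV)}"
  then have "\<exists>S. \<forall>j\<in>J. E j = {\<omega> \<in> space P. num (fst j) (A (snd j)) \<omega> \<in> S j}"
    by (intro bchoice) (auto simp: vimage_def Int_def conj_commute)
  then obtain S where S: "\<And>j. j \<in> J \<Longrightarrow> E j = {\<omega> \<in> space P. num (fst j) (A (snd j)) \<omega> \<in> S j}" by blast
  define T where "T j = (if j \<in> J then S j else UNIV)" for j
  define I where "I = snd ` J"
  have I: "finite I" "I \<noteq> {}" unfolding I_def using J by auto
  define ev where "ev c i = {\<omega> \<in> space P. num c (A i) \<omega> \<in> T (c, i)}" for c i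
  have evJ: "ev (fst j) (snd j) = E j" if "j \<in> J" for j unfolding ev_def using S[OF that] that by (simp add: T_def)
  have evn: "ev (fst j) (snd j) = space P" if "j \<notin> J" for j unfolding ev_def using that by (simp add: T_def)
  define U where "U c = {C \<in> space config_space. \<forall>i\<in>I. card (C \<inter> A i) \<in> T (c, i)}" for c
  have U: "U c \<in> sets config_space" for c
    unfolding U_def by (intro sets.sets_Collect_finite_All config_space_count) (use A I in auto)
  have pre: "pts c -` U c \<inter> space P = (\<Inter>i\<in>I. ev c i)" for c
    unfolding U_def ev_def num_def using I measurable_space[OF pts_measurable] by auto
  have one: "prob (\<Inter>i\<in>I. ev c i) = (\<Prod>i\<in>I. prob (ev c i))" for c
  proof -
    have "indep_vars (\<lambda>_. count_space UNIV) (\<lambda>i. num c (A i)) I"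
      by (rule indep_one) (use I dis A in \<open>auto simp: disjoint_family_on_def\<close>)
    from indep_varsD_finite[OF this I(2,1), of "\<lambda>i. T (c, i)"]
    have "prob (\<Inter>i\<in>I. num c (A i) -` T (c, i) \<inter> space P) = (\<Prod>i\<in>I. prob (num c (A i) -` T (c, i) \<inter> space P))" by simp
    moreover have "num c (A i) -` T (c, i) \<inter> space P = ev c i" for i unfolding ev_def by auto
    ultimately show ?thesis by simp
  qed
  have "(\<Inter>j\<in>J. E j) = (\<Inter>i\<in>I. ev True i) \<inter> (\<Inter>i\<in>I. ev False i)"
  proof
    show "(\<Inter>j\<in>J. E j) \<subseteq> (\<Inter>i\<in>I. ev True i) \<inter> (\<Inter>i\<in>I. ev False i)"
    proof -
      have "\<omega> \<in> ev c i" if "\<omega> \<in> (\<Inter>j\<in>J. E j)" for \<omega> c i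
      proof (cases "(c, i) \<in> J")
        case True
        then show ?thesis using evJ[OF True] that by auto
      next
        case False
        obtain j where "j \<in> J" using J by blast
        then have "\<omega> \<in> space P" using that S by auto
        then show ?thesis using evn[OF False] by simp
      qed
      then show ?thesis by blast
    qed
    show "(\<Inter>i\<in>I. ev True i) \<inter> (\<Inter>i\<in>I. ev False i) \<subseteq> (\<Inter>j\<in>J. E j)"
    proof
      fix \<omega> assume w: "\<omega> \<in> (\<Inter>i\<in>I. ev True i) \<inter> (\<Inter>i\<in>I. ev False i)"
      have "\<omega> \<in> E j" if "j \<in> J" for j
        using w that evJ[OF that] unfolding I_def by (cases "fst j") auto
      then show "\<omega> \<in> (\<Inter>j\<in>J. E j)" by blast
    qed
  qed
  also have "\<dots> = (\<lambda>\<omega>. (R \<omega>, B \<omega>)) -` (U True \<times> U False) \<inter> space P"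
    unfolding pre[symmetric] pts_def by auto
  finally have "prob (\<Inter>j\<in>J. E j) = prob (R -` U True \<inter> space P) * prob (B -` U False \<inter> space P)"
    using indep_varD[OF indep_RB U U] by simp
  also have "\<dots> = (\<Prod>i\<in>I. prob (ev True i)) * (\<Prod>i\<in>I. prob (ev False i))"
    using pre[of True] pre[of False] one unfolding pts_def by simp
  also have "\<dots> = (\<Prod>c\<in>UNIV. \<Prod>i\<in>I. prob (ev c i))" by (simp add: UNIV_bool mult.commute)
  also have "\<dots> = (\<Prod>j\<in>UNIV \<times> I. prob (ev (fst j) (snd j)))"
    by (simp add: prod.cartesian_product case_prod_beta)
  also have "\<dots> = (\<Prod>j\<in>J. prob (E j))"
  proof (rule prod.mono_neutral_cong_right)
    show "J \<subseteq> UNIV \<times> I" unfolding I_def by force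
    show "\<forall>j\<in>UNIV \<times> I - J. prob (ev (fst j) (snd j)) = 1" using evn prob_space by auto
  qed (use I evJ in auto)
  finally show "prob (\<Inter>j\<in>J. E j) = (\<Prod>j\<in>J. prob (E j))" .
qed

lemma indep_colours:
  assumes "A \<in> sets borel" "bounded A"
  shows "indep_var (count_space UNIV) (num True A) (count_space UNIV) (num False A)"
proof -
  have "(\<lambda>C. card (C \<inter> A)) \<in> measurable config_space (count_space UNIV)"
  proof (rule measurableI)
    fix T :: "nat set"
    have "(\<lambda>C. card (C \<inter> A)) -` T \<inter> space config_space = {C \<in> space config_space. card (C \<inter> A) \<in> T}" by auto
    then show "(\<lambda>C. card (C \<inter> A)) -` T \<inter> space config_space \<in> sets config_space"
      using config_space_count[OF assms] by simp
  qed simp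
  from indep_var_compose[OF indep_RB this this] show ?thesis
    unfolding num_def[abs_def] pts_def comp_def by simp
qed

lemma diff_distr:
  assumes "A \<in> sets borel" "bounded A"
  shows "distr P borel (\<lambda>\<omega>. real (num c A \<omega>) - real (num (\<not> c) A \<omega>)) = diff_law (measure lborel A)"
proof -
  let ?p = "measure_pmf (poisson_law (measure lborel A))"
  have nm: "num c' A \<in> measurable P (count_space UNIV)" for c' using num_measurable assms by blast
  have eq: "?p \<Otimes>\<^sub>M ?p = distr P (count_space UNIV \<Otimes>\<^sub>M count_space UNIV) (\<lambda>\<omega>. (num True A \<omega>, num False A \<omega>))"
    using indep_colours[OF assms] unfolding indep_var_distribution_eq num_distr[OF assms] by simp
  have T: "distr P borel (\<lambda>\<omega>. real (num True A \<omega>) - real (num False A \<omega>)) = diff_law (measure lborel A)"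
    unfolding diff_law_def eq using nm
    by (subst distr_distr) (auto simp: comp_def intro!: distr_cong measurable_Pair)
  show ?thesis
  proof (cases c)
    case True
    then show ?thesis using T by simp
  next
    case False
    have "distr P borel (\<lambda>\<omega>. real (num False A \<omega>) - real (num True A \<omega>)) =
        distr (distr P borel (\<lambda>\<omega>. real (num True A \<omega>) - real (num False A \<omega>))) borel uminus"
      using nm by (subst distr_distr) (auto simp: comp_def intro!: distr_cong borel_measurable_diff measurable_compose[OF nm])
    also have "\<dots> = diff_law (measure lborel A)" unfolding T diff_law_uminus ..
    finally show ?thesis using False by simp
  qed
qed

end

text \<open>The left intervals are mirror images of the right ones, so that counts on them equal
  \<open>cnt\<close> of the reflected points on half-open intervals, without an endpoint
  error.\<close>

definition stretch :: "bool \<Rightarrow> nat \<Rightarrow> nat \<Rightarrow> real set" where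
  "stretch s j m = (if s then {real j<..real (j + m)} else {- real (j + m)..<- real j})"

lemma stretch_borel: "stretch s j m \<in> sets borel" "bounded (stretch s j m)"
proof -
  show "stretch s j m \<in> sets borel" unfolding stretch_def by simp
  have "stretch s j m \<subseteq> {- real (j + m)..real (j + m)}" unfolding stretch_def by auto
  then show "bounded (stretch s j m)" using bounded_subset bounded_closed_interval by blast
qed

lemma stretch_measure: "measure lborel (stretch s j m) = real m"
  unfolding stretch_def by simp

lemma stretch_unit: "x \<in> stretch s i 1 \<Longrightarrow> (s \<longleftrightarrow> 0 < x) \<and> \<lceil>\<bar>x\<bar>\<rceil> = int i + 1"
  unfolding stretch_def by (auto split: if_splits simp: ceiling_eq_iff)

text \<open>Numbers the unit stretches of both sides by naturals, even codes on the right and odd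
  ones on the left, since independence of counts is formulated for families indexed by
  \<open>nat\<close>.\<close>

definition code :: "bool \<times> nat \<Rightarrow> nat" where "code v = 2 * snd v + (if fst v then 0 else 1)"

definition decode :: "nat \<Rightarrow> real set" where "decode k = stretch (even k) (k div 2) 1"

lemma decode_code: "decode (code v) = stretch (fst v) (snd v) 1"
  unfolding decode_def code_def by (cases "fst v") auto

lemma disjoint_decode: "disjoint_family decode"
  unfolding disjoint_family_on_def
proof (intro ballI impI)
  fix k l :: nat assume ne: "k \<noteq> l"
  have False if "x \<in> decode k" "x \<in> decode l" for x
  proof -
    have "even k \<longleftrightarrow> even l" "k div 2 = l div 2"
      using stretch_unit[of x "even k" "k div 2"] stretch_unit[of x "even l" "l div 2"] that
      unfolding decode_def by auto
    then have "k = l" by (metis even_two_times_div_two odd_two_times_div_two_succ)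
    then show False using ne by simp
  qed
  then show "decode k \<inter> decode l = {}" by blast
qed

context poisson_pair
begin

text \<open>The sign is that of the outward walk: red minus blue on the right, blue minus red on the
  left. Descents on the two sides thus become the same event.\<close>

definition Z :: "bool \<times> nat \<Rightarrow> 'w \<Rightarrow> real" where
  "Z v \<omega> = real (num (fst v) (stretch (fst v) (snd v) 1) \<omega>) - real (num (\<not> fst v) (stretch (fst v) (snd v) 1) \<omega>)"

lemma indep_Z: "indep_vars (\<lambda>_. borel) Z UNIV"
proof -
  let ?K = "\<lambda>v. UNIV \<times> {code v} :: (bool \<times> nat) set"
  have A: "decode i \<in> sets borel \<and> bounded (decode i)" for i
    unfolding decode_def using stretch_borel by blast
  have inj: "code v = code w \<Longrightarrow> v = w" for v w
    unfolding code_def by (cases v; cases w) (auto split: if_splits; presburger)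
  have "indep_vars (\<lambda>v. PiM (?K v) (\<lambda>_. count_space UNIV))
      (\<lambda>v \<omega>. restrict (\<lambda>ci. num (fst ci) (decode (snd ci)) \<omega>) (?K v)) UNIV"
    by (rule indep_vars_restrict[OF indep_nums[OF disjoint_decode A]]) (auto simp: disjoint_family_on_def dest: inj)
  then have "indep_vars (\<lambda>_. borel) (\<lambda>v \<omega>. (\<lambda>\<phi>. real (\<phi> (fst v, code v)) - real (\<phi> (\<not> fst v, code v)))
      (restrict (\<lambda>ci. num (fst ci) (decode (snd ci)) \<omega>) (?K v))) UNIV"
  proof (rule indep_vars_compose2)
    fix v
    have c: "(\<lambda>\<phi>. \<phi> (c, code v)) \<in> measurable (PiM (?K v) (\<lambda>_. count_space UNIV)) (count_space (UNIV :: nat set))" for c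
      by (rule measurable_component_singleton) simp
    have "(\<lambda>\<phi>. real (\<phi> (c, code v))) \<in> borel_measurable (PiM (?K v) (\<lambda>_. count_space (UNIV :: nat set)))" for c
      by (rule measurable_compose[OF c]) simp
    then show "(\<lambda>\<phi>. real (\<phi> (fst v, code v)) - real (\<phi> (\<not> fst v, code v))) \<in> borel_measurable (PiM (?K v) (\<lambda>_. count_space (UNIV :: nat set)))"
      by (intro borel_measurable_diff)
  qed
  moreover have "(\<lambda>v \<omega>. (\<lambda>\<phi>. real (\<phi> (fst v, code v)) - real (\<phi> (\<not> fst v, code v)))
      (restrict (\<lambda>ci. num (fst ci) (decode (snd ci)) \<omega>) (?K v))) = Z"
    unfolding Z_def by (intro ext) (simp add: decode_code)
  ultimately show ?thesis by simp
qed

lemma Z_measurable [measurable]: "Z v \<in> borel_measurable P"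
  using indep_Z unfolding indep_vars_def2 by blast

lemma num_stretch_Suc:
  assumes "\<omega> \<in> space P"
  shows "num c (stretch s j (Suc m)) \<omega> = num c (stretch s j m) \<omega> + num c (stretch s (j + m) 1) \<omega>"
proof -
  have fin: "finite (pts c \<omega> \<inter> stretch s j' m')" for j' m'
    using pts_locally_finite[OF assms, of c] stretch_borel(2) unfolding locally_finite_def by blast
  have "stretch s j (Suc m) = stretch s j m \<union> stretch s (j + m) 1" "stretch s j m \<inter> stretch s (j + m) 1 = {}"
    unfolding stretch_def by auto
  then have "pts c \<omega> \<inter> stretch s j (Suc m) = (pts c \<omega> \<inter> stretch s j m) \<union> (pts c \<omega> \<inter> stretch s (j + m) 1)"
    "(pts c \<omega> \<inter> stretch s j m) \<inter> (pts c \<omega> \<inter> stretch s (j + m) 1) = {}" by auto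
  then show ?thesis unfolding num_def using fin by (simp add: card_Un_disjoint)
qed

lemma sum_Z:
  assumes "\<omega> \<in> space P"
  shows "(\<Sum>i\<in>{j..<j + m}. Z (s, i) \<omega>) = real (num s (stretch s j m) \<omega>) - real (num (\<not> s) (stretch s j m) \<omega>)"
proof (induction m)
  case 0
  have "stretch s j 0 = {}" unfolding stretch_def by (cases s) auto
  then show ?case by (simp add: num_def)
next
  case (Suc m)
  have "(\<Sum>i\<in>{j..<j + Suc m}. Z (s, i) \<omega>) = (\<Sum>i\<in>{j..<j + m}. Z (s, i) \<omega>) + Z (s, j + m) \<omega>" by simp
  then show ?case using Suc unfolding num_stretch_Suc[OF assms, of _ s j m] Z_def fst_conv snd_conv of_nat_add by linarith
qed

lemma sum_Z_prob:
  assumes "T \<in> sets borel"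
  shows "prob {\<omega> \<in> space P. (\<Sum>i\<in>{j..<j + m}. Z (s, i) \<omega>) \<in> T} = measure (diff_law (real m)) T"
proof -
  let ?D = "\<lambda>\<omega>. real (num s (stretch s j m) \<omega>) - real (num (\<not> s) (stretch s j m) \<omega>)"
  have nm: "(\<lambda>\<omega>. real (num c (stretch s j m) \<omega>)) \<in> borel_measurable P" for c
    by (rule measurable_compose[OF num_measurable[OF stretch_borel]]) simp
  then have "?D \<in> borel_measurable P" by (intro borel_measurable_diff)
  then have "measure (distr P borel ?D) T = prob (?D -` T \<inter> space P)" using assms by (rule measure_distr)
  moreover have "?D -` T \<inter> space P = {\<omega> \<in> space P. (\<Sum>i\<in>{j..<j + m}. Z (s, i) \<omega>) \<in> T}"
    using sum_Z by auto
  ultimately show ?thesis using diff_distr[OF stretch_borel, of s s j m] unfolding stretch_measure by simp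
qed

lemma num_square_integrable:
  "integrable P (\<lambda>\<omega>. (real (num c (stretch s j 1) \<omega>))\<^sup>2)"
proof -
  have "integrable (distr P (count_space UNIV) (num c (stretch s j 1))) (\<lambda>k. (real k)\<^sup>2)"
    unfolding num_distr[OF stretch_borel] stretch_measure poisson_law_def using poisson_square_integrable[of 1] by simp
  then show ?thesis using num_measurable[OF stretch_borel] by (subst (asm) integrable_distr_eq) auto
qed

lemma Z_square_integrable: "integrable P (\<lambda>\<omega>. (Z v \<omega>)\<^sup>2)"
proof (rule Bochner_Integration.integrable_bound)
  let ?n = "\<lambda>c \<omega>. real (num c (stretch (fst v) (snd v) 1) \<omega>)"
  show "integrable P (\<lambda>\<omega>. 2 * (?n True \<omega>)\<^sup>2 + 2 * (?n False \<omega>)\<^sup>2)"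
    using num_square_integrable by (intro Bochner_Integration.integrable_add integrable_mult_right) auto
  show "(\<lambda>\<omega>. (Z v \<omega>)\<^sup>2) \<in> borel_measurable P" by measurable
  have sq: "(x - y)\<^sup>2 \<le> 2 * x\<^sup>2 + 2 * y\<^sup>2" for x y :: real
    using zero_le_power2[of "x + y"] by (simp add: power2_eq_square algebra_simps)
  show "AE \<omega> in P. norm ((Z v \<omega>)\<^sup>2) \<le> norm (2 * (?n True \<omega>)\<^sup>2 + 2 * (?n False \<omega>)\<^sup>2)"
  proof (rule AE_I2)
    fix \<omega>
    show "norm ((Z v \<omega>)\<^sup>2) \<le> norm (2 * (?n True \<omega>)\<^sup>2 + 2 * (?n False \<omega>)\<^sup>2)"
      using sq[of "?n True \<omega>" "?n False \<omega>"] sq[of "?n False \<omega>" "?n True \<omega>"] unfolding Z_def by (cases "fst v") simp_all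
  qed
qed

lemma Z_distr: "distr P borel (Z v) = diff_law 1"
  using diff_distr[OF stretch_borel, of "fst v" "fst v" "snd v" 1] unfolding stretch_measure Z_def[abs_def] by simp

lemma Z_mean: "expectation (Z v) = 0"
proof -
  have "expectation (Z v) = (\<integral>x. x \<partial>diff_law 1)" unfolding Z_distr[of v, symmetric] by (simp add: integral_distr)
  moreover have "(\<integral>x. x \<partial>diff_law 1) = (\<integral>x. x \<partial>distr (diff_law 1) borel uminus)" unfolding diff_law_uminus ..
  moreover have "\<dots> = (\<integral>x. - x \<partial>diff_law 1)"
    by (rule integral_distr) (auto intro!: measurable_ident_sets)
  moreover have "\<dots> = - (\<integral>x. x \<partial>diff_law 1)" by simp
  ultimately show ?thesis by linarith
qed

text \<open>All increments have law \<open>diff_law 1\<close>, so the variance is common to them. It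
  is positive since one red point and no blue point occur in a unit interval with positive
  probability.\<close>

lemma Z_variance: "\<exists>\<sigma>>0. \<forall>v. variance (Z v) = \<sigma>\<^sup>2"
proof -
  let ?V = "\<integral>x. x\<^sup>2 \<partial>diff_law 1"
  have V: "variance (Z v) = ?V" for v
    unfolding Z_mean Z_distr[of v, symmetric] by (simp add: integral_distr)
  let ?v = "(True, 0) :: bool \<times> nat" and ?A = "stretch True 0 1"
  have "0 \<le> ?V" by simp
  moreover have "?V \<noteq> 0"
  proof
    assume "?V = 0"
    then have "expectation (\<lambda>\<omega>. (Z ?v \<omega>)\<^sup>2) = 0" using V[of ?v] unfolding Z_mean by simp
    then have "AE \<omega> in P. (Z ?v \<omega>)\<^sup>2 = 0"
      using integral_nonneg_eq_0_iff_AE[OF Z_square_integrable[of ?v]] by simp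
    then have "AE \<omega> in P. Z ?v \<omega> = 0" by simp
    moreover have "prob ((\<lambda>\<omega>. (num True ?A \<omega>, num False ?A \<omega>)) -` ({1} \<times> {0}) \<inter> space P) = exp (- 1) * exp (- 1)"
    proof -
      have "prob ((\<lambda>\<omega>. (num True ?A \<omega>, num False ?A \<omega>)) -` ({1} \<times> {0}) \<inter> space P) =
          prob (num True ?A -` {1} \<inter> space P) * prob (num False ?A -` {0} \<inter> space P)"
        by (rule indep_varD[OF indep_colours[OF stretch_borel]]) auto
      also have "num True ?A -` {1} \<inter> space P = {\<omega> \<in> space P. num True ?A \<omega> \<in> {1}}" by auto
      also have "num False ?A -` {0} \<inter> space P = {\<omega> \<in> space P. num False ?A \<omega> \<in> {0}}" by auto
      finally show ?thesis unfolding num_event(2)[OF stretch_borel] stretch_measure poisson_law_def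
        by (simp add: measure_pmf_single)
    qed
    ultimately have "AE \<omega> in P. \<omega> \<notin> (\<lambda>\<omega>. (num True ?A \<omega>, num False ?A \<omega>)) -` ({1} \<times> {0}) \<inter> space P"
      by (auto simp: Z_def elim!: AE_mp)
    moreover have "(\<lambda>\<omega>. (num True ?A \<omega>, num False ?A \<omega>)) -` ({1} \<times> {0}) \<inter> space P \<in> events"
    proof -
      have "(\<lambda>\<omega>. (num True ?A \<omega>, num False ?A \<omega>)) -` ({1} \<times> {0}) \<inter> space P =
        {\<omega> \<in> space P. num True ?A \<omega> \<in> {1}} \<inter> {\<omega> \<in> space P. num False ?A \<omega> \<in> {0}}" by auto
      then show ?thesis by (simp only: sets.Int num_event(1)[OF stretch_borel])
    qed
    ultimately have "prob ((\<lambda>\<omega>. (num True ?A \<omega>, num False ?A \<omega>)) -` ({1} \<times> {0}) \<inter> space P) = 0"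
      by (simp add: prob_eq_0)
    then show False
      using \<open>prob ((\<lambda>\<omega>. (num True ?A \<omega>, num False ?A \<omega>)) -` ({1} \<times> {0}) \<inter> space P) = exp (- 1) * exp (- 1)\<close>
      by (metis exp_not_eq_zero mult_eq_0_iff)
  qed
  ultimately have "0 < ?V" by linarith
  then show ?thesis using V by (intro exI[of _ "sqrt ?V"]) simp
qed

lemma indep_Z_row: "indep_vars (\<lambda>_. borel) (\<lambda>i. Z (s, j + i)) (UNIV :: nat set)"
proof -
  have "indep_vars (\<lambda>i. PiM {(s, j + i)} (\<lambda>_. borel)) (\<lambda>i \<omega>. restrict (\<lambda>v. Z v \<omega>) {(s, j + i)}) UNIV"
    by (rule indep_vars_restrict[OF indep_Z]) (auto simp: disjoint_family_on_def)
  then have "indep_vars (\<lambda>_. borel) (\<lambda>i \<omega>. (\<lambda>\<phi>. \<phi> (s, j + i)) (restrict (\<lambda>v. Z v \<omega>) {(s, j + i)})) UNIV"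
    by (rule indep_vars_compose2) (rule measurable_component_singleton, simp)
  then show ?thesis by simp
qed

text \<open>Stated for \<open>diff_law\<close>, so that it applies to stretches on either side and
  with any starting point.\<close>

lemma clt:
  "\<exists>\<sigma>>0. \<forall>x. (\<lambda>n. measure (diff_law (real n)) {..x * (\<sigma> * sqrt (real n))}) \<longlonglongrightarrow> cdf std_normal_distribution x"
proof -
  obtain \<sigma> where \<sigma>: "0 < \<sigma>" "\<And>v. variance (Z v) = \<sigma>\<^sup>2" using Z_variance by blast
  have wc: "weak_conv_m (\<lambda>n. distr P borel (\<lambda>x. (\<Sum>i<n. Z (True, 0 + i) x) / sqrt (real n * \<sigma>\<^sup>2))) std_normal_distribution"
    by (rule central_limit_theorem_zero_mean[OF indep_Z_row Z_mean \<sigma>(1) Z_square_integrable \<sigma>(2) Z_distr])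
  have "(\<lambda>n. measure (diff_law (real n)) {..x * (\<sigma> * sqrt (real n))}) \<longlonglongrightarrow> cdf std_normal_distribution x" for x
  proof -
    interpret N: real_distribution std_normal_distribution by (rule real_dist_normal_dist)
    have "emeasure std_normal_distribution {x} = 0"
      by (simp add: emeasure_density nn_integral_indicator_singleton')
    then have "isCont (cdf std_normal_distribution) x"
      unfolding N.isCont_cdf by (simp add: measure_def)
    then have "(\<lambda>n. cdf (distr P borel (\<lambda>x. (\<Sum>i<n. Z (True, 0 + i) x) / sqrt (real n * \<sigma>\<^sup>2))) x) \<longlonglongrightarrow> cdf std_normal_distribution x"
      using wc unfolding weak_conv_m_def weak_conv_def by blast
    moreover have "\<forall>\<^sub>F n in sequentially. cdf (distr P borel (\<lambda>x. (\<Sum>i<n. Z (True, 0 + i) x) / sqrt (real n * \<sigma>\<^sup>2))) x =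
        measure (diff_law (real n)) {..x * (\<sigma> * sqrt (real n))}"
      using eventually_gt_at_top[of 0]
    proof eventually_elim
      case (elim n)
      have "cdf (distr P borel (\<lambda>x. (\<Sum>i<n. Z (True, 0 + i) x) / sqrt (real n * \<sigma>\<^sup>2))) x =
          prob ((\<lambda>x. (\<Sum>i<n. Z (True, 0 + i) x) / sqrt (real n * \<sigma>\<^sup>2)) -` {..x} \<inter> space P)"
        unfolding cdf_def by (rule measure_distr) auto
      also have "(\<lambda>x. (\<Sum>i<n. Z (True, 0 + i) x) / sqrt (real n * \<sigma>\<^sup>2)) -` {..x} \<inter> space P =
          {\<omega> \<in> space P. (\<Sum>i\<in>{0..<0 + n}. Z (True, i) \<omega>) \<in> {..x * (\<sigma> * sqrt (real n))}}"
        using elim \<sigma>(1) by (auto simp: real_sqrt_mult pos_divide_le_eq lessThan_atLeast0 mult.commute mult.left_commute)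
      also have "prob \<dots> = measure (diff_law (real n)) {..x * (\<sigma> * sqrt (real n))}"
        by (rule sum_Z_prob) simp
      finally show ?case .
    qed
    ultimately show ?thesis by (rule Lim_transform_eventually)
  qed
  then show ?thesis using \<sigma>(1) by blast
qed

lemma std_normal_cdf_pos: "0 < cdf std_normal_distribution x"
proof (rule ccontr)
  assume "\<not> 0 < cdf std_normal_distribution x"
  interpret N: real_distribution std_normal_distribution by (rule real_dist_normal_dist)
  have "measure std_normal_distribution {..x} = 0"
    using \<open>\<not> 0 < cdf std_normal_distribution x\<close> N.cdf_nonneg[of x] unfolding cdf_def by linarith
  then have "{..x} \<in> null_sets std_normal_distribution" by (simp add: null_sets_def N.emeasure_eq_measure)
  then have "AE y in lborel. y \<in> {..x} \<longrightarrow> ennreal (std_normal_density y) = 0"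
    by (subst (asm) null_sets_density_iff) auto
  moreover have "ennreal (std_normal_density y) \<noteq> 0" for y
    using normal_density_pos[of 1 0 y] by (simp add: ennreal_eq_0_iff)
  ultimately have "AE y in lborel. y \<notin> {..x}" by auto
  then have "{..x} \<in> null_sets lborel" by (simp add: AE_iff_null_sets)
  moreover have "{x - 1..x} \<subseteq> {..x}" by auto
  ultimately have "{x - 1..x} \<in> null_sets lborel"
    using null_sets_subset[of "{..x}" lborel "{x - 1..x}"] by simp
  then show False by (simp add: null_sets_def)
qed

text \<open>Lengths \<open>n\<^sup>2\<close> turn the normalisation into a multiple of
  \<open>n\<close>. The bound \<open>\<delta> / 2\<close> for large rises anticipates the factor 2
  in the maximal inequality.\<close>

lemma clt_bounds:
  "\<exists>\<delta>>0. \<exists>L :: nat. \<forall>\<^sub>F n in sequentially.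
     2 * \<delta> \<le> measure (diff_law (real (n\<^sup>2))) {..- real n} \<and> measure (diff_law (real (n\<^sup>2))) {real (L * n)<..} \<le> \<delta> / 2"
proof -
  obtain \<sigma> where \<sigma>: "0 < \<sigma>" and lim: "\<And>x. (\<lambda>n. measure (diff_law (real n)) {..x * (\<sigma> * sqrt (real n))}) \<longlonglongrightarrow> cdf std_normal_distribution x"
    using clt by blast
  interpret N: real_distribution std_normal_distribution by (rule real_dist_normal_dist)
  \<comment> \<open>A third of the limiting probability, so that \<open>2 * \<delta>\<close> lies
    strictly below the limit.\<close>
  define \<delta> where "\<delta> = cdf std_normal_distribution (- 1 / \<sigma>) / 3"
  have \<delta>: "0 < \<delta>" unfolding \<delta>_def using std_normal_cdf_pos by simp
  have "\<forall>\<^sub>F y in at_top. 1 - \<delta> / 4 < cdf std_normal_distribution y"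
    using order_tendstoD(1)[OF N.cdf_lim_at_top_prob, of "1 - \<delta> / 4"] \<delta> by simp
  then obtain y where y: "\<And>z. y \<le> z \<Longrightarrow> 1 - \<delta> / 4 < cdf std_normal_distribution z"
    unfolding eventually_at_top_linorder by blast
  obtain L :: nat where "y * \<sigma> \<le> real L" using real_arch_simple by blast
  then have L: "1 - \<delta> / 4 < cdf std_normal_distribution (real L / \<sigma>)" using \<sigma> by (intro y) (simp add: field_simps)
  have sq: "filterlim (\<lambda>n :: nat. n\<^sup>2) sequentially sequentially"
    by (rule filterlim_at_top_mono[OF filterlim_ident]) (auto simp: power2_eq_square)
  have lim2: "(\<lambda>n. measure (diff_law (real (n\<^sup>2))) {..x * \<sigma> * real n}) \<longlonglongrightarrow> cdf std_normal_distribution x" for x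
    using filterlim_compose[OF lim[of x] sq] by (simp add: real_sqrt_abs mult.assoc)
  have "\<forall>\<^sub>F n in sequentially. 2 * \<delta> < measure (diff_law (real (n\<^sup>2))) {..(- 1 / \<sigma>) * \<sigma> * real n}"
    using order_tendstoD(1)[OF lim2[of "- 1 / \<sigma>"], of "2 * \<delta>"] std_normal_cdf_pos[of "- 1 / \<sigma>"] unfolding \<delta>_def by simp
  moreover have "\<forall>\<^sub>F n in sequentially. 1 - \<delta> / 4 < measure (diff_law (real (n\<^sup>2))) {..(real L / \<sigma>) * \<sigma> * real n}"
    using order_tendstoD(1)[OF lim2 L] .
  ultimately have "\<forall>\<^sub>F n in sequentially.
     2 * \<delta> \<le> measure (diff_law (real (n\<^sup>2))) {..- real n} \<and> measure (diff_law (real (n\<^sup>2))) {real (L * n)<..} \<le> \<delta> / 2"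
  proof eventually_elim
    case (elim n)
    interpret D: prob_space "diff_law (real (n\<^sup>2))" by (rule prob_space_diff_law)
    have e: "(- 1 / \<sigma>) * \<sigma> * real n = - real n" "(real L / \<sigma>) * \<sigma> * real n = real (L * n)" using \<sigma> by simp_all
    have "{real (L * n)<..} = space (diff_law (real (n\<^sup>2))) - {..real (L * n)}" by auto
    then have "measure (diff_law (real (n\<^sup>2))) {real (L * n)<..} = 1 - measure (diff_law (real (n\<^sup>2))) {..real (L * n)}"
      using D.prob_compl[of "{..real (L * n)}"] by simp
    then show ?case using elim \<delta> unfolding e by simp
  qed
  then show ?thesis using \<delta> by blast
qed

section \<open>Descents on blocks of pieces\<close>

definition piece :: "nat \<Rightarrow> nat \<Rightarrow> bool \<Rightarrow> nat \<Rightarrow> (bool \<times> nat \<Rightarrow> real) \<Rightarrow> bool" where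
  "piece L n s j \<phi> \<longleftrightarrow> (\<Sum>i\<in>{j..<j + n\<^sup>2}. \<phi> (s, i)) \<le> - real n \<and>
     (\<forall>k\<in>{..n\<^sup>2}. (\<Sum>i\<in>{j..<j + k}. \<phi> (s, i)) \<le> real (L * n))"

lemma sum_shift: "(\<Sum>i<k. f (j + i)) = (\<Sum>i\<in>{j..<j + k}. f i)" for f :: "nat \<Rightarrow> real"
  by (induction k) simp_all

text \<open>The drop by \<open>n\<close> has probability at least \<open>2 * \<delta>\<close>, and
  by the maximal inequality a rise above \<open>L * n\<close> has probability at most
  \<open>\<delta>\<close>. Neither estimate depends on the side or the position.\<close>

lemma piece_prob:
  "\<exists>\<delta>>0. \<exists>L n0. \<forall>n\<ge>n0. \<forall>s j. \<delta> \<le> prob {\<omega> \<in> space P. piece L n s j (\<lambda>v. Z v \<omega>)}"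
proof -
  obtain \<delta> L n0 where \<delta>: "0 < \<delta>" and b: "\<And>n. n \<ge> n0 \<Longrightarrow> 2 * \<delta> \<le> measure (diff_law (real (n\<^sup>2))) {..- real n} \<and>
      measure (diff_law (real (n\<^sup>2))) {real (L * n)<..} \<le> \<delta> / 2"
    using clt_bounds unfolding eventually_sequentially by blast
  have "\<delta> \<le> prob {\<omega> \<in> space P. piece L n s j (\<lambda>v. Z v \<omega>)}" if n: "n \<ge> n0" for n s j
  proof -
    let ?E = "{\<omega> \<in> space P. (\<Sum>i\<in>{j..<j + n\<^sup>2}. Z (s, i) \<omega>) \<in> {..- real n}}"
    let ?F = "{\<omega> \<in> space P. \<exists>k\<le>n\<^sup>2. real (L * n) < (\<Sum>i<k. Z (s, j + i) \<omega>)}"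
    have "prob ?F \<le> 2 * prob {\<omega> \<in> space P. real (L * n) < (\<Sum>i<n\<^sup>2. Z (s, j + i) \<omega>)}"
    proof (rule levy_maximal[OF indep_Z_row])
      fix k assume k: "k \<le> n\<^sup>2"
      have "(\<Sum>i\<in>{k..<n\<^sup>2}. Z (s, j + i) \<omega>) = (\<Sum>i\<in>{j + k..<j + k + (n\<^sup>2 - k)}. Z (s, i) \<omega>)" for \<omega>
        using sum.shift_bounds_nat_ivl[of "\<lambda>i. Z (s, i) \<omega>" k j "n\<^sup>2"] k by (simp add: add.commute)
      then show "1 / 2 \<le> prob {w \<in> space P. 0 \<le> (\<Sum>i\<in>{k..<n\<^sup>2}. Z (s, j + i) w)}"
        using sum_Z_prob[of "{0..}" s "j + k" "n\<^sup>2 - k"] diff_law_nonneg[of "real (n\<^sup>2 - k)"] by simp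
    qed
    also have "prob {\<omega> \<in> space P. real (L * n) < (\<Sum>i<n\<^sup>2. Z (s, j + i) \<omega>)} = measure (diff_law (real (n\<^sup>2))) {real (L * n)<..}"
      using sum_Z_prob[of "{real (L * n)<..}" s j "n\<^sup>2"] unfolding sum_shift[of "\<lambda>i. Z (s, i) _"] by simp
    finally have F: "prob ?F \<le> \<delta>" using b[OF n] by simp
    have E: "2 * \<delta> \<le> prob ?E" using sum_Z_prob[of "{..- real n}" s j "n\<^sup>2"] b[OF n] by simp
    have mF: "?F \<in> events" by measurable
    have mE: "?E \<in> events" by measurable
    have "prob ?E \<le> prob ({\<omega> \<in> space P. piece L n s j (\<lambda>v. Z v \<omega>)} \<union> ?F)"
    proof (rule finite_measure_mono)
      show "?E \<subseteq> {\<omega> \<in> space P. piece L n s j (\<lambda>v. Z v \<omega>)} \<union> ?F"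
        unfolding piece_def sum_shift[of "\<lambda>i. Z (s, i) _"] by (auto simp: not_le)
      show "{\<omega> \<in> space P. piece L n s j (\<lambda>v. Z v \<omega>)} \<union> ?F \<in> events"
        using mF unfolding piece_def by measurable
    qed
    also have "\<dots> \<le> prob {\<omega> \<in> space P. piece L n s j (\<lambda>v. Z v \<omega>)} + prob ?F"
      by (rule measure_Un_le) (use mF in \<open>auto simp: piece_def\<close>)
    finally show ?thesis using E F by linarith
  qed
  then show ?thesis using \<delta> by blast
qed

lemma piece_measurable:
  assumes "{s} \<times> {j..<j + n\<^sup>2} \<subseteq> K"
  shows "{\<phi> \<in> space (PiM K (\<lambda>_. borel)). piece L n s j \<phi>} \<in> sets (PiM K (\<lambda>_. borel :: real measure))"
proof -
  have s: "(\<lambda>\<phi>. \<Sum>i\<in>{j..<j + k}. \<phi> (s, i)) \<in> borel_measurable (PiM K (\<lambda>_. borel :: real measure))" if "k \<le> n\<^sup>2" for k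
    by (intro borel_measurable_sum measurable_component_singleton) (use that assms in auto)
  have a: "{\<phi> \<in> space (PiM K (\<lambda>_. borel)). (\<Sum>i\<in>{j..<j + n\<^sup>2}. \<phi> (s, i)) \<le> - real n} \<in> sets (PiM K (\<lambda>_. borel :: real measure))"
    using s[OF order_refl] by measurable
  have b: "{\<phi> \<in> space (PiM K (\<lambda>_. borel)). \<forall>k\<in>{..n\<^sup>2}. (\<Sum>i\<in>{j..<j + k}. \<phi> (s, i)) \<le> real (L * n)} \<in> sets (PiM K (\<lambda>_. borel :: real measure))"
  proof (rule sets.sets_Collect_finite_All)
    fix k assume "k \<in> {..n\<^sup>2}"
    then have "(\<lambda>\<phi>. \<Sum>i\<in>{j..<j + k}. \<phi> (s, i)) \<in> borel_measurable (PiM K (\<lambda>_. borel :: real measure))" by (intro s) simp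
    then show "{\<phi> \<in> space (PiM K (\<lambda>_. borel)). (\<Sum>i\<in>{j..<j + k}. \<phi> (s, i)) \<le> real (L * n)} \<in> sets (PiM K (\<lambda>_. borel :: real measure))"
      by measurable
  qed simp
  have "{\<phi> \<in> space (PiM K (\<lambda>_. borel)). piece L n s j \<phi>} =
    {\<phi> \<in> space (PiM K (\<lambda>_. borel)). (\<Sum>i\<in>{j..<j + n\<^sup>2}. \<phi> (s, i)) \<le> - real n} \<inter>
    {\<phi> \<in> space (PiM K (\<lambda>_. borel)). \<forall>k\<in>{..n\<^sup>2}. (\<Sum>i\<in>{j..<j + k}. \<phi> (s, i)) \<le> real (L * n)}"
    unfolding piece_def by auto
  then show ?thesis using sets.Int[OF a b] by simp
qed

lemma piece_restrict:
  assumes "{s} \<times> {j..<j + n\<^sup>2} \<subseteq> K"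
  shows "piece L n s j (restrict \<phi> K) \<longleftrightarrow> piece L n s j \<phi>"
proof -
  have "(\<Sum>i\<in>{j..<j + k}. restrict \<phi> K (s, i)) = (\<Sum>i\<in>{j..<j + k}. \<phi> (s, i))" if "k \<le> n\<^sup>2" for k
  proof (rule sum.cong[OF refl])
    fix i assume "i \<in> {j..<j + k}"
    then have "(s, i) \<in> {s} \<times> {j..<j + n\<^sup>2}" using that by simp
    then have "(s, i) \<in> K" using assms by blast
    then show "restrict \<phi> K (s, i) = \<phi> (s, i)" by simp
  qed
  then show ?thesis unfolding piece_def by auto
qed

definition block :: "nat \<Rightarrow> nat \<Rightarrow> nat \<Rightarrow> (bool \<times> nat \<Rightarrow> real) \<Rightarrow> bool" where
  "block N L n \<phi> \<longleftrightarrow> (\<forall>sq\<in>UNIV \<times> {..<N}. piece L n (fst sq) (n + snd sq * n\<^sup>2) \<phi>)"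

lemma block_indices:
  fixes n q N :: nat
  assumes "q < N"
  shows "{n + q * n\<^sup>2..<n + q * n\<^sup>2 + n\<^sup>2} \<subseteq> {n..<n + N * n\<^sup>2}"
proof -
  have "Suc q * n\<^sup>2 \<le> N * n\<^sup>2" using assms by (intro mult_right_mono) auto
  then show ?thesis by auto
qed

text \<open>A block consists of \<open>2 * N\<close> pieces with disjoint index ranges,
  \<open>N\<close> on each side.\<close>

lemma block_prob:
  assumes \<delta>: "0 < \<delta>" and p: "\<And>s j. \<delta> \<le> prob {\<omega> \<in> space P. piece L n s j (\<lambda>v. Z v \<omega>)}" and N: "0 < N"
  shows "\<delta> ^ (2 * N) \<le> prob {\<omega> \<in> space P. block N L n (\<lambda>v. Z v \<omega>)}"
proof -
  let ?I = "UNIV \<times> {..<N} :: (bool \<times> nat) set"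
  let ?K = "\<lambda>sq. {fst sq} \<times> {n + snd sq * n\<^sup>2..<n + snd sq * n\<^sup>2 + n\<^sup>2} :: (bool \<times> nat) set"
  let ?F = "\<lambda>sq. {\<omega> \<in> space P. piece L n (fst sq) (n + snd sq * n\<^sup>2) (\<lambda>v. Z v \<omega>)}"
  have dj: "disjoint_family_on ?K ?I"
    unfolding disjoint_family_on_def
  proof (intro ballI impI)
    fix u v :: "bool \<times> nat" assume "u \<noteq> v"
    have "u = v" if "x \<in> ?K u" "x \<in> ?K v" for x
    proof -
      have q: "snd w = (snd x - n) div n\<^sup>2" if "x \<in> ?K w" for w
      proof -
        have "snd w * n\<^sup>2 \<le> snd x - n" "snd x - n < Suc (snd w) * n\<^sup>2" using that by auto
        then show ?thesis by (metis div_nat_eqI mult.commute)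
      qed
      show ?thesis using q[OF that(1)] q[OF that(2)] that by (auto simp: prod_eq_iff)
    qed
    then show "?K u \<inter> ?K v = {}" using \<open>u \<noteq> v\<close> by blast
  qed
  have "indep_vars (\<lambda>sq. PiM (?K sq) (\<lambda>_. borel)) (\<lambda>sq \<omega>. restrict (\<lambda>v. Z v \<omega>) (?K sq)) ?I"
    by (rule indep_vars_restrict[OF indep_Z _ dj]) simp
  then have "indep_events (\<lambda>sq. {\<omega> \<in> space P. piece L n (fst sq) (n + snd sq * n\<^sup>2) (restrict (\<lambda>v. Z v \<omega>) (?K sq))}) ?I"
    by (rule indep_eventsI_indep_vars) (rule piece_measurable, simp)
  moreover have "piece L n (fst sq) (n + snd sq * n\<^sup>2) (restrict \<phi> (?K sq)) \<longleftrightarrow> piece L n (fst sq) (n + snd sq * n\<^sup>2) \<phi>" for sq \<phi>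
    by (rule piece_restrict) (rule order_refl)
  ultimately have ie: "indep_events ?F ?I" by (simp only:)
  have ieD: "\<forall>J\<subseteq>?I. J \<noteq> {} \<longrightarrow> finite J \<longrightarrow> prob (\<Inter>sq\<in>J. ?F sq) = (\<Prod>sq\<in>J. prob (?F sq))"
    using ie unfolding indep_events_def by (rule conjunct2)
  have ne: "?I \<noteq> {}" "finite ?I" using N by (auto simp: lessThan_empty_iff)
  have "prob (\<Inter>sq\<in>?I. ?F sq) = (\<Prod>sq\<in>?I. prob (?F sq))"
    by (rule ieD[rule_format, OF order_refl ne])
  moreover have "(\<Prod>sq\<in>?I. \<delta>) \<le> (\<Prod>sq\<in>?I. prob (?F sq))" using p \<delta> by (intro prod_mono) auto
  moreover have "(\<Inter>sq\<in>?I. ?F sq) = {\<omega> \<in> space P. block N L n (\<lambda>v. Z v \<omega>)}"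
    using N unfolding block_def by auto
  ultimately show ?thesis by (simp add: card_cartesian_product)
qed

text \<open>Each scale starts where the block of the previous one ends, so the block events are
  independent. Their limit superior has probability at least \<open>\<delta> ^ (2 * N)\<close>, and
  the 0-1 law raises this to 1.\<close>

lemma blocks_infinitely_often:
  assumes \<delta>: "0 < \<delta>" and p: "\<And>n s j. n0 \<le> n \<Longrightarrow> \<delta> \<le> prob {\<omega> \<in> space P. piece L n s j (\<lambda>v. Z v \<omega>)}" and N: "0 < N"
  shows "AE \<omega> in P. \<exists>\<^sub>F n in sequentially. block N L n (\<lambda>v. Z v \<omega>)"
proof -
  define nn where "nn = rec_nat (Suc n0) (\<lambda>_ m. m + N * m\<^sup>2)"
  have nn0: "nn 0 = Suc n0" and nnS: "nn (Suc k) = nn k + N * (nn k)\<^sup>2" for k unfolding nn_def by simp_all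
  have nnpos: "n0 < nn k" for k by (induction k) (simp_all add: nn0 nnS)
  have nnlt: "nn k < nn (Suc k)" for k
    using nnpos[of k] N unfolding nnS by simp
  then have sm: "strict_mono nn" by (rule strict_mono_Suc_iff[THEN iffD2, rule_format])
  let ?K = "\<lambda>k. UNIV \<times> {nn k..<nn (Suc k)} :: (bool \<times> nat) set"
  let ?F = "\<lambda>k. {\<omega> \<in> space P. block N L (nn k) (\<lambda>v. Z v \<omega>)}"
  have dj: "disjoint_family ?K"
    unfolding disjoint_family_on_def
  proof (intro ballI impI)
    fix k l :: nat assume "k \<noteq> l"
    then consider "Suc k \<le> l" | "Suc l \<le> k" by linarith
    then show "?K k \<inter> ?K l = {}"
    proof cases
      case 1
      then have "nn (Suc k) \<le> nn l" using sm by (simp add: strict_mono_less_eq)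
      then show ?thesis by auto
    next
      case 2
      then have "nn (Suc l) \<le> nn k" using sm by (simp add: strict_mono_less_eq)
      then show ?thesis by auto
    qed
  qed
  have sub: "{s} \<times> {nn k + q * (nn k)\<^sup>2..<nn k + q * (nn k)\<^sup>2 + (nn k)\<^sup>2} \<subseteq> ?K k" if "q < N" for s q k
    using block_indices[OF that, of "nn k"] unfolding nnS by blast
  have "indep_vars (\<lambda>k. PiM (?K k) (\<lambda>_. borel)) (\<lambda>k \<omega>. restrict (\<lambda>v. Z v \<omega>) (?K k)) UNIV"
    by (rule indep_vars_restrict[OF indep_Z _ dj]) simp
  then have "indep_events (\<lambda>k. {\<omega> \<in> space P. block N L (nn k) (restrict (\<lambda>v. Z v \<omega>) (?K k))}) UNIV"
  proof (rule indep_eventsI_indep_vars)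
    fix k
    show "{\<phi> \<in> space (PiM (?K k) (\<lambda>_. borel)). block N L (nn k) \<phi>} \<in> sets (PiM (?K k) (\<lambda>_. borel))"
      unfolding block_def
    proof (rule sets.sets_Collect_finite_All)
      fix sq :: "bool \<times> nat" assume "sq \<in> UNIV \<times> {..<N}"
      then have "snd sq < N" by auto
      then show "{\<phi> \<in> space (PiM (?K k) (\<lambda>_. borel)). piece L (nn k) (fst sq) (nn k + snd sq * (nn k)\<^sup>2) \<phi>} \<in> sets (PiM (?K k) (\<lambda>_. borel))"
        by (intro piece_measurable sub)
    qed simp
  qed
  moreover have "block N L (nn k) (restrict \<phi> (?K k)) \<longleftrightarrow> block N L (nn k) \<phi>" for k \<phi>
    unfolding block_def using piece_restrict[OF sub] by auto
  ultimately have ie: "indep_events ?F UNIV" by simp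
  have ev: "?F k \<in> events" for k using ie unfolding indep_events_def by auto
  have "prob (\<Inter>n. \<Union>m\<in>{n..}. ?F m) \<ge> \<delta> ^ (2 * N)"
  proof -
    have "(\<lambda>n. prob (\<Union>m\<in>{n..}. ?F m)) \<longlonglongrightarrow> prob (\<Inter>n. \<Union>m\<in>{n..}. ?F m)"
    proof (rule finite_Lim_measure_decseq)
      show "range (\<lambda>n. \<Union>m\<in>{n..}. ?F m) \<subseteq> events" using ev by auto
      show "decseq (\<lambda>n. \<Union>m\<in>{n..}. ?F m)" by (intro decseq_SucI UN_mono) auto
    qed
    moreover have "\<delta> ^ (2 * N) \<le> prob (\<Union>m\<in>{n..}. ?F m)" for n
    proof -
      have "\<delta> ^ (2 * N) \<le> prob (?F n)" by (rule block_prob[OF \<delta> p N]) (use nnpos[of n] in simp)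
      also have "\<dots> \<le> prob (\<Union>m\<in>{n..}. ?F m)" by (rule finite_measure_mono) (use ev in auto)
      finally show ?thesis .
    qed
    ultimately show ?thesis by (intro LIMSEQ_le_const) auto
  qed
  moreover have "0 < \<delta> ^ (2 * N)" using \<delta> by simp
  ultimately have "prob (\<Inter>n. \<Union>m\<in>{n..}. ?F m) = 1" using borel_0_1_law[OF ie] by linarith
  moreover have "(\<Inter>n. \<Union>m\<in>{n..}. ?F m) \<in> events" using ev by auto
  ultimately have "AE \<omega> in P. \<omega> \<in> (\<Inter>n. \<Union>m\<in>{n..}. ?F m)" by (simp add: prob_eq_1)
  then show ?thesis
  proof (rule AE_mp, intro AE_I2 impI)
    fix \<omega> assume w: "\<omega> \<in> (\<Inter>n. \<Union>m\<in>{n..}. ?F m)"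
    show "\<exists>\<^sub>F n in sequentially. block N L n (\<lambda>v. Z v \<omega>)"
      unfolding frequently_sequentially
    proof
      fix T
      obtain m where "m \<ge> T" "block N L (nn m) (\<lambda>v. Z v \<omega>)" using w by auto
      moreover have "m \<le> nn m" using strict_mono_imp_increasing[OF sm] .
      ultimately show "\<exists>n\<ge>T. block N L n (\<lambda>v. Z v \<omega>)" by (meson order_trans)
    qed
  qed
qed

lemma blocks_all:
  "\<exists>L. AE \<omega> in P. \<forall>N. \<exists>\<^sub>F n in sequentially. block N L n (\<lambda>v. Z v \<omega>)"
proof -
  obtain \<delta> L n0 where d: "0 < \<delta>" "\<And>n s j. n0 \<le> n \<Longrightarrow> \<delta> \<le> prob {\<omega> \<in> space P. piece L n s j (\<lambda>v. Z v \<omega>)}"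
    using piece_prob by blast
  have "AE \<omega> in P. \<forall>N. \<exists>\<^sub>F n in sequentially. block (Suc N) L n (\<lambda>v. Z v \<omega>)"
    unfolding AE_all_countable using blocks_infinitely_often[OF d] by blast
  moreover have "block (Suc N) L n \<phi> \<Longrightarrow> block N L n \<phi>" for N n \<phi> unfolding block_def by auto
  ultimately have "AE \<omega> in P. \<forall>N. \<exists>\<^sub>F n in sequentially. block N L n (\<lambda>v. Z v \<omega>)"
    by (elim AE_mp) (intro AE_I2 impI allI, blast intro: frequently_elim1)
  then show ?thesis by blast
qed

text \<open>Two colours, two sides, \<open>n ^ 3\<close> windows and two tails give the bound
  \<open>8 * n ^ 3 * (99 / 100) ^ n\<close>, which is summable, so the first Borel-Cantelli lemma
  applies.\<close>

lemma windows_dense: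
  "AE \<omega> in P. \<forall>\<^sub>F n in sequentially. \<forall>c s. \<forall>i<n ^ 3. n \<le> 2 * num c (stretch s (i * n) n) \<omega> \<and> num c (stretch s (i * n) n) \<omega> \<le> 2 * n"
proof -
  define D where "D n c s i = {\<omega> \<in> space P. num c (stretch s (i * n) n) \<omega> \<in> {k. 2 * k < n} \<union> {k. 2 * n < k}}" for n c s i
  define A where "A n = (\<Union>x\<in>UNIV \<times> UNIV \<times> {..<n ^ 3}. D n (fst x) (fst (snd x)) (snd (snd x)))" for n
  have mD: "D n c s i \<in> events" for n c s i unfolding D_def by (rule num_event(1)[OF stretch_borel])
  have mA: "A n \<in> events" for n unfolding A_def using mD by (intro sets.finite_UN) auto
  have pD: "prob (D n c s i) \<le> 2 * (99 / 100) ^ n" if "0 < n" for n c s i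
  proof -
    have "prob (D n c s i) = measure_pmf.prob (poisson_pmf (real n)) ({k. 2 * k < n} \<union> {k. 2 * n < k})"
      unfolding D_def num_event(2)[OF stretch_borel] stretch_measure poisson_law_def using that by simp
    also have "\<dots> \<le> measure_pmf.prob (poisson_pmf (real n)) {k. 2 * k < n} + measure_pmf.prob (poisson_pmf (real n)) {k. 2 * n < k}"
      by (rule measure_Un_le) auto
    finally show ?thesis using poisson_tails[OF that] by simp
  qed
  have "prob (A n) \<le> 8 * real n ^ 3 * (99 / 100) ^ n" if "0 < n" for n
  proof -
    have "prob (A n) \<le> (\<Sum>x\<in>UNIV \<times> UNIV \<times> {..<n ^ 3}. prob (D n (fst x) (fst (snd x)) (snd (snd x))))"
      unfolding A_def by (rule finite_measure_subadditive_finite) (use mD in auto)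
    also have "\<dots> \<le> (\<Sum>x\<in>(UNIV \<times> UNIV \<times> {..<n ^ 3} :: (bool \<times> bool \<times> nat) set). 2 * (99 / 100) ^ n)"
      by (intro sum_mono pD that)
    also have "\<dots> = 8 * real n ^ 3 * (99 / 100) ^ n" by (simp add: card_cartesian_product)
    finally show ?thesis .
  qed
  note pA = this
  have "summable (\<lambda>n. prob (A n))"
  proof (rule summable_comparison_test_bigo)
    show "summable (\<lambda>n. norm ((999 / 1000 :: real) ^ n))" by (simp add: summable_geometric)
    have "(\<lambda>n. prob (A n)) \<in> O(\<lambda>n. 8 * real n ^ 3 * (99 / 100) ^ n)"
      by (intro bigoI[of _ 1] eventually_mono[OF eventually_gt_at_top[of 0]]) (use pA in auto)
    also have "(\<lambda>n. 8 * real n ^ 3 * (99 / 100) ^ n) \<in> O(\<lambda>n. (999 / 1000) ^ n)" by real_asymp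
    finally show "(\<lambda>n. prob (A n)) \<in> O(\<lambda>n. (999 / 1000) ^ n)" .
  qed
  then have "AE \<omega> in P. \<forall>\<^sub>F n in sequentially. \<omega> \<in> space P - A n"
    by (intro borel_cantelli_AE1 mA) (simp_all add: less_top[symmetric])
  then show ?thesis
  proof (rule AE_mp, intro AE_I2 impI)
    fix \<omega> assume "\<forall>\<^sub>F n in sequentially. \<omega> \<in> space P - A n"
    then show "\<forall>\<^sub>F n in sequentially. \<forall>c s. \<forall>i<n ^ 3. n \<le> 2 * num c (stretch s (i * n) n) \<omega> \<and> num c (stretch s (i * n) n) \<omega> \<le> 2 * n"
    proof eventually_elim
      case (elim n)
      show ?case
      proof (intro allI impI)
        fix c s i assume "i < n ^ 3"
        then have "\<omega> \<notin> D n c s i" "\<omega> \<in> space P" using elim unfolding A_def by force+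
        then show "n \<le> 2 * num c (stretch s (i * n) n) \<omega> \<and> num c (stretch s (i * n) n) \<omega> \<le> 2 * n"
          unfolding D_def by auto
      qed
    qed
  qed
qed

end

section \<open>Thin sets are avoided\<close>

definition grid :: "nat \<Rightarrow> int \<Rightarrow> real set" where
  "grid N k = {real_of_int k / real N<..(real_of_int k + 1) / real N}"

definition grid_index :: "nat \<Rightarrow> real \<Rightarrow> int" where
  "grid_index N x = \<lceil>x * real N\<rceil> - 1"

lemma mem_grid: "0 < N \<Longrightarrow> x \<in> grid N k \<longleftrightarrow> grid_index N x = k"
  unfolding grid_def grid_index_def by (auto simp: field_simps ceiling_eq_iff; linarith)

lemma grid_borel: "grid N k \<in> sets borel" "bounded (grid N k)"
proof -
  show "grid N k \<in> sets borel" unfolding grid_def by simp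
  show "bounded (grid N k)"
    by (rule bounded_subset[OF bounded_closed_interval[of "real_of_int k / real N" "(real_of_int k + 1) / real N"]])
      (auto simp: grid_def)
qed

lemma grid_measure: "0 < N \<Longrightarrow> measure lborel (grid N k) = 1 / real N"
  unfolding grid_def by (simp add: field_simps)

lemma grid_index_close: "0 < N \<Longrightarrow> grid_index N x = grid_index N y \<Longrightarrow> \<bar>x - y\<bar> < 1 / real N"
proof -
  assume N: "0 < N" and e: "grid_index N x = grid_index N y"
  have "x \<in> grid N (grid_index N x)" "y \<in> grid N (grid_index N x)" using mem_grid[OF N] e by auto
  then show ?thesis using N unfolding grid_def by (auto simp: field_simps abs_less_iff)
qed

lemma card_bounded_ints:
  fixes S :: "int set"
  assumes "\<And>a b. a \<in> S \<Longrightarrow> b \<in> S \<Longrightarrow> \<bar>a - b\<bar> \<le> int D"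
  shows "card S \<le> 2 * D + 1"
proof (cases "S = {}")
  case False
  then obtain a where a: "a \<in> S" by blast
  have "S \<subseteq> {a - int D..a + int D}"
  proof
    fix b assume "b \<in> S"
    then have "\<bar>b - a\<bar> \<le> int D" using assms a by blast
    then show "b \<in> {a - int D..a + int D}" by auto
  qed
  then have "card S \<le> card {a - int D..a + int D}" by (intro card_mono) auto
  then show ?thesis by simp
qed simp

text \<open>All coordinates but the \<open>j\<close>-th determine the cell of the \<open>j\<close>-th one up to boundedly many choices.\<close>

lemma thin_cells:
  fixes Bad :: "(nat \<Rightarrow> real) set" and N m Mb D :: nat
  assumes j: "j < m" and N: "0 < N"
    and bnd: "\<And>v i. v \<in> Bad \<Longrightarrow> i < m \<Longrightarrow> \<bar>v i\<bar> \<le> real Mb"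
    and thin: "\<And>v v'. v \<in> Bad \<Longrightarrow> v' \<in> Bad \<Longrightarrow> (\<And>i. i < m \<Longrightarrow> i \<noteq> j \<Longrightarrow> \<bar>v i - v' i\<bar> \<le> 1 / real N) \<Longrightarrow>
      \<bar>v j - v' j\<bar> \<le> real D / real N"
  shows "finite ((\<lambda>v. restrict (\<lambda>i. grid_index N (v i)) {..<m}) ` Bad)" (is "finite ?T")
    and "card ((\<lambda>v. restrict (\<lambda>i. grid_index N (v i)) {..<m}) ` Bad) \<le> (2 * Mb + 3) ^ (m - 1) * N ^ (m - 1) * (2 * D + 3)"
proof -
  let ?k = "\<lambda>v. restrict (\<lambda>i. grid_index N (v i)) {..<m}"
  let ?I = "{- int (Mb * N) - 1..int (Mb * N)}"
  let ?J = "{..<m} - {j}"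
  have idx: "grid_index N (v i) \<in> ?I" if "v \<in> Bad" "i < m" for v i
  proof -
    have "- real Mb \<le> v i" "v i \<le> real Mb" using bnd[OF that] by auto
    then have "- real Mb * real N \<le> v i * real N" "v i * real N \<le> real Mb * real N" by (intro mult_right_mono; simp)+
    then have "\<lceil>v i * real N\<rceil> \<le> int (Mb * N)" "- int (Mb * N) \<le> \<lceil>v i * real N\<rceil>"
      by (simp_all add: ceiling_le_iff le_ceiling_iff)
    then show ?thesis unfolding grid_index_def by simp
  qed
  have TP: "?T \<subseteq> PiE {..<m} (\<lambda>_. ?I)"
  proof (rule image_subsetI)
    fix v assume v: "v \<in> Bad"
    show "?k v \<in> PiE {..<m} (\<lambda>_. ?I)" unfolding restrict_PiE_iff using idx[OF v] by blast
  qed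
  then show fT: "finite ?T" by (rule finite_subset) (intro finite_PiE, auto)
  let ?P = "PiE ?J (\<lambda>_. ?I)"
  let ?fib = "\<lambda>\<rho>. {\<kappa> \<in> ?T. restrict \<kappa> ?J = \<rho>}"
  have fP: "finite ?P" by (intro finite_PiE) auto
  have "?T \<subseteq> (\<Union>\<rho>\<in>?P. ?fib \<rho>)"
  proof
    fix \<kappa> assume k: "\<kappa> \<in> ?T"
    then have "\<kappa> \<in> PiE {..<m} (\<lambda>_. ?I)" using TP by blast
    then have "restrict \<kappa> ?J \<in> ?P" by auto
    then show "\<kappa> \<in> (\<Union>\<rho>\<in>?P. ?fib \<rho>)" using k by blast
  qed
  then have "card ?T \<le> card (\<Union>\<rho>\<in>?P. ?fib \<rho>)" using fP fT by (intro card_mono) auto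
  also have "\<dots> \<le> (\<Sum>\<rho>\<in>?P. card (?fib \<rho>))" by (rule card_UN_le[OF fP])
  also have "\<dots> \<le> (\<Sum>\<rho>\<in>?P. 2 * D + 3)"
  proof (rule sum_mono)
    fix \<rho>
    have inj: "inj_on (\<lambda>\<kappa>. \<kappa> j) (?fib \<rho>)"
    proof (rule inj_onI)
      fix \<kappa> \<kappa>' assume k: "\<kappa> \<in> ?fib \<rho>" "\<kappa>' \<in> ?fib \<rho>" "\<kappa> j = \<kappa>' j"
      have "\<kappa> i = \<kappa>' i" if "i < m" for i
      proof (cases "i = j")
        case False
        have "restrict \<kappa> ?J i = restrict \<kappa>' ?J i" using k by simp
        then show ?thesis using False that by simp
      qed (use k in simp)
      moreover have "\<kappa> \<in> extensional {..<m}" "\<kappa>' \<in> extensional {..<m}" using k by auto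
      ultimately show "\<kappa> = \<kappa>'" by (intro extensionalityI[of \<kappa> "{..<m}" \<kappa>']) auto
    qed
    have "card ((\<lambda>\<kappa>. \<kappa> j) ` ?fib \<rho>) \<le> 2 * (D + 1) + 1"
    proof (rule card_bounded_ints)
      fix a b assume "a \<in> (\<lambda>\<kappa>. \<kappa> j) ` ?fib \<rho>" "b \<in> (\<lambda>\<kappa>. \<kappa> j) ` ?fib \<rho>"
      then obtain v v' where v: "v \<in> Bad" "v' \<in> Bad" "restrict (?k v) ?J = restrict (?k v') ?J"
        "a = ?k v j" "b = ?k v' j" by auto
      have ab: "a = grid_index N (v j)" "b = grid_index N (v' j)" using v j by simp_all
      have close: "\<bar>v j - v' j\<bar> \<le> real D / real N"
      proof (rule thin[OF v(1,2)])
        fix i assume i: "i < m" "i \<noteq> j"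
        have "restrict (?k v) ?J i = restrict (?k v') ?J i" using v(3) by simp
        then have "grid_index N (v i) = grid_index N (v' i)" using i by simp
        then show "\<bar>v i - v' i\<bar> \<le> 1 / real N" using grid_index_close[OF N] by (intro less_imp_le) blast
      qed
      have "\<bar>v j * real N - v' j * real N\<bar> = \<bar>v j - v' j\<bar> * real N" by (simp add: left_diff_distrib[symmetric] abs_mult)
      also have "\<dots> \<le> real D" using close N by (simp add: pos_le_divide_eq)
      finally have "\<bar>v j * real N - v' j * real N\<bar> \<le> real D" .
      then have "\<bar>\<lceil>v j * real N\<rceil> - \<lceil>v' j * real N\<rceil>\<bar> \<le> int (D + 1)" by linarith
      then show "\<bar>a - b\<bar> \<le> int (D + 1)" unfolding ab grid_index_def by simp
    qed
    then show "card (?fib \<rho>) \<le> 2 * D + 3" using card_image[OF inj] by simp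
  qed
  also have "\<dots> = card ?P * (2 * D + 3)" by simp
  also have "card ?P = (2 * (Mb * N) + 2) ^ (m - 1)"
  proof -
    have "int (Mb * N) - (- int (Mb * N) - 1) + 1 = int (2 * (Mb * N) + 2)" by simp
    then have cI: "card ?I = 2 * (Mb * N) + 2" by (simp only: card_atLeastAtMost_int nat_int)
    have "card ?P = (\<Prod>i\<in>?J. card ?I)" by (rule card_PiE) simp
    also have "\<dots> = card ?I ^ card ?J" by simp
    finally show ?thesis unfolding cI using j by simp
  qed
  also have "(2 * (Mb * N) + 2) ^ (m - 1) * (2 * D + 3) \<le> ((2 * Mb + 3) * N) ^ (m - 1) * (2 * D + 3)"
    using N by (intro mult_le_mono1 power_mono) (auto simp: algebra_simps)
  finally show "card ?T \<le> (2 * Mb + 3) ^ (m - 1) * N ^ (m - 1) * (2 * D + 3)" unfolding power_mult_distrib .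
qed

context poisson_pair
begin

lemma num_grid_pos:
  assumes "0 < N"
  shows "prob {\<omega> \<in> space P. num c (grid N k) \<omega> \<in> {1..}} \<le> 1 / real N"
proof -
  have "prob {\<omega> \<in> space P. num c (grid N k) \<omega> \<in> {1..}} = measure_pmf.prob (poisson_pmf (1 / real N)) {1..}"
    unfolding num_event(2)[OF grid_borel] grid_measure[OF assms] poisson_law_def using assms by simp
  also have "\<dots> = 1 - measure_pmf.prob (poisson_pmf (1 / real N)) {0}"
  proof -
    have e: "{1..} = space (measure_pmf (poisson_pmf (1 / real N))) - {0 :: nat}" by auto
    show ?thesis unfolding e by (rule measure_pmf.prob_compl) simp
  qed
  also have "\<dots> = 1 - exp (- (1 / real N))" using assms by (simp add: measure_pmf_single)
  also have "\<dots> \<le> 1 / real N" using exp_ge_add_one_self[of "- (1 / real N)"] by simp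
  finally show ?thesis .
qed

text \<open>Distinct pairs of colour and cell have independent counts, and a cell of length
  \<open>1 / N\<close> is occupied with probability at most \<open>1 / N\<close>.\<close>

lemma cells_prob:
  assumes N: "0 < N" and m: "0 < m"
    and inj: "inj_on (\<lambda>i. (col i, \<kappa> i)) {..<m :: nat}"
  shows "(\<Inter>i\<in>{..<m}. {\<omega> \<in> space P. num (col i) (grid N (\<kappa> i)) \<omega> \<in> {1..}}) \<in> events"
    and "prob (\<Inter>i\<in>{..<m}. {\<omega> \<in> space P. num (col i) (grid N (\<kappa> i)) \<omega> \<in> {1..}}) \<le> (1 / real N) ^ m"
proof -
  let ?E = "\<lambda>i. {\<omega> \<in> space P. num (col i) (grid N (\<kappa> i)) \<omega> \<in> {1..}}"
  let ?A = "\<lambda>n. grid N (int_decode n)"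
  have ne: "{..<m} \<noteq> {}" using m by auto
  show "(\<Inter>i\<in>{..<m}. ?E i) \<in> events" by (intro sets.finite_INT num_event(1) grid_borel) (use ne in auto)
  have dis: "disjoint_family ?A"
    unfolding disjoint_family_on_def
  proof (intro ballI impI)
    fix k l :: nat assume "k \<noteq> l"
    then have "int_decode k \<noteq> int_decode l" by (metis int_decode_inverse)
    then show "?A k \<inter> ?A l = {}" by (auto simp: mem_grid[OF N])
  qed
  have iv: "indep_vars (\<lambda>_. count_space UNIV) (\<lambda>ci. num (fst ci) (?A (snd ci))) UNIV"
    by (rule indep_nums[OF dis]) (use grid_borel in blast)
  let ?h = "\<lambda>i. (col i, int_encode (\<kappa> i))"
  have injh: "inj_on ?h {..<m}"
  proof (rule inj_onI)
    fix i k assume ik: "i \<in> {..<m}" "k \<in> {..<m}" "?h i = ?h k"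
    then have "col i = col k" "\<kappa> i = \<kappa> k" by (auto dest: injD[OF inj_int_encode])
    then show "i = k" using inj ik by (auto simp: inj_on_def)
  qed
  have pre: "num (fst (?h i)) (?A (snd (?h i))) -` {1..} \<inter> space P = ?E i" for i by auto
  have "prob (\<Inter>v\<in>?h ` {..<m}. num (fst v) (?A (snd v)) -` {1..} \<inter> space P) =
      (\<Prod>v\<in>?h ` {..<m}. prob (num (fst v) (?A (snd v)) -` {1..} \<inter> space P))"
    by (rule indep_varsD[OF iv]) (use ne in auto)
  also have "\<dots> = (\<Prod>i<m. prob (?E i))"
    by (subst prod.reindex[OF injh]) (intro prod.cong refl, simp only: comp_def pre)
  also have "(\<Inter>v\<in>?h ` {..<m}. num (fst v) (?A (snd v)) -` {1..} \<inter> space P) = (\<Inter>i\<in>{..<m}. ?E i)"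
    unfolding INT_simps image_image using pre by auto
  finally have "prob (\<Inter>i\<in>{..<m}. ?E i) = (\<Prod>i<m. prob (?E i))" .
  also have "\<dots> \<le> (\<Prod>i<m. 1 / real N)" by (intro prod_mono) (use num_grid_pos[OF N] in auto)
  finally show "prob (\<Inter>i\<in>{..<m}. ?E i) \<le> (1 / real N) ^ m" by simp
qed

text \<open>Of the order of \<open>N ^ (m - 1)\<close> tuples of cells meet \<open>Bad\<close>, each
  occupied with probability at most \<open>(1 / N) ^ m\<close>, so the total is of order
  \<open>1 / N\<close>. The separation \<open>\<delta>\<close> puts points of one colour into
  different cells, as independence requires.\<close>

lemma thin_null:
  fixes Bad :: "(nat \<Rightarrow> real) set" and m Mb D :: nat and \<delta> :: real
  assumes j: "j < m" and \<delta>: "0 < \<delta>" and e0: "0 < e0"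
    and bnd: "\<And>v i. v \<in> Bad \<Longrightarrow> i < m \<Longrightarrow> \<bar>v i\<bar> \<le> real Mb"
    and sep: "\<And>v i k. v \<in> Bad \<Longrightarrow> i < m \<Longrightarrow> k < m \<Longrightarrow> i \<noteq> k \<Longrightarrow> col i = col k \<Longrightarrow> \<delta> \<le> \<bar>v i - v k\<bar>"
    and thin: "\<And>v v' e. v \<in> Bad \<Longrightarrow> v' \<in> Bad \<Longrightarrow> 0 < e \<Longrightarrow> e < e0 \<Longrightarrow>
      (\<And>i. i < m \<Longrightarrow> i \<noteq> j \<Longrightarrow> \<bar>v i - v' i\<bar> \<le> e) \<Longrightarrow> \<bar>v j - v' j\<bar> \<le> real D * e"
  shows "AE \<omega> in P. \<forall>v\<in>Bad. \<exists>i<m. v i \<notin> pts (col i) \<omega>"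
proof -
  let ?k = "\<lambda>N v. restrict (\<lambda>i. grid_index N (v i)) {..<m}"
  let ?E = "\<lambda>N \<kappa>. (\<Inter>i\<in>{..<m}. {\<omega> \<in> space P. num (col i) (grid N (\<kappa> i)) \<omega> \<in> {1..}})"
  define G where "G N = (\<Union>\<kappa>\<in>?k N ` Bad. ?E N \<kappa>)" for N
  define c where "c = (2 * Mb + 3) ^ (m - 1) * (2 * D + 3)"
  have G: "G N \<in> events \<and> prob (G N) \<le> real c / real N" if N: "0 < N" "1 / real N < \<delta>" "1 / real N < e0" for N
  proof -
    have th: "\<bar>v j - v' j\<bar> \<le> real D / real N" if "v \<in> Bad" "v' \<in> Bad" "\<And>i. i < m \<Longrightarrow> i \<noteq> j \<Longrightarrow> \<bar>v i - v' i\<bar> \<le> 1 / real N" for v v'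
      using thin[OF that(1,2) _ N(3) that(3)] N(1) by simp
    note cells = thin_cells[where j = j and m = m and N = N and Mb = Mb and D = D and Bad = Bad, OF j N(1)]
    have tc: "finite (?k N ` Bad)" "card (?k N ` Bad) \<le> (2 * Mb + 3) ^ (m - 1) * N ^ (m - 1) * (2 * D + 3)"
    proof -
      show "finite (?k N ` Bad)"
      proof (rule cells(1))
        show "\<bar>v i\<bar> \<le> real Mb" if "v \<in> Bad" "i < m" for v i by (rule bnd[OF that])
        show "\<bar>v j - v' j\<bar> \<le> real D / real N" if "v \<in> Bad" "v' \<in> Bad" "\<And>i. i < m \<Longrightarrow> i \<noteq> j \<Longrightarrow> \<bar>v i - v' i\<bar> \<le> 1 / real N" for v v'
          by (rule th[OF that])
      qed
      show "card (?k N ` Bad) \<le> (2 * Mb + 3) ^ (m - 1) * N ^ (m - 1) * (2 * D + 3)"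
      proof (rule cells(2))
        show "\<bar>v i\<bar> \<le> real Mb" if "v \<in> Bad" "i < m" for v i by (rule bnd[OF that])
        show "\<bar>v j - v' j\<bar> \<le> real D / real N" if "v \<in> Bad" "v' \<in> Bad" "\<And>i. i < m \<Longrightarrow> i \<noteq> j \<Longrightarrow> \<bar>v i - v' i\<bar> \<le> 1 / real N" for v v'
          by (rule th[OF that])
      qed
    qed
    have ev: "?E N \<kappa> \<in> events \<and> prob (?E N \<kappa>) \<le> (1 / real N) ^ m" if \<kappa>: "\<kappa> \<in> ?k N ` Bad" for \<kappa>
    proof -
      obtain v where v: "v \<in> Bad" "\<kappa> = ?k N v" using \<kappa> by blast
      have injk: "inj_on (\<lambda>i. (col i, \<kappa> i)) {..<m}"
      proof (rule inj_onI, rule ccontr)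
        fix i k assume ik: "i \<in> {..<m}" "k \<in> {..<m}" "(col i, \<kappa> i) = (col k, \<kappa> k)" "i \<noteq> k"
        then have "grid_index N (v i) = grid_index N (v k)" using v by simp
        then have "\<bar>v i - v k\<bar> < 1 / real N" by (rule grid_index_close[OF N(1)])
        moreover have "\<delta> \<le> \<bar>v i - v k\<bar>" using sep[OF v(1)] ik by simp
        ultimately show False using N(2) by linarith
      qed
      have "0 < m" using j by simp
      from cells_prob[OF N(1) this injk] show ?thesis by (rule conjI)
    qed
    have mG: "G N \<in> events" unfolding G_def using tc(1) ev by (intro sets.finite_UN) auto
    have "prob (G N) \<le> (\<Sum>\<kappa>\<in>?k N ` Bad. prob (?E N \<kappa>))"
      unfolding G_def by (rule finite_measure_subadditive_finite) (use tc(1) ev in auto)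
    also have "\<dots> \<le> (\<Sum>\<kappa>\<in>?k N ` Bad. (1 / real N) ^ m)" by (rule sum_mono) (use ev in blast)
    also have "\<dots> = real (card (?k N ` Bad)) * (1 / real N) ^ m" by simp
    also have "\<dots> \<le> real ((2 * Mb + 3) ^ (m - 1) * N ^ (m - 1) * (2 * D + 3)) * (1 / real N) ^ m"
      by (rule mult_right_mono[OF of_nat_mono[OF tc(2)]]) simp
    also have "\<dots> = real c * (real N ^ (m - 1) * (1 / real N) ^ m)" unfolding c_def by simp
    also have "real N ^ (m - 1) * (1 / real N) ^ m = 1 / real N"
    proof -
      obtain m' where m': "m = Suc m'" using j by (cases m) auto
      show ?thesis unfolding m' using N(1) by (simp add: power_one_over power_divide)
    qed
    finally show ?thesis using mG by simp
  qed
  obtain N0 :: nat where N0: "0 < N0" "1 / real N0 < min \<delta> e0"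
    using \<delta> e0 nat_approx_posE[of "min \<delta> e0"] by (metis min_less_iff_conj zero_less_Suc)
  have big: "0 < N" "1 / real N < \<delta>" "1 / real N < e0" if "N \<ge> N0" for N
  proof -
    have "1 / real N \<le> 1 / real N0" using that N0 by (intro divide_left_mono) auto
    then show "0 < N" "1 / real N < \<delta>" "1 / real N < e0" using N0 that by auto
  qed
  define G' where "G' = (\<Inter>N\<in>{N0..}. G N)"
  have mG': "G' \<in> events" unfolding G'_def using G big by (intro sets.countable_INT') auto
  have "prob G' \<le> real c / real N" if "N \<ge> N0" for N
  proof -
    have "prob G' \<le> prob (G N)" by (rule finite_measure_mono) (use that G big in \<open>auto simp: G'_def\<close>)
    then show ?thesis using G[OF big[OF that]] by linarith
  qed
  moreover have "(\<lambda>N. real c / real N) \<longlonglongrightarrow> 0" by real_asymp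
  ultimately have "prob G' \<le> 0" by (intro LIMSEQ_le_const) auto
  then have z: "prob G' = 0" using measure_nonneg[of P G'] by linarith
  show ?thesis
  proof (rule AE_I[of _ _ G'])
    show "emeasure P G' = 0" using z by (simp add: emeasure_eq_measure)
    show "{\<omega> \<in> space P. \<not> (\<forall>v\<in>Bad. \<exists>i<m. v i \<notin> pts (col i) \<omega>)} \<subseteq> G'"
    proof
      fix \<omega> assume "\<omega> \<in> {\<omega> \<in> space P. \<not> (\<forall>v\<in>Bad. \<exists>i<m. v i \<notin> pts (col i) \<omega>)}"
      then obtain v where w: "\<omega> \<in> space P" and v: "v \<in> Bad" "\<And>i. i < m \<Longrightarrow> v i \<in> pts (col i) \<omega>" by blast
      have "\<omega> \<in> G N" if "N \<ge> N0" for N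
      proof -
        have "num (col i) (grid N (?k N v i)) \<omega> \<in> {1..}" if i: "i < m" for i
        proof -
          have "v i \<in> pts (col i) \<omega> \<inter> grid N (?k N v i)"
            using v(2)[OF i] mem_grid[of N "v i" "?k N v i"] big(1)[OF \<open>N \<ge> N0\<close>] i by simp
          moreover have "finite (pts (col i) \<omega> \<inter> grid N (?k N v i))"
            using pts_locally_finite[OF w] grid_borel(2) unfolding locally_finite_def by blast
          ultimately have "0 < card (pts (col i) \<omega> \<inter> grid N (?k N v i))" by (metis card_gt_0_iff emptyE)
          then show ?thesis unfolding num_def by simp
        qed
        then have "\<omega> \<in> ?E N (?k N v)" using w by auto
        then show ?thesis unfolding G_def using v(1) by blast
      qed
      then show "\<omega> \<in> G'" unfolding G'_def by blast
    qed
  qed (rule mG')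
qed

text \<open>Two coordinates of different colours with \<open>v 0 = v 1\<close> form a thin set,
  since one determines the other; the bound \<open>Mb\<close> exhausts the line.\<close>

lemma colours_disjoint: "AE \<omega> in P. R \<omega> \<inter> B \<omega> = {}"
proof -
  define Bad where "Bad Mb = {v :: nat \<Rightarrow> real. \<bar>v 0\<bar> \<le> real Mb \<and> v 0 = v 1}" for Mb
  have "AE \<omega> in P. \<forall>v\<in>Bad Mb. \<exists>i<2. v i \<notin> pts (i = 0) \<omega>" for Mb
  proof (rule thin_null[of 0 2 1 1 "Bad Mb" Mb "\<lambda>i. i = 0" 1])
    show "\<bar>v i\<bar> \<le> real Mb" if "v \<in> Bad Mb" "i < 2" for v i
      using that unfolding Bad_def by (auto simp: less_2_cases_iff)
    show "1 \<le> \<bar>v i - v k\<bar>" if "v \<in> Bad Mb" "i < 2" "k < 2" "i \<noteq> k" "(i = 0) = (k = 0)" for v i k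
      using that by (auto simp: less_2_cases_iff)
    show "\<bar>v 0 - v' 0\<bar> \<le> real 1 * e" if "v \<in> Bad Mb" "v' \<in> Bad Mb" "\<And>i. i < 2 \<Longrightarrow> i \<noteq> 0 \<Longrightarrow> \<bar>v i - v' i\<bar> \<le> e" for v v' e
      using that(1,2) that(3)[of 1] unfolding Bad_def by simp
  qed auto
  then have "AE \<omega> in P. \<forall>Mb. \<forall>v\<in>Bad Mb. \<exists>i<2. v i \<notin> pts (i = 0) \<omega>" unfolding AE_all_countable by blast
  then show ?thesis
  proof (rule AE_mp, intro AE_I2 impI)
    fix \<omega> assume H: "\<forall>Mb. \<forall>v\<in>Bad Mb. \<exists>i<2. v i \<notin> pts (i = 0) \<omega>"
    show "R \<omega> \<inter> B \<omega> = {}"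
    proof (rule ccontr)
      assume "R \<omega> \<inter> B \<omega> \<noteq> {}"
      then obtain x where x: "x \<in> R \<omega>" "x \<in> B \<omega>" by blast
      obtain Mb :: nat where "\<bar>x\<bar> \<le> real Mb" using real_arch_simple by blast
      then have "(\<lambda>_. x) \<in> Bad Mb" unfolding Bad_def by simp
      from H[rule_format, OF this] show False using x unfolding pts_def by (auto split: if_splits)
    qed
  qed
qed

end

section \<open>Ties have probability zero\<close>

lemma power_slope_lipschitz:
  assumes "power_slope k s f" "s < 0" "0 < d" "d \<le> z" "d \<le> z'"
  shows "\<bar>f z - f z'\<bar> \<le> k * d powr s * \<bar>z - z'\<bar>"
proof -
  have k: "0 < k" using assms(1) unfolding power_slope_def by blast
  have main: "f w' - f w \<le> k * d powr s * (w' - w) \<and> f w \<le> f w'" if w: "d \<le> w" "w < w'" for w w'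
  proof -
    have "(f has_real_derivative k * x powr s) (at x)" if "w \<le> x" for x
      using assms(1,3) w that unfolding power_slope_def by auto
    then obtain x where x: "w < x" "x < w'" "f w' - f w = (w' - w) * (k * x powr s)"
      using MVT2[OF w(2), of f "\<lambda>x. k * x powr s"] by blast
    have "x powr s \<le> d powr s" using x w assms by (intro powr_mono2') auto
    then have "k * x powr s \<le> k * d powr s" using k by simp
    then have "(w' - w) * (k * x powr s) \<le> (w' - w) * (k * d powr s)" by (rule mult_left_mono) (use w in simp)
    moreover have "0 \<le> (w' - w) * (k * x powr s)" using w k by simp
    ultimately show ?thesis using x(3) by (simp add: algebra_simps)
  qed
  consider "z = z'" | "z < z'" | "z' < z" by linarith
  then show ?thesis
  proof cases
    case 2
    then show ?thesis using main[of z z'] assms by (simp add: abs_if)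
  next
    case 3
    then show ?thesis using main[of z' z] assms by (simp add: abs_if)
  qed simp
qed

lemma powr_difference:
  fixes s :: real
  assumes "s < 0" "0 < z" "0 < z'" "z \<le> H" "z' \<le> H" "d \<le> \<bar>z - z'\<bar>" "0 < d"
  shows "d * \<bar>s\<bar> * H powr (s - 1) \<le> \<bar>z powr s - z' powr s\<bar>"
proof -
  have main: "d * \<bar>s\<bar> * H powr (s - 1) \<le> w powr s - w' powr s" if w: "0 < w" "w < w'" "w' \<le> H" "d \<le> w' - w" for w w'
  proof -
    have "((\<lambda>x. x powr s) has_real_derivative s * x powr (s - 1)) (at x)" if "w \<le> x" for x
      using w that by (auto intro!: derivative_eq_intros)
    then obtain x where x: "w < x" "x < w'" "w' powr s - w powr s = (w' - w) * (s * x powr (s - 1))"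
      using MVT2[OF w(2), of "\<lambda>x. x powr s" "\<lambda>x. s * x powr (s - 1)"] by blast
    have "H powr (s - 1) \<le> x powr (s - 1)" using x w assms by (intro powr_mono2') auto
    then have "\<bar>s\<bar> * H powr (s - 1) \<le> \<bar>s\<bar> * x powr (s - 1)" by (rule mult_left_mono) simp
    then have "d * (\<bar>s\<bar> * H powr (s - 1)) \<le> (w' - w) * (\<bar>s\<bar> * x powr (s - 1))"
      by (rule mult_mono[OF w(4)]) (use w(2) in simp_all)
    then show ?thesis using x(3) assms by (simp add: abs_if algebra_simps)
  qed
  have "z < z' \<or> z' < z" using assms by auto
  then show ?thesis
  proof
    assume "z < z'"
    then show ?thesis using main[of z z'] assms by (simp add: abs_if split: if_splits)
  next
    assume "z' < z"
    then show ?thesis using main[of z' z] assms by (simp add: abs_if split: if_splits)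
  qed
qed

text \<open>The leftmost point \<open>u\<close> has partners at different distances, so its derivative of the cost
  difference does not vanish.\<close>

lemma leftmost_expansion:
  assumes "power_slope k s f" "s < 0" "0 < d" "d \<le> p - u" "d \<le> q - u" "d \<le> p - u'" "d \<le> q - u'"
    "d \<le> \<bar>p - q\<bar>" "p - u \<le> H" "q - u \<le> H" "p - u' \<le> H" "q - u' \<le> H"
  shows "k * (d * \<bar>s\<bar> * H powr (s - 1)) * \<bar>u - u'\<bar> \<le> \<bar>(f (p - u) - f (q - u)) - (f (p - u') - f (q - u'))\<bar>"
proof -
  have k: "0 < k" using assms(1) unfolding power_slope_def by blast
  have main: "k * (d * \<bar>s\<bar> * H powr (s - 1)) * (w' - w) \<le> \<bar>(f (p - w') - f (q - w')) - (f (p - w) - f (q - w))\<bar>"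
    if w: "w < w'" "d \<le> p - w'" "d \<le> q - w'" "p - w \<le> H" "q - w \<le> H" for w w'
  proof -
    have dd: "((\<lambda>x. f (r - x)) has_real_derivative k * (r - x) powr s * (- 1)) (at x)" if "x < r" for r x
    proof (rule DERIV_chain2[of f])
      show "(f has_real_derivative k * (r - x) powr s) (at (r - x))"
        using assms(1) that unfolding power_slope_def by simp
    qed (auto intro!: derivative_eq_intros)
    have "((\<lambda>x. f (p - x) - f (q - x)) has_real_derivative
        k * (p - x) powr s * (- 1) - k * (q - x) powr s * (- 1)) (at x)" if "x \<le> w'" for x
      by (rule DERIV_diff) (rule dd, use that w assms(3) in linarith)+
    then obtain x where x: "w < x" "x < w'"
      "(f (p - w') - f (q - w')) - (f (p - w) - f (q - w)) =
        (w' - w) * (k * (p - x) powr s * (- 1) - k * (q - x) powr s * (- 1))"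
      using MVT2[OF w(1), of "\<lambda>x. f (p - x) - f (q - x)" "\<lambda>x. k * (p - x) powr s * (- 1) - k * (q - x) powr s * (- 1)"]
      by blast
    have "d * \<bar>s\<bar> * H powr (s - 1) \<le> \<bar>(q - x) powr s - (p - x) powr s\<bar>"
      by (rule powr_difference[OF assms(2)]) (use x w assms in \<open>auto simp: abs_minus_commute\<close>)
    then have "k * (d * \<bar>s\<bar> * H powr (s - 1)) \<le> k * \<bar>(q - x) powr s - (p - x) powr s\<bar>"
      using k by (intro mult_left_mono) auto
    also have "\<dots> = \<bar>k * (p - x) powr s * (- 1) - k * (q - x) powr s * (- 1)\<bar>"
    proof -
      have "k * (p - x) powr s * (- 1) - k * (q - x) powr s * (- 1) = k * ((q - x) powr s - (p - x) powr s)"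
        by (simp add: algebra_simps)
      then show ?thesis using k by (simp add: abs_mult)
    qed
    finally have "(w' - w) * (k * (d * \<bar>s\<bar> * H powr (s - 1))) \<le> (w' - w) * \<bar>k * (p - x) powr s * (- 1) - k * (q - x) powr s * (- 1)\<bar>"
      using w by (intro mult_left_mono) auto
    then show ?thesis unfolding x(3) using w by (simp add: abs_mult mult.commute)
  qed
  consider "u = u'" | "u < u'" | "u' < u" by linarith
  then show ?thesis
  proof cases
    case 2
    have "\<bar>u - u'\<bar> = u' - u" using 2 by simp
    moreover have "\<bar>(f (p - u) - f (q - u)) - (f (p - u') - f (q - u'))\<bar> =
        \<bar>(f (p - u') - f (q - u')) - (f (p - u) - f (q - u))\<bar>" by (rule abs_minus_commute)
    ultimately show ?thesis using main[of u u'] assms 2 by simp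
  next
    case 3
    then show ?thesis using main[of u' u] assms by simp
  qed simp
qed

text \<open>Coordinates below \<open>k\<close> are red points, the others blue. The first matching
  joins \<open>i\<close> to \<open>k + i\<close>, the second joins \<open>i\<close> to
  \<open>k + ps ! i\<close>, and \<open>j\<close> is leftmost. Encoding the rearrangement as a list
  and boundedness and separation by naturals keeps all parameters in countable types.\<close>

definition tie_set :: "(real \<Rightarrow> real) \<Rightarrow> nat \<Rightarrow> nat list \<Rightarrow> nat \<Rightarrow> nat \<Rightarrow> nat \<Rightarrow> (nat \<Rightarrow> real) set" where
  "tie_set f k ps j Mb d = {v.
     (\<forall>i<2 * k. \<bar>v i\<bar> \<le> real Mb \<and> v j \<le> v i \<and> (\<forall>i'<2 * k. i \<noteq> i' \<longrightarrow> 1 / real (Suc d) \<le> \<bar>v i - v i'\<bar>)) \<and>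
     (\<Sum>i<k. f (v (k + i) - v i)) = (\<Sum>i<k. f (v (k + ps ! i) - v i))}"

context
  fixes f :: "real \<Rightarrow> real" and k1 k2 s :: real and k :: nat and ps :: "nat list" and j Mb d :: nat
  assumes f1: "power_slope k1 s f" and f2: "power_slope k2 s (\<lambda>z. f (- z))" and s: "s < 0"
    and j: "j < k" and ps: "\<And>i. i < k \<Longrightarrow> ps ! i < k" "ps ! j \<noteq> j"
begin

definition "del = 1 / real (Suc d)"

lemma del_pos: "0 < del"
  unfolding del_def by simp

text \<open>The slopes decrease with distance, so they are largest at the shortest distance that can
  occur after a small displacement, \<open>del / 2\<close>.\<close>

definition "lip = max k1 k2 * (del / 2) powr s"

lemma two_sided_lipschitz:
  assumes "del \<le> \<bar>z\<bar>" "\<bar>z - z'\<bar> \<le> e" "e \<le> del / 2"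
  shows "\<bar>f z - f z'\<bar> \<le> lip * e"
proof -
  have kp: "0 < k1" "0 < k2" using f1 f2 unfolding power_slope_def by auto
  have e0: "0 \<le> e" using assms by linarith
  have p: "0 \<le> (del / 2) powr s" by simp
  consider "0 < z" | "z < 0" using assms del_pos by linarith
  then show ?thesis
  proof cases
    case 1
    then have "\<bar>f z - f z'\<bar> \<le> k1 * (del / 2) powr s * \<bar>z - z'\<bar>"
      using assms del_pos by (intro power_slope_lipschitz[OF f1 s]) auto
    also have "\<dots> \<le> lip * e" unfolding lip_def using assms kp p by (intro mult_mono) auto
    finally show ?thesis .
  next
    case 2
    then have "\<bar>f (- (- z)) - f (- (- z'))\<bar> \<le> k2 * (del / 2) powr s * \<bar>- z - - z'\<bar>"
      using assms del_pos by (intro power_slope_lipschitz[OF f2 s]) auto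
    also have "\<dots> \<le> lip * e" unfolding lip_def using assms kp p by (intro mult_mono) auto
    finally show ?thesis by simp
  qed
qed

text \<open>The coordinate \<open>v j\<close> occurs only in the \<open>j\<close>-th summand of the
  tie equation. The other summands move by a multiple of \<open>e\<close> with the other
  coordinates, whereas the \<open>j\<close>-th one changes with \<open>v j\<close> at a rate bounded
  below. Hence \<open>v j\<close> is determined up to a multiple of \<open>e\<close>.\<close>

lemma tie_thin:
  assumes v: "v \<in> tie_set f k ps j Mb d" and v': "v' \<in> tie_set f k ps j Mb d"
    and e: "0 < e" "e < del / 4" and cl: "\<And>i. i < 2 * k \<Longrightarrow> i \<noteq> j \<Longrightarrow> \<bar>v i - v' i\<bar> \<le> e"
  shows "k1 * (del / 2 * \<bar>s\<bar> * (real (2 * Mb) + del) powr (s - 1)) * \<bar>v j - v' j\<bar> \<le> 4 * real (Suc k) * lip * e"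
proof -
  have T: "\<bar>w i\<bar> \<le> real Mb" "w j \<le> w i" "i' < 2 * k \<Longrightarrow> i \<noteq> i' \<Longrightarrow> del \<le> \<bar>w i - w i'\<bar>"
    if "w \<in> tie_set f k ps j Mb d" "i < 2 * k" for w i i'
    using that unfolding tie_set_def del_def by blast+
  have eq: "(\<Sum>i<k. f (w (k + i) - w i)) = (\<Sum>i<k. f (w (k + ps ! i) - w i))" if "w \<in> tie_set f k ps j Mb d" for w
    using that unfolding tie_set_def by blast
  define H where "H w i = f (w (k + i) - w i) - f (w (k + ps ! i) - w i)" for w :: "nat \<Rightarrow> real" and i
  have H0: "(\<Sum>i<k. H w i) = 0" if "w \<in> tie_set f k ps j Mb d" for w
    unfolding H_def using eq[OF that] by (simp add: sum_subtractf)
  have split: "H w j = - (\<Sum>i\<in>{..<k} - {j}. H w i)" if "w \<in> tie_set f k ps j Mb d" for w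
    using H0[OF that] j by (simp add: sum.remove)
  have "0 < k1" using f1 unfolding power_slope_def by blast
  then have lip0: "0 \<le> lip" unfolding lip_def by (intro mult_nonneg_nonneg) (auto simp: le_max_iff_disj)
  have summand: "\<bar>f (v (k + b) - v i) - f (v' (k + b) - v' i)\<bar> \<le> lip * (2 * e)" if i: "i < k" "i \<noteq> j" "b < k" for i b
  proof (rule two_sided_lipschitz)
    show "del \<le> \<bar>v (k + b) - v i\<bar>" using T(3)[OF v, of "k + b" i] i by simp
    have "\<bar>v (k + b) - v' (k + b)\<bar> \<le> e" "\<bar>v i - v' i\<bar> \<le> e" using cl[of "k + b"] cl[of i] i j by simp_all
    then show "\<bar>v (k + b) - v i - (v' (k + b) - v' i)\<bar> \<le> 2 * e" by linarith
    show "2 * e \<le> del / 2" using e by simp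
  qed
  have Hd: "\<bar>H v i - H v' i\<bar> \<le> 4 * lip * e" if "i \<in> {..<k} - {j}" for i
    using summand[of i i] summand[of i "ps ! i"] ps(1)[of i] that unfolding H_def by simp
  have "\<bar>H v j - H v' j\<bar> = \<bar>\<Sum>i\<in>{..<k} - {j}. H v i - H v' i\<bar>"
    unfolding split[OF v] split[OF v'] by (simp add: sum_subtractf abs_minus_commute)
  also have "\<dots> \<le> (\<Sum>i\<in>{..<k} - {j}. \<bar>H v i - H v' i\<bar>)" by (rule sum_abs)
  also have "\<dots> \<le> (\<Sum>i\<in>{..<k} - {j}. 4 * lip * e)" by (rule sum_mono[OF Hd])
  also have "\<dots> = real (k - 1) * (4 * lip * e)" using j by simp
  also have "\<dots> \<le> real k * (4 * lip * e)" using lip0 e by (intro mult_right_mono) auto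
  finally have A: "\<bar>H v j - H v' j\<bar> \<le> real k * (4 * lip * e)" .
  let ?p = "v (k + j)" and ?q = "v (k + ps ! j)" and ?p' = "v' (k + j)" and ?q' = "v' (k + ps ! j)"
  have idx: "k + j < 2 * k" "k + ps ! j < 2 * k" "j < 2 * k" using j ps(1)[OF j] by simp_all
  have pq: "\<bar>?p - ?p'\<bar> \<le> e" "\<bar>?q - ?q'\<bar> \<le> e" using cl[OF idx(1)] cl[OF idx(2)] j by simp_all
  have gap: "del \<le> ?p - v j" "del \<le> ?q - v j" "del \<le> ?p' - v' j" "del \<le> ?q' - v' j"
    using T(3)[OF v idx(1) idx(3)] T(3)[OF v idx(2) idx(3)] T(3)[OF v' idx(1) idx(3)] T(3)[OF v' idx(2) idx(3)]
      T(2)[OF v idx(1)] T(2)[OF v idx(2)] T(2)[OF v' idx(1)] T(2)[OF v' idx(2)] j by simp_all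
  have pqd: "del \<le> \<bar>?p - ?q\<bar>" using T(3)[OF v idx(1) idx(2)] ps(2) by simp
  have M: "\<bar>?p\<bar> \<le> real Mb" "\<bar>?q\<bar> \<le> real Mb" "\<bar>v j\<bar> \<le> real Mb" "\<bar>v' j\<bar> \<le> real Mb"
    using T(1)[OF v] T(1)[OF v' idx(3)] idx by blast+
  have "\<bar>f (?p' - v' j) - f (?p - v' j)\<bar> \<le> lip * (2 * e)"
    by (rule two_sided_lipschitz) (use gap pq e in \<open>auto simp: abs_minus_commute\<close>)
  moreover have "\<bar>f (?q' - v' j) - f (?q - v' j)\<bar> \<le> lip * (2 * e)"
    by (rule two_sided_lipschitz) (use gap pq e in \<open>auto simp: abs_minus_commute\<close>)
  ultimately have B: "\<bar>(f (?p - v j) - f (?q - v j)) - (f (?p - v' j) - f (?q - v' j))\<bar> \<le> real k * (4 * lip * e) + 4 * lip * e"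
    using A unfolding H_def by linarith
  have "k1 * (del / 2 * \<bar>s\<bar> * (real (2 * Mb) + del) powr (s - 1)) * \<bar>v j - v' j\<bar> \<le>
      \<bar>(f (?p - v j) - f (?q - v j)) - (f (?p - v' j) - f (?q - v' j))\<bar>"
  proof -
    have nb: "?p - ?p' \<le> e" "?p' - ?p \<le> e" "?q - ?q' \<le> e" "?q' - ?q \<le> e" using pq by (simp_all add: abs_le_iff)
    have Mb: "?p \<le> real Mb" "?q \<le> real Mb" "- real Mb \<le> v j" "- real Mb \<le> v' j" using M by (simp_all add: abs_le_iff)
    have H2: "real (2 * Mb) = 2 * real Mb" by simp
    have pqd2: "del / 2 \<le> \<bar>?p - ?q\<bar>" using pqd del_pos by simp
    show ?thesis
      by (rule leftmost_expansion[OF f1 s]) (rule pqd2 | (use gap nb e Mb H2 del_pos in linarith))+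
  qed
  also have "\<dots> \<le> 4 * real (Suc k) * lip * e" using B by (simp add: algebra_simps)
  finally show ?thesis .
qed

lemma tie_thin': "\<exists>D. \<forall>v v' e. v \<in> tie_set f k ps j Mb d \<longrightarrow> v' \<in> tie_set f k ps j Mb d \<longrightarrow> 0 < e \<longrightarrow> e < del / 4 \<longrightarrow>
    (\<forall>i<2 * k. i \<noteq> j \<longrightarrow> \<bar>v i - v' i\<bar> \<le> e) \<longrightarrow> \<bar>v j - v' j\<bar> \<le> real D * e"
proof -
  define c where "c = k1 * (del / 2 * \<bar>s\<bar> * (real (2 * Mb) + del) powr (s - 1))"
  have c: "0 < c" unfolding c_def using f1 s del_pos unfolding power_slope_def by (intro mult_pos_pos) auto
  obtain D :: nat where D: "4 * real (Suc k) * lip / c \<le> real D" using real_arch_simple by blast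
  have "\<bar>v j - v' j\<bar> \<le> real D * e"
    if "v \<in> tie_set f k ps j Mb d" "v' \<in> tie_set f k ps j Mb d" "0 < e" "e < del / 4"
      "\<forall>i<2 * k. i \<noteq> j \<longrightarrow> \<bar>v i - v' i\<bar> \<le> e" for v v' e
  proof -
    have "c * \<bar>v j - v' j\<bar> \<le> 4 * real (Suc k) * lip * e"
      unfolding c_def by (rule tie_thin[OF that(1-4)]) (use that(5) in blast)
    then have "\<bar>v j - v' j\<bar> \<le> 4 * real (Suc k) * lip / c * e" using c by (simp add: field_simps)
    also have "\<dots> \<le> real D * e" using D that(3) by (intro mult_right_mono) auto
    finally show ?thesis .
  qed
  then show ?thesis by blast
qed

end

text \<open>Disjointness of \<open>N\<close> and \<open>N'\<close> gives the leftmost vertex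
  \<open>u\<close> two different partners. As \<open>u\<close> is red and leftmost, both its edges
  point right, so only one branch of the cost has to be differentiated in \<open>u\<close>.\<close>

definition red_first_tie :: "(real \<Rightarrow> real) \<Rightarrow> real set \<Rightarrow> real set \<Rightarrow> bool" where
  "red_first_tie f R B \<longleftrightarrow> (\<exists>N N' u. matching R B N \<and> matching R B N' \<and> finite N \<and> N \<inter> N' = {} \<and>
     fst ` N = fst ` N' \<and> snd ` N = snd ` N' \<and> cost f N = cost f N' \<and> u \<in> fst ` N \<and>
     (\<forall>w\<in>fst ` N \<union> snd ` N. u \<le> w))"

lemma red_first_tie_obtain:
  assumes "red_first_tie f R B" and disj: "R \<inter> B = {}"
  obtains k ps j Mb d v where "j < k" "\<And>i. i < k \<Longrightarrow> ps ! i < k" "ps ! j \<noteq> j" "v \<in> tie_set f k ps j Mb d"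
    "\<And>i. i < 2 * k \<Longrightarrow> v i \<in> (if i < k then R else B)"
proof -
  obtain N N' u where N: "matching R B N" "matching R B N'" "finite N" "N \<inter> N' = {}"
    and V: "fst ` N = fst ` N'" "snd ` N = snd ` N'" and co: "cost f N = cost f N'"
    and u: "u \<in> fst ` N" "\<And>w. w \<in> fst ` N \<union> snd ` N \<Longrightarrow> u \<le> w"
    using assms(1) unfolding red_first_tie_def by blast
  define k where "k = card N"
  obtain h where h: "bij_betw h {0..<k} N" using ex_bij_betw_nat_finite[OF N(3)] unfolding k_def by blast
  then have hN: "h i \<in> N" if "i < k" for i using that by (auto simp: bij_betw_def)
  have hinj: "i = i'" if "h i = h i'" "i < k" "i' < k" for i i'
    using h that unfolding bij_betw_def inj_on_def by simp
  have hsur: "\<exists>i<k. e = h i" if "e \<in> N" for e using h that unfolding bij_betw_def by force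
  have edge: "(fst (h i), snd (h i)) \<in> N" if "i < k" for i using hN[OF that] by simp
  have "\<exists>p<k. (fst (h i), snd (h p)) \<in> N'" if i: "i < k" for i
  proof -
    have "fst (h i) \<in> fst ` N'" using hN[OF i] V by force
    then obtain y where y: "(fst (h i), y) \<in> N'" by auto
    then have "y \<in> snd ` N" using V by force
    then obtain e where "e \<in> N" "y = snd e" by blast
    then show ?thesis using hsur y by blast
  qed
  then obtain \<pi> where \<pi>: "\<And>i. i < k \<Longrightarrow> \<pi> i < k \<and> (fst (h i), snd (h (\<pi> i))) \<in> N'" by metis
  have \<pi>ne: "\<pi> i \<noteq> i" if "i < k" for i using \<pi>[OF that] edge[OF that] N(4) by force
  define ps where "ps = map \<pi> [0..<k]"
  have psn: "ps ! i = \<pi> i" if "i < k" for i unfolding ps_def using that by simp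
  obtain j where j: "j < k" "u = fst (h j)" using u(1) hsur by blast
  define v where "v i = (if i < k then fst (h i) else snd (h (i - k)))" for i
  have vR: "v i \<in> R" "v i \<in> fst ` N" if "i < k" for i
    using matching_mem[OF N(1) edge[OF that]] hN[OF that] that unfolding v_def by auto
  have vB: "v (k + i) \<in> B" "v (k + i) \<in> snd ` N" if "i < k" for i
    using matching_mem[OF N(1) edge[OF that]] hN[OF that] unfolding v_def by auto
  have vall: "v i \<in> fst ` N \<union> snd ` N" "v i \<in> (if i < k then R else B)" if "i < 2 * k" for i
  proof -
    have "i < k \<or> (\<exists>i'<k. i = k + i')" using that by (metis add_diff_inverse_nat mult_2 nat_add_left_cancel_less)
    then show "v i \<in> fst ` N \<union> snd ` N" "v i \<in> (if i < k then R else B)" using vR vB by auto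
  qed
  have vinj: "v i \<noteq> v i'" if i: "i < 2 * k" "i' < 2 * k" "i \<noteq> i'" for i i'
  proof
    assume eq: "v i = v i'"
    have c: "i < k \<longleftrightarrow> i' < k" using vall(2)[OF i(1)] vall(2)[OF i(2)] eq disj by (auto split: if_splits)
    show False
    proof (cases "i < k")
      case True
      then have "fst (h i) = fst (h i')" using eq c unfolding v_def by simp
      then have "h i = h i'" using matching_inj_fst[OF N(1)] hN True c by (auto simp: inj_on_def)
      then show False using hinj True c i by blast
    next
      case False
      then have lt: "i - k < k" "i' - k < k" using c i by simp_all
      have "snd (h (i - k)) = snd (h (i' - k))" using eq c False unfolding v_def by simp
      then have "h (i - k) = h (i' - k)" using matching_inj_snd[OF N(1)] hN lt by (auto simp: inj_on_def)
      then have "i - k = i' - k" using hinj lt by blast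
      then show False using False c i by simp
    qed
  qed
  let ?S = "(\<lambda>(i, i'). \<bar>v i - v i'\<bar>) ` {(i, i'). i < 2 * k \<and> i' < 2 * k \<and> i \<noteq> i'}"
  have "finite {(i, i'). i < 2 * k \<and> i' < 2 * k \<and> i \<noteq> i'}"
    by (rule finite_subset[of _ "{..<2 * k} \<times> {..<2 * k}"]) auto
  then have "finite (insert 1 ?S)" by simp
  moreover have "\<forall>z\<in>insert 1 ?S. 0 < z" using vinj by auto
  ultimately have "0 < Min (insert 1 ?S)" by simp
  then obtain d where d: "1 / real (Suc d) < Min (insert 1 ?S)" using nat_approx_posE by blast
  have sep: "1 / real (Suc d) \<le> \<bar>v i - v i'\<bar>" if "i < 2 * k" "i' < 2 * k" "i \<noteq> i'" for i i'
  proof -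
    have "Min (insert 1 ?S) \<le> \<bar>v i - v i'\<bar>" using that \<open>finite (insert 1 ?S)\<close> by (intro Min_le) auto
    then show ?thesis using d by linarith
  qed
  obtain Mb :: nat where Mb: "Max (insert 0 ((\<lambda>i. \<bar>v i\<bar>) ` {..<2 * k})) \<le> real Mb" using real_arch_simple by blast
  have bnd: "\<bar>v i\<bar> \<le> real Mb" if "i < 2 * k" for i
  proof -
    have "\<bar>v i\<bar> \<le> Max (insert 0 ((\<lambda>i. \<bar>v i\<bar>) ` {..<2 * k}))" using that by (intro Max_ge) auto
    then show ?thesis using Mb by linarith
  qed
  have first: "v j \<le> v i" if "i < 2 * k" for i
    using u(2)[OF vall(1)[OF that]] j unfolding v_def[of j] by simp
  have c1: "cost f N = (\<Sum>i<k. f (v (k + i) - v i))"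
  proof -
    have "cost f N = (\<Sum>i\<in>{0..<k}. (\<lambda>(x, y). f (y - x)) (h i))"
      unfolding cost_def by (rule sum.reindex_bij_betw[OF h, symmetric])
    also have "\<dots> = (\<Sum>i<k. f (v (k + i) - v i))"
      unfolding lessThan_atLeast0 by (rule sum.cong) (auto simp: v_def case_prod_beta)
    finally show ?thesis .
  qed
  have c2: "cost f N' = (\<Sum>i<k. f (v (k + ps ! i) - v i))"
  proof -
    let ?g = "\<lambda>i. (fst (h i), snd (h (\<pi> i)))"
    have "bij_betw ?g {..<k} N'"
      unfolding bij_betw_def
    proof
      show "inj_on ?g {..<k}"
      proof (rule inj_onI)
        fix i i' assume "i \<in> {..<k}" "i' \<in> {..<k}" "?g i = ?g i'"
        then have "h i = h i'" using matching_inj_fst[OF N(1)] hN by (auto simp: inj_on_def)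
        then show "i = i'" using hinj \<open>i \<in> {..<k}\<close> \<open>i' \<in> {..<k}\<close> by simp
      qed
      show "?g ` {..<k} = N'"
      proof
        show "?g ` {..<k} \<subseteq> N'" using \<pi> by auto
        show "N' \<subseteq> ?g ` {..<k}"
        proof (rule subrelI)
          fix x y assume xy: "(x, y) \<in> N'"
          then have "x \<in> fst ` N" using V by force
          then obtain i where i: "i < k" "x = fst (h i)" using hsur by blast
          then have "y = snd (h (\<pi> i))" using matching_red_unique[OF N(2) xy] \<pi> by blast
          then show "(x, y) \<in> ?g ` {..<k}" using i by blast
        qed
      qed
    qed
    then have "cost f N' = (\<Sum>i<k. (\<lambda>(x, y). f (y - x)) (?g i))"
      unfolding cost_def by (rule sum.reindex_bij_betw[symmetric])
    also have "\<dots> = (\<Sum>i<k. f (v (k + ps ! i) - v i))"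
      by (rule sum.cong) (auto simp: v_def psn)
    finally show ?thesis .
  qed
  have "v \<in> tie_set f k ps j Mb d"
    unfolding tie_set_def using bnd first sep co c1 c2 by auto
  moreover have "ps ! i < k" if "i < k" for i using psn[OF that] \<pi>[OF that] by simp
  moreover have "ps ! j \<noteq> j" using psn[OF j(1)] \<pi>ne[OF j(1)] by simp
  ultimately show thesis using that j(1) vall(2) by blast
qed

text \<open>A countable union, over \<open>k\<close>, \<open>ps\<close>, \<open>j\<close>,
  \<open>Mb\<close> and \<open>d\<close>, of null events from \<open>thin_null\<close>.\<close>

lemma (in poisson_pair) no_red_first_tie:
  assumes f: "power_slope k1 s f" "power_slope k2 s (\<lambda>z. f (- z))" "s < 0"
  shows "AE \<omega> in P. \<not> red_first_tie f (R \<omega>) (B \<omega>)"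
proof -
  let ?ok = "\<lambda>k ps j. j < k \<and> (\<forall>i<k. ps ! i < k) \<and> ps ! j \<noteq> (j :: nat)"
  have "AE \<omega> in P. ?ok k ps j \<longrightarrow> (\<forall>v\<in>tie_set f k ps j Mb d. \<exists>i<2 * k. v i \<notin> pts (i < k) \<omega>)" for k ps j Mb d
  proof (cases "?ok k ps j")
    case ok: True
    let ?T = "tie_set f k ps j Mb d"
    have j: "j < k" and ps: "\<And>i. i < k \<Longrightarrow> ps ! i < k" "ps ! j \<noteq> j" using ok by auto
    obtain D where D: "\<forall>v v' e. v \<in> ?T \<longrightarrow> v' \<in> ?T \<longrightarrow> 0 < e \<longrightarrow> e < del d / 4 \<longrightarrow>
        (\<forall>i<2 * k. i \<noteq> j \<longrightarrow> \<bar>v i - v' i\<bar> \<le> e) \<longrightarrow> \<bar>v j - v' j\<bar> \<le> real D * e"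
      using tie_thin'[OF f j ps] by blast
    have "AE \<omega> in P. \<forall>v\<in>?T. \<exists>i<2 * k. v i \<notin> pts (i < k) \<omega>"
    proof (rule thin_null[of j "2 * k" "1 / real (Suc d)" "del d / 4" ?T Mb "\<lambda>i. i < k" D])
      show "0 < del d / 4" using del_pos[OF f j ps] by simp
      show "\<bar>v i\<bar> \<le> real Mb" if "v \<in> ?T" "i < 2 * k" for v i using that unfolding tie_set_def by blast
      show "1 / real (Suc d) \<le> \<bar>v i - v i'\<bar>" if "v \<in> ?T" "i < 2 * k" "i' < 2 * k" "i \<noteq> i'" for v i i'
        using that unfolding tie_set_def by blast
    qed (use j D in auto)
    then show ?thesis by simp
  next
    case False
    then show ?thesis by (intro AE_I2) blast
  qed
  then have "AE \<omega> in P. \<forall>k ps j Mb d. ?ok k ps j \<longrightarrow> (\<forall>v\<in>tie_set f k ps j Mb d. \<exists>i<2 * k. v i \<notin> pts (i < k) \<omega>)"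
    unfolding AE_all_countable by blast
  with colours_disjoint show ?thesis
  proof eventually_elim
    case (elim \<omega>)
    show ?case
    proof
      assume t: "red_first_tie f (R \<omega>) (B \<omega>)"
      show False
      proof (rule red_first_tie_obtain[OF t elim(1)])
        fix k ps j Mb d v
        assume o: "j < k" "\<And>i. i < k \<Longrightarrow> ps ! i < k" "ps ! j \<noteq> j" "v \<in> tie_set f k ps j Mb d"
          "\<And>i. i < 2 * k \<Longrightarrow> v i \<in> (if i < k then R \<omega> else B \<omega>)"
        have ok: "?ok k ps j" using o(1,2,3) by simp
        obtain i where "i < 2 * k" "v i \<notin> pts (i < k) \<omega>" using elim(2)[rule_format, OF ok o(4)] by blast
        then show False using o(5)[of i] unfolding pts_def by (auto split: if_splits)
      qed
    qed
  qed
qed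

lemma (in poisson_pair) swap: "poisson_pair P B R"
proof
  have sym: "indep_set C A" if "indep_set A C" for A C
    unfolding indep_sets2_eq
  proof (intro conjI ballI)
    show "C \<subseteq> events" "A \<subseteq> events" using that unfolding indep_sets2_eq by blast+
    fix c b assume "c \<in> C" "b \<in> A"
    then have "prob (b \<inter> c) = prob b * prob c" using that unfolding indep_sets2_eq by blast
    then show "prob (c \<inter> b) = prob c * prob b" by (simp add: Int_commute mult.commute)
  qed
  show "indep_var config_space B config_space R"
    using indep_RB sym unfolding indep_var_eq by blast
qed (rule PB PR)+

text \<open>Common edges cancel from the equation of costs and are removed first. If the leftmost
  remaining point is blue, exchanging the colours and negating displacements makes it red.\<close>

lemma tie_first:
  assumes "\<not> no_ties f R B" "R \<inter> B = {}"
  shows "red_first_tie f R B \<or> red_first_tie (\<lambda>z. f (- z)) B R"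
proof -
  obtain N N' where N: "matching R B N" "matching R B N'" "finite N" "finite N'"
    "fst ` N = fst ` N'" "snd ` N = snd ` N'" "cost f N = cost f N'" "N \<noteq> N'"
    using assms(1) unfolding no_ties_def by blast
  let ?A = "N - N'" and ?A' = "N' - N"
  have m: "matching R B ?A" "matching R B ?A'" using matching_sub[OF N(1)] matching_sub[OF N(2)] by simp_all
  have fst_sub: "fst ` (K - L) \<subseteq> fst ` (L - K)" if "matching R B K" "matching R B L" "fst ` K = fst ` L" for K L
  proof
    fix x assume "x \<in> fst ` (K - L)"
    then obtain y where y: "(x, y) \<in> K" "(x, y) \<notin> L" by auto
    then have "x \<in> fst ` L" using that(3) by force
    then obtain y' where y': "(x, y') \<in> L" by auto
    then have "(x, y') \<notin> K" using matching_red_unique[OF that(1) y(1)] y by blast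
    then show "x \<in> fst ` (L - K)" using y' by force
  qed
  have snd_sub: "snd ` (K - L) \<subseteq> snd ` (L - K)" if "matching R B K" "matching R B L" "snd ` K = snd ` L" for K L
  proof
    fix y assume "y \<in> snd ` (K - L)"
    then obtain x where x: "(x, y) \<in> K" "(x, y) \<notin> L" by auto
    then have "y \<in> snd ` L" using that(3) by force
    then obtain x' where x': "(x', y) \<in> L" by auto
    then have "(x', y) \<notin> K" using matching_blue_unique[OF that(1) x(1)] x by blast
    then show "y \<in> snd ` (L - K)" using x' by force
  qed
  have v: "fst ` ?A = fst ` ?A'" "snd ` ?A = snd ` ?A'"
    using fst_sub[OF N(1,2,5)] fst_sub[OF N(2,1) N(5)[symmetric]]
      snd_sub[OF N(1,2,6)] snd_sub[OF N(2,1) N(6)[symmetric]] by auto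
  have "cost f N = cost f ?A + cost f (N \<inter> N')" "cost f N' = cost f ?A' + cost f (N \<inter> N')"
    unfolding cost_def using N by (simp_all add: sum.Int_Diff[of N _ N'] sum.Int_Diff[of N' _ N] Int_commute)
  then have co: "cost f ?A = cost f ?A'" using N(7) by linarith
  have "?A \<noteq> {}"
  proof
    assume "?A = {}"
    then have "?A' = {}" using v by auto
    then show False using N(8) \<open>?A = {}\<close> by blast
  qed
  define u where "u = Min (fst ` ?A \<union> snd ` ?A)"
  have fin: "finite (fst ` ?A \<union> snd ` ?A)" using N by simp
  have u: "u \<in> fst ` ?A \<union> snd ` ?A" "\<And>w. w \<in> fst ` ?A \<union> snd ` ?A \<Longrightarrow> u \<le> w"
    unfolding u_def using Min_in[OF fin] Min_le[OF fin] \<open>?A \<noteq> {}\<close> by blast+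
  show ?thesis
  proof (cases "u \<in> fst ` ?A")
    case True
    have "red_first_tie f R B"
      unfolding red_first_tie_def
      by (rule exI[of _ ?A], rule exI[of _ ?A'], rule exI[of _ u]) (use m N v co u True in auto)
    then show ?thesis ..
  next
    case False
    then have us: "u \<in> snd ` ?A" using u by blast
    have mc: "matching B R (K\<inverse>)" if "matching R B K" for K using that unfolding matching_def by blast
    have vc: "fst ` (K\<inverse>) = snd ` K" "snd ` (K\<inverse>) = fst ` K" for K :: "(real \<times> real) set" by force+
    have cc: "cost (\<lambda>z. f (- z)) (K\<inverse>) = cost f K" for K
    proof -
      have "K\<inverse> = prod.swap ` K" by force
      moreover have "(\<Sum>(x, y)\<in>prod.swap ` K. f (- (y - x))) = (\<Sum>(x, y)\<in>K. f (y - x))"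
        by (subst sum.reindex) (auto simp: case_prod_unfold)
      ultimately show ?thesis unfolding cost_def by simp
    qed
    have "red_first_tie (\<lambda>z. f (- z)) B R"
      unfolding red_first_tie_def
    proof (rule exI[of _ "?A\<inverse>"], rule exI[of _ "?A'\<inverse>"], rule exI[of _ u], intro conjI)
      show "matching B R (?A\<inverse>)" "matching B R (?A'\<inverse>)" using mc m by blast+
      show "finite (?A\<inverse>)" using N by simp
      show "?A\<inverse> \<inter> ?A'\<inverse> = {}" by blast
      show "fst ` (?A\<inverse>) = fst ` (?A'\<inverse>)" "snd ` (?A\<inverse>) = snd ` (?A'\<inverse>)" unfolding vc using v by simp_all
      show "cost (\<lambda>z. f (- z)) (?A\<inverse>) = cost (\<lambda>z. f (- z)) (?A'\<inverse>)" unfolding cc by (rule co)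
      show "u \<in> fst ` (?A\<inverse>)" unfolding vc by (rule us)
      show "\<forall>w\<in>fst ` (?A\<inverse>) \<union> snd ` (?A\<inverse>). u \<le> w" unfolding vc using u(2) by blast
    qed
    then show ?thesis ..
  qed
qed

theorem (in poisson_pair) no_ties_almost_surely:
  assumes a: "0 < a" and g: "g < 1"
  shows "AE \<omega> in P. no_ties (cost_fun g a) (R \<omega>) (B \<omega>)"
proof -
  obtain k1 k2 where k: "power_slope k1 (g - 1) (cost_fun g a)" "power_slope k2 (g - 1) (\<lambda>z. cost_fun g a (- z))"
    using power_slope_cost_pos power_slope_cost_neg[OF a] by meson
  interpret S: poisson_pair P B R by (rule swap)
  have "AE \<omega> in P. \<not> red_first_tie (cost_fun g a) (R \<omega>) (B \<omega>)"
    using no_red_first_tie[OF k] g by simp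
  moreover have "AE \<omega> in P. \<not> red_first_tie (\<lambda>z. cost_fun g a (- z)) (B \<omega>) (R \<omega>)"
    using S.no_red_first_tie[OF k(2), of k1] k(1) g by simp
  ultimately show ?thesis using colours_disjoint
    by eventually_elim (use tie_first in blast)
qed

section \<open>Almost sure regularity\<close>

context poisson_pair
begin

lemma cnt_stretch: "cnt (pts c \<omega>) (real j) (real (j + m)) = int (num c (stretch True j m) \<omega>)"
  unfolding cnt_def num_def stretch_def by simp

lemma cnt_stretch_uminus: "cnt (uminus ` pts c \<omega>) (real j) (real (j + m)) = int (num c (stretch False j m) \<omega>)"
proof -
  have "uminus ` pts c \<omega> \<inter> {real j<..real (j + m)} = uminus ` (pts c \<omega> \<inter> {- real (j + m)..<- real j})"
    by force
  then show ?thesis unfolding cnt_def num_def stretch_def by (simp add: card_image)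
qed

lemma dense_at_stretch:
  assumes "\<forall>c s. \<forall>i<n ^ 3. n \<le> 2 * num c (stretch s (i * n) n) \<omega> \<and> num c (stretch s (i * n) n) \<omega> \<le> 2 * n"
  shows "dense_at n (pts c \<omega>)" "dense_at n (uminus ` pts c \<omega>)"
proof -
  have w: "n \<le> 2 * num c (stretch s (i * n) n) \<omega> \<and> num c (stretch s (i * n) n) \<omega> \<le> 2 * n" if "i < n ^ 3" for s i
    using assms that by blast
  have e: "(i + 1) * n = i * n + n" for i by simp
  show "dense_at n (pts c \<omega>)" unfolding dense_at_def
  proof (intro allI impI)
    fix i assume "i < n ^ 3"
    then show "int n \<le> 2 * cnt (pts c \<omega>) (real (i * n)) (real ((i + 1) * n)) \<and>
        cnt (pts c \<omega>) (real (i * n)) (real ((i + 1) * n)) \<le> 2 * int n"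
      unfolding e cnt_stretch using w[of i True] by linarith
  qed
  show "dense_at n (uminus ` pts c \<omega>)" unfolding dense_at_def
  proof (intro allI impI)
    fix i assume "i < n ^ 3"
    then show "int n \<le> 2 * cnt (uminus ` pts c \<omega>) (real (i * n)) (real ((i + 1) * n)) \<and>
        cnt (uminus ` pts c \<omega>) (real (i * n)) (real ((i + 1) * n)) \<le> 2 * int n"
      unfolding e cnt_stretch_uminus using w[of i False] by linarith
  qed
qed

lemma descent_piece:
  assumes ex: "\<And>p k. real_of_int (excess A C (real (p + k)) - excess A C (real p)) = (\<Sum>i\<in>{p..<p + k}. \<phi> (s, i))"
    and b: "block N L n \<phi>"
  shows "descent N L n A C"
  unfolding descent_def Let_def
proof (intro allI impI conjI)
  fix q k assume "q < N"
  then have "piece L n s (n + q * n\<^sup>2) \<phi>" using b unfolding block_def by auto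
  then have p: "(\<Sum>i\<in>{n + q * n\<^sup>2..<n + q * n\<^sup>2 + n\<^sup>2}. \<phi> (s, i)) \<le> - real n"
    "k \<le> n\<^sup>2 \<Longrightarrow> (\<Sum>i\<in>{n + q * n\<^sup>2..<n + q * n\<^sup>2 + k}. \<phi> (s, i)) \<le> real (L * n)"
    unfolding piece_def by auto
  show "excess A C (real (n + q * n\<^sup>2 + n\<^sup>2)) - excess A C (real (n + q * n\<^sup>2)) \<le> - int n"
    using p(1) unfolding ex[symmetric] by linarith
  assume "k \<le> n\<^sup>2"
  then have "real_of_int (excess A C (real (n + q * n\<^sup>2 + k)) - excess A C (real (n + q * n\<^sup>2))) \<le> real_of_int (int (L * n))"
    using p(2) unfolding ex[symmetric] by simp
  then show "excess A C (real (n + q * n\<^sup>2 + k)) - excess A C (real (n + q * n\<^sup>2)) \<le> int (L * n)"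
    by (simp only: of_int_le_iff)
qed

lemma excess_diff:
  assumes "locally_finite A" "locally_finite C"
  shows "excess A C (real (p + k)) - excess A C (real p) = cnt A (real p) (real (p + k)) - cnt C (real p) (real (p + k))"
  unfolding excess_def using cnt_add[OF assms(1), of 0 "real p" "real (p + k)"] cnt_add[OF assms(2), of 0 "real p" "real (p + k)"]
  by simp

lemma good_scales_almost_surely: "AE \<omega> in P. good_scales (R \<omega>) (B \<omega>)"
proof -
  obtain L where L: "AE \<omega> in P. \<forall>N. \<exists>\<^sub>F n in sequentially. block N L n (\<lambda>v. Z v \<omega>)"
    using blocks_all by blast
  have "AE \<omega> in P. \<omega> \<in> space P" by simp
  with L windows_dense show ?thesis
  proof eventually_elim
    fix \<omega>
    assume b: "\<forall>N. \<exists>\<^sub>F n in sequentially. block N L n (\<lambda>v. Z v \<omega>)"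
      and w: "\<forall>\<^sub>F n in sequentially. \<forall>c s. \<forall>i<n ^ 3. n \<le> 2 * num c (stretch s (i * n) n) \<omega> \<and> num c (stretch s (i * n) n) \<omega> \<le> 2 * n"
      and s: "\<omega> \<in> space P"
    have lf: "locally_finite (pts c \<omega>)" "locally_finite (uminus ` pts c \<omega>)" for c
      using pts_locally_finite[OF s] locally_finite_uminus by blast+
    have d1: "descent N L n (pts True \<omega>) (pts False \<omega>)" if "block N L n (\<lambda>v. Z v \<omega>)" for N n
    proof (rule descent_piece[where s = True, OF _ that])
      fix p k show "real_of_int (excess (pts True \<omega>) (pts False \<omega>) (real (p + k)) - excess (pts True \<omega>) (pts False \<omega>) (real p)) =
          (\<Sum>i\<in>{p..<p + k}. Z (True, i) \<omega>)"
        unfolding excess_diff[OF lf(1) lf(1)] cnt_stretch sum_Z[OF s] by simp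
    qed
    have d2: "descent N L n (uminus ` pts False \<omega>) (uminus ` pts True \<omega>)" if "block N L n (\<lambda>v. Z v \<omega>)" for N n
    proof (rule descent_piece[where s = False, OF _ that])
      fix p k show "real_of_int (excess (uminus ` pts False \<omega>) (uminus ` pts True \<omega>) (real (p + k)) -
          excess (uminus ` pts False \<omega>) (uminus ` pts True \<omega>) (real p)) = (\<Sum>i\<in>{p..<p + k}. Z (False, i) \<omega>)"
        unfolding excess_diff[OF lf(2) lf(2)] cnt_stretch_uminus sum_Z[OF s] by simp
    qed
    have "\<exists>\<^sub>F n in sequentially. descent N L n (pts True \<omega>) (pts False \<omega>) \<and>
        descent N L n (uminus ` pts False \<omega>) (uminus ` pts True \<omega>)" for N
      by (rule frequently_elim1[OF b[rule_format, of N]]) (intro conjI d1 d2)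
    moreover have "\<forall>\<^sub>F n in sequentially. dense_at n (pts True \<omega>) \<and> dense_at n (pts False \<omega>) \<and>
        dense_at n (uminus ` pts True \<omega>) \<and> dense_at n (uminus ` pts False \<omega>)"
      using w
    proof (rule eventually_mono)
      fix n assume h: "\<forall>c s. \<forall>i<n ^ 3. n \<le> 2 * num c (stretch s (i * n) n) \<omega> \<and> num c (stretch s (i * n) n) \<omega> \<le> 2 * n"
      show "dense_at n (pts True \<omega>) \<and> dense_at n (pts False \<omega>) \<and>
          dense_at n (uminus ` pts True \<omega>) \<and> dense_at n (uminus ` pts False \<omega>)"
        by (intro conjI dense_at_stretch[OF h])
    qed
    ultimately have "good_scales (pts True \<omega>) (pts False \<omega>)" unfolding good_scales_def by blast
    then show "good_scales (R \<omega>) (B \<omega>)" unfolding pts_def by simp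
  qed
qed

end

theorem theorem1p2:
  fixes P :: "'w measure" and R B :: "'w \<Rightarrow> real set" and a :: real
  assumes "prob_space P"
    and "poisson_process P 1 R" and "poisson_process P 1 B"
    and "prob_space.indep_var P config_space R config_space B"
    and "0 < a" and "a \<noteq> 1"
  shows "(AE \<omega> in P. \<forall>\<gamma> \<in> {MinusInf, OneMinus, OnePlus, PlusInf} \<union> Exponent ` {1<..}.
            {M. balanced_minimal_matching \<gamma> (R \<omega>) (B \<omega>) M}
              = {M. minimal_matching \<gamma> a (R \<omega>) (B \<omega>) M})
       \<and> (\<forall>\<gamma><1. AE \<omega> in P. \<exists>M M'.
            {N. balanced_minimal_matching (Exponent \<gamma>) (R \<omega>) (B \<omega>) N} = {M} \<and>
            {N. minimal_matching (Exponent \<gamma>) a (R \<omega>) (B \<omega>) N} = {M'} \<and>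
            finite_difference (R \<omega>) (B \<omega>) M M')"
proof -
  interpret poisson_pair P R B
    by (intro poisson_pair.intro poisson_pair_axioms.intro assms)
  have lf: "locally_finite (R \<omega>)" "locally_finite (B \<omega>)" if "\<omega> \<in> space P" for \<omega>
    using pts_locally_finite[OF that, of True] pts_locally_finite[OF that, of False] unfolding pts_def by simp_all
  have sp: "AE \<omega> in P. \<omega> \<in> space P" by simp
  show ?thesis
  proof (intro conjI allI impI)
    show "AE \<omega> in P. \<forall>\<gamma> \<in> {MinusInf, OneMinus, OnePlus, PlusInf} \<union> Exponent ` {1<..}.
            {M. balanced_minimal_matching \<gamma> (R \<omega>) (B \<omega>) M} = {M. minimal_matching \<gamma> a (R \<omega>) (B \<omega>) M}"
      using sp colours_disjoint good_scales_almost_surely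
    proof eventually_elim
      fix \<omega> assume s: "\<omega> \<in> space P" and disj: "R \<omega> \<inter> B \<omega> = {}" and gs: "good_scales (R \<omega>) (B \<omega>)"
      note l = lf[OF s]
      note l' = locally_finite_uminus[OF l(1)] locally_finite_uminus[OF l(2)]
      \<comment> \<open>The implications hold between any two positive values of the asymmetry;
        applied to \<open>1, a\<close> and to \<open>a, 1\<close> they give an equivalence.\<close>
      have conv: "locally_minimal F 1 (R \<omega>) (B \<omega>) M \<longleftrightarrow> locally_minimal F a (R \<omega>) (B \<omega>) M"
        if F: "F \<noteq> bot" "\<forall>\<^sub>F g in F. g \<in> {1<..}" for F M
        using convex_minimal_iff[OF F zero_less_one \<open>0 < a\<close> disj l l' good_scales_good_right[OF l gs]]
          convex_minimal_iff[OF F \<open>0 < a\<close> zero_less_one disj l l' good_scales_good_right[OF l gs]] by blast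
      have near: "locally_minimal (at_left 1) 1 (R \<omega>) (B \<omega>) M \<longleftrightarrow> locally_minimal (at_left 1) a (R \<omega>) (B \<omega>) M" for M
        using near_one_minimal_iff[OF zero_less_one \<open>0 < a\<close> disj l good_scales_valleys[OF l gs]]
          near_one_minimal_iff[OF \<open>0 < a\<close> zero_less_one disj l good_scales_valleys[OF l gs]] by blast
      have plus: "\<forall>\<^sub>F g in at_right (1 :: real). g \<in> {1<..}" by (simp add: eventually_at_right_less)
      show "\<forall>\<gamma> \<in> {MinusInf, OneMinus, OnePlus, PlusInf} \<union> Exponent ` {1<..}.
            {M. balanced_minimal_matching \<gamma> (R \<omega>) (B \<omega>) M} = {M. minimal_matching \<gamma> a (R \<omega>) (B \<omega>) M}"
      proof
        fix \<gamma> assume "\<gamma> \<in> {MinusInf, OneMinus, OnePlus, PlusInf} \<union> Exponent ` {1<..}"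
        then consider "\<gamma> = MinusInf" | "\<gamma> = PlusInf" | "\<gamma> = OneMinus" | "\<gamma> = OnePlus" | g where "\<gamma> = Exponent g" "1 < g" by auto
        then have "balanced_minimal_matching \<gamma> (R \<omega>) (B \<omega>) M \<longleftrightarrow> minimal_matching \<gamma> a (R \<omega>) (B \<omega>) M" for M
        proof cases
          \<comment> \<open>Stability, and altruism in the next case, are defined by lengths alone,
            so both sides are the same predicate.\<close>
          case 1
          then show ?thesis by simp
        next
          case 2
          then show ?thesis by simp
        next
          case 3
          show ?thesis unfolding 3 minimal_matching_OneMinus_iff[OF disj] by (rule near)
        next
          case 4
          show ?thesis unfolding 4 minimal_matching_OnePlus_iff[OF disj] by (rule conv[OF _ plus]) simp
        next
          case (5 g)
          show ?thesis unfolding 5 minimal_matching_Exponent_iff[OF disj]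
            by (rule conv) (use 5 in \<open>simp_all add: eventually_principal principal_eq_bot_iff\<close>)
        qed
        then show "{M. balanced_minimal_matching \<gamma> (R \<omega>) (B \<omega>) M} = {M. minimal_matching \<gamma> a (R \<omega>) (B \<omega>) M}" by simp
      qed
    qed
  next
    fix \<gamma> :: real assume g: "\<gamma> < 1"
    show "AE \<omega> in P. \<exists>M M'. {N. balanced_minimal_matching (Exponent \<gamma>) (R \<omega>) (B \<omega>) N} = {M} \<and>
            {N. minimal_matching (Exponent \<gamma>) a (R \<omega>) (B \<omega>) N} = {M'} \<and> finite_difference (R \<omega>) (B \<omega>) M M'"
      using sp colours_disjoint good_scales_almost_surely no_ties_almost_surely[OF zero_less_one g]
        no_ties_almost_surely[OF \<open>0 < a\<close> g]
    proof eventually_elim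
      fix \<omega> assume s: "\<omega> \<in> space P" and disj: "R \<omega> \<inter> B \<omega> = {}" and gs: "good_scales (R \<omega>) (B \<omega>)"
        and nt: "no_ties (cost_fun \<gamma> 1) (R \<omega>) (B \<omega>)" "no_ties (cost_fun \<gamma> a) (R \<omega>) (B \<omega>)"
      note l = lf[OF s] and V = good_scales_valleys[OF lf[OF s] gs]
      obtain M where M: "locally_minimal (principal {\<gamma>}) 1 (R \<omega>) (B \<omega>) M"
        "\<And>N. locally_minimal (principal {\<gamma>}) 1 (R \<omega>) (B \<omega>) N \<Longrightarrow> N = M"
        using concave_unique[OF l disj zero_less_one g V nt(1)] by blast
      obtain M' where M': "locally_minimal (principal {\<gamma>}) a (R \<omega>) (B \<omega>) M'"
        "\<And>N. locally_minimal (principal {\<gamma>}) a (R \<omega>) (B \<omega>) N \<Longrightarrow> N = M'"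
        using concave_unique[OF l disj \<open>0 < a\<close> g V nt(2)] by blast
      have "{N. balanced_minimal_matching (Exponent \<gamma>) (R \<omega>) (B \<omega>) N} = {M}"
        "{N. minimal_matching (Exponent \<gamma>) a (R \<omega>) (B \<omega>) N} = {M'}"
        unfolding minimal_matching_Exponent_iff[OF disj] using M M' by blast+
      moreover have "finite_difference (R \<omega>) (B \<omega>) M M'"
        by (rule concave_finite_difference[OF l disj g V zero_less_one \<open>0 < a\<close> M(1) M'(1)])
      ultimately show "\<exists>M M'. {N. balanced_minimal_matching (Exponent \<gamma>) (R \<omega>) (B \<omega>) N} = {M} \<and>
            {N. minimal_matching (Exponent \<gamma>) a (R \<omega>) (B \<omega>) N} = {M'} \<and> finite_difference (R \<omega>) (B \<omega>) M M'" by blast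
    qed
  qed
qed

end
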